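(* Let $p$ be a prime, $G$ and $G'$ finite groups, $C$ and $C'$ the sets of $p$-regular elements of $G$ and $G'$, and $\mathcal C$, $\mathcal C'$ the corresponding sets of conjugacy classes. Let $B$ and $B'$ be unions of $p$-blocks of $G$ and $G'$. Suppose that: (i) The following hold: (1) $G$ has an MN-structure with respect to $\mathcal C$ and $B$, and $G'$ has an MN-structure with respect to $\mathcal C'$ and $B'$ (objects attached to $G'$ are denoted with a prime). (2) There are subsets $\Lambda_0\subseteq\Lambda$ and $\Lambda_0'\subseteq\Lambda'$ such that: (a) $r^{\lambda}=0$ for every $\lambda\in\Lambda\setminus\Lambda_0$ and $r'^{\lambda'}=0$ for every $\lambda'\in\Lambda'\setminus\Lambda_0'$; (b) there is a bijection $\sigma:\Lambda_0\to\Lambda_0'$ with $\sigma(\{1\})=\{1\}$ and, for every $\lambda\in\Lambda_0$, an isometry $I_\lambda:\mathbb C\operatorname{Irr}(B_\lambda)\to\mathbb C\operatorname{Irr}(B'_{\sigma(\lambda)})$ such that $I_\lambda\circ r^\lambda=r'^{\sigma(\lambda)}\circ I_{\{1\}}$. (3) $I_\lambda(\mathbb C b_\lambda^\vee)=\mathbb C {b'}_{\sigma(\lambda)}^{\vee}$ for every $\lambda\in\Lambda_0$. (ii) For every $\lambda\in\Lambda_0$, $I_\lambda(\mathbb Z\operatorname{Irr}(B_\lambda))=\mathbb Z\operatorname{Irr}(B'_{\sigma(\lambda)})$. (iii) For every $g=g_S\cdot g_C\in G$ and $g'=g'_{S'}\cdot g'_{C'}\in G'$, $p$ does not divide $|\mathcal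 E^{\lambda}_{g_S,g_C}|$, where $\lambda\in\Lambda$ is the class of $g_S$, and $p$ does not divide $|\mathcal E^{\lambda'}_{g'_{S'},g'_{C'}}|$, where $\lambda'\in\Lambda'$ is the class of $g'_{S'}$. Then $I_{\{1\}}$ is a Broué isometry.
   Context: **Restriction and blocks.** For a finite group $G$, $\mathbb C\operatorname{Irr}(G)$ is the space of complex class functions with usual hermitian product $\langle\,,\rangle_G$. An element is $p$-regular if its order is prime to $p$. For a union $C$ of conjugacy classes, $\operatorname{res}_C(\varphi)$ equals $\varphi$ on $C$ and $0$ off $C$; for a set $X$ of class functions $X^{\mathcal C}=\{\operatorname{res}_C(\chi):\chi\in X\}$, where $\mathcal C$ is the set of classes in $C$. In general, given a $\mathbb Z$-basis $b$ of $\mathbb Z\operatorname{Irr}(G)^{\mathcal C}$, with $\operatorname{res}_C(\chi)=\sum_{\varphi\in b}d_{\chi\varphi}\varphi$, the $\mathcal C$-blocks of $G$ are the connected components of the graph on $\operatorname{Irr}(G)$ joining $\chi,\chi'$ when $d_{\chi\varphi}\neq0\neq d_{\chi'\varphi}$ for some $\varphi\in b$. Here $C$ is always the set of $p$-regular elements and $b=\operatorname{IBr}_p(G)$ (irreducible Brauer characters extended by $0$), so that $\mathcal C$-blocks are $p$-blocks. **MN-structure.** Write ${}^gx=gxg^{-1}$. $G$ has an MN-structure with respect to $\mathcal C$ and $B$ if: 1. There is a subset $S\subseteq G$ containing $1$ and stable under $G$-conjugation. 2. There is a bijection from a subset $A\subseteq S\times C$ onto $G$, $(x_S,x_C)\mapsto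 x_S\cdot x_C$, such that for $(x_S,x_C)\in A$ and $g\in G$: ${}^g(x_S\cdot x_C)=({}^gx_S)\cdot({}^gx_C)$ and $x_S\cdot x_C=x_Sx_C=x_Cx_S$. Moreover $(x_S,1)\in A$ and $(1,x_C)\in A$ for all $x_S\in S$, $x_C\in C$. 3. For each $x_S\in S$ there is a subgroup $G_{x_S}\le \operatorname{C}_G(x_S)$ with $G_{x_S}\cap C=\{x_C\in C:(x_S,x_C)\in A\}$; let $\mathcal C_{x_S}$ be the set of $G_{x_S}$-conjugacy classes of $G_{x_S}\cap C$. 4. For each $x_S\in S$ there are a union $B_{x_S}$ of $\mathcal C_{x_S}$-blocks (i.e. $p$-blocks) of $G_{x_S}$ and a linear map $r^{x_S}:\mathbb C\operatorname{Irr}(B)\to\mathbb C\operatorname{Irr}(B_{x_S})$ with $r^{x_S}(\chi)(x_C)=\chi(x_S\cdot x_C)$ for all $\chi\in\mathbb C\operatorname{Irr}(B)$ and $(x_S,x_C)\in A$. Moreover $G_1=G$, $B_1=B$, $r^1=\mathrm{id}$. **Further notation.** $\Lambda$ is the set of $G$-conjugacy classes contained in $S$. For each $\lambda\in\Lambda$ choose $x_\lambda\in\lambda$ and put $G_\lambda=G_{x_\lambda}$, $B_\lambda=B_{x_\lambda}$, $r^\lambda=r^{x_\lambda}$. Let $b_\lambda=\operatorname{IBr}_p(B_\lambda)$ and let $b_\lambda^\vee$ be the basis of $\mathbb C b_\lambda$ dual to $b_\lambda$ with respect to $\langle\,,\rangle_{G_\lambda}$. For $g=g_S\cdot g_C\in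 G$ with $g_S\in\lambda$, the set $\{{}^tg_C: t\in G,\ {}^tg_S=x_\lambda\}\subseteq G_\lambda$ is stable under $G_\lambda$-conjugation, and $\mathcal E^\lambda_{g_S,g_C}$ denotes a set of representatives of the $G_\lambda$-classes it contains. "Isometry" means a $\mathbb C$-linear bijection preserving the hermitian products. **Broué isometry.** Let $(K,\mathcal R,k)$ be a splitting $p$-modular system for $G$ and $G'$ (character values, being sums of roots of unity, are regarded as elements of $\mathcal R$). An isometry $I:\mathbb C\operatorname{Irr}(B)\to\mathbb C\operatorname{Irr}(B')$ is a Broué isometry if $I(\mathbb Z\operatorname{Irr}(B))=\mathbb Z\operatorname{Irr}(B')$ and $\widehat I(x,x')=\sum_{\chi\in\operatorname{Irr}(B)}\overline{\chi(x)}\,I(\chi)(x')$ satisfies: for all $(x,x')\in G\times G'$, $\widehat I(x,x')\in|\operatorname{C}_G(x)|\mathcal R\cap|\operatorname{C}_{G'}(x')|\mathcal R$; and if $\widehat I(x,x')\neq0$ then $x$ and $x'$ are either both $p$-regular or both not $p$-regular. *)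

theory Defs
  imports
    "HOL-Algebra.Multiplicative_Group"
    "HOL-Computational_Algebra.Primes"
    "HOL-Library.Function_Algebras"
    "Jordan_Normal_Form.Char_Poly"
begin

section \<open>Conjugation and p-regular elements\<close>

text \<open>A subgroup H of G is used as a group in its own right through the record
  \<open>G\<lparr>carrier := H\<rparr>\<close>.\<close>

definition conjugate :: "('g, 'm) monoid_scheme \<Rightarrow> 'g \<Rightarrow> 'g \<Rightarrow> 'g" where
  "conjugate G g x = g \<otimes>\<^bsub>G\<^esub> x \<otimes>\<^bsub>G\<^esub> inv\<^bsub>G\<^esub> g"

definition conj_class :: "('g, 'm) monoid_scheme \<Rightarrow> 'g \<Rightarrow> 'g set" where
  "conj_class G x = (\<lambda>g. conjugate G g x) ` carrier G"

definition conj_classes :: "('g, 'm) monoid_scheme \<Rightarrow> 'g set set" where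
  "conj_classes G = conj_class G ` carrier G"

definition centralizer :: "('g, 'm) monoid_scheme \<Rightarrow> 'g \<Rightarrow> 'g set" where
  "centralizer G x = {g \<in> carrier G. g \<otimes>\<^bsub>G\<^esub> x = x \<otimes>\<^bsub>G\<^esub> g}"

definition p_regular :: "nat \<Rightarrow> ('g, 'm) monoid_scheme \<Rightarrow> 'g set" where
  "p_regular p G = {x \<in> carrier G. coprime (group.ord G x) p}"

definition group_exponent :: "('g, 'm) monoid_scheme \<Rightarrow> nat" where
  "group_exponent G = Lcm (group.ord G ` carrier G)"

text \<open>E represents the G-classes contained in the conjugation-stable set X.\<close>

definition class_representatives :: "('g, 'm) monoid_scheme \<Rightarrow> 'g set \<Rightarrow> 'g set \<Rightarrow> bool" where
  "class_representatives G X E \<longleftrightarrow> E \<subseteq> X \<and> (\<forall>y\<in>X. \<exists>!e. e \<in> E \<and> e \<in> conj_class G y)"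


section \<open>Representations and irreducible characters\<close>

definition matrix_rep :: "('g, 'm) monoid_scheme \<Rightarrow> nat \<Rightarrow> ('g \<Rightarrow> 'a::field mat) \<Rightarrow> bool" where
  "matrix_rep G n \<rho> \<longleftrightarrow>
     (\<forall>g\<in>carrier G. \<rho> g \<in> carrier_mat n n) \<and> \<rho> \<one>\<^bsub>G\<^esub> = 1\<^sub>m n \<and>
     (\<forall>g\<in>carrier G. \<forall>h\<in>carrier G. \<rho> (g \<otimes>\<^bsub>G\<^esub> h) = \<rho> g * \<rho> h)"

definition invariant_subspace ::
    "('g, 'm) monoid_scheme \<Rightarrow> nat \<Rightarrow> ('g \<Rightarrow> 'a::field mat) \<Rightarrow> 'a vec set \<Rightarrow> bool" where
  "invariant_subspace G n \<rho> W \<longleftrightarrow>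
     W \<subseteq> carrier_vec n \<and> 0\<^sub>v n \<in> W \<and>
     (\<forall>u\<in>W. \<forall>w\<in>W. u + w \<in> W) \<and> (\<forall>c. \<forall>w\<in>W. c \<cdot>\<^sub>v w \<in> W) \<and>
     (\<forall>g\<in>carrier G. \<forall>w\<in>W. \<rho> g *\<^sub>v w \<in> W)"

definition irreducible_rep :: "('g, 'm) monoid_scheme \<Rightarrow> nat \<Rightarrow> ('g \<Rightarrow> 'a::field mat) \<Rightarrow> bool" where
  "irreducible_rep G n \<rho> \<longleftrightarrow> matrix_rep G n \<rho> \<and> n > 0 \<and>
     (\<forall>W. invariant_subspace G n \<rho> W \<longrightarrow> W = {0\<^sub>v n} \<or> W = carrier_vec n)"

text \<open>Class functions of G are functions on the whole ground type vanishing outside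
  \<open>carrier G\<close>; functions defined on a subset of the carrier are likewise extended by 0.\<close>

definition character :: "('g, 'm) monoid_scheme \<Rightarrow> ('g \<Rightarrow> complex mat) \<Rightarrow> 'g \<Rightarrow> complex" where
  "character G \<rho> x = (if x \<in> carrier G then \<Sum>i<dim_row (\<rho> x). \<rho> x $$ (i, i) else 0)"

definition Irr :: "('g, 'm) monoid_scheme \<Rightarrow> ('g \<Rightarrow> complex) set" where
  "Irr G = {character G \<rho> | \<rho>. \<exists>n. irreducible_rep G n \<rho>}"

definition cf_inner ::
    "('g, 'm) monoid_scheme \<Rightarrow> ('g \<Rightarrow> complex) \<Rightarrow> ('g \<Rightarrow> complex) \<Rightarrow> complex" where
  "cf_inner G \<phi> \<psi> = (\<Sum>x\<in>carrier G. \<phi> x * cnj (\<psi> x)) / of_nat (card (carrier G))"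

definition cscale :: "complex \<Rightarrow> ('g \<Rightarrow> complex) \<Rightarrow> 'g \<Rightarrow> complex" where
  "cscale c \<phi> = (\<lambda>x. c * \<phi> x)"

definition zscale :: "int \<Rightarrow> ('g \<Rightarrow> complex) \<Rightarrow> 'g \<Rightarrow> complex" where
  "zscale n \<phi> = (\<lambda>x. of_int n * \<phi> x)"

interpretation cfun: Vector_Spaces.vector_space "cscale :: complex \<Rightarrow> ('g \<Rightarrow> complex) \<Rightarrow> 'g \<Rightarrow> complex"
  by standard (auto simp: cscale_def algebra_simps)

interpretation zfun: Modules.module "zscale :: int \<Rightarrow> ('g \<Rightarrow> complex) \<Rightarrow> 'g \<Rightarrow> complex"
  by standard (auto simp: zscale_def algebra_simps)

text \<open>Thus \<open>cfun.span X\<close> is \<open>\<complex>X\<close> and \<open>zfun.span X\<close> is \<open>\<int>X\<close>.\<close>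

definition cf_linear_map ::
    "('g \<Rightarrow> complex) set \<Rightarrow> ('h \<Rightarrow> complex) set \<Rightarrow>
     (('g \<Rightarrow> complex) \<Rightarrow> 'h \<Rightarrow> complex) \<Rightarrow> bool" where
  "cf_linear_map V W f \<longleftrightarrow> f ` V \<subseteq> W \<and>
     (\<forall>\<phi>\<in>V. \<forall>\<psi>\<in>V. f (\<phi> + \<psi>) = f \<phi> + f \<psi>) \<and>
     (\<forall>c. \<forall>\<phi>\<in>V. f (cscale c \<phi>) = cscale c (f \<phi>))"

definition cf_isometry ::
    "('g, 'm) monoid_scheme \<Rightarrow> ('h, 'n) monoid_scheme \<Rightarrow>
     ('g \<Rightarrow> complex) set \<Rightarrow> ('h \<Rightarrow> complex) set \<Rightarrow>
     (('g \<Rightarrow> complex) \<Rightarrow> 'h \<Rightarrow> complex) \<Rightarrow> bool" where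
  "cf_isometry G G' V W f \<longleftrightarrow> cf_linear_map V W f \<and> bij_betw f V W \<and>
     (\<forall>\<phi>\<in>V. \<forall>\<psi>\<in>V. cf_inner G' (f \<phi>) (f \<psi>) = cf_inner G \<phi> \<psi>)"

text \<open>The basis of \<open>\<complex>b\<close> dual to \<open>b\<close> with respect to the hermitian product.\<close>

definition dual_basis :: "('g, 'm) monoid_scheme \<Rightarrow> ('g \<Rightarrow> complex) set \<Rightarrow> ('g \<Rightarrow> complex) set" where
  "dual_basis G b =
     (\<lambda>\<phi>. THE \<psi>. \<psi> \<in> cfun.span b \<and> (\<forall>\<theta>\<in>b. cf_inner G \<psi> \<theta> = (if \<theta> = \<phi> then 1 else 0))) ` b"


section \<open>Splitting p-modular systems\<close>

text \<open>Here \<open>v 0\<close> is a junk value; mathematically it is \<open>\<infinity>\<close>.\<close>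

definition discrete_valuation :: "('K::field \<Rightarrow> int) \<Rightarrow> bool" where
  "discrete_valuation v \<longleftrightarrow>
     (\<forall>x y. x \<noteq> 0 \<longrightarrow> y \<noteq> 0 \<longrightarrow> v (x * y) = v x + v y) \<and>
     (\<forall>x y. x \<noteq> 0 \<longrightarrow> y \<noteq> 0 \<longrightarrow> x + y \<noteq> 0 \<longrightarrow> min (v x) (v y) \<le> v (x + y)) \<and>
     (\<exists>x. x \<noteq> 0 \<and> v x = 1)"

definition valuation_complete :: "('K::field \<Rightarrow> int) \<Rightarrow> bool" where
  "valuation_complete v \<longleftrightarrow>
     (\<forall>X :: nat \<Rightarrow> 'K.
        (\<forall>M. \<exists>N. \<forall>i\<ge>N. \<forall>j\<ge>N. X i = X j \<or> M \<le> v (X i - X j)) \<longrightarrow>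
        (\<exists>L. \<forall>M. \<exists>N. \<forall>i\<ge>N. X i = L \<or> M \<le> v (X i - L)))"

text \<open>R is a complete discrete valuation ring whose field of fractions is the whole type \<open>'K\<close>
  of characteristic 0. Its residue field is the type \<open>'k\<close> of characteristic p, by means of the
  surjection \<open>red\<close>, whose kernel on R is the maximal ideal; \<open>red\<close> is irrelevant outside R.\<close>

definition p_modular_system ::
    "nat \<Rightarrow> 'K::field_char_0 set \<Rightarrow> ('K \<Rightarrow> 'k::field) \<Rightarrow> bool" where
  "p_modular_system p R red \<longleftrightarrow>
     (\<exists>v. discrete_valuation v \<and> valuation_complete v \<and>
          R = {x. x = 0 \<or> 0 \<le> v x} \<and>
          (\<forall>x\<in>R. red x = 0 \<longleftrightarrow> x = 0 \<or> 0 < v x)) \<and>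
     red 1 = 1 \<and> (\<forall>x\<in>R. \<forall>y\<in>R. red (x + y) = red x + red y \<and> red (x * y) = red x * red y) \<and>
     red ` R = UNIV \<and> CHAR('k) = p"

text \<open>\<open>'a\<close> is a splitting field for G: the endomorphisms of every irreducible representation of G
  over \<open>'a\<close> are the scalars.\<close>

definition splitting_field :: "'a::field itself \<Rightarrow> ('g, 'm) monoid_scheme \<Rightarrow> bool" where
  "splitting_field _ G \<longleftrightarrow>
     (\<forall>n (\<rho> :: 'g \<Rightarrow> 'a mat). irreducible_rep G n \<rho> \<longrightarrow>
        (\<forall>M\<in>carrier_mat n n. (\<forall>g\<in>carrier G. M * \<rho> g = \<rho> g * M) \<longrightarrow> (\<exists>c. M = c \<cdot>\<^sub>m 1\<^sub>m n)))"

definition splitting_p_modular_system ::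
    "nat \<Rightarrow> 'K::field_char_0 set \<Rightarrow> ('K \<Rightarrow> 'k::field) \<Rightarrow> ('g, 'm) monoid_scheme \<Rightarrow> bool" where
  "splitting_p_modular_system p R red G \<longleftrightarrow> p_modular_system p R red \<and>
     (\<forall>H. subgroup H G \<longrightarrow>
        splitting_field TYPE('K) (G\<lparr>carrier := H\<rparr>) \<and> splitting_field TYPE('k) (G\<lparr>carrier := H\<rparr>))"

text \<open>The ring \<open>\<int>[\<zeta>\<^sub>n]\<close> generated by the complex n-th roots of unity.\<close>

definition cyclotomic_ring :: "nat \<Rightarrow> complex set" where
  "cyclotomic_ring n =
     range (\<lambda>q :: int poly. poly (map_poly of_int q) (cis (2 * pi / of_nat n)))"

text \<open>\<open>\<iota>\<close> identifies sums of complex n-th roots of unity with elements of R.\<close>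

definition cyclotomic_embedding :: "nat \<Rightarrow> 'K::field set \<Rightarrow> (complex \<Rightarrow> 'K) \<Rightarrow> bool" where
  "cyclotomic_embedding n R \<iota> \<longleftrightarrow>
     \<iota> ` cyclotomic_ring n \<subseteq> R \<and> inj_on \<iota> (cyclotomic_ring n) \<and> \<iota> 1 = 1 \<and>
     (\<forall>x\<in>cyclotomic_ring n. \<forall>y\<in>cyclotomic_ring n.
        \<iota> (x + y) = \<iota> x + \<iota> y \<and> \<iota> (x * y) = \<iota> x * \<iota> y)"


section \<open>Brauer characters and p-blocks\<close>

text \<open>The map \<open>\<theta> :: complex \<Rightarrow> 'k\<close> below is reduction modulo the maximal ideal of R, precomposed
  with the identification of roots of unity (i.e. \<open>red \<circ> \<iota>\<close>). For m prime to p, the lift of an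
  m-th root of unity in \<open>'k\<close> is the complex m-th root of unity reducing to it. The value of a Brauer
  character at a p-regular x is the sum of the lifts of the eigenvalues of x, counted with their
  multiplicities in the characteristic polynomial.\<close>

definition root_lift :: "(complex \<Rightarrow> 'k) \<Rightarrow> nat \<Rightarrow> 'k \<Rightarrow> complex" where
  "root_lift \<theta> m a = (THE w. w ^ m = 1 \<and> \<theta> w = a)"

definition brauer_character ::
    "nat \<Rightarrow> (complex \<Rightarrow> 'k) \<Rightarrow> ('g, 'm) monoid_scheme \<Rightarrow> ('g \<Rightarrow> 'k::field mat) \<Rightarrow> 'g \<Rightarrow> complex" where
  "brauer_character p \<theta> G \<rho> x =
     (if x \<in> p_regular p G
      then \<Sum>a | poly (char_poly (\<rho> x)) a = 0.
             of_nat (Polynomial.order a (char_poly (\<rho> x))) * root_lift \<theta> (group.ord G x) a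
      else 0)"

definition IBr ::
    "nat \<Rightarrow> (complex \<Rightarrow> 'k::field) \<Rightarrow> ('g, 'm) monoid_scheme \<Rightarrow> ('g \<Rightarrow> complex) set" where
  "IBr p \<theta> G = {brauer_character p \<theta> G \<rho> | \<rho>. \<exists>n. irreducible_rep G n \<rho>}"

definition res_regular ::
    "nat \<Rightarrow> ('g, 'm) monoid_scheme \<Rightarrow> ('g \<Rightarrow> complex) \<Rightarrow> 'g \<Rightarrow> complex" where
  "res_regular p G \<phi> x = (if x \<in> p_regular p G then \<phi> x else 0)"

definition decomposition_number ::
    "nat \<Rightarrow> (complex \<Rightarrow> 'k::field) \<Rightarrow> ('g, 'm) monoid_scheme \<Rightarrow>
     ('g \<Rightarrow> complex) \<Rightarrow> ('g \<Rightarrow> complex) \<Rightarrow> int" where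
  "decomposition_number p \<theta> G \<chi> \<phi> = zfun.representation (IBr p \<theta> G) (res_regular p G \<chi>) \<phi>"

definition block_link ::
    "nat \<Rightarrow> (complex \<Rightarrow> 'k::field) \<Rightarrow> ('g, 'm) monoid_scheme \<Rightarrow>
     (('g \<Rightarrow> complex) \<times> ('g \<Rightarrow> complex)) set" where
  "block_link p \<theta> G = {(\<chi>, \<chi>'). \<chi> \<in> Irr G \<and> \<chi>' \<in> Irr G \<and>
     (\<exists>\<phi>\<in>IBr p \<theta> G. decomposition_number p \<theta> G \<chi> \<phi> \<noteq> 0 \<and> decomposition_number p \<theta> G \<chi>' \<phi> \<noteq> 0)}"

definition p_blocks ::
    "nat \<Rightarrow> (complex \<Rightarrow> 'k::field) \<Rightarrow> ('g, 'm) monoid_scheme \<Rightarrow> ('g \<Rightarrow> complex) set set" where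
  "p_blocks p \<theta> G = Irr G // (block_link p \<theta> G)\<^sup>*"

text \<open>A union B of p-blocks is represented by the set \<open>Irr(B)\<close>, so that \<open>\<complex>Irr(B)\<close> is
  \<open>cfun.span B\<close> and \<open>\<int>Irr(B)\<close> is \<open>zfun.span B\<close>.\<close>

definition union_of_blocks ::
    "nat \<Rightarrow> (complex \<Rightarrow> 'k::field) \<Rightarrow> ('g, 'm) monoid_scheme \<Rightarrow> ('g \<Rightarrow> complex) set \<Rightarrow> bool" where
  "union_of_blocks p \<theta> G B \<longleftrightarrow> (\<exists>X\<subseteq>p_blocks p \<theta> G. B = \<Union>X)"

definition IBr_of ::
    "nat \<Rightarrow> (complex \<Rightarrow> 'k::field) \<Rightarrow> ('g, 'm) monoid_scheme \<Rightarrow>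
     ('g \<Rightarrow> complex) set \<Rightarrow> ('g \<Rightarrow> complex) set" where
  "IBr_of p \<theta> G B = {\<phi> \<in> IBr p \<theta> G. \<exists>\<chi>\<in>B. decomposition_number p \<theta> G \<chi> \<phi> \<noteq> 0}"


section \<open>MN-structures\<close>

text \<open>\<open>mn_dot\<close> matters only on \<open>mn_A\<close>; \<open>mn_sub s\<close>, \<open>mn_blk s\<close>, \<open>mn_r s\<close> are
  \<open>G\<^sub>s\<close>, \<open>B\<^sub>s\<close> and \<open>r\<close> with superscript s, and matter only for \<open>s \<in> mn_S\<close>.\<close>

record 'g mn_data =
  mn_S :: "'g set"
  mn_A :: "('g \<times> 'g) set"
  mn_dot :: "'g \<Rightarrow> 'g \<Rightarrow> 'g"
  mn_sub :: "'g \<Rightarrow> 'g set"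
  mn_blk :: "'g \<Rightarrow> ('g \<Rightarrow> complex) set"
  mn_r :: "'g \<Rightarrow> ('g \<Rightarrow> complex) \<Rightarrow> 'g \<Rightarrow> complex"

abbreviation mn_grp :: "('g, 'm) monoid_scheme \<Rightarrow> 'g mn_data \<Rightarrow> 'g \<Rightarrow> ('g, 'm) monoid_scheme" where
  "mn_grp G M s \<equiv> G\<lparr>carrier := mn_sub M s\<rparr>"

text \<open>Stability of \<open>mn_A\<close> under conjugation is implicit in the equivariance of the product, which
  is only defined on \<open>mn_A\<close>.\<close>

definition mn_structure ::
    "nat \<Rightarrow> (complex \<Rightarrow> 'k::field) \<Rightarrow> ('g, 'm) monoid_scheme \<Rightarrow>
     ('g \<Rightarrow> complex) set \<Rightarrow> 'g mn_data \<Rightarrow> bool" where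
  "mn_structure p \<theta> G B M \<longleftrightarrow>
     (mn_S M \<subseteq> carrier G \<and> \<one>\<^bsub>G\<^esub> \<in> mn_S M \<and>
      (\<forall>g\<in>carrier G. \<forall>s\<in>mn_S M. conjugate G g s \<in> mn_S M)) \<and>
     (mn_A M \<subseteq> mn_S M \<times> p_regular p G \<and>
      bij_betw (\<lambda>(s, c). mn_dot M s c) (mn_A M) (carrier G) \<and>
      (\<forall>(s, c)\<in>mn_A M.
         (\<forall>g\<in>carrier G.
            (conjugate G g s, conjugate G g c) \<in> mn_A M \<and>
            conjugate G g (mn_dot M s c) = mn_dot M (conjugate G g s) (conjugate G g c)) \<and>
         mn_dot M s c = s \<otimes>\<^bsub>G\<^esub> c \<and> mn_dot M s c = c \<otimes>\<^bsub>G\<^esub> s) \<and>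
      (\<forall>s\<in>mn_S M. (s, \<one>\<^bsub>G\<^esub>) \<in> mn_A M) \<and> (\<forall>c\<in>p_regular p G. (\<one>\<^bsub>G\<^esub>, c) \<in> mn_A M)) \<and>
     (\<forall>s\<in>mn_S M. subgroup (mn_sub M s) G \<and> mn_sub M s \<subseteq> centralizer G s \<and>
        mn_sub M s \<inter> p_regular p G = {c \<in> p_regular p G. (s, c) \<in> mn_A M}) \<and>
     (\<forall>s\<in>mn_S M. union_of_blocks p \<theta> (mn_grp G M s) (mn_blk M s) \<and>
        cf_linear_map (cfun.span B) (cfun.span (mn_blk M s)) (mn_r M s) \<and>
        (\<forall>\<chi>\<in>cfun.span B. \<forall>c. (s, c) \<in> mn_A M \<longrightarrow> mn_r M s \<chi> c = \<chi> (mn_dot M s c))) \<and>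
     mn_sub M \<one>\<^bsub>G\<^esub> = carrier G \<and> mn_blk M \<one>\<^bsub>G\<^esub> = B \<and> (\<forall>\<chi>\<in>cfun.span B. mn_r M \<one>\<^bsub>G\<^esub> \<chi> = \<chi>)"

definition mn_Lambda :: "('g, 'm) monoid_scheme \<Rightarrow> 'g mn_data \<Rightarrow> 'g set set" where
  "mn_Lambda G M = {l \<in> conj_classes G. l \<subseteq> mn_S M}"

definition transported :: "('g, 'm) monoid_scheme \<Rightarrow> 'g \<Rightarrow> 'g \<Rightarrow> 'g \<Rightarrow> 'g set" where
  "transported G x gS gC = {conjugate G t gC | t. t \<in> carrier G \<and> conjugate G t gS = x}"


section \<open>Broue isometries\<close>

definition I_hat ::
    "('g \<Rightarrow> complex) set \<Rightarrow> (('g \<Rightarrow> complex) \<Rightarrow> 'h \<Rightarrow> complex) \<Rightarrow> 'g \<Rightarrow> 'h \<Rightarrow> complex" where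
  "I_hat B I x x' = (\<Sum>\<chi>\<in>B. cnj (\<chi> x) * I \<chi> x')"

definition broue_isometry ::
    "nat \<Rightarrow> 'K::field set \<Rightarrow> (complex \<Rightarrow> 'K) \<Rightarrow>
     ('g, 'm) monoid_scheme \<Rightarrow> ('h, 'n) monoid_scheme \<Rightarrow>
     ('g \<Rightarrow> complex) set \<Rightarrow> ('h \<Rightarrow> complex) set \<Rightarrow>
     (('g \<Rightarrow> complex) \<Rightarrow> 'h \<Rightarrow> complex) \<Rightarrow> bool" where
  "broue_isometry p R \<iota> G G' B B' I \<longleftrightarrow>
     cf_isometry G G' (cfun.span B) (cfun.span B') I \<and>
     I ` zfun.span B = zfun.span B' \<and>
     (\<forall>x\<in>carrier G. \<forall>x'\<in>carrier G'.
        \<iota> (I_hat B I x x') \<in> (\<lambda>r. of_nat (card (centralizer G x)) * r) ` R \<inter>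
                            (\<lambda>r. of_nat (card (centralizer G' x')) * r) ` R \<and>
        (I_hat B I x x' \<noteq> 0 \<longrightarrow> (x \<in> p_regular p G \<longleftrightarrow> x' \<in> p_regular p G')))"

end

theory Submission
  imports Defs "HOL-Algebra.Algebraic_Closure_Type" "HOL-Algebra.Sylow"
begin

text \<open>
  Let n be a common multiple of the exponents of G and G'. Both arithmetic conditions on \<open>I_hat\<close>
  say that certain quotients lie in \<open>cyc_local p n\<close>, the localisation of \<open>\<int>[\<zeta>\<^sub>n]\<close> at p, because an
  integer prime to p is invertible in R (\<open>local_divisible_embed\<close>).

  The idea is to expand \<open>I_hat\<close> along the Brauer characters of the groups \<open>G'\<^sub>\<lambda>\<close>. Write x' as
  \<open>s' \<cdot> c'\<close> in the MN-structure of G', where s' may be taken to be the chosen representative of its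
  class. If that class is outside \<open>\<Lambda>0'\<close>, every I(\<open>\<chi>\<close>) vanishes at x'. Otherwise it is \<open>\<sigma> \<lambda>\<close>, and
  I(\<open>\<chi>\<close>)(x') is the value of \<open>I\<^sub>\<lambda> (r\<^sup>\<lambda> \<chi>)\<close> at the p-regular element c'. On p-regular elements a class
  function v in a union of blocks equals \<open>\<Sum> \<langle>v, \<Phi>\<^sub>\<phi>\<rangle> \<phi>\<close>, the sum over the Brauer characters \<open>\<phi>\<close> of these
  blocks, where the projective indecomposable characters \<open>\<Phi>\<^sub>\<phi>\<close> form the basis dual to the \<open>\<phi>\<close>
  (\<open>block_restriction\<close>, \<open>dual_basis_PIM\<close>). The preimage \<open>\<Psi>\<^sub>\<phi>\<close> of \<open>\<Phi>\<^sub>\<phi>\<close> under \<open>I\<^sub>\<lambda>\<close> is a generalized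
  character because \<open>I\<^sub>\<lambda>\<close> respects the lattices of generalized characters, and it vanishes off the
  p-regular elements because \<open>I\<^sub>\<lambda>\<close> respects the spans of the dual bases (\<open>dual_transfer\<close>). As \<open>I\<^sub>\<lambda>\<close> is
  an isometry, this gives (\<open>hat_formula\<close>)

    \<open>I_hat x x' = \<Sum> \<langle>w, \<Psi>\<^sub>\<phi>\<rangle> \<phi>(c')\<close>  with  \<open>w = \<Sum> cnj (\<chi> x) r\<^sup>\<lambda>(\<chi>)\<close>, the sum over \<open>\<chi> \<in> B\<close>.

  Divisibility by the order of \<open>C\<^sub>G(x)\<close> (\<open>hat_divisible\<close>): for p-regular d, the number w(d) divided by
  this order is the value at \<open>x\<^sub>\<lambda> \<cdot> d\<close> of the projection onto B of the indicator function of the class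
  of x. By Osima's theorem on block idempotents this value is p-local (\<open>block_projection_local\<close>). A
  generalized character that vanishes off the p-regular elements takes at d a value that is divisible,
  p-locally, by the order of the centralizer of d (\<open>vanishing_character_divisible\<close>). Collecting the
  scalar product of w and \<open>\<Psi>\<^sub>\<phi>\<close> by conjugacy classes of \<open>G\<^sub>\<lambda>\<close> combines the two statements.

  Separation (\<open>hat_vanishes\<close>): if x' is p-regular then s' = 1, r is the identity, and \<open>\<langle>w, \<Psi>\<^sub>\<phi>\<rangle>\<close> is the
  conjugate of \<open>\<Psi>\<^sub>\<phi>(x)\<close>, which is 0 unless x is p-regular.

  The other half of either condition follows by symmetry: the inverses of the \<open>I\<^sub>\<lambda>\<close> satisfy the
  same hypotheses with G and G' exchanged, and their \<open>I_hat\<close> is the conjugate of the given one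
  (\<open>inverse_transfer\<close>, \<open>hat_inverse\<close>).

  The modular theory rests on two facts. Ordinary characters restrict on p-regular elements to sums of
  irreducible Brauer characters (\<open>decomposition_exists\<close>), and the irreducible Brauer characters are
  linearly independent (\<open>IBr_linear_independent\<close>). Both come from a place of the complex numbers that
  extends \<open>\<theta> :: \<int>[\<zeta>\<^sub>n] \<rightarrow> k\<close> and takes its values in the algebraic closure of k (\<open>place_extension\<close>):
  complex matrices and complex linear relations are reduced along this place. One returns from the
  closure to k because k is a splitting field (\<open>irreducible_over_closure\<close>).
\<close>

section \<open>Block triangular matrices and composition factors\<close>

text \<open>From here on \<open>$\<close> indexes vectors, and \<open>prime\<close>, \<open>irreducible\<close>, \<open>degree\<close> and
  \<open>lead_coeff\<close> are the notions for numbers and univariate polynomials.\<close>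

no_notation fps_nth (infixl \<open>$\<close> 75) and Polynomials.var (\<open>X\<index>\<close>)

hide_const (open) Polynomials.degree Polynomials.lead_coeff Divisibility.prime Divisibility.irreducible

definition mtrace :: "'a::comm_monoid_add mat \<Rightarrow> 'a" where
  "mtrace A = (\<Sum>i<dim_row A. A $$ (i, i))"

lemma mtrace_mult_commute:
  fixes A :: "'a::comm_semiring_0 mat"
  assumes "A \<in> carrier_mat n m" "B \<in> carrier_mat m n"
  shows "mtrace (A * B) = mtrace (B * A)"
proof -
  have "mtrace (A * B) = (\<Sum>i<n. \<Sum>j<m. A $$ (i,j) * B $$ (j,i))"
    using assms unfolding mtrace_def
    by (auto simp: scalar_prod_def atLeast0LessThan intro!: sum.cong)
  also have "\<dots> = (\<Sum>j<m. \<Sum>i<n. B $$ (j,i) * A $$ (i,j))"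
    by (subst sum.swap) (simp add: mult.commute)
  also have "\<dots> = mtrace (B * A)"
    using assms unfolding mtrace_def
    by (auto simp: scalar_prod_def atLeast0LessThan intro!: sum.cong)
  finally show ?thesis .
qed

lemma mtrace_conjugate:
  fixes A :: "'a::comm_semiring_1 mat"
  assumes A: "A \<in> carrier_mat n n" and P: "P \<in> carrier_mat n m" and Q: "Q \<in> carrier_mat m n"
    and PQ: "P * Q = 1\<^sub>m n"
  shows "mtrace (Q * A * P) = mtrace A"
proof -
  have "mtrace (Q * A * P) = mtrace (P * (Q * A))"
    using assms by (intro mtrace_mult_commute[of _ m n]) auto
  also have "P * (Q * A) = A"
    using assms by (simp flip: assoc_mult_mat[of P n m Q n A n])
  finally show ?thesis .
qed

lemma det_nonzero_inverse:
  fixes P :: "'a::field mat"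
  assumes P: "P \<in> carrier_mat n n" and d: "det P \<noteq> 0"
  obtains Q where "Q \<in> carrier_mat n n" "P * Q = 1\<^sub>m n" "Q * P = 1\<^sub>m n"
proof -
  from det_non_zero_imp_unit[OF P d]
  have "P \<in> Units (ring_mat TYPE('a) n ())" .
  then show ?thesis using that P unfolding Units_def ring_mat_def by auto
qed

text \<open>Block upper triangular matrices with diagonal blocks of sizes m and \<open>dim_row B - m\<close>: passing to
  the two diagonal blocks is multiplicative on them. A subrepresentation and its quotient are obtained
  in this form, so that no quotient spaces have to be built.\<close>

definition low_zero :: "nat \<Rightarrow> 'a::zero mat \<Rightarrow> bool" where
  "low_zero m B \<longleftrightarrow> (\<forall>i j. m \<le> i \<longrightarrow> i < dim_row B \<longrightarrow> j < m \<longrightarrow> B $$ (i, j) = 0)"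

definition ul_block :: "nat \<Rightarrow> 'a mat \<Rightarrow> 'a mat" where
  "ul_block m B = mat m m (\<lambda>(i, j). B $$ (i, j))"

definition lr_block :: "nat \<Rightarrow> 'a mat \<Rightarrow> 'a mat" where
  "lr_block m B = mat (dim_row B - m) (dim_row B - m) (\<lambda>(i, j). B $$ (i + m, j + m))"

lemma block_carrier [simp]:
  "ul_block m B \<in> carrier_mat m m"
  "B \<in> carrier_mat n n \<Longrightarrow> lr_block m B \<in> carrier_mat (n - m) (n - m)"
  by (auto simp: ul_block_def lr_block_def)

lemma sum_lessThan_split:
  fixes f :: "nat \<Rightarrow> 'a::comm_monoid_add"
  assumes "m \<le> n"
  shows "(\<Sum>k<n. f k) = (\<Sum>k<m. f k) + (\<Sum>k<n - m. f (k + m))"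
proof -
  have "(\<Sum>k<n. f k) = (\<Sum>k<m. f k) + (\<Sum>k\<in>{m..<n}. f k)"
    by (subst sum.union_disjoint[symmetric]) (use assms in \<open>auto intro!: sum.cong\<close>)
  also have "(\<Sum>k\<in>{m..<n}. f k) = (\<Sum>k<n - m. f (k + m))"
    by (rule sum.reindex_bij_witness[of _ "\<lambda>k. k + m" "\<lambda>k. k - m"]) (use assms in auto)
  finally show ?thesis .
qed

lemma mult_index_sum:
  assumes "A \<in> carrier_mat n k" "B \<in> carrier_mat k m" "i < n" "j < m"
  shows "(A * B) $$ (i, j) = (\<Sum>l<k. A $$ (i, l) * B $$ (l, j))"
  using assms by (auto simp: scalar_prod_def atLeast0LessThan intro!: sum.cong)

lemma low_zero_mult:
  fixes B C :: "'a::semiring_0 mat"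
  assumes B: "B \<in> carrier_mat n n" and C: "C \<in> carrier_mat n n" and m: "m \<le> n"
    and zB: "low_zero m B" and zC: "low_zero m C"
  shows "low_zero m (B * C)"
    and "ul_block m (B * C) = ul_block m B * ul_block m C"
    and "lr_block m (B * C) = lr_block m B * lr_block m C"
proof -
  have zB': "B $$ (i, j) = 0" if "m \<le> i" "i < n" "j < m" for i j
    using that zB B by (auto simp: low_zero_def)
  have zC': "C $$ (i, j) = 0" if "m \<le> i" "i < n" "j < m" for i j
    using that zC C by (auto simp: low_zero_def)
  note e = mult_index_sum[OF B C] sum_lessThan_split[OF m]
  show "low_zero m (B * C)"
    unfolding low_zero_def using B C m by (auto simp: e zB' zC' simp del: index_mult_mat(1))
  show "ul_block m (B * C) = ul_block m B * ul_block m C"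
  proof (rule eq_matI)
    fix i j assume "i < dim_row (ul_block m B * ul_block m C)" "j < dim_col (ul_block m B * ul_block m C)"
    then have ij: "i < m" "j < m" by (auto simp: ul_block_def)
    show "ul_block m (B * C) $$ (i, j) = (ul_block m B * ul_block m C) $$ (i, j)"
      using ij m B C
      by (subst mult_index_sum[of _ m m _ m]) (auto simp: e zC' ul_block_def simp del: index_mult_mat(1))
  qed (auto simp: ul_block_def)
  show "lr_block m (B * C) = lr_block m B * lr_block m C"
  proof (rule eq_matI)
    fix i j assume "i < dim_row (lr_block m B * lr_block m C)" "j < dim_col (lr_block m B * lr_block m C)"
    then have ij: "i < n - m" "j < n - m" using B C by (auto simp: lr_block_def)
    show "lr_block m (B * C) $$ (i, j) = (lr_block m B * lr_block m C) $$ (i, j)"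
      using ij m B C
      by (subst mult_index_sum[of _ "n - m" "n - m" _ "n - m"])
        (auto simp: e zB' lr_block_def simp del: index_mult_mat(1))
  qed (use B C in \<open>auto simp: lr_block_def\<close>)
qed

lemma low_zero_one:
  assumes m: "m \<le> n"
  shows "low_zero m (1\<^sub>m n :: 'a::zero_neq_one mat)"
    "ul_block m (1\<^sub>m n :: 'a mat) = 1\<^sub>m m" "lr_block m (1\<^sub>m n :: 'a mat) = 1\<^sub>m (n - m)"
  using m by (auto simp: low_zero_def ul_block_def lr_block_def intro!: eq_matI)

lemma mtrace_blocks:
  assumes B: "B \<in> carrier_mat n n" and m: "m \<le> n"
  shows "mtrace B = mtrace (ul_block m B) + mtrace (lr_block m B)"
  using B sum_lessThan_split[OF m, of "\<lambda>i. B $$ (i, i)"]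
  by (auto simp: mtrace_def ul_block_def lr_block_def)

lemma char_poly_blocks:
  fixes B :: "'a::idom mat"
  assumes B: "B \<in> carrier_mat n n" and m: "m \<le> n" and z: "low_zero m B"
  shows "char_poly B = char_poly (ul_block m B) * char_poly (lr_block m B)"
proof -
  let ?U = "mat m (n - m) (\<lambda>(i, j). [:- B $$ (i, j + m):])"
  have "char_poly_matrix B = four_block_mat (char_poly_matrix (ul_block m B)) ?U
          (0\<^sub>m (n - m) m) (char_poly_matrix (lr_block m B))"
  proof (rule eq_matI)
    fix i j
    assume "i < dim_row (four_block_mat (char_poly_matrix (ul_block m B)) ?U
          (0\<^sub>m (n - m) m) (char_poly_matrix (lr_block m B)))"
      "j < dim_col (four_block_mat (char_poly_matrix (ul_block m B)) ?U
          (0\<^sub>m (n - m) m) (char_poly_matrix (lr_block m B)))"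
    then have ij: "i < n" "j < n"
      using m B by (auto simp: char_poly_matrix_def ul_block_def lr_block_def)
    have zB: "B $$ (i, j) = 0" if "m \<le> i" "j < m"
      using that z ij B by (auto simp: low_zero_def)
    show "char_poly_matrix B $$ (i, j) = four_block_mat (char_poly_matrix (ul_block m B)) ?U
          (0\<^sub>m (n - m) m) (char_poly_matrix (lr_block m B)) $$ (i, j)"
      using ij m B zB by (auto simp: char_poly_matrix_def ul_block_def lr_block_def)
  qed (use m B in \<open>auto simp: char_poly_matrix_def ul_block_def lr_block_def\<close>)
  then show ?thesis
    unfolding char_poly_def
    using det_four_block_mat_lower_left_zero[of "char_poly_matrix (ul_block m B)" m ?U "n - m"
        "0\<^sub>m (n - m) m" "char_poly_matrix (lr_block m B)"] B
    by (simp add: char_poly_matrix_closed)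
qed

definition vec_subspace :: "nat \<Rightarrow> 'a::semiring_1 vec set \<Rightarrow> bool" where
  "vec_subspace n W \<longleftrightarrow> W \<subseteq> carrier_vec n \<and> 0\<^sub>v n \<in> W \<and>
     (\<forall>u\<in>W. \<forall>w\<in>W. u + w \<in> W) \<and> (\<forall>c. \<forall>w\<in>W. c \<cdot>\<^sub>v w \<in> W)"

lemma mult_mat_vec_in_subspace:
  fixes P :: "'a::comm_semiring_1 mat"
  assumes W: "vec_subspace n W" and P: "P \<in> carrier_mat n m" and x: "x \<in> carrier_vec m"
    and *: "\<And>j. j < m \<Longrightarrow> x $ j = 0 \<or> col P j \<in> W"
  shows "P *\<^sub>v x \<in> W"
proof -
  have "vec n (\<lambda>i. \<Sum>j<k. P $$ (i, j) * x $ j) \<in> W" if "k \<le> m" for k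
    using that
  proof (induction k)
    case 0
    have "vec n (\<lambda>i. \<Sum>j<0. P $$ (i, j) * x $ j) = 0\<^sub>v n" by auto
    then show ?case using W by (simp add: vec_subspace_def)
  next
    case (Suc k)
    have "vec n (\<lambda>i. \<Sum>j<Suc k. P $$ (i, j) * x $ j)
        = vec n (\<lambda>i. \<Sum>j<k. P $$ (i, j) * x $ j) + x $ k \<cdot>\<^sub>v col P k"
      using P Suc.prems by (auto simp: mult.commute)
    moreover have "x $ k \<cdot>\<^sub>v col P k \<in> W"
    proof (cases "x $ k = 0")
      case True
      then have "x $ k \<cdot>\<^sub>v col P k = 0\<^sub>v n" using P Suc.prems by auto
      then show ?thesis using W by (simp add: vec_subspace_def)
    next
      case False
      then show ?thesis using *[of k] W Suc.prems by (auto simp: vec_subspace_def)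
    qed
    ultimately show ?case using Suc W by (auto simp: vec_subspace_def)
  qed
  from this[of m] have "vec n (\<lambda>i. \<Sum>j<m. P $$ (i, j) * x $ j) \<in> W" by simp
  also have "vec n (\<lambda>i. \<Sum>j<m. P $$ (i, j) * x $ j) = P *\<^sub>v x"
    using P x by (auto simp: scalar_prod_def atLeast0LessThan intro!: eq_vecI sum.cong)
  finally show ?thesis .
qed

text \<open>A basis of the whole space that begins with a basis of W, given as an invertible matrix P: its
  first m columns span W, so that W is cut out by the last coordinates \<open>Q *\<^sub>v w\<close>. P is an invertible
  matrix with the largest possible number m of leading columns in W. If some w in W had a nonzero
  coordinate beyond m, replacing that column by w would keep the determinant nonzero (Cramer) and
  raise m.\<close>

lemma subspace_basis:
  fixes W :: "'a::field vec set"
  assumes W: "vec_subspace n W"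
  obtains P Q m where "P \<in> carrier_mat n n" "Q \<in> carrier_mat n n" "P * Q = 1\<^sub>m n" "Q * P = 1\<^sub>m n"
    "m \<le> n" "\<And>w. w \<in> carrier_vec n \<Longrightarrow> w \<in> W \<longleftrightarrow> (\<forall>i. m \<le> i \<longrightarrow> i < n \<longrightarrow> (Q *\<^sub>v w) $ i = 0)"
proof -
  define S where "S = {m. m \<le> n \<and> (\<exists>P\<in>carrier_mat n n. det P \<noteq> 0 \<and> (\<forall>j<m. col P j \<in> W))}"
  have "0 \<in> S" unfolding S_def by (auto intro!: bexI[of _ "1\<^sub>m n"])
  moreover have fin: "finite S" unfolding S_def by auto
  ultimately have MS: "Max S \<in> S" by (intro Max_in) auto
  define m where "m = Max S"
  from MS obtain P where P: "P \<in> carrier_mat n n" "det P \<noteq> 0" "\<And>j. j < m \<Longrightarrow> col P j \<in> W"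
    and m: "m \<le> n" unfolding S_def m_def by auto
  from det_nonzero_inverse[OF P(1,2)] obtain Q where
    Q: "Q \<in> carrier_mat n n" "P * Q = 1\<^sub>m n" "Q * P = 1\<^sub>m n" .
  have "w \<in> W \<longleftrightarrow> (\<forall>i. m \<le> i \<longrightarrow> i < n \<longrightarrow> (Q *\<^sub>v w) $ i = 0)" if w: "w \<in> carrier_vec n" for w
  proof
    assume R: "\<forall>i. m \<le> i \<longrightarrow> i < n \<longrightarrow> (Q *\<^sub>v w) $ i = 0"
    have "w = P *\<^sub>v (Q *\<^sub>v w)"
      using P Q w by (simp flip: assoc_mult_mat_vec[of P n n Q n w])
    also have "\<dots> \<in> W"
      by (rule mult_mat_vec_in_subspace[OF W P(1)]) (use Q w P R in \<open>auto simp: not_less\<close>, metis not_less)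
    finally show "w \<in> W" .
  next
    assume wW: "w \<in> W"
    show "\<forall>i. m \<le> i \<longrightarrow> i < n \<longrightarrow> (Q *\<^sub>v w) $ i = 0"
    proof (intro allI impI, rule ccontr)
      fix i assume i: "m \<le> i" "i < n" and nz: "(Q *\<^sub>v w) $ i \<noteq> 0"
      define P' where "P' = replace_col P w i"
      have PQw: "P *\<^sub>v (Q *\<^sub>v w) = w"
        using P Q w by (simp flip: assoc_mult_mat_vec[of P n n Q n w])
      have P': "P' \<in> carrier_mat n n" unfolding P'_def replace_col_def using P by auto
      have d: "det P' \<noteq> 0"
        using cramer_lemma_mat[OF P(1), of "Q *\<^sub>v w" i] Q w i nz P unfolding PQw P'_def by auto
      have eP': "P' $$ (r, j) = (if j = i then w $ r else P $$ (r, j))" if "r < n" "j < n" for r j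
        using that P w i unfolding P'_def replace_col_def by auto
      \<comment> \<open>w is moved to position m, next to the columns already in W\<close>
      define P'' where "P'' = (if i = m then P' else swapcols m i P')"
      have P'': "P'' \<in> carrier_mat n n" "det P'' \<noteq> 0"
        using P' d det_swapcols[of m n i P'] i unfolding P''_def by auto
      have "col P'' j \<in> W" if "j < Suc m" for j
      proof -
        have "col P'' j = (if j = m then w else col P j)"
          using that i P' P(1) P''(1) w
          by (intro eq_vecI) (auto simp: P''_def eP' mat_swapcols_def)
        then show ?thesis using that P(3)[of j] wW by auto
      qed
      then have "Suc m \<in> S" unfolding S_def using i P'' by auto
      then have "Suc m \<le> m" unfolding m_def using fin by (intro Max_ge) auto
      then show False by simp
    qed
  qed
  with that P Q m show ?thesis by blast
qed

definition inverse_mats :: "nat \<Rightarrow> 'a::semiring_1 mat \<Rightarrow> 'a mat \<Rightarrow> bool" where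
  "inverse_mats n P Q \<longleftrightarrow> P \<in> carrier_mat n n \<and> Q \<in> carrier_mat n n \<and> P * Q = 1\<^sub>m n \<and> Q * P = 1\<^sub>m n"

lemma inverse_mats_vec:
  assumes "inverse_mats n P Q" "w \<in> carrier_vec n"
  shows "P *\<^sub>v (Q *\<^sub>v w) = w" "Q *\<^sub>v (P *\<^sub>v w) = w"
  using assms unfolding inverse_mats_def
  by (metis assoc_mult_mat_vec one_mult_mat_vec)+

lemma conj_mult:
  assumes "inverse_mats n P Q" and A: "A \<in> carrier_mat n n" and B: "B \<in> carrier_mat n n"
  shows "Q * A * P * (Q * B * P) = Q * (A * B) * (P :: 'a::semiring_1 mat)"
proof -
  from assms have P: "P \<in> carrier_mat n n" and Q: "Q \<in> carrier_mat n n" and PQ: "P * Q = 1\<^sub>m n"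
    by (auto simp: inverse_mats_def)
  have "Q * A * P * (Q * B * P) = Q * (A * ((P * Q) * (B * P)))"
    using A B P Q by (simp add: assoc_mult_mat[of _ n n _ n _ n])
  also have "\<dots> = Q * (A * B) * P"
    using A B P Q by (simp add: PQ assoc_mult_mat[of _ n n _ n _ n])
  finally show ?thesis .
qed

lemma conj_pow:
  assumes "inverse_mats n P Q" and A: "A \<in> carrier_mat n n"
  shows "(Q * A * P) ^\<^sub>m k = Q * (A ^\<^sub>m k) * (P :: 'a::semiring_1 mat)"
proof (induction k)
  case 0
  then show ?case using assms by (auto simp: inverse_mats_def)
next
  case (Suc k)
  then show ?case
    using conj_mult[OF assms(1), of "A ^\<^sub>m k" A] A by simp
qed

lemma mtrace_conj:
  assumes "inverse_mats n P Q" and A: "A \<in> carrier_mat n n"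
  shows "mtrace (Q * A * P) = mtrace (A :: 'a::comm_semiring_1 mat)"
  using mtrace_conjugate[of A n P n Q] assms by (auto simp: inverse_mats_def)

lemma char_poly_conj:
  assumes "inverse_mats n P Q" and A: "A \<in> carrier_mat n n"
  shows "char_poly (Q * A * P) = char_poly (A :: 'a::comm_ring_1 mat)"
proof (rule char_poly_similar)
  show "similar_mat (Q * A * P) A"
    using assms by (intro similar_matI[of _ _ Q P n]) (auto simp: inverse_mats_def)
qed

lemma low_zero_of_invariant:
  fixes A :: "'a::field mat"
  assumes PQ: "inverse_mats n P Q" and A: "A \<in> carrier_mat n n" and m: "m \<le> n"
    and W: "\<And>w. w \<in> carrier_vec n \<Longrightarrow> w \<in> W \<longleftrightarrow> (\<forall>i. m \<le> i \<longrightarrow> i < n \<longrightarrow> (Q *\<^sub>v w) $ i = 0)"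
    and inv: "\<And>w. w \<in> W \<Longrightarrow> A *\<^sub>v w \<in> W"
  shows "low_zero m (Q * A * P)"
  unfolding low_zero_def
proof (intro allI impI)
  fix i j assume i: "m \<le> i" "i < dim_row (Q * A * P)" and j: "j < m"
  from PQ have P: "P \<in> carrier_mat n n" and Q: "Q \<in> carrier_mat n n" and QP: "Q * P = 1\<^sub>m n"
    by (auto simp: inverse_mats_def)
  have i': "i < n" using i Q by simp
  have jn: "j < n" using j m by simp
  let ?w = "col P j"
  have w: "?w \<in> carrier_vec n" using P jn by auto
  have "Q *\<^sub>v ?w = col (Q * P) j" using col_mult2[OF Q P jn] by simp
  also have "\<dots> = unit_vec n j" using QP jn by simp
  finally have "?w \<in> W" using W[OF w] j by simp
  then have "A *\<^sub>v ?w \<in> W" by (rule inv)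
  then have "(Q *\<^sub>v (A *\<^sub>v ?w)) $ i = 0" using W[of "A *\<^sub>v ?w"] A w i(1) i' by (meson mult_mat_vec_carrier)
  also have "Q *\<^sub>v (A *\<^sub>v ?w) = col (Q * A * P) j"
    using col_mult2[of Q n n "A * P" n j] col_mult2[of A n n P n j] P Q A jn
    by (simp add: assoc_mult_mat[of Q n n A n P n])
  finally show "(Q * A * P) $$ (i, j) = 0" using i i' jn P Q A by simp
qed

lemma degree_prod_list_linear: "degree (\<Prod>e\<leftarrow>es. [:- e, 1:]) = length (es :: 'a::idom list)"
  using degree_linear_factors[of uminus es] by simp

lemma low_zero_pow:
  fixes B :: "'a::semiring_1 mat"
  assumes B: "B \<in> carrier_mat n n" and m: "m \<le> n" and z: "low_zero m B"
  shows "low_zero m (B ^\<^sub>m k) \<and> ul_block m (B ^\<^sub>m k) = ul_block m B ^\<^sub>m k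
      \<and> lr_block m (B ^\<^sub>m k) = lr_block m B ^\<^sub>m k"
proof (induction k)
  case 0
  then show ?case using low_zero_one[OF m] B by (auto simp: ul_block_def lr_block_def)
next
  case (Suc k)
  then show ?case using low_zero_mult[OF _ B m _ z, of "B ^\<^sub>m k"] B by simp
qed

text \<open>By induction on the number of roots: an eigenvector as first basis vector splits off a \<open>1 \<times> 1\<close>
  block. The case \<open>k = 1\<close> expresses the trace by the roots of the characteristic polynomial; larger k are
  needed for inverses of group elements and for the Frobenius map.\<close>

theorem mtrace_pow_split:
  fixes A :: "'a::field mat"
  assumes "A \<in> carrier_mat n n" and "char_poly A = (\<Prod>e\<leftarrow>es. [:- e, 1:])"
  shows "mtrace (A ^\<^sub>m k) = (\<Sum>e\<leftarrow>es. e ^ k)"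
  using assms
proof (induction es arbitrary: n A)
  case Nil
  then have "n = 0" using degree_monic_char_poly[of A n] by simp
  then show ?case using Nil by (simp add: mtrace_def)
next
  case (Cons e es)
  note A = Cons.prems(1)
  have "length (e # es) = n"
    using degree_monic_char_poly[OF A] degree_prod_list_linear[of "e # es"] Cons.prems(2) by simp
  then have n: "0 < n" by auto
  have "eigenvalue A e"
    using eigenvalue_root_char_poly[OF A] Cons.prems(2) by simp
  then obtain v where v: "v \<in> carrier_vec n" "v \<noteq> 0\<^sub>v n" "A *\<^sub>v v = e \<cdot>\<^sub>v v"
    using A unfolding eigenvalue_def eigenvector_def by auto
  then obtain i where i: "i < n" "v $ i \<noteq> 0"
    by (metis carrier_vecD eq_vecI index_zero_vec(1) index_zero_vec(2))
  \<comment> \<open>an invertible matrix with the eigenvector v among its columns\<close>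
  define P' where "P' = replace_col (1\<^sub>m n) v i"
  have P': "P' \<in> carrier_mat n n" by (auto simp: P'_def replace_col_def)
  have d: "det P' \<noteq> 0"
    using cramer_lemma_mat[of "1\<^sub>m n" n v i] v i by (simp add: P'_def)
  define P where "P = (if i = 0 then P' else swapcols 0 i P')"
  have P: "P \<in> carrier_mat n n" "det P \<noteq> 0"
    using P' d det_swapcols[of 0 n i P'] i n unfolding P_def by auto
  have c0: "col P 0 = v"
    using P' v i n P(1) by (intro eq_vecI) (auto simp: P_def P'_def replace_col_def mat_swapcols_def)
  from det_nonzero_inverse[OF P] obtain Q where
    Q: "Q \<in> carrier_mat n n" "P * Q = 1\<^sub>m n" "Q * P = 1\<^sub>m n" .
  have PQ: "inverse_mats n P Q" using P Q by (simp add: inverse_mats_def)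
  define B where "B = Q * A * P"
  have B: "B \<in> carrier_mat n n" using P Q A by (auto simp: B_def)
  have "col B 0 = Q *\<^sub>v (A *\<^sub>v v)"
    using c0 col_mult2[of Q n n "A * P" n 0] col_mult2[of A n n P n 0] P Q A n
    by (simp add: B_def assoc_mult_mat[of Q n n A n P n])
  also have "\<dots> = e \<cdot>\<^sub>v (Q *\<^sub>v v)" using v Q by (simp add: mult_mat_vec)
  also have "Q *\<^sub>v v = col (Q * P) 0" using col_mult2[OF Q(1) P(1) n] c0 by simp
  also have "\<dots> = unit_vec n 0" using Q n by simp
  finally have cB: "col B 0 = e \<cdot>\<^sub>v unit_vec n 0" .
  have B0: "B $$ (i, 0) = (if i = 0 then e else 0)" if "i < n" for i
    using arg_cong[OF cB, of "\<lambda>u. u $ i"] that n B by auto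
  have z: "low_zero 1 B" unfolding low_zero_def using B0 B by auto
  have ul: "ul_block 1 B = mat 1 1 (\<lambda>_. e)" using B0[of 0] n by (auto simp: ul_block_def)
  have lr: "lr_block 1 B \<in> carrier_mat (n - 1) (n - 1)" using B by simp
  have cul: "char_poly (ul_block 1 B) = [:- e, 1:]"
    by (subst ul, subst char_poly_upper_triangular[of _ 1]) (auto simp: diag_mat_def upper_triangular_def)
  have "[:- e, 1:] * char_poly (lr_block 1 B) = [:- e, 1:] * (\<Prod>e\<leftarrow>es. [:- e, 1:])"
    using char_poly_blocks[OF B _ z] n char_poly_conj[OF PQ A] Cons.prems(2) cul
    by (simp add: B_def)
  then have "char_poly (lr_block 1 B) = (\<Prod>e\<leftarrow>es. [:- e, 1:])"
    by (simp only: mult_cancel_left) auto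
  note IH = Cons.IH[OF lr this]
  have pw: "mat 1 1 (\<lambda>_. e) ^\<^sub>m k = mat 1 1 (\<lambda>_. e ^ k)" for k
    by (induction k) (auto intro!: eq_matI simp: scalar_prod_def)
  have "mtrace (A ^\<^sub>m k) = mtrace (B ^\<^sub>m k)"
    unfolding B_def conj_pow[OF PQ A] using mtrace_conj[OF PQ, of "A ^\<^sub>m k"] A by simp
  also have "\<dots> = mtrace (ul_block 1 (B ^\<^sub>m k)) + mtrace (lr_block 1 (B ^\<^sub>m k))"
    using mtrace_blocks[of "B ^\<^sub>m k" n 1] B n by simp
  also have "\<dots> = e ^ k + (\<Sum>e\<leftarrow>es. e ^ k)"
    using low_zero_pow[OF B _ z, of k] n IH ul pw[of k] by (simp add: mtrace_def)
  finally show ?case by simp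
qed

lemma invariant_subspace_vec_subspace:
  "invariant_subspace G n \<rho> W \<longleftrightarrow> vec_subspace n W \<and> (\<forall>g\<in>carrier G. \<forall>w\<in>W. \<rho> g *\<^sub>v w \<in> W)"
  unfolding invariant_subspace_def vec_subspace_def by blast

lemma reducible_block_form:
  fixes \<rho> :: "'g \<Rightarrow> 'a::field mat"
  assumes G: "group G" and r: "matrix_rep G n \<rho>" and n: "n > 0" and ni: "\<not> irreducible_rep G n \<rho>"
  shows "\<exists>P Q m. inverse_mats n P Q \<and> 0 < m \<and> m < n \<and>
    (\<forall>g\<in>carrier G. low_zero m (Q * \<rho> g * P)) \<and>
    matrix_rep G m (\<lambda>g. ul_block m (Q * \<rho> g * P)) \<and>
    matrix_rep G (n - m) (\<lambda>g. lr_block m (Q * \<rho> g * P))"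
proof -
  interpret group G by fact
  from ni r n obtain W where W: "invariant_subspace G n \<rho> W" "W \<noteq> {0\<^sub>v n}" "W \<noteq> carrier_vec n"
    unfolding irreducible_rep_def by auto
  have sW: "vec_subspace n W" and iW: "\<And>g w. g \<in> carrier G \<Longrightarrow> w \<in> W \<Longrightarrow> \<rho> g *\<^sub>v w \<in> W"
    using W(1) by (auto simp: invariant_subspace_vec_subspace)
  have WC: "W \<subseteq> carrier_vec n" "0\<^sub>v n \<in> W" using sW by (auto simp: vec_subspace_def)
  obtain P Q m where P: "P \<in> carrier_mat n n" "Q \<in> carrier_mat n n" "P * Q = 1\<^sub>m n" "Q * P = 1\<^sub>m n"
    and m: "m \<le> n"
    and Wm: "\<And>w. w \<in> carrier_vec n \<Longrightarrow> w \<in> W \<longleftrightarrow> (\<forall>i. m \<le> i \<longrightarrow> i < n \<longrightarrow> (Q *\<^sub>v w) $ i = 0)"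
    using subspace_basis[OF sW] by metis
  have PQ: "inverse_mats n P Q" using P by (simp add: inverse_mats_def)
  have "m \<noteq> n"
  proof
    assume "m = n"
    then have "carrier_vec n \<subseteq> W" using Wm by auto
    then show False using W(3) WC by auto
  qed
  moreover have "m \<noteq> 0"
  proof
    assume "m = 0"
    have "w = 0\<^sub>v n" if "w \<in> W" for w
    proof -
      have w: "w \<in> carrier_vec n" using that WC by auto
      have "Q *\<^sub>v w = 0\<^sub>v n" using Wm[OF w] that \<open>m = 0\<close> P by (auto intro!: eq_vecI)
      then have "P *\<^sub>v (Q *\<^sub>v w) = 0\<^sub>v n" using P by auto
      then show ?thesis using inverse_mats_vec(1)[OF PQ w] by simp
    qed
    then show False using W(2) WC(2) by blast
  qed
  ultimately have m': "0 < m" "m < n" using m by auto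
  have rc: "\<rho> g \<in> carrier_mat n n" if "g \<in> carrier G" for g using r that by (auto simp: matrix_rep_def)
  have lz: "low_zero m (Q * \<rho> g * P)" if "g \<in> carrier G" for g
    using low_zero_of_invariant[OF PQ rc[OF that] m Wm] iW that by blast
  have cc: "Q * \<rho> g * P \<in> carrier_mat n n" if "g \<in> carrier G" for g using P by auto
  have one: "Q * \<rho> \<one>\<^bsub>G\<^esub> * P = 1\<^sub>m n" using r P by (auto simp: matrix_rep_def)
  have mul: "Q * \<rho> (g \<otimes>\<^bsub>G\<^esub> h) * P = (Q * \<rho> g * P) * (Q * \<rho> h * P)"
    if "g \<in> carrier G" "h \<in> carrier G" for g h
    using conj_mult[OF PQ rc rc] that r by (auto simp: matrix_rep_def)
  have "matrix_rep G m (\<lambda>g. ul_block m (Q * \<rho> g * P))"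
    unfolding matrix_rep_def using low_zero_mult(2)[OF cc cc m lz lz] low_zero_one(2)[OF m]
    by (auto simp: one mul)
  moreover have "matrix_rep G (n - m) (\<lambda>g. lr_block m (Q * \<rho> g * P))"
    unfolding matrix_rep_def using low_zero_mult(3)[OF cc cc m lz lz] low_zero_one(3)[OF m] block_carrier(2)[OF cc]
    by (auto simp: one mul)
  ultimately show ?thesis using PQ m' lz by blast
qed

text \<open>The composition factors of a representation enter only through their characteristic polynomials
  and traces, hence a list of irreducible representations is enough; no filtration is recorded.\<close>

theorem composition_factors:
  fixes \<rho> :: "'g \<Rightarrow> 'a::field mat"
  assumes G: "group G" and "matrix_rep G n \<rho>"
  shows "\<exists>rs. (\<forall>(m, \<tau>)\<in>set rs. irreducible_rep G m \<tau>) \<and>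
      (\<forall>g\<in>carrier G. char_poly (\<rho> g) = (\<Prod>(m, \<tau>)\<leftarrow>rs. char_poly (\<tau> g))
         \<and> mtrace (\<rho> g) = (\<Sum>(m, \<tau>)\<leftarrow>rs. mtrace (\<tau> g)))"
  using assms(2)
proof (induction n arbitrary: \<rho> rule: less_induct)
  case (less n)
  note r = less.prems
  have rc: "\<rho> g \<in> carrier_mat n n" if "g \<in> carrier G" for g using r that by (auto simp: matrix_rep_def)
  consider "n = 0" | "irreducible_rep G n \<rho>" | "n > 0" "\<not> irreducible_rep G n \<rho>" by blast
  then show ?case
  proof cases
    case 1
    then show ?thesis
      using rc by (intro exI[of _ "[]"]) (auto simp: char_poly_def mtrace_def char_poly_matrix_closed dest: rc)
  next
    case 2
    then show ?thesis by (intro exI[of _ "[(n, \<rho>)]"]) auto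
  next
    case 3
    obtain P Q m where PQ: "inverse_mats n P Q" and m: "0 < m" "m < n"
      and lz: "\<And>g. g \<in> carrier G \<Longrightarrow> low_zero m (Q * \<rho> g * P)"
      and r1: "matrix_rep G m (\<lambda>g. ul_block m (Q * \<rho> g * P))"
      and r2: "matrix_rep G (n - m) (\<lambda>g. lr_block m (Q * \<rho> g * P))"
      using reducible_block_form[OF G r 3] by blast
    from less.IH[OF m(2) r1] obtain rs1 where rs1: "\<forall>(m, \<tau>)\<in>set rs1. irreducible_rep G m \<tau>"
      "\<forall>g\<in>carrier G. char_poly (ul_block m (Q * \<rho> g * P)) = (\<Prod>(m, \<tau>)\<leftarrow>rs1. char_poly (\<tau> g))
       \<and> mtrace (ul_block m (Q * \<rho> g * P)) = (\<Sum>(m, \<tau>)\<leftarrow>rs1. mtrace (\<tau> g))"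
      by blast
    from less.IH[OF _ r2] m obtain rs2 where rs2: "\<forall>(m, \<tau>)\<in>set rs2. irreducible_rep G m \<tau>"
      "\<forall>g\<in>carrier G. char_poly (lr_block m (Q * \<rho> g * P)) = (\<Prod>(m, \<tau>)\<leftarrow>rs2. char_poly (\<tau> g))
       \<and> mtrace (lr_block m (Q * \<rho> g * P)) = (\<Sum>(m, \<tau>)\<leftarrow>rs2. mtrace (\<tau> g))"
      by auto
    have cc: "Q * \<rho> g * P \<in> carrier_mat n n" for g
      using PQ by (auto simp: inverse_mats_def)
    have tr: "mtrace (\<rho> g) = mtrace (ul_block m (Q * \<rho> g * P)) + mtrace (lr_block m (Q * \<rho> g * P))"
      if "g \<in> carrier G" for g
      using mtrace_blocks[OF cc, of m g] mtrace_conj[OF PQ rc[OF that]] m by simp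
    have cp: "char_poly (\<rho> g) = char_poly (ul_block m (Q * \<rho> g * P)) * char_poly (lr_block m (Q * \<rho> g * P))"
      if "g \<in> carrier G" for g
      using char_poly_blocks[OF cc _ lz[OF that]] char_poly_conj[OF PQ rc[OF that]] m by simp
    show ?thesis
      using rs1 rs2 tr cp by (intro exI[of _ "rs1 @ rs2"]) auto
  qed
qed

section \<open>Schur's lemma and the independence of matrix coefficients\<close>

locale fin_group = group G for G (structure) +
  assumes finG: "finite (carrier G)"
begin

lemma rep_carrier:
  assumes "matrix_rep G n \<rho>" "g \<in> carrier G" shows "\<rho> g \<in> carrier_mat n n"
  using assms by (auto simp: matrix_rep_def)

lemma rep_mult:
  assumes "matrix_rep G n \<rho>" "g \<in> carrier G" "h \<in> carrier G"
  shows "\<rho> (g \<otimes> h) = \<rho> g * \<rho> h"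
  using assms by (auto simp: matrix_rep_def)

lemma rep_one: assumes "matrix_rep G n \<rho>" shows "\<rho> \<one> = 1\<^sub>m n"
  using assms by (auto simp: matrix_rep_def)

lemma rep_pow:
  assumes "matrix_rep G n \<rho>" "g \<in> carrier G"
  shows "\<rho> (g [^] (k::nat)) = \<rho> g ^\<^sub>m k"
proof (induction k)
  case 0
  then show ?case using rep_one[OF assms(1)] rep_carrier[OF assms] by simp
next
  case (Suc k)
  then show ?case using rep_mult[OF assms(1), of "g [^] k" g] assms(2) by simp
qed

lemma rep_inv:
  assumes "matrix_rep G n \<rho>" "g \<in> carrier G"
  shows "inverse_mats n (\<rho> g) (\<rho> (inv g))"
  using assms rep_mult[OF assms(1), of g "inv g"] rep_mult[OF assms(1), of "inv g" g]
    rep_one[OF assms(1)] rep_carrier[OF assms(1)]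
  by (auto simp: inverse_mats_def)

lemma irr_rep: "irreducible_rep G n \<rho> \<Longrightarrow> matrix_rep G n \<rho>"
  by (simp add: irreducible_rep_def)

lemma irr_pos: "irreducible_rep G n \<rho> \<Longrightarrow> 0 < n"
  by (simp add: irreducible_rep_def)

lemma irr_invariant:
  assumes "irreducible_rep G n \<rho>" "vec_subspace n W"
    and "\<And>g w. g \<in> carrier G \<Longrightarrow> w \<in> W \<Longrightarrow> \<rho> g *\<^sub>v w \<in> W"
  shows "W = {0\<^sub>v n} \<or> W = carrier_vec n"
  using assms invariant_subspace_vec_subspace[of G n \<rho> W] by (auto simp: irreducible_rep_def)

lemma sum_shift:
  fixes f :: "'a \<Rightarrow> 'c::comm_monoid_add"
  assumes "g \<in> carrier G"
  shows "(\<Sum>h\<in>carrier G. f (g \<otimes> h)) = (\<Sum>h\<in>carrier G. f h)"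
  by (rule sum.reindex_bij_witness[of _ "\<lambda>h. inv g \<otimes> h" "\<lambda>h. g \<otimes> h"])
    (use assms in \<open>auto simp: m_assoc[symmetric]\<close>)

lemma sum_shift_right:
  fixes f :: "'a \<Rightarrow> 'c::comm_monoid_add"
  assumes "g \<in> carrier G"
  shows "(\<Sum>h\<in>carrier G. f (h \<otimes> g)) = (\<Sum>h\<in>carrier G. f h)"
  by (rule sum.reindex_bij_witness[of _ "\<lambda>h. h \<otimes> inv g" "\<lambda>h. h \<otimes> g"])
    (use assms in \<open>auto simp: m_assoc\<close>)

end

lemma unit_vec_mult:
  fixes M :: "'a::semiring_1 mat"
  assumes "M \<in> carrier_mat n m" "j < m"
  shows "M *\<^sub>v unit_vec m j = col M j"
  using assms by (intro eq_vecI) auto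

lemma mat_eq_by_vecs:
  fixes A B :: "'a::semiring_1 mat"
  assumes "A \<in> carrier_mat n m" "B \<in> carrier_mat n m"
    and "\<And>j. j < m \<Longrightarrow> A *\<^sub>v unit_vec m j = B *\<^sub>v unit_vec m j"
  shows "A = B"
proof (rule eq_matI)
  fix i j assume ij: "i < dim_row B" "j < dim_col B"
  then have "col A j = col B j"
    using assms(3)[of j] assms(1,2) by (simp add: unit_vec_mult[of A n m] unit_vec_mult[of B n m])
  then show "A $$ (i, j) = B $$ (i, j)"
    using ij assms(1,2) by (metis carrier_matD(1,2) index_col)
qed (use assms in auto)

text \<open>Otherwise pad M and N to square matrices of size m with zeros: the padded product would still be
  the identity, although the padded M has a zero row.\<close>

lemma left_inverse_dim:
  fixes M N :: "'a::field mat"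
  assumes M: "M \<in> carrier_mat n m" and N: "N \<in> carrier_mat m n" and NM: "N * M = 1\<^sub>m m"
  shows "m \<le> n"
proof (rule ccontr)
  assume "\<not> m \<le> n" then have nm: "n < m" by simp
  define M' where "M' = mat m m (\<lambda>(i, j). if i < n then M $$ (i, j) else 0)"
  define N' where "N' = mat m m (\<lambda>(i, j). if j < n then N $$ (i, j) else 0)"
  have c: "M' \<in> carrier_mat m m" "N' \<in> carrier_mat m m" by (auto simp: M'_def N'_def)
  have "N' * M' = N * M"
  proof (rule eq_matI)
    fix i j assume "i < dim_row (N * M)" "j < dim_col (N * M)"
    then have ij: "i < m" "j < m" using M N by auto
    show "(N' * M') $$ (i, j) = (N * M) $$ (i, j)"
      unfolding mult_index_sum[OF c(2,1) ij] mult_index_sum[OF N M ij]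
      using sum_lessThan_split[of n m "\<lambda>l. N' $$ (i, l) * M' $$ (l, j)"] nm ij
      by (simp add: M'_def N'_def)
  qed (use M N c in auto)
  then have "M' * N' = 1\<^sub>m m" using mat_mult_left_right_inverse[OF c(2,1)] NM by simp
  then have "(M' * N') $$ (n, n) = 1" using nm by simp
  moreover have "(M' * N') $$ (n, n) = 0"
    unfolding mult_index_sum[OF c nm nm] using nm by (simp add: M'_def)
  ultimately show False by simp
qed

context fin_group
begin

text \<open>Kernel and image of the intertwiner M are invariant subspaces, so M is bijective.\<close>

theorem schur_invertible:
  fixes \<tau> \<rho> :: "'a \<Rightarrow> 'k::field mat"
  assumes \<tau>: "irreducible_rep G n \<tau>" and \<rho>: "irreducible_rep G m \<rho>" and M: "M \<in> carrier_mat n m"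
    and int: "\<And>g. g \<in> carrier G \<Longrightarrow> \<tau> g * M = M * \<rho> g" and nz: "M \<noteq> 0\<^sub>m n m"
  shows "n = m" "\<exists>N. inverse_mats n M N"
proof -
  note t = rep_carrier[OF irr_rep[OF \<tau>]] and r = rep_carrier[OF irr_rep[OF \<rho>]]
  have intv: "\<tau> g *\<^sub>v (M *\<^sub>v v) = M *\<^sub>v (\<rho> g *\<^sub>v v)" if "g \<in> carrier G" "v \<in> carrier_vec m" for g v
    using int[OF that(1)] t[OF that(1)] r[OF that(1)] M that(2)
    by (metis assoc_mult_mat_vec)
  from nz M obtain j where j: "j < m" "col M j \<noteq> 0\<^sub>v n"
  proof -
    have "\<exists>j<m. col M j \<noteq> 0\<^sub>v n"
    proof (rule ccontr)
      assume "\<not> ?thesis"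
      then have "M = 0\<^sub>m n m" using M by (intro mat_eq_by_vecs[of _ n m]) (auto simp: unit_vec_mult[of _ n m])
      then show False using nz by simp
    qed
    then show ?thesis using that by blast
  qed
  have cj: "M *\<^sub>v unit_vec m j = col M j" using unit_vec_mult[OF M j(1)] .
  define K where "K = {v \<in> carrier_vec m. M *\<^sub>v v = 0\<^sub>v n}"
  have "vec_subspace m K"
    unfolding vec_subspace_def K_def using M by (auto simp: mult_add_distrib_mat_vec[of _ n m] mult_mat_vec)
  then have "K = {0\<^sub>v m} \<or> K = carrier_vec m"
  proof (rule irr_invariant[OF \<rho>])
    fix g w assume g: "g \<in> carrier G" and "w \<in> K"
    then have w: "w \<in> carrier_vec m" "M *\<^sub>v w = 0\<^sub>v n" by (auto simp: K_def)
    have "M *\<^sub>v (\<rho> g *\<^sub>v w) = \<tau> g *\<^sub>v 0\<^sub>v n" using intv[OF g w(1)] w(2) by simp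
    also have "\<dots> = 0\<^sub>v n" using t[OF g] by (auto intro!: eq_vecI)
    finally show "\<rho> g *\<^sub>v w \<in> K"
      using mult_mat_vec_carrier[OF r[OF g] w(1)] by (simp add: K_def)
  qed
  moreover have "unit_vec m j \<notin> K" using cj j by (simp add: K_def)
  ultimately have K: "K = {0\<^sub>v m}" by auto
  have inj: "u = v" if "u \<in> carrier_vec m" "v \<in> carrier_vec m" "M *\<^sub>v u = M *\<^sub>v v" for u v
  proof -
    have "M *\<^sub>v (u - v) = 0\<^sub>v n"
      using that M by (simp add: mult_minus_distrib_mat_vec[of M n m])
    then have "u - v \<in> K" using that by (simp add: K_def)
    then have d: "u - v = 0\<^sub>v m" using K by simp
    show ?thesis
    proof (rule eq_vecI)
      fix i assume "i < dim_vec v"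
      then show "u $ i = v $ i" using arg_cong[OF d, of "\<lambda>x. x $ i"] that by simp
    qed (use that in auto)
  qed
  define J where "J = (\<lambda>v. M *\<^sub>v v) ` carrier_vec m"
  have "vec_subspace n J"
    unfolding vec_subspace_def
  proof (intro conjI ballI allI)
    show "J \<subseteq> carrier_vec n" using M by (auto simp: J_def)
    show "0\<^sub>v n \<in> J" unfolding J_def using M by (intro image_eqI[of _ _ "0\<^sub>v m"]) auto
    fix u w assume "u \<in> J" "w \<in> J"
    then obtain u' w' where "u' \<in> carrier_vec m" "w' \<in> carrier_vec m" "u = M *\<^sub>v u'" "w = M *\<^sub>v w'"
      by (auto simp: J_def)
    then show "u + w \<in> J" unfolding J_def using M
      by (intro image_eqI[of _ _ "u' + w'"]) (auto simp: mult_add_distrib_mat_vec[of M n m])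
  next
    fix c w assume "w \<in> J"
    then obtain w' where "w' \<in> carrier_vec m" "w = M *\<^sub>v w'" by (auto simp: J_def)
    then show "c \<cdot>\<^sub>v w \<in> J" unfolding J_def using M
      by (intro image_eqI[of _ _ "c \<cdot>\<^sub>v w'"]) (auto simp: mult_mat_vec[of M n m])
  qed
  then have "J = {0\<^sub>v n} \<or> J = carrier_vec n"
    by (rule irr_invariant[OF \<tau>]) (use intv r in \<open>auto simp: J_def intro!: image_eqI mult_mat_vec_carrier\<close>)
  moreover have "col M j \<in> J" unfolding J_def using cj by (metis image_eqI unit_vec_carrier)
  ultimately have J: "J = carrier_vec n" using j by auto
  have "\<forall>i. \<exists>v\<in>carrier_vec m. M *\<^sub>v v = unit_vec n i"
    using J unfolding J_def by (metis imageE unit_vec_carrier)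
  then obtain f where f: "\<And>i. f i \<in> carrier_vec m" "\<And>i. M *\<^sub>v f i = unit_vec n i" by metis
  define N where "N = mat m n (\<lambda>(a, i). f i $ a)"
  have N: "N \<in> carrier_mat m n" by (simp add: N_def)
  have cN: "N *\<^sub>v unit_vec n i = f i" if "i < n" for i
    using that f(1)[of i] by (subst unit_vec_mult[OF N that]) (auto simp: N_def intro!: eq_vecI)
  have MN: "M * N = 1\<^sub>m n"
  proof (rule mat_eq_by_vecs[of _ n n])
    fix i assume i: "i < n"
    show "M * N *\<^sub>v unit_vec n i = 1\<^sub>m n *\<^sub>v unit_vec n i"
      using M N by (simp add: assoc_mult_mat_vec[of M n m N n] cN[OF i] f)
  qed (use M N in auto)
  have NM: "N * M = 1\<^sub>m m"
  proof (rule mat_eq_by_vecs[of _ m m])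
    fix i assume i: "i < m"
    have "M *\<^sub>v (N *\<^sub>v (M *\<^sub>v unit_vec m i)) = (M * N) *\<^sub>v (M *\<^sub>v unit_vec m i)"
      using M N by (subst assoc_mult_mat_vec[of M n m N n]) auto
    also have "\<dots> = M *\<^sub>v unit_vec m i" using M by (simp add: MN)
    finally have "N *\<^sub>v (M *\<^sub>v unit_vec m i) = unit_vec m i"
      by (rule inj[rotated 2]) (use M N in auto)
    then show "N * M *\<^sub>v unit_vec m i = 1\<^sub>m m *\<^sub>v unit_vec m i"
      using M N by (simp add: assoc_mult_mat_vec[of N m n M m])
  qed (use M N in auto)
  show "n = m"
    using left_inverse_dim[OF M N NM] left_inverse_dim[OF N M MN] by simp
  then show "\<exists>N. inverse_mats n M N" using M N MN NM by (auto simp: inverse_mats_def)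
qed

text \<open>The condition of a splitting field for a single representation. It is the hypothesis of the
  results below, since over the complex numbers it holds for every irreducible representation, while
  over k it comes from the assumption that k is a splitting field.\<close>

definition scalar_endos :: "nat \<Rightarrow> ('a \<Rightarrow> 'k::field mat) \<Rightarrow> bool" where
  "scalar_endos n \<rho> \<longleftrightarrow>
     (\<forall>M\<in>carrier_mat n n. (\<forall>g\<in>carrier G. M * \<rho> g = \<rho> g * M) \<longrightarrow> (\<exists>c. M = c \<cdot>\<^sub>m 1\<^sub>m n))"

text \<open>The action of the group algebra element \<open>\<Sum> f(h) h\<close>.\<close>

definition gact :: "nat \<Rightarrow> ('a \<Rightarrow> 'k::field mat) \<Rightarrow> ('a \<Rightarrow> 'k) \<Rightarrow> 'k mat" where
  "gact n \<rho> f = mat n n (\<lambda>(a, b). \<Sum>h\<in>carrier G. f h * \<rho> h $$ (a, b))"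

lemma gact_carrier [simp]: "gact n \<rho> f \<in> carrier_mat n n" by (simp add: gact_def)

lemma gact_vec:
  assumes \<rho>: "matrix_rep G n \<rho>" and v: "v \<in> carrier_vec n" and a: "a < n"
  shows "(gact n \<rho> f *\<^sub>v v) $ a = (\<Sum>h\<in>carrier G. f h * (\<rho> h *\<^sub>v v) $ a)"
proof -
  have "(gact n \<rho> f *\<^sub>v v) $ a = (\<Sum>b<n. (\<Sum>h\<in>carrier G. f h * \<rho> h $$ (a, b)) * v $ b)"
    using v a by (auto simp: gact_def scalar_prod_def atLeast0LessThan intro!: sum.cong)
  also have "\<dots> = (\<Sum>b<n. \<Sum>h\<in>carrier G. f h * (\<rho> h $$ (a, b) * v $ b))"
    by (simp add: sum_distrib_right mult.assoc)
  also have "\<dots> = (\<Sum>h\<in>carrier G. f h * (\<Sum>b<n. \<rho> h $$ (a, b) * v $ b))"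
    by (subst sum.swap) (simp add: sum_distrib_left)
  also have "\<dots> = (\<Sum>h\<in>carrier G. f h * (\<rho> h *\<^sub>v v) $ a)"
  proof (rule sum.cong[OF refl])
    fix h assume "h \<in> carrier G"
    from rep_carrier[OF \<rho> this] v a
    show "f h * (\<Sum>b<n. \<rho> h $$ (a, b) * v $ b) = f h * (\<rho> h *\<^sub>v v) $ a"
      by (auto simp: scalar_prod_def atLeast0LessThan intro!: sum.cong)
  qed
  finally show ?thesis .
qed

lemma gact_shift:
  assumes \<rho>: "matrix_rep G n \<rho>" and v: "v \<in> carrier_vec n" and g: "g \<in> carrier G"
  shows "\<rho> g *\<^sub>v (gact n \<rho> f *\<^sub>v v) = gact n \<rho> (\<lambda>h. f (inv g \<otimes> h)) *\<^sub>v v"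
proof (rule eq_vecI)
  note c = rep_carrier[OF \<rho>]
  fix a assume "a < dim_vec (gact n \<rho> (\<lambda>h. f (inv g \<otimes> h)) *\<^sub>v v)"
  then have a: "a < n" by (simp add: gact_def)
  have "(\<rho> g *\<^sub>v (gact n \<rho> f *\<^sub>v v)) $ a = (\<Sum>b<n. \<rho> g $$ (a, b) * (\<Sum>h\<in>carrier G. f h * (\<rho> h *\<^sub>v v) $ b))"
    using a c[OF g] v gact_vec[OF \<rho> v] gact_carrier[of n \<rho> f]
    by (auto simp: scalar_prod_def atLeast0LessThan gact_def intro!: sum.cong)
  also have "\<dots> = (\<Sum>b<n. \<Sum>h\<in>carrier G. f h * (\<rho> g $$ (a, b) * (\<rho> h *\<^sub>v v) $ b))"
    by (simp add: sum_distrib_left mult.left_commute)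
  also have "\<dots> = (\<Sum>h\<in>carrier G. f h * (\<Sum>b<n. \<rho> g $$ (a, b) * (\<rho> h *\<^sub>v v) $ b))"
    by (subst sum.swap) (simp add: sum_distrib_left)
  also have "\<dots> = (\<Sum>h\<in>carrier G. f h * (\<rho> (g \<otimes> h) *\<^sub>v v) $ a)"
  proof (rule sum.cong[OF refl])
    fix h assume h: "h \<in> carrier G"
    have "\<rho> (g \<otimes> h) *\<^sub>v v = \<rho> g *\<^sub>v (\<rho> h *\<^sub>v v)"
      using c g h v by (simp add: rep_mult[OF \<rho> g h] assoc_mult_mat_vec[of _ n n _ n])
    then show "f h * (\<Sum>b<n. \<rho> g $$ (a, b) * (\<rho> h *\<^sub>v v) $ b) = f h * (\<rho> (g \<otimes> h) *\<^sub>v v) $ a"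
      using a c[OF g] c[OF h] by (auto simp: scalar_prod_def atLeast0LessThan intro!: sum.cong)
  qed
  also have "\<dots> = (\<Sum>h\<in>carrier G. f (inv g \<otimes> (g \<otimes> h)) * (\<rho> (g \<otimes> h) *\<^sub>v v) $ a)"
    using g by (intro sum.cong) (auto simp: m_assoc[symmetric])
  also have "\<dots> = (\<Sum>h\<in>carrier G. f (inv g \<otimes> h) * (\<rho> h *\<^sub>v v) $ a)"
    by (rule sum_shift[OF g])
  also have "\<dots> = (gact n \<rho> (\<lambda>h. f (inv g \<otimes> h)) *\<^sub>v v) $ a"
    by (rule gact_vec[OF \<rho> v a, symmetric])
  finally show "(\<rho> g *\<^sub>v (gact n \<rho> f *\<^sub>v v)) $ a = (gact n \<rho> (\<lambda>h. f (inv g \<otimes> h)) *\<^sub>v v) $ a" .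
qed (use rep_carrier[OF \<rho> g] in \<open>auto simp: gact_def\<close>)

lemma gact_delta:
  assumes \<rho>: "matrix_rep G n \<rho>" and v: "v \<in> carrier_vec n"
  shows "gact n \<rho> (\<lambda>h. if h = \<one> then 1 else 0) *\<^sub>v v = v"
proof (rule eq_vecI)
  fix a assume "a < dim_vec v"
  then have a: "a < n" using v by simp
  show "(gact n \<rho> (\<lambda>h. if h = \<one> then 1 else 0) *\<^sub>v v) $ a = v $ a"
    unfolding gact_vec[OF \<rho> v a] using finG rep_one[OF \<rho>] v
    by (simp add: if_distrib[of "\<lambda>x. x * _"] cong: if_cong)
qed (use v in \<open>auto simp: gact_def\<close>)

lemma gact_lin:
  assumes \<rho>: "matrix_rep G n \<rho>" and v: "v \<in> carrier_vec n" and a: "a < n" and fin: "finite S"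
  shows "(gact n \<rho> (\<lambda>h. f h - (\<Sum>b\<in>S. c b * F b h)) *\<^sub>v v) $ a
       = (gact n \<rho> f *\<^sub>v v) $ a - (\<Sum>b\<in>S. c b * (gact n \<rho> (F b) *\<^sub>v v) $ a)"
proof -
  have "(\<Sum>h\<in>carrier G. (\<Sum>b\<in>S. c b * F b h) * (\<rho> h *\<^sub>v v) $ a)
      = (\<Sum>h\<in>carrier G. \<Sum>b\<in>S. c b * (F b h * (\<rho> h *\<^sub>v v) $ a))"
    by (simp add: sum_distrib_right mult.assoc)
  also have "\<dots> = (\<Sum>b\<in>S. c b * (\<Sum>h\<in>carrier G. F b h * (\<rho> h *\<^sub>v v) $ a))"
    by (subst sum.swap) (simp add: sum_distrib_left)
  finally show ?thesis
    unfolding gact_vec[OF \<rho> v a] left_diff_distrib sum_subtractf by simp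
qed

text \<open>The group algebra maps v onto a nonzero invariant subspace.\<close>

lemma gact_all:
  assumes \<rho>: "irreducible_rep G n \<rho>" and v: "v \<in> carrier_vec n" "v \<noteq> 0\<^sub>v n"
    and u: "u \<in> carrier_vec n"
  shows "\<exists>f. gact n \<rho> f *\<^sub>v v = u"
proof -
  note r = irr_rep[OF \<rho>]
  define U where "U = range (\<lambda>f. gact n \<rho> f *\<^sub>v v)"
  have "vec_subspace n U"
    unfolding vec_subspace_def
  proof (intro conjI ballI allI)
    show "U \<subseteq> carrier_vec n" using v by (auto simp: U_def intro!: mult_mat_vec_carrier[of _ n n])
    show "0\<^sub>v n \<in> U" unfolding U_def using v
      by (intro range_eqI[of _ _ "\<lambda>_. 0"]) (auto simp: gact_def scalar_prod_def intro!: eq_vecI)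
    fix u w assume "u \<in> U" "w \<in> U"
    then obtain f f' where f: "u = gact n \<rho> f *\<^sub>v v" "w = gact n \<rho> f' *\<^sub>v v" by (auto simp: U_def)
    have "u + w = gact n \<rho> (\<lambda>h. f h + f' h) *\<^sub>v v"
    proof (rule eq_vecI)
      fix a assume "a < dim_vec (gact n \<rho> (\<lambda>h. f h + f' h) *\<^sub>v v)"
      then have a: "a < n" by (simp add: gact_def)
      then have "(u + w) $ a = u $ a + w $ a" by (simp add: f gact_def)
      also have "\<dots> = (gact n \<rho> (\<lambda>h. f h + f' h) *\<^sub>v v) $ a"
        unfolding f gact_vec[OF r v(1) a] by (simp add: distrib_right sum.distrib)
      finally show "(u + w) $ a = (gact n \<rho> (\<lambda>h. f h + f' h) *\<^sub>v v) $ a" .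
    qed (auto simp: f gact_def)
    then show "u + w \<in> U" by (auto simp: U_def)
  next
    fix c w assume "w \<in> U"
    then obtain f where f: "w = gact n \<rho> f *\<^sub>v v" by (auto simp: U_def)
    have "c \<cdot>\<^sub>v w = gact n \<rho> (\<lambda>h. c * f h) *\<^sub>v v"
    proof (rule eq_vecI)
      fix a assume "a < dim_vec (gact n \<rho> (\<lambda>h. c * f h) *\<^sub>v v)"
      then have a: "a < n" by (simp add: gact_def)
      then have "(c \<cdot>\<^sub>v w) $ a = c * w $ a" by (simp add: f gact_def)
      also have "\<dots> = (gact n \<rho> (\<lambda>h. c * f h) *\<^sub>v v) $ a"
        unfolding f gact_vec[OF r v(1) a] by (simp add: sum_distrib_left mult.assoc)
      finally show "(c \<cdot>\<^sub>v w) $ a = (gact n \<rho> (\<lambda>h. c * f h) *\<^sub>v v) $ a" .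
    qed (auto simp: f gact_def)
    then show "c \<cdot>\<^sub>v w \<in> U" by (auto simp: U_def)
  qed
  then have "U = {0\<^sub>v n} \<or> U = carrier_vec n"
    by (rule irr_invariant[OF \<rho>]) (auto simp: U_def gact_shift[OF r v(1)])
  moreover have "v \<in> U" unfolding U_def using gact_delta[OF r v(1)] by (metis rangeI)
  ultimately have "U = carrier_vec n" using v by auto
  then have "u \<in> U" using u by simp
  then show ?thesis by (auto simp: U_def)
qed

text \<open>The matrix coefficients of pairwise non-isomorphic irreducible representations with scalar
  endomorphisms are linearly independent functions on G (Frobenius and Schur, Burnside). A relation
  among coefficients is a family \<open>X\<close> of matrices with \<open>\<Sum> mtrace (X i * \<rho> i g) = 0\<close>, and the group algebra
  acts on relations by left multiplication. Take a nonzero relation with the fewest nonzero columns, one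
  of them \<open>v = col (X i0) j0\<close>. A group algebra element that kills v yields a relation with fewer nonzero
  columns, so it kills all columns. Hence \<open>a v \<mapsto> a w\<close> is a well defined intertwiner for any
  other column w of \<open>X i\<close>. It is zero for \<open>i \<noteq> i0\<close> and a scalar for \<open>i = i0\<close>, which means that all
  columns are multiples \<open>y j \<cdot> v\<close>. The relation then says that the functional y vanishes on the orbit of v,
  which spans the space; so \<open>y = 0\<close>.\<close>

theorem coefficient_independence:
  fixes \<rho> :: "'i \<Rightarrow> 'a \<Rightarrow> 'k::field mat"
  assumes J: "finite J"
    and irr: "\<And>i. i \<in> J \<Longrightarrow> irreducible_rep G (n i) (\<rho> i)"
    and sc: "\<And>i. i \<in> J \<Longrightarrow> scalar_endos (n i) (\<rho> i)"
    and noniso: "\<And>i j M. i \<in> J \<Longrightarrow> j \<in> J \<Longrightarrow> i \<noteq> j \<Longrightarrow> M \<in> carrier_mat (n i) (n j) \<Longrightarrow>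
        (\<And>g. g \<in> carrier G \<Longrightarrow> \<rho> i g * M = M * \<rho> j g) \<Longrightarrow> M = 0\<^sub>m (n i) (n j)"
    and X: "\<And>i. i \<in> J \<Longrightarrow> X i \<in> carrier_mat (n i) (n i)"
    and tr: "\<And>g. g \<in> carrier G \<Longrightarrow> (\<Sum>i\<in>J. mtrace (X i * \<rho> i g)) = 0"
    and i: "i \<in> J"
  shows "X i = 0\<^sub>m (n i) (n i)"
proof -
  note rep = irr_rep[OF irr] and rc = rep_carrier[OF irr_rep[OF irr]]
  define N where "N = {X. (\<forall>i\<in>J. X i \<in> carrier_mat (n i) (n i)) \<and>
      (\<forall>g\<in>carrier G. (\<Sum>i\<in>J. mtrace (X i * \<rho> i g)) = 0)}"
  \<comment> \<open>the positions of the nonzero columns of a relation\<close>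
  define cs :: "('i \<Rightarrow> 'k mat) \<Rightarrow> ('i \<times> nat) set" where "cs = (\<lambda>X. {(i, j). i \<in> J \<and> j < n i \<and> col (X i) j \<noteq> 0\<^sub>v (n i)})"
  have fcs: "finite (cs X)" for X
    by (rule finite_subset[of _ "Sigma J (\<lambda>i. {..<n i})"]) (use J in \<open>auto simp: cs_def\<close>)
  have Nact: "(\<lambda>i. gact (n i) (\<rho> i) f * X i) \<in> N" if XN: "X \<in> N" for X f
  proof -
    have Xc: "X i \<in> carrier_mat (n i) (n i)" if "i \<in> J" for i using XN that by (auto simp: N_def)
    have "(\<Sum>i\<in>J. mtrace (gact (n i) (\<rho> i) f * X i * \<rho> i g)) = 0" if g: "g \<in> carrier G" for g
    proof -
      have t: "mtrace (gact (n i) (\<rho> i) f * X i * \<rho> i g)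
          = (\<Sum>h\<in>carrier G. f h * mtrace (X i * \<rho> i (g \<otimes> h)))" if iJ: "i \<in> J" for i
      proof -
        note c = Xc[OF iJ] rc[OF iJ g]
        have "mtrace (gact (n i) (\<rho> i) f * X i * \<rho> i g) = mtrace (gact (n i) (\<rho> i) f * (X i * \<rho> i g))"
          using c by (simp add: assoc_mult_mat[of _ "n i" "n i" _ "n i" _ "n i"])
        also have "\<dots> = (\<Sum>a<n i. \<Sum>b<n i. (\<Sum>h\<in>carrier G. f h * \<rho> i h $$ (a, b)) * (X i * \<rho> i g) $$ (b, a))"
          using c unfolding mtrace_def
          by (auto simp: mult_index_sum[of _ "n i" "n i" _ "n i"] gact_def simp del: index_mult_mat(1) intro!: sum.cong)
        also have "\<dots> = (\<Sum>a<n i. \<Sum>b<n i. \<Sum>h\<in>carrier G. f h * (\<rho> i h $$ (a, b) * (X i * \<rho> i g) $$ (b, a)))"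
          by (simp add: sum_distrib_right mult.assoc)
        also have "\<dots> = (\<Sum>a<n i. \<Sum>h\<in>carrier G. \<Sum>b<n i. f h * (\<rho> i h $$ (a, b) * (X i * \<rho> i g) $$ (b, a)))"
          by (rule sum.cong[OF refl sum.swap])
        also have "\<dots> = (\<Sum>h\<in>carrier G. \<Sum>a<n i. \<Sum>b<n i. f h * (\<rho> i h $$ (a, b) * (X i * \<rho> i g) $$ (b, a)))"
          by (rule sum.swap)
        also have "\<dots> = (\<Sum>h\<in>carrier G. f h * mtrace (X i * \<rho> i (g \<otimes> h)))"
        proof (rule sum.cong[OF refl])
          fix h assume h: "h \<in> carrier G"
          have "X i * \<rho> i (g \<otimes> h) = X i * \<rho> i g * \<rho> i h"
            using c rc[OF iJ h] by (simp add: rep_mult[OF rep[OF iJ] g h] assoc_mult_mat[of _ "n i" "n i" _ "n i" _ "n i"])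
          also have "mtrace \<dots> = mtrace (\<rho> i h * (X i * \<rho> i g))"
            using c rc[OF iJ h] by (intro mtrace_mult_commute) auto
          also have "\<dots> = (\<Sum>a<n i. \<Sum>b<n i. \<rho> i h $$ (a, b) * (X i * \<rho> i g) $$ (b, a))"
            using c rc[OF iJ h] unfolding mtrace_def
            by (auto simp: mult_index_sum[of "\<rho> i h" "n i" "n i" _ "n i"] simp del: index_mult_mat(1) intro!: sum.cong)
          finally show "(\<Sum>a<n i. \<Sum>b<n i. f h * (\<rho> i h $$ (a, b) * (X i * \<rho> i g) $$ (b, a)))
              = f h * mtrace (X i * \<rho> i (g \<otimes> h))" by (simp add: sum_distrib_left)
        qed
        finally show ?thesis .
      qed
      have "(\<Sum>i\<in>J. mtrace (gact (n i) (\<rho> i) f * X i * \<rho> i g))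
          = (\<Sum>i\<in>J. \<Sum>h\<in>carrier G. f h * mtrace (X i * \<rho> i (g \<otimes> h)))"
        by (rule sum.cong[OF refl t])
      also have "\<dots> = (\<Sum>h\<in>carrier G. f h * (\<Sum>i\<in>J. mtrace (X i * \<rho> i (g \<otimes> h))))"
        by (subst sum.swap) (simp add: sum_distrib_left)
      also have "\<dots> = 0" using XN g by (intro sum.neutral) (auto simp: N_def)
      finally show ?thesis .
    qed
    moreover have "gact (n i) (\<rho> i) f * X i \<in> carrier_mat (n i) (n i)" if "i \<in> J" for i
      using Xc[OF that] by (rule mult_carrier_mat[OF gact_carrier])
    ultimately show ?thesis by (auto simp: N_def)
  qed
  have zero: "X i = 0\<^sub>m (n i) (n i)" if "X \<in> N" "cs X = {}" "i \<in> J" for X i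
  proof (rule mat_eq_by_vecs[of _ "n i" "n i"])
    show c: "X i \<in> carrier_mat (n i) (n i)" using that by (auto simp: N_def)
    fix j assume j: "j < n i"
    then have "col (X i) j = 0\<^sub>v (n i)" using that(2,3) by (auto simp: cs_def)
    then show "X i *\<^sub>v unit_vec (n i) j = 0\<^sub>m (n i) (n i) *\<^sub>v unit_vec (n i) j"
      using j c by (simp add: unit_vec_mult[of _ "n i" "n i"])
  qed auto
  have "cs X = {}" if "X \<in> N" for X
  proof (rule ccontr)
    assume "cs X \<noteq> {}"
    then have "\<exists>X. X \<in> N \<and> cs X \<noteq> {}" using that by blast
    then obtain X where XN: "X \<in> N" and ne: "cs X \<noteq> {}"
      and least: "\<And>Y. Y \<in> N \<Longrightarrow> cs Y \<noteq> {} \<Longrightarrow> card (cs X) \<le> card (cs Y)"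
      using ex_has_least_nat[of "\<lambda>X. X \<in> N \<and> cs X \<noteq> {}" _ "\<lambda>X. card (cs X)"] by blast
    have Xc: "X i \<in> carrier_mat (n i) (n i)" if "i \<in> J" for i using XN that by (auto simp: N_def)
    from ne obtain i0 j0 where i0: "i0 \<in> J" and j0: "j0 < n i0" and v0: "col (X i0) j0 \<noteq> 0\<^sub>v (n i0)"
      by (auto simp: cs_def)
    define v where "v = col (X i0) j0"
    have v: "v \<in> carrier_vec (n i0)" "v \<noteq> 0\<^sub>v (n i0)" using v0 Xc[OF i0] j0 by (auto simp: v_def)
    let ?A = "\<lambda>i. gact (n i) (\<rho> i)"
    have kill: "?A i f *\<^sub>v col (X i) j = 0\<^sub>v (n i)"
      if f: "?A i0 f *\<^sub>v v = 0\<^sub>v (n i0)" and ij: "i \<in> J" "j < n i" for f i j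
    proof -
      let ?Y = "\<lambda>i. ?A i f * X i"
      have colY: "col (?Y i) j = ?A i f *\<^sub>v col (X i) j" if "i \<in> J" "j < n i" for i j
        using col_mult2[OF gact_carrier Xc[OF that(1)] that(2)] .
      have "cs ?Y \<subseteq> cs X"
      proof (clarsimp simp: cs_def)
        fix i j assume ij: "i \<in> J" "j < n i" and "col (?Y i) j \<noteq> 0\<^sub>v (n i)" and z: "col (X i) j = 0\<^sub>v (n i)"
        moreover have "?A i f *\<^sub>v 0\<^sub>v (n i) = 0\<^sub>v (n i)" by (auto simp: gact_def intro!: eq_vecI)
        ultimately show False using colY[OF ij] by simp
      qed
      moreover have "(i0, j0) \<in> cs X" "(i0, j0) \<notin> cs ?Y"
        using i0 j0 v0 f colY[OF i0 j0] by (auto simp: cs_def v_def)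
      ultimately have "card (cs ?Y) < card (cs X)" by (intro psubset_card_mono fcs) auto
      then have "cs ?Y = {}" using least[OF Nact[OF XN, of f]] by auto
      then show ?thesis using colY[OF ij] ij by (auto simp: cs_def)
    qed
    have "\<forall>b. \<exists>f. ?A i0 f *\<^sub>v v = unit_vec (n i0) b"
      using gact_all[OF irr[OF i0] v] by simp
    then obtain F where F: "\<And>b. ?A i0 (F b) *\<^sub>v v = unit_vec (n i0) b" by metis
    have key: "col (X i) j \<in> {0\<^sub>v (n i)} \<and> i \<noteq> i0 \<or> i = i0 \<and> (\<exists>c. col (X i) j = c \<cdot>\<^sub>v v)"
      if ij: "i \<in> J" "j < n i" for i j
    proof -
      define w where "w = col (X i) j"
      have w: "w \<in> carrier_vec (n i)" using Xc[OF ij(1)] ij(2) by (auto simp: w_def)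
      \<comment> \<open>the intertwiner with \<open>a v \<mapsto> a w\<close> for all group algebra elements a, written on the
        basis of unit vectors \<open>F b v\<close>\<close>
      define M where "M = mat (n i) (n i0) (\<lambda>(a, b). (?A i (F b) *\<^sub>v w) $ a)"
      have Mc: "M \<in> carrier_mat (n i) (n i0)" by (simp add: M_def)
      have Mact: "M *\<^sub>v (?A i0 f *\<^sub>v v) = ?A i f *\<^sub>v w" for f
      proof -
        let ?c = "\<lambda>b. (?A i0 f *\<^sub>v v) $ b"
        let ?f = "\<lambda>h. f h - (\<Sum>b<n i0. ?c b * F b h)"
        have "?A i0 ?f *\<^sub>v v = 0\<^sub>v (n i0)"
        proof (rule eq_vecI)
          fix a assume "a < dim_vec (0\<^sub>v (n i0) :: 'k vec)" then have a: "a < n i0" by simp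
          have "(?A i0 ?f *\<^sub>v v) $ a = ?c a - (\<Sum>b<n i0. ?c b * unit_vec (n i0) b $ a)"
            by (subst gact_lin[OF rep[OF i0] v(1) a]) (simp_all add: F)
          also have "(\<Sum>b<n i0. ?c b * unit_vec (n i0) b $ a) = (\<Sum>b<n i0. if b = a then ?c b else 0)"
            using a by (intro sum.cong) (auto simp: unit_vec_def)
          also have "\<dots> = ?c a" using a by simp
          finally show "(?A i0 ?f *\<^sub>v v) $ a = 0\<^sub>v (n i0) $ a" using a by simp
        qed (simp add: gact_def)
        from kill[OF this ij] have z: "?A i ?f *\<^sub>v w = 0\<^sub>v (n i)" by (simp add: w_def)
        show ?thesis
        proof (rule eq_vecI)
          fix a assume "a < dim_vec (?A i f *\<^sub>v w)" then have a: "a < n i" by (simp add: gact_def)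
          have "(?A i f *\<^sub>v w) $ a - (\<Sum>b<n i0. ?c b * (?A i (F b) *\<^sub>v w) $ a) = 0"
            using arg_cong[OF z, of "\<lambda>u. u $ a"] a
            by (subst (asm) gact_lin[OF rep[OF ij(1)] w a]) auto
          moreover have "(M *\<^sub>v (?A i0 f *\<^sub>v v)) $ a = (\<Sum>b<n i0. ?c b * (?A i (F b) *\<^sub>v w) $ a)"
            using a by (auto simp: M_def scalar_prod_def atLeast0LessThan gact_def mult.commute intro!: sum.cong)
          ultimately show "(M *\<^sub>v (?A i0 f *\<^sub>v v)) $ a = (?A i f *\<^sub>v w) $ a" by simp
        qed (simp add: M_def gact_def)
      qed
      have Mv: "M *\<^sub>v v = w"
        using Mact[of "\<lambda>h. if h = \<one> then 1 else 0"]
        by (simp only: gact_delta[OF rep[OF i0] v(1)] gact_delta[OF rep[OF ij(1)] w])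
      have int: "\<rho> i g * M = M * \<rho> i0 g" if g: "g \<in> carrier G" for g
      proof (rule mat_eq_by_vecs[of _ "n i" "n i0"])
        fix b assume b: "b < n i0"
        have "\<rho> i g * M *\<^sub>v unit_vec (n i0) b = \<rho> i g *\<^sub>v (M *\<^sub>v (?A i0 (F b) *\<^sub>v v))"
          using rc[OF ij(1) g] Mc by (simp add: assoc_mult_mat_vec[of _ "n i" "n i" _ "n i0"] F)
        also have "\<dots> = ?A i (\<lambda>h. F b (inv g \<otimes> h)) *\<^sub>v w"
          unfolding Mact by (rule gact_shift[OF rep[OF ij(1)] w g])
        also have "\<dots> = M *\<^sub>v (\<rho> i0 g *\<^sub>v (?A i0 (F b) *\<^sub>v v))"
          unfolding gact_shift[OF rep[OF i0] v(1) g] Mact ..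
        also have "\<dots> = M * \<rho> i0 g *\<^sub>v unit_vec (n i0) b"
          using rc[OF i0 g] Mc by (simp add: assoc_mult_mat_vec[of _ "n i" "n i0" _ "n i0"] F)
        finally show "\<rho> i g * M *\<^sub>v unit_vec (n i0) b = M * \<rho> i0 g *\<^sub>v unit_vec (n i0) b" .
      qed (use Mc rc[OF ij(1) g] rc[OF i0 g] in auto)
      show ?thesis
      proof (cases "i = i0")
        case False
        then have "M = 0\<^sub>m (n i) (n i0)" using noniso[OF ij(1) i0 False Mc int] by simp
        then have "w = 0\<^sub>v (n i)" using Mv v by auto
        then show ?thesis using False by (simp add: w_def)
      next
        case True
        then obtain c where "M = c \<cdot>\<^sub>m 1\<^sub>m (n i0)"
          using sc[OF i0] Mc int unfolding scalar_endos_def by metis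
        moreover have "c \<cdot>\<^sub>v (1\<^sub>m (n i0) *\<^sub>v v) = (c \<cdot>\<^sub>m 1\<^sub>m (n i0)) *\<^sub>v v" using v by auto
        ultimately have "w = c \<cdot>\<^sub>v v" using Mv v by simp
        then show ?thesis using True by (auto simp: w_def)
      qed
    qed
    then have "\<forall>j. \<exists>c. j < n i0 \<longrightarrow> col (X i0) j = c \<cdot>\<^sub>v v" using i0 by blast
    then obtain y where y: "\<And>j. j < n i0 \<Longrightarrow> col (X i0) j = y j \<cdot>\<^sub>v v" by metis
    have Xi0: "X i0 $$ (a, j) = y j * v $ a" if "a < n i0" "j < n i0" for a j
      using arg_cong[OF y[OF that(2)], of "\<lambda>u. u $ a"] that Xc[OF i0] v by simp
    have Xi: "X i = 0\<^sub>m (n i) (n i)" if "i \<in> J" "i \<noteq> i0" for i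
    proof (rule mat_eq_by_vecs[of _ "n i" "n i"])
      fix j assume j: "j < n i"
      then have "col (X i) j = 0\<^sub>v (n i)" using key[OF that(1) j] that(2) by auto
      then show "X i *\<^sub>v unit_vec (n i) j = 0\<^sub>m (n i) (n i) *\<^sub>v unit_vec (n i) j"
        using j Xc[OF that(1)] by (simp add: unit_vec_mult[of _ "n i" "n i"])
    qed (use Xc[OF that(1)] in auto)
    have yz: "(\<Sum>j<n i0. y j * (\<rho> i0 g *\<^sub>v v) $ j) = 0" if g: "g \<in> carrier G" for g
    proof -
      have "(\<Sum>i\<in>J. mtrace (X i * \<rho> i g)) = mtrace (X i0 * \<rho> i0 g)"
      proof (subst sum.remove[OF J i0])
        have "(\<Sum>i\<in>J - {i0}. mtrace (X i * \<rho> i g)) = 0"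
        proof (rule sum.neutral, rule ballI)
          fix i assume "i \<in> J - {i0}"
          then have "X i = 0\<^sub>m (n i) (n i)" "\<rho> i g \<in> carrier_mat (n i) (n i)" using Xi rc g by auto
          then have "X i * \<rho> i g = 0\<^sub>m (n i) (n i)" by simp
          then show "mtrace (X i * \<rho> i g) = 0" by (simp add: mtrace_def)
        qed
        then show "mtrace (X i0 * \<rho> i0 g) + (\<Sum>i\<in>J - {i0}. mtrace (X i * \<rho> i g)) = mtrace (X i0 * \<rho> i0 g)"
          by simp
      qed
      then have "0 = mtrace (X i0 * \<rho> i0 g)" using XN g by (simp add: N_def)
      also have "\<dots> = (\<Sum>a<n i0. \<Sum>j<n i0. y j * (\<rho> i0 g $$ (j, a) * v $ a))"
        using Xc[OF i0] rc[OF i0 g] unfolding mtrace_def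
        by (auto simp: mult_index_sum[of "X i0" "n i0" "n i0" _ "n i0"] Xi0 mult_ac simp del: index_mult_mat(1) intro!: sum.cong)
      also have "\<dots> = (\<Sum>j<n i0. \<Sum>a<n i0. y j * (\<rho> i0 g $$ (j, a) * v $ a))" by (rule sum.swap)
      also have "\<dots> = (\<Sum>j<n i0. y j * (\<rho> i0 g *\<^sub>v v) $ j)"
        using rc[OF i0 g] v
        by (auto simp: scalar_prod_def atLeast0LessThan sum_distrib_left intro!: sum.cong)
      finally show ?thesis by simp
    qed
    \<comment> \<open>\<open>F j0\<close> maps v to the unit vector at \<open>j0\<close>, where y takes the value \<open>y j0\<close>\<close>
    have "(\<Sum>j<n i0. y j * (?A i0 (F j0) *\<^sub>v v) $ j)
        = (\<Sum>j<n i0. \<Sum>h\<in>carrier G. F j0 h * (y j * (\<rho> i0 h *\<^sub>v v) $ j))"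
      by (intro sum.cong refl) (simp add: gact_vec[OF rep[OF i0] v(1)] sum_distrib_left mult.left_commute)
    also have "\<dots> = (\<Sum>h\<in>carrier G. F j0 h * (\<Sum>j<n i0. y j * (\<rho> i0 h *\<^sub>v v) $ j))"
      by (subst sum.swap) (simp add: sum_distrib_left)
    also have "\<dots> = 0" by (simp add: yz)
    finally have "(\<Sum>j<n i0. y j * unit_vec (n i0) j0 $ j) = 0" by (simp add: F)
    also have "(\<Sum>j<n i0. y j * unit_vec (n i0) j0 $ j) = (\<Sum>j<n i0. if j = j0 then y j else 0)"
      using j0 by (intro sum.cong) auto
    finally have "y j0 = 0" using j0 by simp
    then have "col (X i0) j0 = 0\<^sub>v (n i0)" using y[OF j0] v by (auto intro!: eq_vecI)
    then show False using v0 by simp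
  qed
  moreover have "X \<in> N" using X tr by (simp add: N_def)
  ultimately show ?thesis using zero i by blast
qed

end

text \<open>Unknowns are eliminated one at a time without dividing, so that D is never left. The lemma is used
  for the subfield k of its algebraic closure: a nontrivial relation between coefficients over the closure yields one over k.\<close>

lemma subring_linear_relation:
  fixes v :: "'i \<Rightarrow> 'x \<Rightarrow> 'b::field"
  assumes "finite J" and D: "1 \<in> D" "\<And>x y. x \<in> D \<Longrightarrow> y \<in> D \<Longrightarrow> x - y \<in> D" "\<And>x y. x \<in> D \<Longrightarrow> y \<in> D \<Longrightarrow> x * y \<in> D"
    and "\<And>i x. i \<in> J \<Longrightarrow> x \<in> X \<Longrightarrow> v i x \<in> D"
    and "\<And>x. x \<in> X \<Longrightarrow> (\<Sum>i\<in>J. a i * v i x) = 0" and "\<exists>i\<in>J. a i \<noteq> 0"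
  shows "\<exists>d. (\<forall>i\<in>J. d i \<in> D) \<and> (\<exists>i\<in>J. d i \<noteq> 0) \<and> (\<forall>x\<in>X. (\<Sum>i\<in>J. d i * v i x) = 0)"
  using assms(1,5-)
proof (induction J arbitrary: v a rule: finite_induct)
  case empty
  then show ?case by simp
next
  case (insert n J)
  have D0: "0 \<in> D" using D(2)[OF D(1) D(1)] by simp
  have Dneg: "- x \<in> D" if "x \<in> D" for x using D(2)[OF D0 that] by simp
  have Dadd: "x + y \<in> D" if "x \<in> D" "y \<in> D" for x y using D(2)[OF that(1) Dneg[OF that(2)]] by simp
  have Dsum: "sum f S \<in> D" if "\<And>i. i \<in> S \<Longrightarrow> f i \<in> D" for f and S :: "'i set"
    using that by (induction S rule: infinite_finite_induct) (auto intro: D0 Dadd)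
  show ?case
  proof (cases "\<forall>x\<in>X. v n x = 0")
    case True
    show ?thesis
    proof (intro exI[of _ "\<lambda>i. if i = n then 1 else 0"] conjI ballI)
      fix x assume "x \<in> X"
      then show "(\<Sum>i\<in>insert n J. (if i = n then 1 else 0) * v i x) = 0"
        using True insert.hyps by (intro sum.neutral) auto
    qed (use D0 D(1) in auto)
  next
    case False
    then obtain x0 where x0: "x0 \<in> X" "v n x0 \<noteq> 0" by blast
    \<comment> \<open>elimination of the unknown n by means of the equation \<open>x0\<close>, whose coefficient at n is not 0\<close>
    define w where "w = (\<lambda>i x. v n x0 * v i x - v i x0 * v n x)"
    have rel: "(\<Sum>i\<in>J. a i * v i x) = - a n * v n x" if "x \<in> X" for x
      using insert.prems(2)[OF that] insert.hyps by (simp add: eq_neg_iff_add_eq_0 add.commute)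
    have "\<exists>i\<in>J. a i \<noteq> 0"
    proof (rule ccontr)
      assume none: "\<not> (\<exists>i\<in>J. a i \<noteq> 0)"
      then have "(\<Sum>i\<in>J. a i * v i x0) = 0" by (intro sum.neutral) auto
      then have "a n = 0" using rel[OF x0(1)] x0(2) by simp
      then show False using insert.prems(3) none by auto
    qed
    moreover have "(\<Sum>i\<in>J. a i * w i x) = 0" if "x \<in> X" for x
    proof -
      have "(\<Sum>i\<in>J. a i * w i x) = v n x0 * (\<Sum>i\<in>J. a i * v i x) - v n x * (\<Sum>i\<in>J. a i * v i x0)"
        by (simp add: w_def right_diff_distrib sum_subtractf sum_distrib_left mult_ac)
      then show ?thesis by (simp add: rel[OF that] rel[OF x0(1)])
    qed
    moreover have "w i x \<in> D" if "i \<in> J" "x \<in> X" for i x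
      unfolding w_def using insert.prems(1) that x0 by (intro D(2,3)) auto
    ultimately obtain d where d: "\<forall>i\<in>J. d i \<in> D" "\<exists>i\<in>J. d i \<noteq> 0" "\<forall>x\<in>X. (\<Sum>i\<in>J. d i * w i x) = 0"
      using insert.IH[of w a] by blast
    define d' where "d' = (\<lambda>i. if i = n then - (\<Sum>i\<in>J. d i * v i x0) else v n x0 * d i)"
    show ?thesis
    proof (intro exI[of _ d'] conjI ballI)
      fix i assume "i \<in> insert n J"
      then show "d' i \<in> D"
        using d(1) insert.prems(1) x0 by (auto simp: d'_def intro!: Dneg Dsum D(3))
    next
      from d(2) obtain i where "i \<in> J" "d i \<noteq> 0" by blast
      then show "\<exists>i\<in>insert n J. d' i \<noteq> 0"
        using x0 insert.hyps by (intro bexI[of _ i]) (auto simp: d'_def)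
    next
      fix x assume x: "x \<in> X"
      have "(\<Sum>i\<in>insert n J. d' i * v i x) = d' n * v n x + (\<Sum>i\<in>J. v n x0 * d i * v i x)"
        using insert.hyps by (auto simp: d'_def intro!: sum.cong)
      also have "\<dots> = (\<Sum>i\<in>J. d i * w i x)"
        by (simp add: w_def d'_def right_diff_distrib sum_subtractf sum_distrib_left sum_distrib_right mult_ac)
      finally show "(\<Sum>i\<in>insert n J. d' i * v i x) = 0" using d(3) x by simp
    qed
  qed
qed

section \<open>Extension of scalars to the algebraic closure\<close>

interpretation to_ac_hom: inj_comm_ring_hom to_ac
  by standard auto

context fin_group
begin

definition enum :: "nat \<Rightarrow> 'a" where
  "enum = (SOME e. bij_betw e {..<card (carrier G)} (carrier G))"

lemma enum: "bij_betw enum {..<card (carrier G)} (carrier G)"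
proof -
  have "\<exists>e. bij_betw e {..<card (carrier G)} (carrier G)"
    using ex_bij_betw_nat_finite[OF finG] by (simp add: atLeast0LessThan)
  then show ?thesis unfolding enum_def by (rule someI_ex)
qed

lemma enum_carrier: "i < card (carrier G) \<Longrightarrow> enum i \<in> carrier G"
  using enum by (auto simp: bij_betw_def)

lemma enum_inj: "i < card (carrier G) \<Longrightarrow> j < card (carrier G) \<Longrightarrow> enum i = enum j \<longleftrightarrow> i = j"
  using enum by (auto simp: bij_betw_def inj_on_def)

lemma sum_enum: "(\<Sum>i<card (carrier G). f (enum i)) = (\<Sum>g\<in>carrier G. f g)"
  by (rule sum.reindex_bij_betw[OF enum])

definition reg_rep :: "'a \<Rightarrow> 'k::field mat" where
  "reg_rep g = mat (card (carrier G)) (card (carrier G)) (\<lambda>(i, j). if enum i = g \<otimes> enum j then 1 else 0)"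

lemma matrix_rep_reg: "matrix_rep G (card (carrier G)) (reg_rep :: 'a \<Rightarrow> 'k::field mat)"
  unfolding matrix_rep_def
proof (intro conjI ballI)
  show "reg_rep \<one> = 1\<^sub>m (card (carrier G))"
    by (rule eq_matI) (auto simp: reg_rep_def enum_carrier enum_inj)
  fix g h assume g: "g \<in> carrier G" and h: "h \<in> carrier G"
  show "reg_rep (g \<otimes> h) = (reg_rep g :: 'k mat) * reg_rep h"
  proof (rule eq_matI)
    fix i j assume "i < dim_row ((reg_rep g :: 'k mat) * reg_rep h)" "j < dim_col ((reg_rep g :: 'k mat) * reg_rep h)"
    then have ij: "i < card (carrier G)" "j < card (carrier G)" by (auto simp: reg_rep_def)
    have "((reg_rep g :: 'k mat) * reg_rep h) $$ (i, j) =
      (\<Sum>k<card (carrier G). (if enum i = g \<otimes> enum k then 1 else 0) * (if enum k = h \<otimes> enum j then 1 else 0))"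
      using ij by (subst mult_index_sum[of _ "card (carrier G)" "card (carrier G)" _ "card (carrier G)"]) (auto simp: reg_rep_def)
    also have "\<dots> = (\<Sum>x\<in>carrier G. (if enum i = g \<otimes> x then 1 else 0) * (if x = h \<otimes> enum j then 1 else 0))"
      by (rule sum_enum)
    also have "\<dots> = (\<Sum>x\<in>carrier G. if x = h \<otimes> enum j then (if enum i = g \<otimes> x then 1 else 0) else 0)"
      by (intro sum.cong) auto
    also have "\<dots> = (if enum i = g \<otimes> (h \<otimes> enum j) then 1 else 0)"
      using finG h ij enum_carrier by (simp add: sum.delta)
    finally show "(reg_rep (g \<otimes> h) :: 'k mat) $$ (i, j) = (reg_rep g * reg_rep h) $$ (i, j)"
      using ij g h enum_carrier by (simp add: reg_rep_def m_assoc)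
  qed (auto simp: reg_rep_def)
qed (auto simp: reg_rep_def)

lemma mtrace_reg: "g \<in> carrier G \<Longrightarrow> mtrace (reg_rep g) = (if g = \<one> then of_nat (card (carrier G)) else 0)"
proof -
  assume g: "g \<in> carrier G"
  have "enum i = g \<otimes> enum i \<longleftrightarrow> g = \<one>" if "i < card (carrier G)" for i
    using g enum_carrier[OF that] by (metis l_one one_closed r_cancel)
  then show ?thesis by (auto simp: mtrace_def reg_rep_def)
qed

lemma scalar_endos_splitting:
  "splitting_field TYPE('k::field) G \<Longrightarrow> irreducible_rep G n (\<rho> :: 'a \<Rightarrow> 'k mat) \<Longrightarrow> scalar_endos n \<rho>"
  unfolding splitting_field_def scalar_endos_def by blast

lemma matrix_rep_hom:
  assumes "matrix_rep G n \<rho>"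
  shows "matrix_rep G n (\<lambda>g. map_mat to_ac (\<rho> g))"
  using assms to_ac_hom.mat_hom_mult[of _ n n _ n] unfolding matrix_rep_def
  by (auto simp: to_ac_hom.mat_hom_one)

text \<open>If W is a proper nonzero invariant subspace over the closure, a vector w in W and a functional y
  that vanishes on W give the relation \<open>y (\<rho> g w) = 0\<close> between the matrix coefficients of \<open>\<rho>\<close>. It descends
  to a nontrivial relation over k, against the independence of coefficients.\<close>

theorem absolutely_irreducible:
  fixes \<rho> :: "'a \<Rightarrow> 'k::field mat"
  assumes sp: "splitting_field TYPE('k) G" and \<rho>: "irreducible_rep G n \<rho>"
  shows "irreducible_rep G n (\<lambda>g. map_mat to_ac (\<rho> g))"
  unfolding irreducible_rep_def
proof (intro conjI allI impI)
  note rc = rep_carrier[OF irr_rep[OF \<rho>]]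
  show "matrix_rep G n (\<lambda>g. map_mat to_ac (\<rho> g))" by (rule matrix_rep_hom[OF irr_rep[OF \<rho>]])
  show "0 < n" by (rule irr_pos[OF \<rho>])
  fix W :: "'k alg_closure vec set" assume "invariant_subspace G n (\<lambda>g. map_mat to_ac (\<rho> g)) W"
  then have sW: "vec_subspace n W" and iW: "\<And>g w. g \<in> carrier G \<Longrightarrow> w \<in> W \<Longrightarrow> map_mat to_ac (\<rho> g) *\<^sub>v w \<in> W"
    by (auto simp: invariant_subspace_vec_subspace)
  have WC: "W \<subseteq> carrier_vec n" "0\<^sub>v n \<in> W" using sW by (auto simp: vec_subspace_def)
  show "W = {0\<^sub>v n} \<or> W = carrier_vec n"
  proof (rule ccontr)
    assume neg: "\<not> (W = {0\<^sub>v n} \<or> W = carrier_vec n)"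
    then obtain w where w: "w \<in> W" "w \<noteq> 0\<^sub>v n" using WC by blast
    have wc: "w \<in> carrier_vec n" using w WC by auto
    obtain P Q m where P: "P \<in> carrier_mat n n" "Q \<in> carrier_mat n n" "P * Q = 1\<^sub>m n" "Q * P = 1\<^sub>m n"
      and m: "m \<le> n"
      and Wm: "\<And>w. w \<in> carrier_vec n \<Longrightarrow> w \<in> W \<longleftrightarrow> (\<forall>i. m \<le> i \<longrightarrow> i < n \<longrightarrow> (Q *\<^sub>v w) $ i = 0)"
      using subspace_basis[OF sW] by metis
    have "m \<noteq> n" using Wm neg WC by auto
    then have mn: "m < n" using m by simp
    \<comment> \<open>the coordinate m vanishes on W because \<open>m < n\<close>\<close>
    define y where "y = row Q m"
    have y: "y \<in> carrier_vec n" using P(2) mn by (simp add: y_def)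
    have "y \<noteq> 0\<^sub>v n"
    proof
      assume "y = 0\<^sub>v n"
      then have "(Q * P) $$ (m, m) = 0" using P(1,2) mn by (simp add: y_def)
      then show False using P(4) mn by simp
    qed
    then obtain b0 where b0: "b0 < n" "y $ b0 \<noteq> 0" using y
      by (metis carrier_vecD eq_vecI index_zero_vec(1) index_zero_vec(2))
    obtain a0 where a0: "a0 < n" "w $ a0 \<noteq> 0" using w(2) wc
      by (metis carrier_vecD eq_vecI index_zero_vec(1) index_zero_vec(2))
    have rel: "(\<Sum>(a, b)\<in>{..<n} \<times> {..<n}. w $ a * y $ b * to_ac (\<rho> g $$ (b, a))) = 0" if g: "g \<in> carrier G" for g
    proof -
      let ?R = "map_mat to_ac (\<rho> g)"
      have "y \<bullet> (?R *\<^sub>v w) = 0"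
        using Wm[of "?R *\<^sub>v w"] iW[OF g w(1)] rc[OF g] wc mn P(2) by (auto simp: y_def)
      moreover have "y \<bullet> (?R *\<^sub>v w) = (\<Sum>b<n. \<Sum>a<n. w $ a * y $ b * to_ac (\<rho> g $$ (b, a)))"
        using rc[OF g] wc y
        by (auto simp: scalar_prod_def atLeast0LessThan sum_distrib_left mult_ac intro!: sum.cong)
      ultimately show ?thesis
        by (subst sum.cartesian_product[symmetric], subst sum.swap) simp
    qed
    have "\<exists>d. (\<forall>i\<in>{..<n} \<times> {..<n}. d i \<in> range to_ac) \<and> (\<exists>i\<in>{..<n} \<times> {..<n}. d i \<noteq> 0) \<and>
      (\<forall>g\<in>carrier G. (\<Sum>i\<in>{..<n} \<times> {..<n}. d i * to_ac (\<rho> g $$ (snd i, fst i))) = 0)"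
    proof (rule subring_linear_relation[where a = "\<lambda>i. w $ fst i * y $ snd i"])
      show "(1 :: 'k alg_closure) \<in> range to_ac" by (metis rangeI to_ac_1)
      show "\<exists>i\<in>{..<n} \<times> {..<n}. w $ fst i * y $ snd i \<noteq> 0"
        using a0 b0 by (intro bexI[of _ "(a0, b0)"]) auto
    qed (use rel in \<open>auto simp: case_prod_unfold simp flip: to_ac_diff to_ac_mult\<close>)
    then obtain d where d: "\<forall>i\<in>{..<n} \<times> {..<n}. d i \<in> range to_ac" "\<exists>i\<in>{..<n} \<times> {..<n}. d i \<noteq> (0 :: 'k alg_closure)"
      "\<forall>g\<in>carrier G. (\<Sum>i\<in>{..<n} \<times> {..<n}. d i * to_ac (\<rho> g $$ (snd i, fst i))) = 0" by blast
    \<comment> \<open>the coefficients d lie in k; as a matrix they are a trace relation for \<open>\<rho>\<close> itself\<close>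
    define X where "X = mat n n (\<lambda>i. of_ac (d i))"
    have dX: "d i = to_ac (X $$ i)" if "i \<in> {..<n} \<times> {..<n}" for i
      using d(1) that by (auto simp: X_def to_ac_of_ac)
    have "mtrace (X * \<rho> g) = 0" if g: "g \<in> carrier G" for g
    proof -
      have "to_ac (mtrace (X * \<rho> g)) = to_ac (\<Sum>a<n. \<Sum>b<n. X $$ (a, b) * \<rho> g $$ (b, a))"
        using rc[OF g] unfolding mtrace_def
        by (auto simp: X_def mult_index_sum[of _ n n _ n] simp del: index_mult_mat(1) intro!: sum.cong)
      also have "\<dots> = (\<Sum>i\<in>{..<n} \<times> {..<n}. d i * to_ac (\<rho> g $$ (snd i, fst i)))"
        by (auto simp: to_ac_sum dX sum.cartesian_product intro!: sum.cong)
      finally show ?thesis using d(3) g by simp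
    qed
    then have "X = 0\<^sub>m n n"
      using coefficient_independence[of "{()}" "\<lambda>_. n" "\<lambda>_. \<rho>" "\<lambda>_. X" "()"] \<rho>
        scalar_endos_splitting[OF sp \<rho>] by (auto simp: X_def)
    then show False using d(2) dX by auto
  qed
qed

text \<open>Source of a nonzero intertwiner from a representation that is defined over the smaller field.\<close>

lemma reg_rep_orbit:
  assumes \<tau>: "matrix_rep G n \<tau>" and v: "v \<in> carrier_vec n" and g: "g \<in> carrier G"
  defines "M \<equiv> mat n (card (carrier G)) (\<lambda>(a, j). (\<tau> (enum j) *\<^sub>v v) $ a)"
  shows "\<tau> g * M = M * reg_rep g"
proof (rule eq_matI)
  note c = rep_carrier[OF \<tau>]
  fix a j assume "a < dim_row (M * reg_rep g)" "j < dim_col (M * reg_rep g)"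
  then have aj: "a < n" "j < card (carrier G)" by (auto simp: M_def reg_rep_def)
  note ej = enum_carrier[OF aj(2)]
  have "(\<tau> g * M) $$ (a, j) = (\<tau> g *\<^sub>v (\<tau> (enum j) *\<^sub>v v)) $ a"
    using aj c[OF g] c[OF ej] by (auto simp: M_def scalar_prod_def intro!: sum.cong)
  also have "\<dots> = (\<tau> (g \<otimes> enum j) *\<^sub>v v) $ a"
    using c[OF g] c[OF ej] v by (simp add: rep_mult[OF \<tau> g ej] assoc_mult_mat_vec[of _ n n _ n])
  also have "\<dots> = (\<Sum>x\<in>carrier G. if x = g \<otimes> enum j then (\<tau> x *\<^sub>v v) $ a else 0)"
    using finG g ej by simp
  also have "\<dots> = (\<Sum>k<card (carrier G). if enum k = g \<otimes> enum j then (\<tau> (enum k) *\<^sub>v v) $ a else 0)"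
    by (rule sum_enum[symmetric])
  also have "\<dots> = (M * reg_rep g) $$ (a, j)"
    using aj by (subst mult_index_sum[of _ n "card (carrier G)" _ "card (carrier G)"])
      (auto simp: M_def reg_rep_def intro!: sum.cong)
  finally show "(\<tau> g * M) $$ (a, j) = (M * reg_rep g) $$ (a, j)" .
qed (use rep_carrier[OF \<tau> g] in \<open>auto simp: M_def reg_rep_def\<close>)

text \<open>Among all representations \<open>\<rho>\<close> over k with a nonzero intertwiner \<open>\<rho> \<rightarrow> \<tau>\<close>, one of smallest degree
  is irreducible: if it were block triangular, the intertwiner would be nonzero on the subrepresentation
  or else factor through the quotient. Such \<open>\<rho>\<close> exist because the regular representation is defined
  over k. The extension of \<open>\<rho>\<close> to the closure stays irreducible, and Schur's lemma makes it
  isomorphic to \<open>\<tau>\<close>.\<close>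

theorem irreducible_over_closure:
  fixes \<tau> :: "'a \<Rightarrow> 'k::field alg_closure mat"
  assumes sp: "splitting_field TYPE('k) G" and \<tau>: "irreducible_rep G n \<tau>"
  shows "\<exists>m (\<rho> :: 'a \<Rightarrow> 'k mat). irreducible_rep G m \<rho> \<and>
     (\<forall>g\<in>carrier G. char_poly (\<tau> g) = map_poly to_ac (char_poly (\<rho> g)))"
proof -
  note tc = rep_carrier[OF irr_rep[OF \<tau>]]
  define ok where "ok = (\<lambda>m. \<exists>M (\<rho> :: 'a \<Rightarrow> 'k mat). matrix_rep G m \<rho> \<and> M \<in> carrier_mat n m \<and> M \<noteq> 0\<^sub>m n m \<and>
     (\<forall>g\<in>carrier G. \<tau> g * M = M * map_mat to_ac (\<rho> g)))"
  have okI: "ok k" if "matrix_rep G k \<sigma>" "N \<in> carrier_mat n k" "N \<noteq> 0\<^sub>m n k"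
    "\<And>g. g \<in> carrier G \<Longrightarrow> \<tau> g * N = N * map_mat to_ac (\<sigma> g)" for k N and \<sigma> :: "'a \<Rightarrow> 'k mat"
    unfolding ok_def using that by (intro exI[of _ N] exI[of _ \<sigma>]) simp
  have "ok (card (carrier G))"
  proof -
    let ?v = "unit_vec n 0"
    define M where "M = mat n (card (carrier G)) (\<lambda>(a, j). (\<tau> (enum j) *\<^sub>v ?v) $ a)"
    have "\<one> \<in> enum ` {..<card (carrier G)}" using enum by (simp add: bij_betw_def)
    then obtain j where j: "j < card (carrier G)" "enum j = \<one>" by auto
    have "M $$ (0, j) = 1"
      using j irr_pos[OF \<tau>] rep_one[OF irr_rep[OF \<tau>]] by (simp add: M_def)
    then have nz: "M \<noteq> 0\<^sub>m n (card (carrier G))" using j irr_pos[OF \<tau>] by auto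
    have "map_mat to_ac (reg_rep g :: 'k mat) = reg_rep g" for g
      by (rule eq_matI) (auto simp: reg_rep_def)
    then show ?thesis
      unfolding ok_def using nz matrix_rep_reg reg_rep_orbit[OF irr_rep[OF \<tau>], of ?v, folded M_def]
      by (intro exI[of _ M] exI[of _ "reg_rep"]) (auto simp: M_def)
  qed
  define m where "m = (LEAST m. ok m)"
  have okm: "ok m" unfolding m_def by (rule LeastI[of ok, OF \<open>ok (card (carrier G))\<close>])
  have least: "m \<le> k" if "ok k" for k unfolding m_def by (rule Least_le[of ok, OF that])
  from okm obtain M \<rho> where \<rho>: "matrix_rep G m (\<rho> :: 'a \<Rightarrow> 'k mat)" and M: "M \<in> carrier_mat n m" "M \<noteq> 0\<^sub>m n m"
    and int: "\<And>g. g \<in> carrier G \<Longrightarrow> \<tau> g * M = M * map_mat to_ac (\<rho> g)" unfolding ok_def by blast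
  note rc = rep_carrier[OF \<rho>]
  have "0 < m" using M by (cases m) auto
  have irr: "irreducible_rep G m \<rho>"
  proof (rule ccontr)
    assume "\<not> ?thesis"
    from reducible_block_form[OF is_group \<rho> \<open>0 < m\<close> this] obtain P Q k where
      PQ: "inverse_mats m P Q" and k: "0 < k" "k < m"
      and lz: "\<forall>g\<in>carrier G. low_zero k (Q * \<rho> g * P)"
      and r1: "matrix_rep G k (\<lambda>g. ul_block k (Q * \<rho> g * P))"
      and r2: "matrix_rep G (m - k) (\<lambda>g. lr_block k (Q * \<rho> g * P))" by blast
    have P: "P \<in> carrier_mat m m" and Q: "Q \<in> carrier_mat m m" using PQ by (auto simp: inverse_mats_def)
    let ?h = "map_mat to_ac :: 'k mat \<Rightarrow> 'k alg_closure mat"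
    define N where "N = M * ?h P"
    have N: "N \<in> carrier_mat n m" using M P by (auto simp: N_def)
    have hPQ: "?h P * ?h Q = 1\<^sub>m m"
      using PQ to_ac_hom.mat_hom_mult[OF P Q] by (simp add: inverse_mats_def to_ac_hom.mat_hom_one)
    have NQ: "N * ?h Q = M" using M P Q hPQ by (simp add: N_def assoc_mult_mat[of M n m _ m _ m])
    define B where "B g = Q * \<rho> g * P" for g
    have B: "B g \<in> carrier_mat m m" for g using P Q by (auto simp: B_def)
    have hB: "?h (B g) \<in> carrier_mat m m" for g using B[of g] by simp
    have Nint: "\<tau> g * N = N * ?h (B g)" if g: "g \<in> carrier G" for g
    proof -
      have "N * ?h (B g) = N * (?h Q * ?h (\<rho> g) * ?h P)"
        using P Q rc[OF g] to_ac_hom.mat_hom_mult[of "Q * \<rho> g" m m P m] to_ac_hom.mat_hom_mult[of Q m m "\<rho> g" m]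
        by (simp add: B_def)
      also have "\<dots> = (N * ?h Q) * (?h (\<rho> g) * ?h P)"
        using N P Q rc[OF g] by (simp add: assoc_mult_mat[of _ n m _ m _ m] assoc_mult_mat[of _ m m _ m _ m])
      also have "\<dots> = M * ?h (\<rho> g) * ?h P"
        unfolding NQ using M P rc[OF g] by (simp add: assoc_mult_mat[of _ n m _ m _ m])
      also have "\<dots> = \<tau> g * M * ?h P" by (simp add: int[OF g])
      also have "\<dots> = \<tau> g * N" unfolding N_def using M P tc[OF g] by (simp add: assoc_mult_mat[of _ n n _ m _ m])
      finally show ?thesis by simp
    qed
    have e: "(\<Sum>b<n. \<tau> g $$ (a, b) * N $$ (b, j)) = (\<Sum>l<k. N $$ (a, l) * to_ac (B g $$ (l, j)))
        + (\<Sum>l<m - k. N $$ (a, l + k) * to_ac (B g $$ (l + k, j)))" if "g \<in> carrier G" "a < n" "j < m" for g a j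
    proof -
      have "(\<tau> g * N) $$ (a, j) = (N * ?h (B g)) $$ (a, j)" using Nint[OF that(1)] by simp
      then show ?thesis
        using that B[of g] mult_index_sum[OF tc[OF that(1)] N that(2,3)]
          mult_index_sum[OF N hB[of g], of a j] sum_lessThan_split[of k m] k
        by (simp del: index_mult_mat(1))
    qed
    have low: "B g $$ (l + k, j) = 0" if "g \<in> carrier G" "l < m - k" "j < k" for g l j
      using lz that B[of g] by (auto simp: low_zero_def B_def)
    \<comment> \<open>the restriction of the intertwiner to the subrepresentation, and the map it induces on the
      quotient once that restriction is 0\<close>
    define N1 where "N1 = mat n k (\<lambda>(a, j). N $$ (a, j))"
    define N2 where "N2 = mat n (m - k) (\<lambda>(a, j). N $$ (a, j + k))"
    have N1: "N1 \<in> carrier_mat n k" and N2: "N2 \<in> carrier_mat n (m - k)" by (auto simp: N1_def N2_def)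
    have int1: "\<tau> g * N1 = N1 * ?h (ul_block k (B g))" if g: "g \<in> carrier G" for g
    proof (rule eq_matI)
      fix a j assume "a < dim_row (N1 * ?h (ul_block k (B g)))" "j < dim_col (N1 * ?h (ul_block k (B g)))"
      then have aj: "a < n" "j < k" by (auto simp: N1_def ul_block_def)
      show "(\<tau> g * N1) $$ (a, j) = (N1 * ?h (ul_block k (B g))) $$ (a, j)"
        unfolding mult_index_sum[OF tc[OF g] N1 aj]
          mult_index_sum[OF N1 map_carrier_mat[THEN iffD2, OF block_carrier(1)] aj]
        using e[OF g aj(1), of j] aj k low[OF g _ aj(2)] by (simp add: N1_def ul_block_def)
    qed (use tc[OF g] in \<open>auto simp: N1_def ul_block_def\<close>)
    have "ok k" if "N1 \<noteq> 0\<^sub>m n k" by (rule okI[OF r1[folded B_def] N1 that int1])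
    then have N1z: "N1 = 0\<^sub>m n k" using least[of k] k by fastforce
    then have N10: "N $$ (a, j) = 0" if "a < n" "j < k" for a j
    proof -
      have "N $$ (a, j) = N1 $$ (a, j)" using that by (simp add: N1_def)
      then show ?thesis using that by (simp add: N1z)
    qed
    have int2: "\<tau> g * N2 = N2 * ?h (lr_block k (B g))" if g: "g \<in> carrier G" for g
    proof (rule eq_matI)
      fix a j assume "a < dim_row (N2 * ?h (lr_block k (B g)))" "j < dim_col (N2 * ?h (lr_block k (B g)))"
      then have aj: "a < n" "j < m - k" using B[of g] by (auto simp: N2_def lr_block_def)
      show "(\<tau> g * N2) $$ (a, j) = (N2 * ?h (lr_block k (B g))) $$ (a, j)"
        unfolding mult_index_sum[OF tc[OF g] N2 aj]
          mult_index_sum[OF N2 map_carrier_mat[THEN iffD2, OF block_carrier(2)[OF B]] aj]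
        using e[OF g aj(1), of "j + k"] aj k B[of g] by (simp add: N2_def lr_block_def N10)
    qed (use tc[OF g] B[of g] in \<open>auto simp: N2_def lr_block_def\<close>)
    have "ok (m - k)" if "N2 \<noteq> 0\<^sub>m n (m - k)" by (rule okI[OF r2[folded B_def] N2 that int2])
    then have N20: "N2 = 0\<^sub>m n (m - k)" using least[of "m - k"] k by fastforce
    have "N = 0\<^sub>m n m"
    proof (rule eq_matI)
      fix a j assume "a < dim_row (0\<^sub>m n m :: 'k alg_closure mat)" "j < dim_col (0\<^sub>m n m :: 'k alg_closure mat)"
      then have aj: "a < n" "j < m" by auto
      show "N $$ (a, j) = 0\<^sub>m n m $$ (a, j)"
      proof (cases "j < k")
        case False
        then have "N $$ (a, j) = N2 $$ (a, j - k)" using aj by (simp add: N2_def)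
        then show ?thesis using aj False by (simp add: N20)
      qed (use aj N10 in simp)
    qed (use N in auto)
    then have "M = 0\<^sub>m n m" using NQ Q by auto
    then show False using M by simp
  qed
  have irr': "irreducible_rep G m (\<lambda>g. map_mat to_ac (\<rho> g))" by (rule absolutely_irreducible[OF sp irr])
  from schur_invertible[OF \<tau> irr' M(1) int M(2)] obtain N where nm: "n = m" and MN: "inverse_mats n M N" by blast
  have "char_poly (\<tau> g) = map_poly to_ac (char_poly (\<rho> g))" if g: "g \<in> carrier G" for g
  proof -
    have "N * \<tau> g * M = N * (M * map_mat to_ac (\<rho> g))"
      using MN tc[OF g] by (simp add: inverse_mats_def assoc_mult_mat[of _ n n _ n _ n] int[OF g])
    also have "\<dots> = (N * M) * map_mat to_ac (\<rho> g)"
      using MN rc[OF g] nm by (subst assoc_mult_mat[of _ n n _ n _ n]) (auto simp: inverse_mats_def)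
    also have "\<dots> = map_mat to_ac (\<rho> g)" using MN rc[OF g] nm by (simp add: inverse_mats_def)
    finally have "char_poly (\<tau> g) = char_poly (map_mat to_ac (\<rho> g))"
      using char_poly_conj[OF MN tc[OF g]] by simp
    then show ?thesis using to_ac_hom.char_poly_hom[OF rc[OF g]] by simp
  qed
  then show ?thesis using irr by blast
qed

end

section \<open>Extension of a ring homomorphism to a place\<close>

text \<open>The graph of a ring homomorphism from a subring of \<open>'b\<close> to \<open>'c\<close>. Graphs are ordered by inclusion,
  which is the ordering of partial homomorphisms that Zorn's lemma needs.\<close>

definition hom_graph :: "('b::field \<times> 'c::field) set \<Rightarrow> bool" where
  "hom_graph \<Gamma> \<longleftrightarrow> (1, 1) \<in> \<Gamma> \<and> (\<forall>a b a' b'. (a, b) \<in> \<Gamma> \<longrightarrow> (a', b') \<in> \<Gamma> \<longrightarrow>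
     (a - a', b - b') \<in> \<Gamma> \<and> (a * a', b * b') \<in> \<Gamma>) \<and> (\<forall>b. (0, b) \<in> \<Gamma> \<longrightarrow> b = 0)"

lemma hom_graphD:
  assumes "hom_graph \<Gamma>"
  shows "(1, 1) \<in> \<Gamma>" "(0, 0) \<in> \<Gamma>"
    "(a, b) \<in> \<Gamma> \<Longrightarrow> (a', b') \<in> \<Gamma> \<Longrightarrow> (a - a', b - b') \<in> \<Gamma>"
    "(a, b) \<in> \<Gamma> \<Longrightarrow> (a', b') \<in> \<Gamma> \<Longrightarrow> (a + a', b + b') \<in> \<Gamma>"
    "(a, b) \<in> \<Gamma> \<Longrightarrow> (a', b') \<in> \<Gamma> \<Longrightarrow> (a * a', b * b') \<in> \<Gamma>"
    "(0, b) \<in> \<Gamma> \<Longrightarrow> b = 0"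
    "(a, b) \<in> \<Gamma> \<Longrightarrow> (a, b') \<in> \<Gamma> \<Longrightarrow> b = b'"
proof -
  note d = assms[unfolded hom_graph_def]
  show 1: "(1, 1) \<in> \<Gamma>" using d by blast
  show m: "(a - a', b - b') \<in> \<Gamma>" if "(a, b) \<in> \<Gamma>" "(a', b') \<in> \<Gamma>" for a b a' b' using d that by blast
  show 0: "(0, 0) \<in> \<Gamma>" using m[OF 1 1] by simp
  show "(a + a', b + b') \<in> \<Gamma>" if "(a, b) \<in> \<Gamma>" "(a', b') \<in> \<Gamma>"
    using m[OF that(1) m[OF 0 that(2)]] by simp
  show "(a * a', b * b') \<in> \<Gamma>" if "(a, b) \<in> \<Gamma>" "(a', b') \<in> \<Gamma>" using d that by blast
  show "b = 0" if "(0, b) \<in> \<Gamma>" using d that by blast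
  show "b = b'" if "(a, b) \<in> \<Gamma>" "(a, b') \<in> \<Gamma>"
    using m[OF that] d by (metis eq_iff_diff_eq_0)
qed

lemma hom_graph_sum:
  assumes "hom_graph \<Gamma>" "\<And>i. i \<in> S \<Longrightarrow> (f i, g i) \<in> \<Gamma>"
  shows "(sum f S, sum g S) \<in> \<Gamma>"
  using assms(2)
  by (induction S rule: infinite_finite_induct) (auto intro: hom_graphD(2,4)[OF assms(1)])

lemma hom_graph_pow:
  assumes "hom_graph \<Gamma>" "(a, b) \<in> \<Gamma>"
  shows "(a ^ k, b ^ k) \<in> \<Gamma>"
  by (induction k) (auto intro: hom_graphD(1,5)[OF assms(1)] assms(2))

text \<open>Pairs of a polynomial over the subring and its image under the homomorphism, coefficient by
  coefficient.\<close>

definition graph_polys :: "('b::field \<times> 'c::field) set \<Rightarrow> ('b poly \<times> 'c poly) set" where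
  "graph_polys \<Gamma> = {(q, r). \<forall>i. (coeff q i, coeff r i) \<in> \<Gamma>}"

lemma graph_polys_coeff: "(q, r) \<in> graph_polys \<Gamma> \<Longrightarrow> (coeff q i, coeff r i) \<in> \<Gamma>"
  by (simp add: graph_polys_def)

lemma graph_polys_diff:
  assumes "hom_graph \<Gamma>" "(q, r) \<in> graph_polys \<Gamma>" "(q', r') \<in> graph_polys \<Gamma>"
  shows "(q - q', r - r') \<in> graph_polys \<Gamma>"
  using assms hom_graphD(3)[OF assms(1)] by (auto simp: graph_polys_def)

lemma graph_polys_mult:
  assumes "hom_graph \<Gamma>" "(q, r) \<in> graph_polys \<Gamma>" "(q', r') \<in> graph_polys \<Gamma>"
  shows "(q * q', r * r') \<in> graph_polys \<Gamma>"
  using assms(2,3) unfolding graph_polys_def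
  by (auto simp: coeff_mult intro!: hom_graph_sum[OF assms(1)] hom_graphD(5)[OF assms(1)])

lemma graph_polys_monom:
  assumes "hom_graph \<Gamma>" "(a, b) \<in> \<Gamma>"
  shows "(Polynomial.monom a k, Polynomial.monom b k) \<in> graph_polys \<Gamma>"
  using assms hom_graphD(2)[OF assms(1)] by (auto simp: graph_polys_def)

text \<open>The hypothesis says that \<open>poly q x \<mapsto> poly r \<alpha>\<close> is well defined.\<close>

lemma hom_graph_adjoin:
  assumes \<Gamma>: "hom_graph \<Gamma>"
    and root: "\<And>q r. (q, r) \<in> graph_polys \<Gamma> \<Longrightarrow> poly q x = 0 \<Longrightarrow> poly r \<alpha> = 0"
  defines "\<Gamma>' \<equiv> (\<lambda>(q, r). (poly q x, poly r \<alpha>)) ` graph_polys \<Gamma>"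
  shows "hom_graph \<Gamma>'" "\<Gamma> \<subseteq> \<Gamma>'" "(x, \<alpha>) \<in> \<Gamma>'"
proof -
  have mem: "(poly q x, poly r \<alpha>) \<in> \<Gamma>'" if "(q, r) \<in> graph_polys \<Gamma>" for q r
    unfolding \<Gamma>'_def using that by (intro image_eqI[of _ _ "(q, r)"]) auto
  show sub: "\<Gamma> \<subseteq> \<Gamma>'"
  proof
    fix z assume "z \<in> \<Gamma>"
    then show "z \<in> \<Gamma>'" using mem[OF graph_polys_monom[OF \<Gamma>, of "fst z" "snd z" 0]]
      by (simp add: poly_monom)
  qed
  show "(x, \<alpha>) \<in> \<Gamma>'"
    using mem[OF graph_polys_monom[OF \<Gamma> hom_graphD(1)[OF \<Gamma>], of 1]] by (simp add: poly_monom)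
  show "hom_graph \<Gamma>'"
    unfolding hom_graph_def
  proof (intro conjI allI impI)
    show "(1, 1) \<in> \<Gamma>'" using sub hom_graphD(1)[OF \<Gamma>] by blast
    fix a b a' b' assume "(a, b) \<in> \<Gamma>'" "(a', b') \<in> \<Gamma>'"
    then obtain q r q' r' where "(q, r) \<in> graph_polys \<Gamma>" "(q', r') \<in> graph_polys \<Gamma>"
      "a = poly q x" "b = poly r \<alpha>" "a' = poly q' x" "b' = poly r' \<alpha>" by (auto simp: \<Gamma>'_def)
    then show "(a - a', b - b') \<in> \<Gamma>'" "(a * a', b * b') \<in> \<Gamma>'"
      using mem[OF graph_polys_diff[OF \<Gamma>, of q r q' r']] mem[OF graph_polys_mult[OF \<Gamma>, of q r q' r']]
      by auto
  next
    fix b assume "(0, b) \<in> \<Gamma>'"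
    then show "b = 0" using root by (auto simp: \<Gamma>'_def)
  qed
qed

lemma poly_sum_upto:
  fixes q :: "'d::field poly"
  assumes "degree q \<le> n" shows "poly q x = (\<Sum>i\<le>n. coeff q i * x ^ i)"
  unfolding poly_altdef using assms
  by (intro sum.mono_neutral_left) (auto simp: coeff_eq_0)

text \<open>A partial homomorphism into an algebraically closed field that cannot be extended. Chevalley's
  argument shows that its domain is a valuation ring. Call x bad if \<open>poly q x = 0\<close> for some polynomial q
  over the subring that is mapped to 1. If x is not bad, the images of the polynomials that vanish
  at x form a proper ideal, and x can be sent to a common root of that ideal (\<open>adjoin_unless_one\<close>). And x and
  \<open>1/x\<close> are not both bad (\<open>not_both\<close>).\<close>

locale max_hom_graph =
  fixes \<Gamma> :: "('b::field \<times> 'c::alg_closed_field) set"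
  assumes \<Gamma>: "hom_graph \<Gamma>" and max: "\<And>\<Delta>. hom_graph \<Delta> \<Longrightarrow> \<Gamma> \<subseteq> \<Delta> \<Longrightarrow> \<Delta> = \<Gamma>"
begin

lemma adjoin_root:
  assumes "\<And>q r. (q, r) \<in> graph_polys \<Gamma> \<Longrightarrow> poly q x = 0 \<Longrightarrow> poly r \<alpha> = 0"
  shows "(x, \<alpha>) \<in> \<Gamma>"
proof -
  let ?\<Gamma>' = "(\<lambda>(q, r). (poly q x, poly r \<alpha>)) ` graph_polys \<Gamma>"
  have "hom_graph ?\<Gamma>'" by (rule hom_graph_adjoin(1)[OF \<Gamma>]) (rule assms)
  moreover have "\<Gamma> \<subseteq> ?\<Gamma>'" by (rule hom_graph_adjoin(2)[OF \<Gamma>]) (rule assms)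
  ultimately have "?\<Gamma>' = \<Gamma>" by (rule max)
  moreover have "(x, \<alpha>) \<in> ?\<Gamma>'" by (rule hom_graph_adjoin(3)[OF \<Gamma>]) (rule assms)
  ultimately show ?thesis by simp
qed

text \<open>Elements with nonzero image are invertible in the domain: \<open>1/a\<close> can be adjoined with image \<open>1/b\<close>,
  since multiplying \<open>poly q (1/a) = 0\<close> by a power of a gives a relation inside the domain.\<close>

lemma unit:
  assumes ab: "(a, b) \<in> \<Gamma>" "b \<noteq> 0"
  shows "(inverse a, inverse b) \<in> \<Gamma>"
proof (rule adjoin_root)
  have a: "a \<noteq> 0" using ab hom_graphD(6)[OF \<Gamma>] by blast
  fix q r assume qr: "(q, r) \<in> graph_polys \<Gamma>" and z: "poly q (inverse a) = 0"
  define n where "n = max (degree q) (degree r)"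
  have e: "(\<Sum>i\<le>n. coeff p i * c ^ (n - i)) = c ^ n * poly p (inverse c)"
    if "degree p \<le> n" "c \<noteq> 0" for p and c :: "'d::field"
    unfolding poly_sum_upto[OF that(1)] sum_distrib_left
    by (intro sum.cong refl) (use that in \<open>simp add: power_diff power_inverse field_simps\<close>)
  have "(\<Sum>i\<le>n. coeff q i * a ^ (n - i), \<Sum>i\<le>n. coeff r i * b ^ (n - i)) \<in> \<Gamma>"
    by (intro hom_graph_sum[OF \<Gamma>] hom_graphD(5)[OF \<Gamma>] graph_polys_coeff[OF qr] hom_graph_pow[OF \<Gamma>] ab)
  then have "(0, b ^ n * poly r (inverse b)) \<in> \<Gamma>"
    using e[of q a] e[of r b] a ab z by (simp add: n_def)
  then show "poly r (inverse b) = 0" using hom_graphD(6)[OF \<Gamma>] ab by fastforce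
qed

text \<open>The constant coefficient of r is mapped to 1, hence is a unit. So the multiple \<open>R\<close> of \<open>x\<^sup>l r(1/x)\<close>,
  a polynomial with nonzero leading coefficient that vanishes at x, cancels the leading term of q. That
  leading coefficient is mapped to 0, so \<open>R\<close> is mapped to 0 and \<open>q - R\<close> is still mapped to 1.\<close>

lemma reduce_integral:
  assumes x: "x \<noteq> 0"
    and q: "(q, 1) \<in> graph_polys \<Gamma>" "poly q x = 0"
    and r: "(r, 1) \<in> graph_polys \<Gamma>" "poly r (inverse x) = 0"
    and le: "degree r \<le> degree q"
  shows "\<exists>q'. (q', 1) \<in> graph_polys \<Gamma> \<and> poly q' x = 0 \<and> degree q' < degree q"
proof -
  define n where "n = degree q"
  define l where "l = degree r"
  have r0: "(coeff r 0, 1) \<in> \<Gamma>" using graph_polys_coeff[OF r(1), of 0] by simp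
  then have r00: "coeff r 0 \<noteq> 0" using hom_graphD(6)[OF \<Gamma>] by fastforce
  have q0: "(coeff q 0, 1) \<in> \<Gamma>" using graph_polys_coeff[OF q(1), of 0] by simp
  then have q00: "coeff q 0 \<noteq> 0" using hom_graphD(6)[OF \<Gamma>] by fastforce
  have n: "0 < n"
  proof (rule ccontr)
    assume "\<not> 0 < n"
    then obtain c where "q = [:c:]" using degree_0_id[of q] by (metis n_def neq0_conv)
    then show False using q(2) q00 by simp
  qed
  have qn: "(coeff q n, 0) \<in> \<Gamma>" using graph_polys_coeff[OF q(1), of n] n by simp
  define c where "c = coeff q n / coeff r 0"
  have c: "(c, 0) \<in> \<Gamma>"
    using hom_graphD(5)[OF \<Gamma> qn unit[OF r0]] by (simp add: c_def field_simps)
  define R where "R = Polynomial.monom c (n - l) * reflect_poly r"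
  have "(Polynomial.monom c (n - l), Polynomial.monom 0 (n - l)) \<in> graph_polys \<Gamma>"
    by (rule graph_polys_monom[OF \<Gamma> c])
  \<comment> \<open>S is the image of \<open>reflect_poly r\<close>; the only use of it is that it gets multiplied by 0\<close>
  moreover define S :: "'c poly" where "S = (\<Sum>j\<le>l. Polynomial.monom (coeff 1 (l - j)) j)"
  have "(coeff (reflect_poly r) i, coeff S i) \<in> \<Gamma>" for i
  proof -
    have "coeff S i = (if i \<le> l then coeff 1 (l - i) else 0)"
      by (simp add: S_def coeff_sum sum.delta del: coeff_1)
    moreover have "coeff (reflect_poly r) i = (if i \<le> l then coeff r (l - i) else 0)"
      by (simp add: coeff_reflect_poly l_def)
    ultimately show ?thesis
      using graph_polys_coeff[OF r(1), of "l - i"] hom_graphD(2)[OF \<Gamma>] by (simp del: coeff_1)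
  qed
  then have "(reflect_poly r, S) \<in> graph_polys \<Gamma>" by (simp add: graph_polys_def)
  ultimately have R: "(R, 0) \<in> graph_polys \<Gamma>"
    unfolding R_def using graph_polys_mult[OF \<Gamma>] by fastforce
  have "(q - R, 1) \<in> graph_polys \<Gamma>" using graph_polys_diff[OF \<Gamma> q(1) R] by simp
  moreover have "poly (q - R) x = 0"
    using q(2) r(2) x by (simp add: R_def poly_reflect_poly_nz)
  moreover have "degree (q - R) < degree q"
  proof -
    have dR: "degree (reflect_poly r) = l" using r00 by (simp add: l_def)
    have "degree R \<le> n"
      unfolding R_def using degree_mult_le[of "Polynomial.monom c (n - l)" "reflect_poly r"]
        degree_monom_le[of c "n - l"] dR le by (simp add: n_def l_def)
    then have "degree (q - R) \<le> n" using degree_diff_le[of q n R] by (simp add: n_def)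
    moreover have "coeff (q - R) n = 0"
    proof -
      have "coeff R n = c * coeff (reflect_poly r) l"
        unfolding R_def using le by (simp add: coeff_monom_mult n_def l_def)
      also have "\<dots> = coeff q n" using r00 by (simp add: c_def coeff_reflect_poly l_def)
      finally show ?thesis by simp
    qed
    ultimately show ?thesis using n unfolding n_def[symmetric]
      by (metis degree_0 leading_coeff_0_iff le_neq_implies_less)
  qed
  ultimately show ?thesis by blast
qed

lemma not_both:
  assumes x: "x \<noteq> 0"
  shows "\<not> (\<exists>q. (q, 1) \<in> graph_polys \<Gamma> \<and> poly q x = 0) \<or> \<not> (\<exists>r. (r, 1) \<in> graph_polys \<Gamma> \<and> poly r (inverse x) = 0)"
proof (rule ccontr)
  assume "\<not> ?thesis"
  then obtain q r where "(q, 1) \<in> graph_polys \<Gamma>" "poly q x = 0" "(r, 1) \<in> graph_polys \<Gamma>" "poly r (inverse x) = 0"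
    by blast
  then show False
  proof (induction "degree q + degree r" arbitrary: q r rule: less_induct)
    case less
    show False
    proof (cases "degree r \<le> degree q")
      case True
      from reduce_integral[OF x less.prems True] less.hyps less.prems show False by fastforce
    next
      case False
      from reduce_integral[of "inverse x" r q] x less.prems False
      obtain r' where "(r', 1) \<in> graph_polys \<Gamma>" "poly r' (inverse x) = 0" "degree r' < degree r" by auto
      then show False using less.hyps[of q r'] less.prems by simp
    qed
  qed
qed

text \<open>The images of the polynomials vanishing at x are closed under division with remainder by a nonzero
  member d of least degree, because the leading coefficient of d lifts to a unit. So they are
  multiples of d, and a root of d is an admissible image for x. If d were constant, 1 would be among
  these images.\<close>

lemma adjoin_unless_one:
  assumes none: "\<not> (\<exists>q. (q, 1) \<in> graph_polys \<Gamma> \<and> poly q x = 0)"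
  shows "\<exists>\<alpha>. (x, \<alpha>) \<in> \<Gamma>"
proof -
  define I where "I = {r. \<exists>q. (q, r) \<in> graph_polys \<Gamma> \<and> poly q x = 0}"
  show ?thesis
  proof (cases "\<exists>d\<in>I. d \<noteq> 0")
    case False
    then show ?thesis by (intro exI[of _ 0] adjoin_root) (auto simp: I_def)
  next
    case True
    then have "\<exists>d. d \<in> I \<and> d \<noteq> 0" by blast
    then obtain d where d: "d \<in> I" "d \<noteq> 0" and least: "\<And>r. r \<in> I \<Longrightarrow> r \<noteq> 0 \<Longrightarrow> degree d \<le> degree r"
      using ex_has_least_nat[of "\<lambda>d. d \<in> I \<and> d \<noteq> 0" _ degree] by blast
    from d obtain D where D: "(D, d) \<in> graph_polys \<Gamma>" "poly D x = 0" by (auto simp: I_def)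
    have "lead_coeff d \<noteq> 0" using d by simp
    with graph_polys_coeff[OF D(1), of "degree d"]
    have inv: "(inverse (coeff D (degree d)), inverse (lead_coeff d)) \<in> \<Gamma>" by (rule unit)
    have dvd: "d dvd r" if "r \<in> I" for r
      using that
    proof (induction "degree r" arbitrary: r rule: less_induct)
      case less
      show ?case
      proof (cases "r = 0")
        case False
        from less.prems obtain q where q: "(q, r) \<in> graph_polys \<Gamma>" "poly q x = 0" by (auto simp: I_def)
        have le: "degree d \<le> degree r" using least[OF less.prems False] .
        define k where "k = degree r - degree d"
        define s where "s = Polynomial.monom (lead_coeff r * inverse (lead_coeff d)) k"
        have s: "(Polynomial.monom (coeff q (degree r) * inverse (coeff D (degree d))) k, s) \<in> graph_polys \<Gamma>"
          unfolding s_def by (intro graph_polys_monom[OF \<Gamma>] hom_graphD(5)[OF \<Gamma>] graph_polys_coeff[OF q(1)] inv)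
        have rI: "r - s * d \<in> I"
          unfolding I_def using graph_polys_diff[OF \<Gamma> q(1) graph_polys_mult[OF \<Gamma> s D(1)]] q(2) D(2)
          by auto
        have "d dvd r - s * d"
        proof (cases "r - s * d = 0")
          case False
          have ds: "degree (s * d) \<le> degree r"
            using degree_mult_le[of s d] degree_monom_le[of "lead_coeff r * inverse (lead_coeff d)" k] le
            by (simp add: s_def k_def)
          have "coeff (s * d) (degree r) = lead_coeff r"
            using le d by (simp add: s_def k_def coeff_monom_mult)
          then have "coeff (r - s * d) (degree r) = 0" by simp
          moreover have "degree (r - s * d) \<le> degree r" using ds by (intro degree_diff_le) auto
          ultimately have "degree (r - s * d) < degree r"
            using False by (metis leading_coeff_0_iff le_neq_implies_less)
          then show ?thesis by (rule less.hyps[OF _ rI])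
        qed simp
        then show ?thesis by (metis dvd_add_left_iff dvd_triv_right diff_add_cancel dvd_add)
      qed simp
    qed
    have "degree d > 0"
    proof (rule ccontr)
      assume "\<not> degree d > 0"
      then obtain b where b: "d = [:b:]" using degree_0_id[of d] by (metis neq0_conv)
      have "(Polynomial.monom (inverse (coeff D 0)) 0 * D, Polynomial.monom (inverse b) 0 * d) \<in> graph_polys \<Gamma>"
        using inv b by (intro graph_polys_mult[OF \<Gamma> _ D(1)] graph_polys_monom[OF \<Gamma>]) simp
      moreover have "Polynomial.monom (inverse b) 0 * d = 1" using b d(2) by (simp add: monom_0 one_pCons)
      ultimately show False using none D(2) by auto
    qed
    then obtain \<alpha> where \<alpha>: "poly d \<alpha> = 0" using alg_closed_imp_poly_has_root by blast
    have "(x, \<alpha>) \<in> \<Gamma>"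
    proof (rule adjoin_root)
      fix q r assume "(q, r) \<in> graph_polys \<Gamma>" "poly q x = 0"
      then have "d dvd r" by (intro dvd) (auto simp: I_def)
      then show "poly r \<alpha> = 0" using \<alpha> by (auto elim!: dvdE)
    qed
    then show ?thesis ..
  qed
qed

lemma valuation: "x \<noteq> 0 \<Longrightarrow> (\<exists>\<alpha>. (x, \<alpha>) \<in> \<Gamma>) \<or> (\<exists>\<alpha>. (inverse x, \<alpha>) \<in> \<Gamma>)"
  using not_both adjoin_unless_one by blast

end

text \<open>A valuation ring \<open>V\<close> of \<open>'b\<close> with a homomorphism \<open>f\<close> from \<open>V\<close> to a field; \<open>f\<close> has arbitrary
  values off \<open>V\<close>.\<close>

locale place =
  fixes V :: "'b::field set" and f :: "'b \<Rightarrow> 'c::field"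
  assumes V1: "1 \<in> V" and Vdiff: "\<And>x y. x \<in> V \<Longrightarrow> y \<in> V \<Longrightarrow> x - y \<in> V"
    and Vmult: "\<And>x y. x \<in> V \<Longrightarrow> y \<in> V \<Longrightarrow> x * y \<in> V"
    and f1: "f 1 = 1" and fdiff: "\<And>x y. x \<in> V \<Longrightarrow> y \<in> V \<Longrightarrow> f (x - y) = f x - f y"
    and fmult: "\<And>x y. x \<in> V \<Longrightarrow> y \<in> V \<Longrightarrow> f (x * y) = f x * f y"
    and total: "\<And>x. x \<in> V \<or> inverse x \<in> V"
begin

lemma V0: "0 \<in> V" using Vdiff[OF V1 V1] by simp
lemma Vneg: "x \<in> V \<Longrightarrow> - x \<in> V" using Vdiff[OF V0, of x] by simp
lemma Vadd: "x \<in> V \<Longrightarrow> y \<in> V \<Longrightarrow> x + y \<in> V" using Vdiff[OF _ Vneg, of x y] by simp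
lemma f0: "f 0 = 0" using fdiff[OF V1 V1] by simp
lemma fneg: "x \<in> V \<Longrightarrow> f (- x) = - f x" using fdiff[OF V0, of x] f0 by simp
lemma fadd: "x \<in> V \<Longrightarrow> y \<in> V \<Longrightarrow> f (x + y) = f x + f y"
  using fdiff[of x "- y"] Vneg[of y] fneg[of y] by simp
lemma Vsum: "(\<And>i. i \<in> S \<Longrightarrow> g i \<in> V) \<Longrightarrow> sum g S \<in> V"
  by (induction S rule: infinite_finite_induct) (auto intro: V0 Vadd)
lemma fsum: "(\<And>i. i \<in> S \<Longrightarrow> g i \<in> V) \<Longrightarrow> f (sum g S) = (\<Sum>i\<in>S. f (g i))"
  by (induction S rule: infinite_finite_induct) (auto simp: f0 fadd Vsum)

text \<open>Divisibility in a valuation ring is a total preorder, so one of finitely many elements divides all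
  others. Dividing by it takes the place of clearing denominators.\<close>

lemma max_element:
  assumes "finite S" "S \<noteq> {}" "0 \<notin> S"
  shows "\<exists>m\<in>S. \<forall>s\<in>S. s / m \<in> V"
  using assms
proof (induction rule: finite_ne_induct)
  case (singleton x)
  then show ?case using V1 by simp
next
  case (insert x S)
  then obtain m where m: "m \<in> S" "\<forall>s\<in>S. s / m \<in> V" by auto
  have m0: "m \<noteq> 0" "x \<noteq> 0" using m insert.prems by auto
  consider "x / m \<in> V" | "m / x \<in> V" using total[of "x / m"] by auto
  then show ?case
  proof cases
    case 1
    then show ?thesis using m by (intro bexI[of _ m]) auto
  next
    case 2
    have "s / x \<in> V" if "s \<in> S" for s
      using Vmult[OF m(2)[rule_format, OF that] 2] m0 by simp
    then show ?thesis using m0 V1 by (intro bexI[of _ x]) auto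
  qed
qed

end

text \<open>Chevalley's extension theorem: by Zorn's lemma the homomorphism has a maximal extension, whose
  domain is a valuation ring.\<close>

theorem place_extension:
  fixes O' :: "'b::field set" and \<theta> :: "'b \<Rightarrow> 'c::alg_closed_field"
  assumes O: "1 \<in> O'" "\<And>x y. x \<in> O' \<Longrightarrow> y \<in> O' \<Longrightarrow> x - y \<in> O'" "\<And>x y. x \<in> O' \<Longrightarrow> y \<in> O' \<Longrightarrow> x * y \<in> O'"
    and \<theta>: "\<theta> 1 = 1" "\<And>x y. x \<in> O' \<Longrightarrow> y \<in> O' \<Longrightarrow> \<theta> (x - y) = \<theta> x - \<theta> y"
      "\<And>x y. x \<in> O' \<Longrightarrow> y \<in> O' \<Longrightarrow> \<theta> (x * y) = \<theta> x * \<theta> y"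
  shows "\<exists>V f. place V f \<and> O' \<subseteq> V \<and> (\<forall>x\<in>O'. f x = \<theta> x)"
proof -
  define \<Gamma>0 where "\<Gamma>0 = (\<lambda>x. (x, \<theta> x)) ` O'"
  have \<theta>0: "\<theta> 0 = 0" using \<theta>(2)[OF O(1) O(1)] by simp
  have g0: "hom_graph \<Gamma>0"
    unfolding hom_graph_def
  proof (intro conjI allI impI)
    show "(1, 1) \<in> \<Gamma>0" using O(1) \<theta>(1) by (force simp: \<Gamma>0_def)
  next
    fix a b a' b' assume "(a, b) \<in> \<Gamma>0" "(a', b') \<in> \<Gamma>0"
    then show "(a - a', b - b') \<in> \<Gamma>0" "(a * a', b * b') \<in> \<Gamma>0"
      using O \<theta> by (auto simp: \<Gamma>0_def)
  next
    fix b assume "(0, b) \<in> \<Gamma>0" then show "b = 0" using \<theta>0 by (auto simp: \<Gamma>0_def)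
  qed
  have "\<exists>\<Gamma>\<in>{\<Gamma>. hom_graph \<Gamma> \<and> \<Gamma>0 \<subseteq> \<Gamma>}. \<forall>\<Delta>\<in>{\<Gamma>. hom_graph \<Gamma> \<and> \<Gamma>0 \<subseteq> \<Gamma>}. \<Gamma> \<subseteq> \<Delta> \<longrightarrow> \<Delta> = \<Gamma>"
  proof (rule subset_Zorn_nonempty)
    show "{\<Gamma>. hom_graph \<Gamma> \<and> \<Gamma>0 \<subseteq> \<Gamma>} \<noteq> {}" using g0 by blast
    fix C assume C: "C \<noteq> {}" "subset.chain {\<Gamma>. hom_graph \<Gamma> \<and> \<Gamma>0 \<subseteq> \<Gamma>} C"
    then have Cg: "hom_graph \<Delta>" "\<Gamma>0 \<subseteq> \<Delta>" if "\<Delta> \<in> C" for \<Delta>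
      using that by (auto simp: subset.chain_def)
    have Ct: "\<Delta> \<subseteq> \<Delta>' \<or> \<Delta>' \<subseteq> \<Delta>" if "\<Delta> \<in> C" "\<Delta>' \<in> C" for \<Delta> \<Delta>'
      using C(2) that unfolding subset_chain_def by blast
    have "hom_graph (\<Union>C)"
      unfolding hom_graph_def
    proof (intro conjI allI impI)
      show "(1, 1) \<in> \<Union>C" using C(1) Cg hom_graphD(1) by blast
    next
      fix a b a' b' assume "(a, b) \<in> \<Union>C" "(a', b') \<in> \<Union>C"
      then obtain \<Delta> where \<Delta>: "\<Delta> \<in> C" "(a, b) \<in> \<Delta>" "(a', b') \<in> \<Delta>" using Ct by blast
      then show "(a - a', b - b') \<in> \<Union>C" "(a * a', b * b') \<in> \<Union>C"
        using hom_graphD(3,5)[OF Cg(1)[OF \<Delta>(1)] \<Delta>(2,3)] by blast+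
    next
      fix b assume "(0, b) \<in> \<Union>C" then show "b = 0" using Cg hom_graphD(6) by blast
    qed
    then show "\<Union>C \<in> {\<Gamma>. hom_graph \<Gamma> \<and> \<Gamma>0 \<subseteq> \<Gamma>}" using C(1) Cg by blast
  qed
  then obtain \<Gamma> where \<Gamma>': "\<Gamma> \<in> {\<Gamma>. hom_graph \<Gamma> \<and> \<Gamma>0 \<subseteq> \<Gamma>}"
    and mx': "\<forall>\<Delta>\<in>{\<Gamma>. hom_graph \<Gamma> \<and> \<Gamma>0 \<subseteq> \<Gamma>}. \<Gamma> \<subseteq> \<Delta> \<longrightarrow> \<Delta> = \<Gamma>" by (rule bexE)
  have \<Gamma>h: "hom_graph \<Gamma>" "\<Gamma>0 \<subseteq> \<Gamma>" using \<Gamma>' by simp_all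
  have mx: "\<Delta> = \<Gamma>" if "hom_graph \<Delta>" "\<Gamma> \<subseteq> \<Delta>" for \<Delta>
    using mx'[rule_format, of \<Delta>] that \<Gamma>h(2) by simp
  interpret max_hom_graph \<Gamma> by unfold_locales (rule \<Gamma>h(1), rule mx)
  define V where "V = fst ` \<Gamma>"
  define f where "f = (\<lambda>x. THE y. (x, y) \<in> \<Gamma>)"
  have fI: "f x = y" if "(x, y) \<in> \<Gamma>" for x y
    unfolding f_def by (rule the_equality) (use that hom_graphD(7)[OF \<Gamma>h(1)] in metis)+
  have VI: "x \<in> V \<longleftrightarrow> (x, f x) \<in> \<Gamma>" for x
  proof
    assume "x \<in> V"
    then obtain y where "(x, y) \<in> \<Gamma>" by (auto simp: V_def)
    then show "(x, f x) \<in> \<Gamma>" using fI by simp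
  next
    assume "(x, f x) \<in> \<Gamma>" then show "x \<in> V" unfolding V_def by (metis fst_conv imageI)
  qed
  have "place V f"
  proof
    have "f 1 = 1" by (rule fI[OF hom_graphD(1)[OF \<Gamma>h(1)]])
    then show "1 \<in> V" "f 1 = 1" using hom_graphD(1)[OF \<Gamma>h(1)] by (simp_all add: VI)
    fix x y assume "x \<in> V" "y \<in> V"
    then have "(x, f x) \<in> \<Gamma>" "(y, f y) \<in> \<Gamma>" by (auto simp: VI)
    note d = hom_graphD(3)[OF \<Gamma>h(1) this] hom_graphD(5)[OF \<Gamma>h(1) this]
    show "f (x - y) = f x - f y" "f (x * y) = f x * f y" by (rule fI d)+
    then show "x - y \<in> V" "x * y \<in> V" using d by (simp_all add: VI)
  next
    fix x
    show "x \<in> V \<or> inverse x \<in> V"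
    proof (cases "x = 0")
      case True
      then show ?thesis using hom_graphD(2)[OF \<Gamma>h(1)] by (force simp: V_def)
    next
      case False
      then show ?thesis using valuation[OF False] by (force simp: V_def)
    qed
  qed
  moreover have "O' \<subseteq> V" "\<forall>x\<in>O'. f x = \<theta> x"
    using \<Gamma>h(2) fI by (force simp: V_def \<Gamma>0_def)+
  ultimately show ?thesis by blast
qed

section \<open>Cyclotomic integers\<close>

lemma cyclotomic_ring_closed:
  shows cyc_1: "1 \<in> cyclotomic_ring n"
    and cyc_diff: "x \<in> cyclotomic_ring n \<Longrightarrow> y \<in> cyclotomic_ring n \<Longrightarrow> x - y \<in> cyclotomic_ring n"
    and cyc_mult: "x \<in> cyclotomic_ring n \<Longrightarrow> y \<in> cyclotomic_ring n \<Longrightarrow> x * y \<in> cyclotomic_ring n"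
proof -
  let ?z = "cis (2 * pi / of_nat n)"
  have I: "poly (map_poly of_int q) ?z \<in> cyclotomic_ring n" for q unfolding cyclotomic_ring_def by blast
  show "1 \<in> cyclotomic_ring n" using I[of 1] by simp
  assume "x \<in> cyclotomic_ring n" "y \<in> cyclotomic_ring n"
  then obtain q r where "x = poly (map_poly of_int q) ?z" "y = poly (map_poly of_int r) ?z"
    unfolding cyclotomic_ring_def by blast
  then show "x - y \<in> cyclotomic_ring n" "x * y \<in> cyclotomic_ring n"
    using I[of "q - r"] I[of "q * r"] by (simp_all add: of_int_poly_hom.hom_mult of_int_poly_hom.hom_minus)
qed

lemma cyc_0: "0 \<in> cyclotomic_ring n" using cyc_diff[OF cyc_1 cyc_1] by simp
lemma cyc_neg: "x \<in> cyclotomic_ring n \<Longrightarrow> - x \<in> cyclotomic_ring n" using cyc_diff[OF cyc_0] by simp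
lemma cyc_add: "x \<in> cyclotomic_ring n \<Longrightarrow> y \<in> cyclotomic_ring n \<Longrightarrow> x + y \<in> cyclotomic_ring n"
  using cyc_diff[OF _ cyc_neg, of x n y] by simp
lemma cyc_sum: "(\<And>i. i \<in> S \<Longrightarrow> f i \<in> cyclotomic_ring n) \<Longrightarrow> sum f S \<in> cyclotomic_ring n"
  by (induction S rule: infinite_finite_induct) (auto intro: cyc_0 cyc_add)
lemma cyc_of_nat: "of_nat k \<in> cyclotomic_ring n"
  by (induction k) (auto intro: cyc_0 cyc_1 cyc_add)
lemma cyc_of_int: "of_int k \<in> cyclotomic_ring n"
proof (cases "k \<ge> 0")
  case True
  then show ?thesis using cyc_of_nat[of "nat k" n] by simp
next
  case False
  then show ?thesis using cyc_neg[OF cyc_of_nat[of "nat (- k)" n]] by simp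
qed
lemma cyc_pow: "x \<in> cyclotomic_ring n \<Longrightarrow> x ^ k \<in> cyclotomic_ring n"
  by (induction k) (auto intro: cyc_1 cyc_mult)
lemma cyc_sum_list: "(\<And>x. x \<in> set xs \<Longrightarrow> x \<in> cyclotomic_ring n) \<Longrightarrow> sum_list xs \<in> cyclotomic_ring n"
  by (induction xs) (auto intro: cyc_0 cyc_add)

lemma cyc_zeta: "cis (2 * pi / of_nat n) \<in> cyclotomic_ring n"
proof -
  have "poly (map_poly of_int [:0, 1:]) (cis (2 * pi / of_nat n)) \<in> cyclotomic_ring n"
    unfolding cyclotomic_ring_def by blast
  then show ?thesis by simp
qed

lemma cyc_root_of_unity:
  assumes w: "w ^ m = 1" and m: "m dvd n" and n: "n > 0"
  shows "w \<in> cyclotomic_ring n"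
proof -
  have "w ^ n = 1" using w m by (metis dvdE power_mult power_one)
  then have "w \<in> (\<lambda>k. cis (2 * pi * real k / real n)) ` {..<n}"
    using bij_betw_roots_unity[OF n] by (simp add: bij_betw_def)
  then obtain k where "w = cis (2 * pi * real k / real n)" by auto
  also have "\<dots> = cis (2 * pi / of_nat n) ^ k" by (simp add: DeMoivre mult_ac)
  finally show ?thesis using cyc_pow[OF cyc_zeta] by simp
qed

lemma cyc_cnj:
  assumes "x \<in> cyclotomic_ring n" and n: "n > 0"
  shows "cnj x \<in> cyclotomic_ring n"
proof -
  let ?z = "cis (2 * pi / of_nat n)"
  from assms obtain q where q: "x = poly (map_poly of_int q) ?z" unfolding cyclotomic_ring_def by blast
  have "?z ^ n = 1" using n by (simp add: DeMoivre)
  then have "cnj ?z ^ n = 1" by (metis complex_cnj_one complex_cnj_power)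
  then have "cnj ?z \<in> cyclotomic_ring n" by (rule cyc_root_of_unity) (use n in auto)
  moreover have "cnj x = (\<Sum>i\<le>degree (map_poly of_int q :: complex poly). of_int (coeff q i) * cnj ?z ^ i)"
    unfolding q poly_altdef by (simp add: coeff_map_poly)
  ultimately show ?thesis by (auto intro!: cyc_sum cyc_mult cyc_of_int cyc_pow)
qed

text \<open>The localisation of \<open>\<int>[\<zeta>\<^sub>n]\<close> at the integers prime to p.\<close>

definition cyc_local :: "nat \<Rightarrow> nat \<Rightarrow> complex set" where
  "cyc_local p n = {z. \<exists>m. coprime m p \<and> of_nat m * z \<in> cyclotomic_ring n}"

lemma loc_cyc: "x \<in> cyclotomic_ring n \<Longrightarrow> x \<in> cyc_local p n"
  unfolding cyc_local_def by (auto intro!: exI[of _ 1])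

lemma loc_add:
  assumes "x \<in> cyc_local p n" "y \<in> cyc_local p n" shows "x + y \<in> cyc_local p n"
proof -
  from assms obtain a b where "coprime a p" "of_nat a * x \<in> cyclotomic_ring n"
    "coprime b p" "of_nat b * y \<in> cyclotomic_ring n" unfolding cyc_local_def by blast
  then have "coprime (a * b) p" "of_nat b * (of_nat a * x) + of_nat a * (of_nat b * y) \<in> cyclotomic_ring n"
    by (auto intro!: cyc_add cyc_mult cyc_of_nat)
  then show ?thesis unfolding cyc_local_def by (auto intro!: exI[of _ "a * b"] simp: algebra_simps)
qed

lemma loc_mult:
  assumes "x \<in> cyc_local p n" "y \<in> cyc_local p n" shows "x * y \<in> cyc_local p n"
proof -
  from assms obtain a b where "coprime a p" "of_nat a * x \<in> cyclotomic_ring n"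
    "coprime b p" "of_nat b * y \<in> cyclotomic_ring n" unfolding cyc_local_def by blast
  then have "coprime (a * b) p" "(of_nat a * x) * (of_nat b * y) \<in> cyclotomic_ring n"
    by (auto intro!: cyc_mult)
  then show ?thesis unfolding cyc_local_def by (auto intro!: exI[of _ "a * b"] simp: algebra_simps)
qed

lemma loc_sum: "(\<And>i. i \<in> S \<Longrightarrow> f i \<in> cyc_local p n) \<Longrightarrow> sum f S \<in> cyc_local p n"
  by (induction S rule: infinite_finite_induct) (auto intro: loc_add loc_cyc cyc_0)

lemma loc_cnj: "x \<in> cyc_local p n \<Longrightarrow> n > 0 \<Longrightarrow> cnj x \<in> cyc_local p n"
  unfolding cyc_local_def using cyc_cnj[of "of_nat _ * x" n] by auto

lemma loc_div:
  assumes "x \<in> cyc_local p n" "coprime m p" "m > 0"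
  shows "x / of_nat m \<in> cyc_local p n"
proof -
  from assms obtain a where "coprime a p" "of_nat a * x \<in> cyclotomic_ring n" unfolding cyc_local_def by blast
  then show ?thesis unfolding cyc_local_def using assms by (auto intro!: exI[of _ "a * m"])
qed

section \<open>Reduction of a representation along a place\<close>

text \<open>The Leibniz formula only needs a homomorphism on a subring that contains the entries.\<close>

lemma partial_hom_det:
  fixes h :: "'a::comm_ring_1 \<Rightarrow> 'b::comm_ring_1"
  assumes S: "1 \<in> S" "\<And>x y. x \<in> S \<Longrightarrow> y \<in> S \<Longrightarrow> x - y \<in> S" "\<And>x y. x \<in> S \<Longrightarrow> y \<in> S \<Longrightarrow> x * y \<in> S"
    and h: "h 1 = 1" "\<And>x y. x \<in> S \<Longrightarrow> y \<in> S \<Longrightarrow> h (x - y) = h x - h y"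
      "\<And>x y. x \<in> S \<Longrightarrow> y \<in> S \<Longrightarrow> h (x * y) = h x * h y"
    and A: "A \<in> carrier_mat n n" and e: "\<And>i j. i < n \<Longrightarrow> j < n \<Longrightarrow> A $$ (i, j) \<in> S"
  shows "h (det A) = det (map_mat h A)"
proof -
  have S0: "0 \<in> S" and h0: "h 0 = 0" using S(2)[OF S(1) S(1)] h(2)[OF S(1) S(1)] by auto
  have neg: "- x \<in> S" "h (- x) = - h x" if "x \<in> S" for x
    using S(2)[OF S0 that] h(2)[OF S0 that] h0 by auto
  have add: "x + y \<in> S" "h (x + y) = h x + h y" if "x \<in> S" "y \<in> S" for x y
    using S(2)[OF that(1) neg(1)[OF that(2)]] h(2)[OF that(1) neg(1)[OF that(2)]] neg(2)[OF that(2)] by auto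
  have sum: "sum f I \<in> S \<and> h (sum f I) = (\<Sum>i\<in>I. h (f i))" if "\<And>i. i \<in> I \<Longrightarrow> f i \<in> S" for f and I :: "(nat \<Rightarrow> nat) set"
    using that by (induction I rule: infinite_finite_induct) (auto simp: S0 h0 add)
  have prod: "prod f I \<in> S \<and> h (prod f I) = (\<Prod>i\<in>I. h (f i))" if "\<And>i. i \<in> I \<Longrightarrow> f i \<in> S" for f and I :: "nat set"
    using that by (induction I rule: infinite_finite_induct) (auto simp: S h)
  have sgn: "signof q \<in> S \<and> h (signof q) = signof q" for q :: "nat \<Rightarrow> nat"
    by (cases q rule: sign_cases) (auto simp: S h neg)
  let ?f = "\<lambda>q. signof q * (\<Prod>i = 0..<n. A $$ (i, q i))"
  have p: "(\<Prod>i = 0..<n. A $$ (i, q i)) \<in> S \<and> h (\<Prod>i = 0..<n. A $$ (i, q i)) = (\<Prod>i = 0..<n. h (A $$ (i, q i)))"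
    if "q permutes {0..<n}" for q
  proof (rule prod)
    fix i assume "i \<in> {0..<n}"
    then show "A $$ (i, q i) \<in> S" using permutes_in_image[OF that, of i] by (intro e) auto
  qed
  have "h (det A) = h (\<Sum>q\<in>{q. q permutes {0..<n}}. ?f q)" by (simp add: det_def'[OF A])
  also have "\<dots> = (\<Sum>q\<in>{q. q permutes {0..<n}}. h (?f q))"
    using sum[of "{q. q permutes {0..<n}}" ?f] p sgn by (auto simp: S)
  also have "\<dots> = (\<Sum>q\<in>{q. q permutes {0..<n}}. signof q * (\<Prod>i = 0..<n. map_mat h A $$ (i, q i)))"
  proof (rule sum.cong[OF refl])
    fix q assume "q \<in> {q. q permutes {0..<n}}"
    then have q: "q permutes {0..<n}" by simp
    have "(\<Prod>i = 0..<n. h (A $$ (i, q i))) = (\<Prod>i = 0..<n. map_mat h A $$ (i, q i))"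
    proof (rule prod.cong[OF refl])
      fix i assume "i \<in> {0..<n}"
      then show "h (A $$ (i, q i)) = map_mat h A $$ (i, q i)"
        using permutes_in_image[OF q, of i] A by auto
    qed
    then show "h (?f q) = signof q * (\<Prod>i = 0..<n. map_mat h A $$ (i, q i))"
      using p[OF q] sgn[of q] h(3) by auto
  qed
  also have "\<dots> = det (map_mat h A)" using A by (subst det_def'[of _ n]) auto
  finally show ?thesis .
qed

context place
begin

lemma coeff_map_f: "coeff (map_poly f q) i = f (coeff q i)"
  by (simp add: coeff_map_poly f0)

definition Vpoly :: "'b poly set" where "Vpoly = {q. \<forall>i. coeff q i \<in> V}"

lemma Vpoly:
  shows "1 \<in> Vpoly" and "q \<in> Vpoly \<Longrightarrow> r \<in> Vpoly \<Longrightarrow> q - r \<in> Vpoly"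
    and "q \<in> Vpoly \<Longrightarrow> r \<in> Vpoly \<Longrightarrow> q * r \<in> Vpoly"
    and "map_poly f 1 = 1" and "q \<in> Vpoly \<Longrightarrow> r \<in> Vpoly \<Longrightarrow> map_poly f (q - r) = map_poly f q - map_poly f r"
    and "q \<in> Vpoly \<Longrightarrow> r \<in> Vpoly \<Longrightarrow> map_poly f (q * r) = map_poly f q * map_poly f r"
  by (auto simp: Vpoly_def V0 V1 Vdiff coeff_mult coeff_map_f fdiff fmult fsum Vmult f0 f1
      intro!: Vsum poly_eqI)

lemma char_poly_map:
  assumes A: "A \<in> carrier_mat n n" and e: "\<And>i j. i < n \<Longrightarrow> j < n \<Longrightarrow> A $$ (i, j) \<in> V"
  shows "char_poly (map_mat f A) = map_poly f (char_poly A)"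
proof -
  have "map_poly f (char_poly A) = det (map_mat (map_poly f) (char_poly_matrix A))"
    unfolding char_poly_def
  proof (rule partial_hom_det[of Vpoly _ _ n])
    fix i j assume "i < n" "j < n"
    then show "char_poly_matrix A $$ (i, j) \<in> Vpoly"
      using A e by (auto simp: char_poly_matrix_def Vpoly_def coeff_pCons V0 V1 Vneg Vadd split: nat.splits)
  qed (use A in \<open>auto intro: Vpoly\<close>)
  also have "map_mat (map_poly f) (char_poly_matrix A) = char_poly_matrix (map_mat f A)"
  proof (rule eq_matI)
    fix i j assume "i < dim_row (char_poly_matrix (map_mat f A))" "j < dim_col (char_poly_matrix (map_mat f A))"
    then have "i < n" "j < n" using A by (auto simp: char_poly_matrix_def)
    then show "map_mat (map_poly f) (char_poly_matrix A) $$ (i, j) = char_poly_matrix (map_mat f A) $$ (i, j)"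
      using A e by (auto simp: char_poly_matrix_def coeff_map_f coeff_pCons f0 f1 fneg split: nat.splits intro!: poly_eqI)
  qed (use A in \<open>auto simp: char_poly_matrix_def\<close>)
  finally show ?thesis by (simp add: char_poly_def)
qed

lemma map_poly_linear_factors:
  assumes "\<And>w. w \<in> set ws \<Longrightarrow> w \<in> V"
  shows "map_poly f (\<Prod>w\<leftarrow>ws. [:- w, 1:]) = (\<Prod>w\<leftarrow>ws. [:- f w, 1:]) \<and> (\<Prod>w\<leftarrow>ws. [:- w, 1:]) \<in> Vpoly"
  using assms
proof (induction ws)
  case (Cons w ws)
  have "[:- w, 1:] \<in> Vpoly" using Cons.prems[of w]
    by (auto simp: Vpoly_def coeff_pCons V0 V1 Vneg split: nat.splits)
  moreover have "map_poly f [:- w, 1:] = [:- f w, 1:]"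
    using Cons.prems[of w] by (auto intro!: poly_eqI simp: coeff_map_f coeff_pCons f0 f1 fneg split: nat.splits)
  moreover have "map_poly f (\<Prod>w\<leftarrow>ws. [:- w, 1:]) = (\<Prod>w\<leftarrow>ws. [:- f w, 1:])" "(\<Prod>w\<leftarrow>ws. [:- w, 1:]) \<in> Vpoly"
    using Cons by auto
  ultimately show ?case using Vpoly(3,6) by (simp only: list.map prod_list.Cons)
qed (auto simp: Vpoly)

lemma mult_mat_map:
  assumes A: "A \<in> carrier_mat n n" "\<And>i j. i < n \<Longrightarrow> j < n \<Longrightarrow> A $$ (i, j) \<in> V"
    and B: "B \<in> carrier_mat n n" "\<And>i j. i < n \<Longrightarrow> j < n \<Longrightarrow> B $$ (i, j) \<in> V"
  shows "map_mat f (A * B) = map_mat f A * map_mat f B"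
proof (rule eq_matI)
  fix i j assume "i < dim_row (map_mat f A * map_mat f B)" "j < dim_col (map_mat f A * map_mat f B)"
  then have ij: "i < n" "j < n" using A B by auto
  have "map_mat f (A * B) $$ (i, j) = f (\<Sum>l<n. A $$ (i, l) * B $$ (l, j))"
    using ij A B mult_index_sum[OF A(1) B(1) ij] by simp
  also have "\<dots> = (\<Sum>l<n. f (A $$ (i, l)) * f (B $$ (l, j)))"
    using ij A B by (subst fsum) (auto intro!: Vmult sum.cong simp: fmult)
  also have "\<dots> = (map_mat f A * map_mat f B) $$ (i, j)"
    using ij A B by (subst mult_index_sum[of _ n n _ n]) auto
  finally show "map_mat f (A * B) $$ (i, j) = (map_mat f A * map_mat f B) $$ (i, j)" .
qed (use A B in auto)

end

context fin_group
begin

text \<open>A basis in which all \<open>\<rho> g\<close> have entries in V takes the place of an invariant lattice. Let S be the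
  finite G-stable set of all \<open>\<rho> g e\<close>, e a unit vector. Among the matrices with columns in S
  choose P such that all other determinants are V-multiples of \<open>det P\<close>. By Cramer's rule the elements of S
  have coordinates in V with respect to the columns of P. Now f can be applied to the matrices
  entrywise.\<close>

theorem reduction_along_place:
  fixes \<rho> :: "'a \<Rightarrow> 'c::field mat" and f :: "'c \<Rightarrow> 'd::field"
  assumes pl: "place V f" and \<rho>: "matrix_rep G n \<rho>"
  shows "\<exists>\<tau>. matrix_rep G n \<tau> \<and> (\<forall>g\<in>carrier G. char_poly (\<tau> g) = map_poly f (char_poly (\<rho> g)))"
proof -
  interpret place V f by fact
  note c = rep_carrier[OF \<rho>]
  define S where "S = (\<lambda>(g, i). \<rho> g *\<^sub>v unit_vec n i) ` (carrier G \<times> {..<n})"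
  have S: "finite S" "S \<subseteq> carrier_vec n" using finG c by (auto simp: S_def intro!: mult_mat_vec_carrier[of _ n n])
  have Sg: "\<rho> g *\<^sub>v s \<in> S" if g: "g \<in> carrier G" and s: "s \<in> S" for g s
  proof -
    from s obtain h i where h: "h \<in> carrier G" "i < n" "s = \<rho> h *\<^sub>v unit_vec n i" by (auto simp: S_def)
    have "\<rho> g *\<^sub>v s = \<rho> (g \<otimes> h) *\<^sub>v unit_vec n i"
      unfolding h rep_mult[OF \<rho> g h(1)] using c[OF g] c[OF h(1)] by (simp add: assoc_mult_mat_vec[of _ n n _ n])
    then show ?thesis using g h by (force simp: S_def)
  qed
  define T where "T = {P \<in> carrier_mat n n. \<forall>j<n. col P j \<in> S}"
  have "T \<subseteq> (\<lambda>t. mat n n (\<lambda>(a, j). t j $ a)) ` ({..<n} \<rightarrow>\<^sub>E S)"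
  proof
    fix P assume P: "P \<in> T"
    then have "P = mat n n (\<lambda>(a, j). (restrict (col P) {..<n}) j $ a)"
      by (intro eq_matI) (auto simp: T_def)
    moreover have "restrict (col P) {..<n} \<in> {..<n} \<rightarrow>\<^sub>E S" using P by (auto simp: T_def)
    ultimately show "P \<in> (\<lambda>t. mat n n (\<lambda>(a, j). t j $ a)) ` ({..<n} \<rightarrow>\<^sub>E S)" by (rule image_eqI)
  qed
  then have "finite T" by (rule finite_subset) (use S in \<open>auto intro!: finite_PiE\<close>)
  then have fin: "finite (det ` T - {0})" by simp
  have "1\<^sub>m n \<in> T"
  proof -
    have "unit_vec n j \<in> S" if "j < n" for j
      unfolding S_def using that rep_one[OF \<rho>] by (intro image_eqI[of _ _ "(\<one>, j)"]) auto
    then show ?thesis by (auto simp: T_def)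
  qed
  then have "1 \<in> det ` T - {0}" by (metis Diff_iff det_one image_eqI singletonD zero_neq_one)
  then obtain d where d: "d \<in> det ` T - {0}" "\<forall>s\<in>det ` T - {0}. s / d \<in> V"
    using max_element[OF fin] by blast
  then obtain P where P: "P \<in> carrier_mat n n" "\<And>j. j < n \<Longrightarrow> col P j \<in> S" "det P = d" "d \<noteq> 0" by (auto simp: T_def)
  obtain Q where Q: "Q \<in> carrier_mat n n" "P * Q = 1\<^sub>m n" "Q * P = 1\<^sub>m n"
    using det_nonzero_inverse[OF P(1)] P by metis
  have PQ: "inverse_mats n P Q" using P Q by (simp add: inverse_mats_def)
  have coord: "(Q *\<^sub>v s) $ k \<in> V" if s: "s \<in> S" and k: "k < n" for s k
  proof -
    have sc: "s \<in> carrier_vec n" using s S by auto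
    have Qs: "Q *\<^sub>v s \<in> carrier_vec n" using Q sc by auto
    have "replace_col P s k \<in> T"
      unfolding T_def
    proof (intro CollectI conjI allI impI)
      show "replace_col P s k \<in> carrier_mat n n" using P by (auto simp: replace_col_def)
      fix j assume j: "j < n"
      have "col (replace_col P s k) j = (if j = k then s else col P j)"
        using P(1) sc j by (auto simp: replace_col_def intro!: eq_vecI)
      then show "col (replace_col P s k) j \<in> S" using s P(2)[OF j] by simp
    qed
    moreover have "det (replace_col P s k) = (Q *\<^sub>v s) $ k * d"
      using cramer_lemma_mat[OF P(1) Qs k] inverse_mats_vec(1)[OF PQ sc] P(3) by simp
    ultimately have "(Q *\<^sub>v s) $ k * d \<in> det ` T" by (metis image_eqI)
    then have "(Q *\<^sub>v s) $ k * d / d \<in> V" if "(Q *\<^sub>v s) $ k \<noteq> 0"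
      using d(2) P(4) that by (metis Diff_iff mult_eq_0_iff singletonD)
    then show ?thesis using P(4) V0 by (cases "(Q *\<^sub>v s) $ k = 0") auto
  qed
  define X where "X g = Q * \<rho> g * P" for g
  have Xc: "X g \<in> carrier_mat n n" for g using P Q by (auto simp: X_def)
  have XV: "X g $$ (i, j) \<in> V" if g: "g \<in> carrier G" and ij: "i < n" "j < n" for g i j
  proof -
    have "col (X g) j = Q *\<^sub>v (\<rho> g *\<^sub>v col P j)"
      using col_mult2[of Q n n "\<rho> g * P" n j] col_mult2[of "\<rho> g" n n P n j] P(1) Q c[OF g] ij
      by (simp add: X_def assoc_mult_mat[of Q n n "\<rho> g" n P n])
    moreover have "X g $$ (i, j) = col (X g) j $ i" using Xc[of g] ij by simp
    ultimately show ?thesis using coord[OF Sg[OF g P(2)[OF ij(2)]] ij(1)] by simp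
  qed
  define \<tau> where "\<tau> g = map_mat f (X g)" for g
  have "matrix_rep G n \<tau>"
    unfolding matrix_rep_def
  proof (intro conjI ballI)
    show "\<tau> g \<in> carrier_mat n n" for g using Xc by (simp add: \<tau>_def)
    have "X \<one> = 1\<^sub>m n" using P(1) Q by (simp add: X_def rep_one[OF \<rho>])
    then show "\<tau> \<one> = 1\<^sub>m n" by (auto simp: \<tau>_def f0 f1 intro!: eq_matI)
    fix g h assume gh: "g \<in> carrier G" "h \<in> carrier G"
    have "X (g \<otimes> h) = X g * X h"
      using conj_mult[OF PQ c[OF gh(1)] c[OF gh(2)]] by (simp add: X_def rep_mult[OF \<rho> gh])
    then show "\<tau> (g \<otimes> h) = \<tau> g * \<tau> h"
      using mult_mat_map[OF Xc XV Xc XV] gh by (simp add: \<tau>_def)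
  qed
  moreover have "char_poly (\<tau> g) = map_poly f (char_poly (\<rho> g))" if g: "g \<in> carrier G" for g
    using char_poly_map[OF Xc XV] char_poly_conj[OF PQ c[OF g]] g by (simp add: \<tau>_def X_def)
  ultimately show ?thesis by blast
qed

end

section \<open>Brauer characters and the decomposition of ordinary characters\<close>

interpretation to_ac_poly: map_poly_inj_idom_hom "to_ac :: 'k::field \<Rightarrow> 'k alg_closure" ..

lemma to_ac_linear_factors:
  "map_poly to_ac (\<Prod>a\<leftarrow>as. [:- a, 1:]) = (\<Prod>a\<leftarrow>as. [:- to_ac a, 1:])"
  by (induction as) (simp_all add: to_ac_poly.hom_mult to_ac_poly.map_poly_pCons_hom
      del: mult_pCons_left mult_pCons_right)

text \<open>The value of the Brauer character as a function of the characteristic polynomial q alone: the sum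
  of the lifts of the roots of q, with multiplicities.\<close>

definition lift_sum :: "(complex \<Rightarrow> 'k::field) \<Rightarrow> nat \<Rightarrow> 'k poly \<Rightarrow> complex" where
  "lift_sum \<theta> m q = (\<Sum>a | poly q a = 0. of_nat (Polynomial.order a q) * root_lift \<theta> m a)"

lemma lift_sum_superset:
  assumes "q \<noteq> 0" "finite A" "{a. poly q a = 0} \<subseteq> A"
  shows "lift_sum \<theta> m q = (\<Sum>a\<in>A. of_nat (Polynomial.order a q) * root_lift \<theta> m a)"
  unfolding lift_sum_def using assms
  by (intro sum.mono_neutral_left) (auto simp: order_root)

lemma lift_sum_mult:
  assumes "q \<noteq> 0" "r \<noteq> 0"
  shows "lift_sum \<theta> m (q * r) = lift_sum \<theta> m q + lift_sum \<theta> m r"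
proof -
  let ?A = "{a. poly (q * r) a = 0}"
  have fin: "finite ?A" using assms poly_roots_finite[of "q * r"] by simp
  have "lift_sum \<theta> m (q * r) = (\<Sum>a\<in>?A. of_nat (Polynomial.order a (q * r)) * root_lift \<theta> m a)"
    by (simp add: lift_sum_def)
  also have "\<dots> = (\<Sum>a\<in>?A. of_nat (Polynomial.order a q) * root_lift \<theta> m a)
      + (\<Sum>a\<in>?A. of_nat (Polynomial.order a r) * root_lift \<theta> m a)"
    using assms by (simp add: order_mult distrib_right sum.distrib)
  also have "\<dots> = lift_sum \<theta> m q + lift_sum \<theta> m r"
    using lift_sum_superset[OF assms(1) fin, of \<theta> m] lift_sum_superset[OF assms(2) fin, of \<theta> m]
    by (metis (mono_tags, lifting) Collect_mono mult_eq_0_iff poly_mult)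
  finally show ?thesis .
qed

lemma lift_sum_prod_list:
  assumes "\<And>q. q \<in> set qs \<Longrightarrow> q \<noteq> 0"
  shows "lift_sum \<theta> m (prod_list qs) = (\<Sum>q\<leftarrow>qs. lift_sum \<theta> m q)"
  using assms
proof (induction qs)
  case Nil
  then show ?case by (simp add: lift_sum_def)
next
  case (Cons q qs)
  then have "0 \<notin> set qs" "q \<noteq> 0" by auto
  then have "lift_sum \<theta> m (q * prod_list qs) = lift_sum \<theta> m q + lift_sum \<theta> m (prod_list qs)"
    by (intro lift_sum_mult) (auto simp: prod_list_zero_iff)
  then show ?case using Cons by simp
qed

lemma lift_sum_linear: "lift_sum \<theta> m [:- a, 1:] = root_lift \<theta> m a"
proof -
  have "Polynomial.order a [:- a, 1:] = 1" using order_power_n_n[of a 1] by simp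
  moreover have "{b. poly [:- a, 1:] b = 0} = {a}" by auto
  ultimately show ?thesis by (simp add: lift_sum_def)
qed

text \<open>The data needed on the arithmetic side: the reduction \<open>\<theta>\<close> is used on \<open>\<int>[\<zeta>\<^sub>n]\<close> only.\<close>

locale modular =
  fixes p n :: nat and \<theta> :: "complex \<Rightarrow> 'k::field"
  assumes p: "prime p" and n: "n > 0" and char_k: "CHAR('k) = p" and \<theta>1: "\<theta> 1 = 1"
    and \<theta>add: "\<And>x y. x \<in> cyclotomic_ring n \<Longrightarrow> y \<in> cyclotomic_ring n \<Longrightarrow> \<theta> (x + y) = \<theta> x + \<theta> y"
    and \<theta>mult: "\<And>x y. x \<in> cyclotomic_ring n \<Longrightarrow> y \<in> cyclotomic_ring n \<Longrightarrow> \<theta> (x * y) = \<theta> x * \<theta> y"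
begin

lemma \<theta>0: "\<theta> 0 = 0" using \<theta>add[OF cyc_0 cyc_0] by (metis add_0 add_right_cancel)

lemma \<theta>diff: "x \<in> cyclotomic_ring n \<Longrightarrow> y \<in> cyclotomic_ring n \<Longrightarrow> \<theta> (x - y) = \<theta> x - \<theta> y"
  using \<theta>add[of "x - y" y] cyc_diff[of x n y] by simp

lemma \<theta>sum: "(\<And>i. i \<in> S \<Longrightarrow> f i \<in> cyclotomic_ring n) \<Longrightarrow> \<theta> (sum f S) = (\<Sum>i\<in>S. \<theta> (f i))"
  by (induction S rule: infinite_finite_induct) (auto simp: \<theta>0 \<theta>add cyc_sum)

lemma \<theta>sum_list: "(\<And>x. x \<in> set xs \<Longrightarrow> x \<in> cyclotomic_ring n) \<Longrightarrow> \<theta> (sum_list xs) = (\<Sum>x\<leftarrow>xs. \<theta> x)"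
  by (induction xs) (auto simp: \<theta>0 \<theta>add cyc_sum_list)

lemma \<theta>pow: "x \<in> cyclotomic_ring n \<Longrightarrow> \<theta> (x ^ k) = \<theta> x ^ k"
  by (induction k) (auto simp: \<theta>1 \<theta>mult cyc_pow)

text \<open>The reduction \<open>\<theta>\<close> alone applies only to matrices over \<open>\<int>[\<zeta>\<^sub>n]\<close>; its extension to a valuation ring
  applies to any complex representation, after a change of basis.\<close>

lemma exists_place:
  "\<exists>V f. place V f \<and> cyclotomic_ring n \<subseteq> V \<and> (\<forall>x\<in>cyclotomic_ring n. f x = to_ac (\<theta> x))"
  using place_extension[of "cyclotomic_ring n" "\<lambda>x. to_ac (\<theta> x)"]
  by (simp add: cyc_1 cyc_diff cyc_mult \<theta>1 \<theta>diff \<theta>mult)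

context
  fixes m assumes m: "m dvd n" "coprime m p"
begin

lemma m_pos: "m > 0" using m n by (auto intro: Nat.gr0I)

text \<open>If \<open>u \<noteq> 1\<close> is an m-th root of unity with \<open>\<theta> u = 1\<close>, then \<open>1 + u + \<dots> + u\<^bsup>m-1\<^esup> = 0\<close> reduces to
  \<open>m = 0\<close> in k, although m is prime to p.\<close>

lemma \<theta>_roots_inj: "inj_on \<theta> {w. w ^ m = 1}"
proof (rule inj_onI)
  fix w w' assume ww: "w \<in> {w. w ^ m = 1}" "w' \<in> {w. w ^ m = 1}" and e: "\<theta> w = \<theta> w'"
  have w': "w' \<noteq> 0" using ww m_pos by (auto simp: power_0_left)
  define u where "u = w / w'"
  have um: "u ^ m = 1" using ww by (simp add: u_def power_divide)
  have cyc: "x \<in> cyclotomic_ring n" if "x ^ m = 1" for x using cyc_root_of_unity[OF that m(1) n] .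
  have "\<theta> w = \<theta> u * \<theta> w'" using \<theta>mult[OF cyc[OF um] cyc[of w']] ww w' by (simp add: u_def)
  moreover have "\<theta> w' ^ m = 1" using \<theta>pow[OF cyc[of w'], of m] ww \<theta>1 by simp
  then have "\<theta> w' \<noteq> 0" using m_pos by (auto simp: power_0_left)
  ultimately have u1: "\<theta> u = 1" using e by simp
  show "w = w'"
  proof (rule ccontr)
    assume "w \<noteq> w'"
    then have "u \<noteq> 1" using w' by (simp add: u_def)
    moreover have "(u - 1) * (\<Sum>i<m. u ^ i) = 0" using power_diff_1_eq[of u m] um by (metis diff_self)
    ultimately have "(\<Sum>i<m. u ^ i) = 0" by (metis eq_iff_diff_eq_0 mult_eq_0_iff)
    then have "0 = \<theta> (\<Sum>i<m. u ^ i)" by (simp add: \<theta>0)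
    also have "\<dots> = (\<Sum>i<m. \<theta> u ^ i)"
      using cyc[OF um] by (subst \<theta>sum) (auto intro: cyc_pow simp: \<theta>pow)
    also have "\<dots> = of_nat m" by (simp add: u1)
    finally have "p dvd m" using char_k of_nat_eq_0_iff_char_dvd[of m, where 'a = 'k] by simp
    then show False using m p by (meson coprime_common_divisor dvd_refl not_prime_unit)
  qed
qed

lemma \<theta>_roots: "\<theta> ` {w. w ^ m = 1} = {a. a ^ m = 1}"
proof (rule card_seteq)
  have nz: "Polynomial.monom (1 :: 'k) m - 1 \<noteq> 0"
  proof
    assume "Polynomial.monom (1 :: 'k) m - 1 = 0"
    then have "coeff (Polynomial.monom (1 :: 'k) m - 1) m = 0" by simp
    then show False using m_pos by simp
  qed
  have e: "{a :: 'k. a ^ m = 1} = {a. poly (Polynomial.monom 1 m - 1) a = 0}" by (simp add: poly_monom)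
  show "finite {a :: 'k. a ^ m = 1}" unfolding e by (rule poly_roots_finite[OF nz])
  show "\<theta> ` {w. w ^ m = 1} \<subseteq> {a. a ^ m = 1}"
    using cyc_root_of_unity[OF _ m(1) n] \<theta>pow[of _ m] \<theta>1 by force
  have "card {a :: 'k. a ^ m = 1} \<le> degree (Polynomial.monom (1 :: 'k) m - 1)"
    unfolding e by (rule card_poly_roots_bound[OF nz])
  also have "\<dots> \<le> m" using degree_diff_le[OF degree_monom_le[of "1 :: 'k" m], of 1] by simp
  also have "m = card (\<theta> ` {w. w ^ m = 1})"
    using card_image[OF \<theta>_roots_inj] card_roots_unity_eq[OF m_pos] by simp
  finally show "card {a :: 'k. a ^ m = 1} \<le> card (\<theta> ` {w. w ^ m = 1})" .
qed

lemma root_lift_\<theta>: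
  assumes "w ^ m = 1" shows "root_lift \<theta> m (\<theta> w) = w"
  unfolding root_lift_def
  by (rule the_equality) (use assms \<theta>_roots_inj in \<open>auto simp: inj_on_def\<close>)

lemma root_lift_root:
  assumes "(a :: 'k) ^ m = 1"
  shows "root_lift \<theta> m a ^ m = 1" "\<theta> (root_lift \<theta> m a) = a" "root_lift \<theta> m a \<in> cyclotomic_ring n"
proof -
  from assms obtain w where w: "w ^ m = 1" "a = \<theta> w" using \<theta>_roots by blast
  then show "root_lift \<theta> m a ^ m = 1" "\<theta> (root_lift \<theta> m a) = a" "root_lift \<theta> m a \<in> cyclotomic_ring n"
    using root_lift_\<theta>[OF w(1)] cyc_root_of_unity[OF w(1) m(1) n] by simp_all
qed

text \<open>The m distinct roots of unity in k are all that the closure can contain.\<close>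

lemma closure_roots:
  assumes "(b :: 'k alg_closure) ^ m = 1"
  shows "\<exists>a. b = to_ac a \<and> a ^ m = 1"
proof -
  have nz: "Polynomial.monom (1 :: 'k alg_closure) m - 1 \<noteq> 0"
  proof
    assume "Polynomial.monom (1 :: 'k alg_closure) m - 1 = 0"
    then have "coeff (Polynomial.monom (1 :: 'k alg_closure) m - 1) m = 0" by simp
    then show False using m_pos by simp
  qed
  have e: "{a :: 'k alg_closure. a ^ m = 1} = {a. poly (Polynomial.monom 1 m - 1) a = 0}" by (simp add: poly_monom)
  have "to_ac ` {a :: 'k. a ^ m = 1} = {b. b ^ m = 1}"
  proof (rule card_seteq)
    show "finite {b :: 'k alg_closure. b ^ m = 1}" unfolding e by (rule poly_roots_finite[OF nz])
    show "to_ac ` {a :: 'k. a ^ m = 1} \<subseteq> {b. b ^ m = 1}" by (auto simp flip: to_ac_power)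
    have "card {b :: 'k alg_closure. b ^ m = 1} \<le> degree (Polynomial.monom (1 :: 'k alg_closure) m - 1)"
      unfolding e by (rule card_poly_roots_bound[OF nz])
    also have "\<dots> \<le> m" using degree_diff_le[OF degree_monom_le[of "1 :: 'k alg_closure" m], of 1] by simp
    also have "m = card (to_ac ` {a :: 'k. a ^ m = 1})"
      using card_image[OF inj_on_subset[OF inj_to_ac]] \<theta>_roots card_image[OF \<theta>_roots_inj]
        card_roots_unity_eq[OF m_pos] by (metis subset_UNIV)
    finally show "card {b :: 'k alg_closure. b ^ m = 1} \<le> card (to_ac ` {a :: 'k. a ^ m = 1})" .
  qed
  then show ?thesis using assms by blast
qed

end

end

lemma eigenvalue_pow_root:
  fixes A :: "'f::field mat"
  assumes A: "A \<in> carrier_mat N N" and pw: "A ^\<^sub>m (k + l) = A ^\<^sub>m l" and r: "poly (char_poly A) e = 0"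
  shows "e ^ (k + l) = e ^ l"
proof -
  from r eigenvalue_root_char_poly[OF A] have "eigenvalue A e" by simp
  then obtain v where v: "eigenvector A v e" by (auto simp: eigenvalue_def)
  have vN: "v \<in> carrier_vec N" "v \<noteq> 0\<^sub>v N" using v A by (auto simp: eigenvector_def)
  have "e ^ (k + l) \<cdot>\<^sub>v v = e ^ l \<cdot>\<^sub>v v"
    using eigenvector_pow[OF A v] pw by metis
  moreover obtain i where "i < N" "v $ i \<noteq> 0" using vN
    by (metis carrier_vecD eq_vecI index_zero_vec(1) index_zero_vec(2))
  ultimately show ?thesis
    using vN by (metis carrier_vecD index_smult_vec(1) mult_right_cancel)
qed

lemma split_over_closed:
  fixes q :: "'f::alg_closed_field poly"
  assumes "q \<noteq> 0" "lead_coeff q = 1"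
  shows "\<exists>as. q = (\<Prod>a\<leftarrow>as. [:- a, 1:])"
proof -
  from alg_closed_imp_factorization[OF assms(1)] obtain A where "q = (\<Prod>x\<in>#A. [:- x, 1:])"
    using assms(2) by auto
  moreover obtain as where "A = mset as" using ex_mset by metis
  ultimately have "q = (\<Prod>a\<leftarrow>as. [:- a, 1:])" by (simp flip: prod_mset_prod_list)
  then show ?thesis ..
qed

text \<open>A finite group whose exponent divides n and for which k is a splitting field.\<close>

locale modular_group = modular p n \<theta> + fin_group G
  for p n and \<theta> :: "complex \<Rightarrow> 'k::field" and G (structure) +
  assumes exp: "\<And>x. x \<in> carrier G \<Longrightarrow> ord x dvd n"
    and split: "splitting_field TYPE('k) G"
begin

lemma p_regularD:
  assumes "x \<in> p_regular p G"
  shows "x \<in> carrier G" "ord x dvd n" "coprime (ord x) p" "x [^] ord x = \<one>"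
  using assms exp by (auto simp: p_regular_def)

lemma rep_ord:
  assumes "matrix_rep G N \<rho>" "x \<in> carrier G"
  shows "\<rho> x ^\<^sub>m ord x = 1\<^sub>m N"
  using rep_pow[OF assms, of "ord x"] rep_one[OF assms(1)] assms(2) by simp

lemma rep_eigenvalue:
  assumes \<rho>: "matrix_rep G N (\<rho> :: 'a \<Rightarrow> 'f::field mat)" and x: "x \<in> carrier G" and r: "poly (char_poly (\<rho> x)) e = 0"
  shows "e ^ ord x = 1"
  using eigenvalue_pow_root[OF rep_carrier[OF \<rho> x], of "ord x" 0 e] rep_ord[OF \<rho> x] r
    rep_carrier[OF \<rho> x] by simp

lemma char_poly_nz:
  assumes "matrix_rep G N (\<rho> :: 'a \<Rightarrow> 'f::field mat)" "x \<in> carrier G"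
  shows "char_poly (\<rho> x) \<noteq> 0" "lead_coeff (char_poly (\<rho> x)) = 1"
proof -
  from degree_monic_char_poly[OF rep_carrier[OF assms]]
  show "lead_coeff (char_poly (\<rho> x)) = 1" by simp
  then show "char_poly (\<rho> x) \<noteq> 0" by auto
qed

lemma brauer_lift_sum:
  "x \<in> p_regular p G \<Longrightarrow> brauer_character p \<theta> G \<sigma> x = lift_sum \<theta> (ord x) (char_poly (\<sigma> x))"
  by (simp add: brauer_character_def lift_sum_def)

lemma brauer_cyc:
  assumes \<sigma>: "matrix_rep G N (\<sigma> :: 'a \<Rightarrow> 'k mat)"
  shows "brauer_character p \<theta> G \<sigma> x \<in> cyclotomic_ring n"
proof (cases "x \<in> p_regular p G")
  case True
  note x = p_regularD[OF True]
  show ?thesis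
    unfolding brauer_character_def
    using True root_lift_root(3)[OF x(2,3)] rep_eigenvalue[OF \<sigma> x(1)]
    by (auto intro!: cyc_sum cyc_mult cyc_of_nat)
qed (simp add: brauer_character_def cyc_0)

text \<open>The eigenvalues at a p-regular element are roots of unity of order prime to p, which lie in k. So the
  sum over the roots in k that defines a Brauer character misses no eigenvalue.\<close>

lemma split_char_poly:
  assumes \<sigma>: "matrix_rep G N (\<sigma> :: 'a \<Rightarrow> 'k mat)" and x: "x \<in> p_regular p G"
  shows "\<exists>as. char_poly (\<sigma> x) = (\<Prod>a\<leftarrow>as. [:- a, 1:]) \<and> (\<forall>a\<in>set as. a ^ ord x = 1)"
proof -
  note x = p_regularD[OF x]
  let ?s = "\<lambda>g. map_mat to_ac (\<sigma> g)"
  have s: "matrix_rep G N ?s" by (rule matrix_rep_hom[OF \<sigma>])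
  obtain bs where bs: "char_poly (?s x) = (\<Prod>b\<leftarrow>bs. [:- b, 1:])"
    using split_over_closed[OF char_poly_nz[OF s x(1)]] by blast
  have "b ^ ord x = 1" if "b \<in> set bs" for b
    using rep_eigenvalue[OF s x(1), of b] that unfolding bs by (auto simp: poly_prod_list prod_list_zero_iff)
  then have ba: "\<exists>a. b = to_ac a \<and> a ^ ord x = 1" if "b \<in> set bs" for b
    using closure_roots[OF x(2,3)] that by blast
  define as where "as = map of_ac bs"
  have as: "a ^ ord x = 1" if "a \<in> set as" for a
    using that ba unfolding as_def by force
  have bs_as: "bs = map to_ac as"
    unfolding as_def using ba by (induction bs) (force simp: to_ac_of_ac)+
  have "map_poly to_ac (char_poly (\<sigma> x)) = (\<Prod>b\<leftarrow>bs. [:- b, 1:])"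
    using to_ac_hom.char_poly_hom[OF rep_carrier[OF \<sigma> x(1)]] bs by simp
  also have "\<dots> = map_poly to_ac (\<Prod>a\<leftarrow>as. [:- a, 1:])"
    unfolding bs_as by (simp add: to_ac_linear_factors o_def)
  finally have "char_poly (\<sigma> x) = (\<Prod>a\<leftarrow>as. [:- a, 1:])"
    by (rule to_ac_poly.injectivity)
  then show ?thesis using as by blast
qed

lemma \<theta>_brauer:
  assumes \<sigma>: "matrix_rep G N (\<sigma> :: 'a \<Rightarrow> 'k mat)" and x: "x \<in> p_regular p G"
  shows "\<theta> (brauer_character p \<theta> G \<sigma> x) = mtrace (\<sigma> x)"
proof -
  note xx = p_regularD[OF x]
  from split_char_poly[OF \<sigma> x] obtain as where as: "char_poly (\<sigma> x) = (\<Prod>a\<leftarrow>as. [:- a, 1:])"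
    "\<And>a. a \<in> set as \<Longrightarrow> a ^ ord x = 1" by blast
  have "brauer_character p \<theta> G \<sigma> x = (\<Sum>a\<leftarrow>as. root_lift \<theta> (ord x) a)"
    unfolding brauer_lift_sum[OF x] as(1)
    by (subst lift_sum_prod_list) (auto simp: lift_sum_linear o_def)
  then have "\<theta> (brauer_character p \<theta> G \<sigma> x) = (\<Sum>a\<leftarrow>as. \<theta> (root_lift \<theta> (ord x) a))"
    using as(2) root_lift_root(3)[OF xx(2,3)] by (simp, subst \<theta>sum_list) (auto simp: o_def)
  also have "\<dots> = (\<Sum>a\<leftarrow>as. a)"
    using as(2) root_lift_root(2)[OF xx(2,3)] by (intro arg_cong[of _ _ sum_list] map_cong) auto
  also have "\<dots> = mtrace (\<sigma> x)"
    using mtrace_pow_split[OF rep_carrier[OF \<sigma> xx(1)] as(1), of 1] rep_carrier[OF \<sigma> xx(1)] by simp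
  finally show ?thesis .
qed

text \<open>Reduce the complex representation along a place, take composition factors over the closure of k,
  and replace these by irreducible representations over k with the same characteristic
  polynomials. At a p-regular element x the roots w of the characteristic polynomial of \<open>\<rho> x\<close> reduce to
  \<open>\<theta> w\<close>, whose lift is w again. Hence the lifted eigenvalues of the factors add up to the trace of
  \<open>\<rho> x\<close>.\<close>

theorem decomposition_exists:
  assumes \<rho>: "matrix_rep G N (\<rho> :: 'a \<Rightarrow> complex mat)"
  shows "\<exists>rs :: (nat \<times> ('a \<Rightarrow> 'k mat)) list. (\<forall>(m, \<sigma>)\<in>set rs. irreducible_rep G m \<sigma>) \<and>
     (\<forall>x\<in>p_regular p G. mtrace (\<rho> x) = (\<Sum>(m, \<sigma>)\<leftarrow>rs. brauer_character p \<theta> G \<sigma> x))"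
proof -
  obtain V and f :: "complex \<Rightarrow> 'k alg_closure" where pl: "place V f" and V: "cyclotomic_ring n \<subseteq> V"
    and f\<theta>: "\<And>x. x \<in> cyclotomic_ring n \<Longrightarrow> f x = to_ac (\<theta> x)" using exists_place by blast
  interpret place V f by fact
  obtain \<tau> where \<tau>: "matrix_rep G N \<tau>"
    and ct: "\<And>g. g \<in> carrier G \<Longrightarrow> char_poly (\<tau> g) = map_poly f (char_poly (\<rho> g))"
    using reduction_along_place[OF pl \<rho>] by blast
  obtain ts where ts: "\<forall>(m, \<tau>)\<in>set ts. irreducible_rep G m \<tau>"
    and tc: "\<forall>g\<in>carrier G. char_poly (\<tau> g) = (\<Prod>(m, \<tau>)\<leftarrow>ts. char_poly (\<tau> g))"
    using composition_factors[OF is_group \<tau>] by blast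
  have "\<exists>rs :: (nat \<times> ('a \<Rightarrow> 'k mat)) list. (\<forall>(m, \<sigma>)\<in>set rs. irreducible_rep G m \<sigma>) \<and>
     (\<forall>g\<in>carrier G. (\<Prod>(m, \<tau>)\<leftarrow>ts. char_poly (\<tau> g)) = map_poly to_ac (\<Prod>(m, \<sigma>)\<leftarrow>rs. char_poly (\<sigma> g)))"
    using ts
  proof (induction ts)
    case Nil
    then show ?case by (intro exI[of _ "[]"]) auto
  next
    case (Cons t ts)
    then obtain rs where rs: "\<forall>(m, \<sigma>)\<in>set rs. irreducible_rep G m (\<sigma> :: 'a \<Rightarrow> 'k mat)"
      "\<forall>g\<in>carrier G. (\<Prod>(m, \<tau>)\<leftarrow>ts. char_poly (\<tau> g)) = map_poly to_ac (\<Prod>(m, \<sigma>)\<leftarrow>rs. char_poly (\<sigma> g))"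
      by auto
    obtain k t' where t: "t = (k, t')" by (cases t)
    then have "irreducible_rep G k t'" using Cons.prems by auto
    from irreducible_over_closure[OF split this] obtain m and \<sigma> :: "'a \<Rightarrow> 'k mat" where "irreducible_rep G m \<sigma>"
      "\<forall>g\<in>carrier G. char_poly (t' g) = map_poly to_ac (char_poly (\<sigma> g))" by blast
    then show ?case using rs t
      by (intro exI[of _ "(m, \<sigma>) # rs"]) (auto simp: to_ac_poly.hom_mult)
  qed
  then obtain rs :: "(nat \<times> ('a \<Rightarrow> 'k mat)) list" where rs: "\<forall>(m, \<sigma>)\<in>set rs. irreducible_rep G m \<sigma>"
    and rc: "\<And>g. g \<in> carrier G \<Longrightarrow> (\<Prod>(m, \<tau>)\<leftarrow>ts. char_poly (\<tau> g)) = map_poly to_ac (\<Prod>(m, \<sigma>)\<leftarrow>rs. char_poly (\<sigma> g))"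
    by blast
  have "mtrace (\<rho> x) = (\<Sum>(m, \<sigma>)\<leftarrow>rs. brauer_character p \<theta> G \<sigma> x)" if x: "x \<in> p_regular p G" for x
  proof -
    note xx = p_regularD[OF x]
    obtain ws where ws: "char_poly (\<rho> x) = (\<Prod>w\<leftarrow>ws. [:- w, 1:])"
      using char_poly_factorized[OF rep_carrier[OF \<rho> xx(1)]] by blast
    have w1: "w ^ ord x = 1" if "w \<in> set ws" for w
      using rep_eigenvalue[OF \<rho> xx(1), of w] that unfolding ws by (auto simp: poly_prod_list prod_list_zero_iff)
    then have wc: "w \<in> cyclotomic_ring n" if "w \<in> set ws" for w
      using cyc_root_of_unity[OF _ xx(2) n] that by blast
    have "map_poly to_ac (\<Prod>(m, \<sigma>)\<leftarrow>rs. char_poly (\<sigma> x)) = map_poly f (\<Prod>w\<leftarrow>ws. [:- w, 1:])"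
      using rc[OF xx(1)] tc xx(1) ct[OF xx(1)] ws by simp
    also have "\<dots> = (\<Prod>w\<leftarrow>ws. [:- f w, 1:])"
      using map_poly_linear_factors[of ws] wc V by blast
    also have "\<dots> = (\<Prod>w\<leftarrow>ws. [:- to_ac (\<theta> w), 1:])"
      using wc f\<theta> by (intro arg_cong[of _ _ prod_list] map_cong) auto
    also have "\<dots> = map_poly to_ac (\<Prod>w\<leftarrow>ws. [:- \<theta> w, 1:])"
      using to_ac_linear_factors[of "map \<theta> ws"] by (simp add: o_def)
    finally have eq: "(\<Prod>(m, \<sigma>)\<leftarrow>rs. char_poly (\<sigma> x)) = (\<Prod>w\<leftarrow>ws. [:- \<theta> w, 1:])"
      by (rule to_ac_poly.injectivity)
    have nz: "char_poly (\<sigma> x) \<noteq> 0" if "(m, \<sigma>) \<in> set rs" for m \<sigma>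
      using rs that char_poly_nz(1)[OF irr_rep xx(1)] by blast
    have "(\<Sum>(m, \<sigma>)\<leftarrow>rs. brauer_character p \<theta> G \<sigma> x) = (\<Sum>q\<leftarrow>map (\<lambda>(m, \<sigma>). char_poly (\<sigma> x)) rs. lift_sum \<theta> (ord x) q)"
      by (simp add: o_def case_prod_unfold brauer_lift_sum[OF x])
    also have "\<dots> = lift_sum \<theta> (ord x) (\<Prod>(m, \<sigma>)\<leftarrow>rs. char_poly (\<sigma> x))"
      by (rule lift_sum_prod_list[symmetric]) (use nz in auto)
    also have "\<dots> = (\<Sum>q\<leftarrow>map (\<lambda>w. [:- \<theta> w, 1:]) ws. lift_sum \<theta> (ord x) q)"
      unfolding eq by (rule lift_sum_prod_list) auto
    also have "\<dots> = (\<Sum>w\<leftarrow>ws. root_lift \<theta> (ord x) (\<theta> w))" by (simp add: o_def lift_sum_linear)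
    also have "\<dots> = (\<Sum>w\<leftarrow>ws. w)"
      using w1 root_lift_\<theta>[OF xx(2,3)] by (intro arg_cong[of _ _ sum_list] map_cong) auto
    also have "\<dots> = mtrace (\<rho> x)"
      using mtrace_pow_split[OF rep_carrier[OF \<rho> xx(1)] ws, of 1] rep_carrier[OF \<rho> xx(1)] by simp
    finally show ?thesis by simp
  qed
  then show ?thesis using rs by blast
qed

end

section \<open>Linear independence of the irreducible Brauer characters\<close>

lemma sum_fun_apply: "sum f S x = (\<Sum>i\<in>S. f i x)"
  by (induction S rule: infinite_finite_induct) auto

context fin_group
begin

text \<open>y is the p'-part of g: with \<open>ord g = p\<^sup>a m\<close> it is a power of g whose exponent is divisible by \<open>p\<^sup>a\<close>
  and congruent to 1 modulo m.\<close>

lemma p_regular_part: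
  assumes p: "prime p" and g: "g \<in> carrier G"
  shows "\<exists>y\<in>p_regular p G. \<exists>a. y [^] (p ^ a :: nat) = g [^] (p ^ a)"
proof -
  define a where "a = multiplicity p (ord g)"
  define m where "m = ord g div p ^ a"
  have g0: "ord g > 0" using ord_ge_1[OF finG g] by simp
  have og: "ord g = p ^ a * m" unfolding m_def a_def by (simp add: multiplicity_dvd)
  have "\<not> p dvd m"
    unfolding m_def a_def using p g0
    by (metis multiplicity_decompose not_prime_unit gr_implies_not0)
  then have cop: "coprime m p" using p by (metis coprime_commute prime_imp_coprime)
  have q0: "p ^ a \<noteq> 0" using p by (auto simp: prime_gt_0_nat)
  have "gcd (p ^ a) m = 1" using cop by (metis coprime_commute coprime_iff_gcd_eq_1 coprime_power_left_iff)
  with bezout_nat[OF q0, of m] obtain u t where ut: "p ^ a * u = m * t + 1" by auto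
  define y where "y = g [^] (p ^ a * u)"
  have y: "y \<in> carrier G" using g by (simp add: y_def)
  have "y [^] m = (g [^] ord g) [^] u"
    using g by (simp add: y_def nat_pow_pow og mult_ac)
  then have "y [^] m = \<one>" using g by simp
  then have "ord y dvd m" using pow_eq_id[OF y] by simp
  then have "coprime (ord y) p" using cop by (meson coprime_divisors dvd_refl)
  then have "y \<in> p_regular p G" using y by (simp add: p_regular_def)
  moreover have "y [^] (p ^ a) = g [^] (p ^ a)"
  proof -
    have "p ^ a * u * p ^ a = ord g * t + p ^ a"
      using arg_cong[OF ut, of "\<lambda>z. z * p ^ a"] by (simp add: og algebra_simps)
    then have "y [^] (p ^ a) = g [^] (ord g * t + p ^ a)"
      unfolding y_def using g by (simp add: nat_pow_pow)
    also have "\<dots> = (g [^] ord g) [^] t \<otimes> g [^] (p ^ a)" using g by (simp flip: nat_pow_mult nat_pow_pow)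
    finally show ?thesis using g by simp
  qed
  ultimately show ?thesis by blast
qed

end

text \<open>The Frobenius map is additive on the eigenvalues in the algebraic closure.\<close>

lemma mtrace_char_power:
  fixes A :: "'k::field mat"
  assumes p: "prime p" and ch: "CHAR('k) = p" and A: "A \<in> carrier_mat N N"
  shows "mtrace (A ^\<^sub>m (p ^ a)) = mtrace A ^ (p ^ a)"
proof -
  let ?A = "map_mat to_ac A"
  have Ac: "?A \<in> carrier_mat N N" using A by simp
  have tr: "to_ac (mtrace B) = mtrace (map_mat to_ac B)" if "B \<in> carrier_mat N N" for B
    using that by (auto simp: mtrace_def to_ac_sum)
  obtain es where es: "char_poly ?A = (\<Prod>e\<leftarrow>es. [:- e, 1:])"
  proof -
    have "lead_coeff (char_poly ?A) = 1" using degree_monic_char_poly[OF Ac] by simp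
    moreover from this have "char_poly ?A \<noteq> 0" by auto
    ultimately show ?thesis using split_over_closed that by blast
  qed
  have "(\<Sum>e\<leftarrow>es. e) ^ (p ^ a) = (\<Sum>e\<leftarrow>es. e ^ (p ^ a))" for es :: "'k alg_closure list"
  proof (induction es)
    case Nil
    then show ?case using p by (simp add: power_0_left prime_gt_0_nat)
  next
    case (Cons e es)
    have "(e + sum_list es) ^ (p ^ a) = e ^ (p ^ a) + sum_list es ^ (p ^ a)"
      by (rule freshmans_dream') (use p ch in auto)
    then show ?case using Cons by simp
  qed
  then have "to_ac (mtrace (A ^\<^sub>m (p ^ a))) = to_ac (mtrace A ^ (p ^ a))"
    using mtrace_pow_split[OF Ac es, of "p ^ a"] mtrace_pow_split[OF Ac es, of 1] A Ac
    by (simp add: tr to_ac_hom.mat_hom_pow)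
  then show ?thesis by (simp only: to_ac_eq_iff)
qed

lemma intertwined_char_poly:
  fixes A :: "'f::field mat"
  assumes MQ: "inverse_mats n M Q" and A: "A \<in> carrier_mat n n" and B: "B \<in> carrier_mat n n"
    and e: "A * M = M * B"
  shows "char_poly A = char_poly B"
proof -
  have "Q * A * M = Q * (M * B)"
    using MQ A by (simp add: inverse_mats_def assoc_mult_mat[of _ n n _ n _ n] e)
  also have "\<dots> = (Q * M) * B"
    using MQ B by (subst assoc_mult_mat[of _ n n _ n _ n]) (auto simp: inverse_mats_def)
  finally have "Q * A * M = B" using MQ B by (simp add: inverse_mats_def)
  then show ?thesis using char_poly_conj[OF MQ A] by simp
qed

context modular_group
begin

text \<open>The Frobenius map is injective, so equal \<open>p\<^sup>a\<close>-th powers of the traces suffice. Traces of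
  modular representations are therefore determined by their values on p-regular elements.\<close>

lemma mtrace_p_regular_part:
  assumes \<sigma>: "matrix_rep G N (\<sigma> :: 'a \<Rightarrow> 'k mat)" and g: "g \<in> carrier G" and y: "y \<in> carrier G"
    and e: "y [^] (p ^ a :: nat) = g [^] (p ^ a)"
  shows "mtrace (\<sigma> g) = mtrace (\<sigma> y)"
proof -
  have "mtrace (\<sigma> g) ^ (p ^ a) = mtrace (\<sigma> y) ^ (p ^ a)"
    using mtrace_char_power[OF p char_k rep_carrier[OF \<sigma> g], of a]
      mtrace_char_power[OF p char_k rep_carrier[OF \<sigma> y], of a]
      rep_pow[OF \<sigma> g, of "p ^ a"] rep_pow[OF \<sigma> y, of "p ^ a"] e by simp
  moreover have "(mtrace (\<sigma> g) - mtrace (\<sigma> y)) ^ (p ^ a) + mtrace (\<sigma> y) ^ (p ^ a) = mtrace (\<sigma> g) ^ (p ^ a)"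
    using freshmans_dream'[of "p ^ a" a "mtrace (\<sigma> g) - mtrace (\<sigma> y)" "mtrace (\<sigma> y)"] p char_k by simp
  ultimately show ?thesis by simp
qed

lemma IBrE:
  assumes "\<phi> \<in> IBr p \<theta> G"
  obtains N \<sigma> where "irreducible_rep G N (\<sigma> :: 'a \<Rightarrow> 'k mat)" "\<phi> = brauer_character p \<theta> G \<sigma>"
  using assms unfolding IBr_def by blast

lemma IBr_cyc: "\<phi> \<in> IBr p \<theta> G \<Longrightarrow> \<phi> x \<in> cyclotomic_ring n"
  by (elim IBrE) (auto intro: brauer_cyc irr_rep)

lemma IBr_zero: "\<phi> \<in> IBr p \<theta> G \<Longrightarrow> x \<notin> p_regular p G \<Longrightarrow> \<phi> x = 0"
  by (elim IBrE) (auto simp: brauer_character_def)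

text \<open>A complex relation between Brauer characters, scaled so that its coefficients lie in the valuation
  ring and one of them is 1, reduces to a nontrivial relation between the traces of irreducible
  representations on p-regular elements. It extends to all elements of G, descends from the closure to
  k, and is there a relation between matrix coefficients with scalar matrices \<open>X \<phi>\<close>.\<close>

theorem IBr_linear_independent:
  assumes fin: "finite \<Phi>" and \<Phi>: "\<Phi> \<subseteq> IBr p \<theta> G"
    and rel: "\<And>x. x \<in> p_regular p G \<Longrightarrow> (\<Sum>\<phi>\<in>\<Phi>. a \<phi> * \<phi> x) = 0" and \<phi>0: "\<phi>0 \<in> \<Phi>"
  shows "a \<phi>0 = 0"
proof (rule ccontr)
  assume nz: "a \<phi>0 \<noteq> 0"
  obtain V and f :: "complex \<Rightarrow> 'k alg_closure" where pl: "place V f" and V: "cyclotomic_ring n \<subseteq> V"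
    and f\<theta>: "\<And>x. x \<in> cyclotomic_ring n \<Longrightarrow> f x = to_ac (\<theta> x)" using exists_place by blast
  interpret place V f by fact
  have "\<forall>\<phi>\<in>\<Phi>. \<exists>N (\<sigma> :: 'a \<Rightarrow> 'k mat). irreducible_rep G N \<sigma> \<and> \<phi> = brauer_character p \<theta> G \<sigma>"
    using \<Phi> by (auto elim!: IBrE)
  then obtain N and \<sigma> :: "('a \<Rightarrow> complex) \<Rightarrow> 'a \<Rightarrow> 'k mat" where irr: "\<And>\<phi>. \<phi> \<in> \<Phi> \<Longrightarrow> irreducible_rep G (N \<phi>) (\<sigma> \<phi>)"
    and br: "\<And>\<phi>. \<phi> \<in> \<Phi> \<Longrightarrow> \<phi> = brauer_character p \<theta> G (\<sigma> \<phi>)" by metis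
  have "\<exists>m\<in>a ` \<Phi> - {0}. \<forall>s\<in>a ` \<Phi> - {0}. s / m \<in> V"
    by (rule max_element) (use fin \<phi>0 nz in auto)
  then obtain \<phi>1 where \<phi>1: "\<phi>1 \<in> \<Phi>" "a \<phi>1 \<noteq> 0" and s: "\<And>\<phi>. \<phi> \<in> \<Phi> \<Longrightarrow> a \<phi> \<noteq> 0 \<Longrightarrow> a \<phi> / a \<phi>1 \<in> V"
    by auto
  define b where "b \<phi> = a \<phi> / a \<phi>1" for \<phi>
  have bV: "b \<phi> \<in> V" if "\<phi> \<in> \<Phi>" for \<phi>
    using s[OF that] V0 by (cases "a \<phi> = 0") (auto simp: b_def)
  have b1: "b \<phi>1 = 1" using \<phi>1 by (simp add: b_def)
  have relk: "(\<Sum>\<phi>\<in>\<Phi>. f (b \<phi>) * to_ac (mtrace (\<sigma> \<phi> x))) = 0" if x: "x \<in> p_regular p G" for x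
  proof -
    have \<phi>V: "\<phi> x \<in> V" if "\<phi> \<in> \<Phi>" for \<phi> using V IBr_cyc \<Phi> that by blast
    have "(\<Sum>\<phi>\<in>\<Phi>. b \<phi> * \<phi> x) = (\<Sum>\<phi>\<in>\<Phi>. a \<phi> * \<phi> x) / a \<phi>1"
      by (simp add: b_def sum_divide_distrib)
    then have "0 = f (\<Sum>\<phi>\<in>\<Phi>. b \<phi> * \<phi> x)" using rel[OF x] by (simp add: f0)
    also have "\<dots> = (\<Sum>\<phi>\<in>\<Phi>. f (b \<phi>) * f (\<phi> x))"
      using bV \<phi>V by (subst fsum) (auto intro: Vmult simp: fmult)
    also have "\<dots> = (\<Sum>\<phi>\<in>\<Phi>. f (b \<phi>) * to_ac (mtrace (\<sigma> \<phi> x)))"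
    proof (rule sum.cong[OF refl])
      fix \<phi> assume \<phi>: "\<phi> \<in> \<Phi>"
      have "f (\<phi> x) = to_ac (\<theta> (\<phi> x))" using f\<theta> IBr_cyc \<Phi> \<phi> by blast
      also have "\<theta> (\<phi> x) = mtrace (\<sigma> \<phi> x)"
        using \<theta>_brauer[OF irr_rep[OF irr[OF \<phi>]] x] br[OF \<phi>] by simp
      finally show "f (b \<phi>) * f (\<phi> x) = f (b \<phi>) * to_ac (mtrace (\<sigma> \<phi> x))" by simp
    qed
    finally show ?thesis by simp
  qed
  have relG: "(\<Sum>\<phi>\<in>\<Phi>. f (b \<phi>) * to_ac (mtrace (\<sigma> \<phi> g))) = 0" if g: "g \<in> carrier G" for g
  proof -
    from p_regular_part[OF p g] obtain y e where y: "y \<in> p_regular p G" "y [^] (p ^ e :: nat) = g [^] (p ^ e)" by blast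
    have "mtrace (\<sigma> \<phi> g) = mtrace (\<sigma> \<phi> y)" if "\<phi> \<in> \<Phi>" for \<phi>
      by (rule mtrace_p_regular_part[OF irr_rep[OF irr[OF that]] g p_regularD(1)[OF y(1)] y(2)])
    then show ?thesis using relk[OF y(1)] by simp
  qed
  have "\<exists>d. (\<forall>\<phi>\<in>\<Phi>. d \<phi> \<in> range to_ac) \<and> (\<exists>\<phi>\<in>\<Phi>. d \<phi> \<noteq> 0) \<and>
      (\<forall>g\<in>carrier G. (\<Sum>\<phi>\<in>\<Phi>. d \<phi> * to_ac (mtrace (\<sigma> \<phi> g))) = 0)"
  proof (rule subring_linear_relation[where a = "\<lambda>\<phi>. f (b \<phi>)"])
    show "(1 :: 'k alg_closure) \<in> range to_ac" by (metis rangeI to_ac_1)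
    show "\<exists>\<phi>\<in>\<Phi>. f (b \<phi>) \<noteq> 0" using \<phi>1 b1 f1 by (intro bexI[of _ \<phi>1]) auto
  qed (use relG fin in \<open>auto simp flip: to_ac_diff to_ac_mult\<close>)
  then obtain d where d: "\<forall>\<phi>\<in>\<Phi>. d \<phi> \<in> range to_ac" "\<exists>\<phi>\<in>\<Phi>. d \<phi> \<noteq> (0 :: 'k alg_closure)"
    "\<forall>g\<in>carrier G. (\<Sum>\<phi>\<in>\<Phi>. d \<phi> * to_ac (mtrace (\<sigma> \<phi> g))) = 0" by blast
  define c where "c \<phi> = of_ac (d \<phi>)" for \<phi>
  have dc: "d \<phi> = to_ac (c \<phi>)" if "\<phi> \<in> \<Phi>" for \<phi> using d(1) that by (simp add: c_def to_ac_of_ac)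
  have cz: "(\<Sum>\<phi>\<in>\<Phi>. c \<phi> * mtrace (\<sigma> \<phi> g)) = 0" if "g \<in> carrier G" for g
  proof -
    have "to_ac (\<Sum>\<phi>\<in>\<Phi>. c \<phi> * mtrace (\<sigma> \<phi> g)) = (\<Sum>\<phi>\<in>\<Phi>. d \<phi> * to_ac (mtrace (\<sigma> \<phi> g)))"
      by (simp add: to_ac_sum dc)
    then show ?thesis using d(3) that by simp
  qed
  define X where "X \<phi> = c \<phi> \<cdot>\<^sub>m 1\<^sub>m (N \<phi>)" for \<phi>
  have trX: "mtrace (X \<phi> * \<sigma> \<phi> g) = c \<phi> * mtrace (\<sigma> \<phi> g)" if "\<phi> \<in> \<Phi>" "g \<in> carrier G" for \<phi> g
  proof -
    have "X \<phi> * \<sigma> \<phi> g = c \<phi> \<cdot>\<^sub>m \<sigma> \<phi> g"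
      using rep_carrier[OF irr_rep[OF irr[OF that(1)]] that(2)]
      by (simp add: X_def mult_smult_assoc_mat[of _ "N \<phi>" "N \<phi>" _ "N \<phi>"])
    then show ?thesis
      using rep_carrier[OF irr_rep[OF irr[OF that(1)]] that(2)] by (simp add: mtrace_def sum_distrib_left)
  qed
  have X0: "X \<phi> = 0\<^sub>m (N \<phi>) (N \<phi>)" if "\<phi> \<in> \<Phi>" for \<phi>
  proof (rule coefficient_independence[OF fin irr _ _ _ _ that])
    fix \<phi> assume "\<phi> \<in> \<Phi>" then show "scalar_endos (N \<phi>) (\<sigma> \<phi>)" using scalar_endos_splitting[OF split irr] by blast
  next
    fix \<phi> show "X \<phi> \<in> carrier_mat (N \<phi>) (N \<phi>)" by (simp add: X_def)
  next
    fix g assume "g \<in> carrier G"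
    then show "(\<Sum>\<phi>\<in>\<Phi>. mtrace (X \<phi> * \<sigma> \<phi> g)) = 0" using cz[of g] by (simp add: trX)
  next
    fix \<phi> \<psi> M assume \<phi>: "\<phi> \<in> \<Phi>" and \<psi>: "\<psi> \<in> \<Phi>" and ne: "\<phi> \<noteq> \<psi>" and M: "M \<in> carrier_mat (N \<phi>) (N \<psi>)"
      and int: "\<And>g. g \<in> carrier G \<Longrightarrow> \<sigma> \<phi> g * M = M * \<sigma> \<psi> g"
    show "M = 0\<^sub>m (N \<phi>) (N \<psi>)"
    proof (rule ccontr)
      assume "M \<noteq> 0\<^sub>m (N \<phi>) (N \<psi>)"
      from schur_invertible[OF irr[OF \<phi>] irr[OF \<psi>] M int this] obtain Q where
        N: "N \<phi> = N \<psi>" and MQ: "inverse_mats (N \<phi>) M Q" by blast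
      have "char_poly (\<sigma> \<phi> g) = char_poly (\<sigma> \<psi> g)" if g: "g \<in> carrier G" for g
        by (rule intertwined_char_poly[OF MQ rep_carrier[OF irr_rep[OF irr[OF \<phi>]] g] _ int[OF g]])
          (use rep_carrier[OF irr_rep[OF irr[OF \<psi>]] g] N in simp)
      then have "brauer_character p \<theta> G (\<sigma> \<phi>) = brauer_character p \<theta> G (\<sigma> \<psi>)"
        by (auto simp: brauer_character_def fun_eq_iff p_regular_def)
      then show False using br[OF \<phi>] br[OF \<psi>] ne by simp
    qed
  qed
  have "d \<phi> = 0" if "\<phi> \<in> \<Phi>" for \<phi>
  proof -
    have "X \<phi> $$ (0, 0) = 0" using X0[OF that] irr_pos[OF irr[OF that]] by simp
    then show ?thesis using irr_pos[OF irr[OF that]] dc[OF that] by (simp add: X_def)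
  qed
  then show False using d(2) by blast
qed

lemma IBr_independent: "cfun.independent (IBr p \<theta> G)"
proof
  assume "cfun.dependent (IBr p \<theta> G)"
  then obtain t u v where t: "finite t" "t \<subseteq> IBr p \<theta> G" "(\<Sum>v\<in>t. cscale (u v) v) = 0" "v \<in> t" "u v \<noteq> 0"
    unfolding cfun.dependent_explicit by blast
  have "(\<Sum>\<phi>\<in>t. u \<phi> * \<phi> x) = 0" for x
  proof -
    have "(\<Sum>\<phi>\<in>t. u \<phi> * \<phi> x) = (\<Sum>v\<in>t. cscale (u v) v) x"
      by (simp add: cscale_def sum_fun_apply)
    then show ?thesis by (simp add: t(3))
  qed
  then show False using IBr_linear_independent[OF t(1,2) _ t(4), of u] t(5) by blast
qed

lemma finite_IBr: "finite (IBr p \<theta> G)"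
proof -
  define \<delta> :: "'a \<Rightarrow> 'a \<Rightarrow> complex" where "\<delta> g = (\<lambda>x. if x = g then 1 else 0)" for g
  have "IBr p \<theta> G \<subseteq> cfun.span (\<delta> ` carrier G)"
  proof
    fix \<phi> assume \<phi>: "\<phi> \<in> IBr p \<theta> G"
    have "\<phi> = (\<Sum>g\<in>carrier G. cscale (\<phi> g) (\<delta> g))"
    proof
      fix x
      have "(\<Sum>g\<in>carrier G. cscale (\<phi> g) (\<delta> g)) x = (\<Sum>g\<in>carrier G. if x = g then \<phi> g else 0)"
        by (simp add: sum_fun_apply cscale_def \<delta>_def if_distrib cong: if_cong)
      also have "\<dots> = (if x \<in> carrier G then \<phi> x else 0)" using finG by simp
      also have "\<dots> = \<phi> x" using IBr_zero[OF \<phi>, of x] p_regularD(1)[of x] by auto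
      finally show "\<phi> x = (\<Sum>g\<in>carrier G. cscale (\<phi> g) (\<delta> g)) x" by simp
    qed
    also have "\<dots> \<in> cfun.span (\<delta> ` carrier G)"
      by (intro cfun.span_sum cfun.span_scale cfun.span_base) auto
    finally show "\<phi> \<in> cfun.span (\<delta> ` carrier G)" .
  qed
  from cfun.independent_span_bound[OF finite_imageI[OF finG] IBr_independent this]
  show ?thesis by simp
qed

end

section \<open>Orthogonality and completeness of the ordinary characters\<close>

context fin_group
begin

lemma scalar_endos_complex:
  assumes \<rho>: "irreducible_rep G N (\<rho> :: 'a \<Rightarrow> complex mat)"
  shows "scalar_endos N \<rho>"
  unfolding scalar_endos_def
proof (intro ballI impI)
  note c = rep_carrier[OF irr_rep[OF \<rho>]]
  fix M :: "complex mat" assume M: "M \<in> carrier_mat N N" and com: "\<forall>g\<in>carrier G. M * \<rho> g = \<rho> g * M"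
  have "degree (char_poly M) = N" using degree_monic_char_poly[OF M] by simp
  then have "\<not> constant (poly (char_poly M))"
    using irr_pos[OF \<rho>] by (simp add: constant_degree)
  then obtain e where "poly (char_poly M) e = 0" using fundamental_theorem_of_algebra by blast
  then have "eigenvalue M e" using eigenvalue_root_char_poly[OF M] by simp
  then obtain v where v: "v \<in> carrier_vec N" "v \<noteq> 0\<^sub>v N" "M *\<^sub>v v = e \<cdot>\<^sub>v v"
    using M by (auto simp: eigenvalue_def eigenvector_def)
  define D where "D = M - e \<cdot>\<^sub>m 1\<^sub>m N"
  have D: "D \<in> carrier_mat N N" unfolding D_def by (rule minus_carrier_mat) simp
  have "e \<cdot>\<^sub>v (1\<^sub>m N *\<^sub>v v) = (e \<cdot>\<^sub>m 1\<^sub>m N) *\<^sub>v v" using v by auto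
  then have "(e \<cdot>\<^sub>m 1\<^sub>m N) *\<^sub>v v = e \<cdot>\<^sub>v v" using v by simp
  then have "D *\<^sub>v v = e \<cdot>\<^sub>v v - e \<cdot>\<^sub>v v"
    using v M by (simp add: D_def minus_mult_distrib_mat_vec[of M N N])
  then have Dv: "D *\<^sub>v v = 0\<^sub>v N" using v by (auto intro!: eq_vecI)
  have int: "\<rho> g * D = D * \<rho> g" if g: "g \<in> carrier G" for g
    using com g c[OF g] M
    by (simp add: D_def mult_minus_distrib_mat[of "\<rho> g" N N M N] minus_mult_distrib_mat[of M N N _ "\<rho> g" N]
        mult_smult_distrib[of "\<rho> g" N N "1\<^sub>m N" N] mult_smult_assoc_mat[of "1\<^sub>m N" N N "\<rho> g" N])
  have "D = 0\<^sub>m N N"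
  proof (rule ccontr)
    assume "D \<noteq> 0\<^sub>m N N"
    from schur_invertible(2)[OF \<rho> \<rho> D int this] obtain Q where "inverse_mats N D Q" by blast
    then have "Q *\<^sub>v (D *\<^sub>v v) = v" using inverse_mats_vec(2) v(1) by blast
    moreover have "Q *\<^sub>v 0\<^sub>v N = 0\<^sub>v N" using \<open>inverse_mats N D Q\<close>
      by (auto simp: inverse_mats_def intro!: eq_vecI)
    ultimately show False using Dv v(2) by simp
  qed
  then have "M = e \<cdot>\<^sub>m 1\<^sub>m N"
    using M unfolding D_def by (intro eq_matI) (auto dest!: arg_cong[where f = "\<lambda>A. A $$ (_, _)"] simp: mat_eq_iff)
  then show "\<exists>c. M = c \<cdot>\<^sub>m 1\<^sub>m N" ..
qed

text \<open>The averaged matrices are \<open>\<Sum> \<rho> g * E * \<tau> (inv g)\<close> with E a matrix unit at \<open>(b, l)\<close>. All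
  orthogonality relations come from them by Schur's lemma.\<close>

lemma average_intertwines:
  assumes \<rho>: "matrix_rep G N (\<rho> :: 'a \<Rightarrow> complex mat)" and \<tau>: "matrix_rep G K \<tau>" and b: "b < N" and l: "l < K"
  defines "M \<equiv> mat N K (\<lambda>(i, j). \<Sum>g\<in>carrier G. \<rho> g $$ (i, b) * \<tau> (inv g) $$ (l, j))"
  assumes h: "h \<in> carrier G"
  shows "\<rho> h * M = M * \<tau> h"
proof (rule eq_matI)
  note cr = rep_carrier[OF \<rho>] and ct = rep_carrier[OF \<tau>]
  have M: "M \<in> carrier_mat N K" by (simp add: M_def)
  fix i j assume "i < dim_row (M * \<tau> h)" "j < dim_col (M * \<tau> h)"
  then have ij: "i < N" "j < K" using M ct[OF h] by auto
  have "(\<rho> h * M) $$ (i, j) = (\<Sum>a<N. \<Sum>g\<in>carrier G. \<rho> h $$ (i, a) * \<rho> g $$ (a, b) * \<tau> (inv g) $$ (l, j))"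
    unfolding mult_index_sum[OF cr[OF h] M ij] using ij by (simp add: M_def sum_distrib_left mult.assoc)
  also have "\<dots> = (\<Sum>g\<in>carrier G. (\<Sum>a<N. \<rho> h $$ (i, a) * \<rho> g $$ (a, b)) * \<tau> (inv g) $$ (l, j))"
    by (subst sum.swap) (simp add: sum_distrib_right)
  also have "\<dots> = (\<Sum>g\<in>carrier G. \<rho> (h \<otimes> g) $$ (i, b) * \<tau> (inv (h \<otimes> g) \<otimes> h) $$ (l, j))"
  proof (rule sum.cong[OF refl])
    fix g assume g: "g \<in> carrier G"
    have "inv (h \<otimes> g) \<otimes> h = inv g" using g h by (simp add: inv_mult_group m_assoc)
    then show "(\<Sum>a<N. \<rho> h $$ (i, a) * \<rho> g $$ (a, b)) * \<tau> (inv g) $$ (l, j)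
        = \<rho> (h \<otimes> g) $$ (i, b) * \<tau> (inv (h \<otimes> g) \<otimes> h) $$ (l, j)"
      using mult_index_sum[OF cr[OF h] cr[OF g] ij(1) b] by (simp add: rep_mult[OF \<rho> h g])
  qed
  also have "\<dots> = (\<Sum>g\<in>carrier G. \<rho> g $$ (i, b) * \<tau> (inv g \<otimes> h) $$ (l, j))"
    by (rule sum_shift[OF h])
  also have "\<dots> = (\<Sum>g\<in>carrier G. \<Sum>a<K. \<rho> g $$ (i, b) * \<tau> (inv g) $$ (l, a) * \<tau> h $$ (a, j))"
  proof (rule sum.cong[OF refl])
    fix g assume g: "g \<in> carrier G"
    show "\<rho> g $$ (i, b) * \<tau> (inv g \<otimes> h) $$ (l, j) = (\<Sum>a<K. \<rho> g $$ (i, b) * \<tau> (inv g) $$ (l, a) * \<tau> h $$ (a, j))"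
      using mult_index_sum[OF ct[of "inv g"] ct[OF h] l ij(2)] g h
      by (simp add: rep_mult[OF \<tau>] sum_distrib_left mult.assoc)
  qed
  also have "\<dots> = (M * \<tau> h) $$ (i, j)"
    unfolding mult_index_sum[OF M ct[OF h] ij] using ij
    by (subst sum.swap) (simp add: M_def sum_distrib_right)
  finally show "(\<rho> h * M) $$ (i, j) = (M * \<tau> h) $$ (i, j)" .
qed (use rep_carrier[OF \<rho> h] rep_carrier[OF \<tau> h] in \<open>auto simp: M_def\<close>)

lemma coefficient_orthogonality:
  assumes \<rho>: "irreducible_rep G N (\<rho> :: 'a \<Rightarrow> complex mat)" and ix: "i < N" "b < N" "l < N" "j < N"
  shows "(\<Sum>g\<in>carrier G. \<rho> g $$ (i, b) * \<rho> (inv g) $$ (l, j))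
    = (if i = j \<and> b = l then of_nat (card (carrier G)) / of_nat N else 0)"
proof -
  note r = irr_rep[OF \<rho>] and c = rep_carrier[OF irr_rep[OF \<rho>]]
  define M where "M = mat N N (\<lambda>(i, j). \<Sum>g\<in>carrier G. \<rho> g $$ (i, b) * \<rho> (inv g) $$ (l, j))"
  have M: "M \<in> carrier_mat N N" by (simp add: M_def)
  have "\<And>h. h \<in> carrier G \<Longrightarrow> M * \<rho> h = \<rho> h * M"
    using average_intertwines[OF r r ix(2,3)] unfolding M_def by simp
  then obtain d where d: "M = d \<cdot>\<^sub>m 1\<^sub>m N" using scalar_endos_complex[OF \<rho>] M unfolding scalar_endos_def by metis
  have "of_nat N * d = mtrace M" by (simp add: d mtrace_def)
  also have "\<dots> = (\<Sum>g\<in>carrier G. \<Sum>i<N. \<rho> (inv g) $$ (l, i) * \<rho> g $$ (i, b))"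
    unfolding mtrace_def by (subst sum.swap) (simp add: M_def mult.commute)
  also have "\<dots> = (\<Sum>g\<in>carrier G. if b = l then 1 else 0)"
  proof (rule sum.cong[OF refl])
    fix g assume g: "g \<in> carrier G"
    have "(\<Sum>i<N. \<rho> (inv g) $$ (l, i) * \<rho> g $$ (i, b)) = (\<rho> (inv g) * \<rho> g) $$ (l, b)"
      using mult_index_sum[OF c[of "inv g"] c[OF g] ix(3,2)] g by simp
    also have "\<rho> (inv g) * \<rho> g = 1\<^sub>m N" using rep_inv[OF r g] by (simp add: inverse_mats_def)
    finally show "(\<Sum>i<N. \<rho> (inv g) $$ (l, i) * \<rho> g $$ (i, b)) = (if b = l then 1 else 0)" using ix by auto
  qed
  finally have "d = (if b = l then of_nat (card (carrier G)) / of_nat N else 0)"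
    using irr_pos[OF \<rho>] by (auto simp: field_simps)
  moreover have "(\<Sum>g\<in>carrier G. \<rho> g $$ (i, b) * \<rho> (inv g) $$ (l, j)) = M $$ (i, j)"
    using ix by (simp add: M_def)
  ultimately show ?thesis using ix by (auto simp: d)
qed

lemma character_mtrace: "x \<in> carrier G \<Longrightarrow> character G \<rho> x = mtrace (\<rho> x)"
  by (simp add: character_def mtrace_def)

lemma coefficient_orthogonality_distinct:
  assumes \<rho>: "irreducible_rep G N (\<rho> :: 'a \<Rightarrow> complex mat)" and \<tau>: "irreducible_rep G K \<tau>"
    and ne: "character G \<rho> \<noteq> character G \<tau>" and ix: "i < N" "b < N" "l < K" "j < K"
  shows "(\<Sum>g\<in>carrier G. \<rho> g $$ (i, b) * \<tau> (inv g) $$ (l, j)) = 0"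
proof -
  define M where "M = mat N K (\<lambda>(i, j). \<Sum>g\<in>carrier G. \<rho> g $$ (i, b) * \<tau> (inv g) $$ (l, j))"
  have M: "M \<in> carrier_mat N K" by (simp add: M_def)
  have int: "\<rho> h * M = M * \<tau> h" if "h \<in> carrier G" for h
    unfolding M_def by (rule average_intertwines[OF irr_rep[OF \<rho>] irr_rep[OF \<tau>] ix(2,3) that])
  have "M = 0\<^sub>m N K"
  proof (rule ccontr)
    assume "M \<noteq> 0\<^sub>m N K"
    from schur_invertible[OF \<rho> \<tau> M int this] obtain Q where NK: "N = K" and Q: "inverse_mats N M Q" by blast
    have "mtrace (\<rho> g) = mtrace (\<tau> g)" if g: "g \<in> carrier G" for g
    proof -
      have rg: "\<rho> g \<in> carrier_mat N N" "\<tau> g \<in> carrier_mat N N"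
        using rep_carrier[OF irr_rep[OF \<rho>] g] rep_carrier[OF irr_rep[OF \<tau>] g] NK by auto
      have "Q * \<rho> g * M = Q * (M * \<tau> g)"
        using Q rg by (simp add: inverse_mats_def assoc_mult_mat[of _ N N _ N _ N] int[OF g])
      also have "\<dots> = (Q * M) * \<tau> g"
        using Q rg by (subst assoc_mult_mat[of _ N N _ N _ N]) (auto simp: inverse_mats_def)
      finally have "Q * \<rho> g * M = \<tau> g" using Q rg by (simp add: inverse_mats_def)
      then show ?thesis using mtrace_conj[OF Q rg(1)] by simp
    qed
    then have "character G \<rho> = character G \<tau>" by (auto simp: character_def mtrace_def fun_eq_iff)
    then show False using ne by simp
  qed
  then have "M $$ (i, j) = 0" using ix by simp
  then show ?thesis using ix by (simp add: M_def)
qed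

lemma IrrE:
  assumes "\<chi> \<in> Irr G"
  obtains N \<rho> where "irreducible_rep G N \<rho>" "\<chi> = character G \<rho>"
  using assms unfolding Irr_def by blast

lemma IrrI: "irreducible_rep G N \<rho> \<Longrightarrow> character G \<rho> \<in> Irr G"
  unfolding Irr_def by blast

lemma character_one:
  assumes "irreducible_rep G N \<rho>" shows "character G \<rho> \<one> = of_nat N"
  using rep_one[OF irr_rep[OF assms]] by (simp add: character_def)

lemma Irr_outside: "\<chi> \<in> Irr G \<Longrightarrow> x \<notin> carrier G \<Longrightarrow> \<chi> x = 0"
  by (elim IrrE) (simp add: character_def)

lemma Irr_one: "\<chi> \<in> Irr G \<Longrightarrow> \<chi> \<one> \<noteq> 0"
  by (elim IrrE) (use irr_pos in \<open>auto simp: character_one\<close>)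

text \<open>The convolution formula for characters, which contains the first orthogonality relation (\<open>y = 1\<close>) and
  is used once more for the projection onto a block.\<close>

theorem Irr_convolution:
  assumes \<chi>: "\<chi> \<in> Irr G" and \<psi>: "\<psi> \<in> Irr G" and y: "y \<in> carrier G"
  shows "(\<Sum>z\<in>carrier G. \<chi> (inv z) * \<psi> (z \<otimes> y))
    = (if \<chi> = \<psi> then of_nat (card (carrier G)) / \<chi> \<one> * \<chi> y else 0)"
proof -
  from \<chi> obtain K \<tau> where \<tau>: "irreducible_rep G K \<tau>" "\<chi> = character G \<tau>" by (rule IrrE)
  from \<psi> obtain N' \<rho>' where \<rho>': "irreducible_rep G N' \<rho>'" "\<psi> = character G \<rho>'" by (rule IrrE)
  \<comment> \<open>equal characters are to be afforded by the same representation, because the orthogonality of the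
    coefficients in the case \<open>\<chi> = \<psi>\<close> is about a single representation\<close>
  obtain N \<rho> where \<rho>: "irreducible_rep G N \<rho>" "\<psi> = character G \<rho>" and same: "\<chi> = \<psi> \<longrightarrow> N = K \<and> \<rho> = \<tau>"
    using \<rho>' \<tau> by (cases "\<chi> = \<psi>") auto
  note cr = rep_carrier[OF irr_rep[OF \<rho>(1)]] and ct = rep_carrier[OF irr_rep[OF \<tau>(1)]]
  have "(\<Sum>z\<in>carrier G. \<chi> (inv z) * \<psi> (z \<otimes> y)) =
    (\<Sum>z\<in>carrier G. \<Sum>l<K. \<Sum>i<N. \<Sum>a<N. \<rho> y $$ (a, i) * (\<rho> z $$ (i, a) * \<tau> (inv z) $$ (l, l)))"
  proof (rule sum.cong[OF refl])
    fix z assume z: "z \<in> carrier G"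
    have "\<psi> (z \<otimes> y) = (\<Sum>i<N. \<Sum>a<N. \<rho> z $$ (i, a) * \<rho> y $$ (a, i))"
      using z y cr[OF z] cr[OF y] mult_index_sum[OF cr[OF z] cr[OF y]]
      by (simp add: \<rho>(2) character_mtrace mtrace_def rep_mult[OF irr_rep[OF \<rho>(1)]] del: index_mult_mat(1))
    moreover have "\<chi> (inv z) = (\<Sum>l<K. \<tau> (inv z) $$ (l, l))"
      using z ct[of "inv z"] by (simp add: \<tau>(2) character_mtrace mtrace_def)
    ultimately show "\<chi> (inv z) * \<psi> (z \<otimes> y)
        = (\<Sum>l<K. \<Sum>i<N. \<Sum>a<N. \<rho> y $$ (a, i) * (\<rho> z $$ (i, a) * \<tau> (inv z) $$ (l, l)))"
      by (simp only: sum_distrib_right) (simp add: sum_distrib_left mult_ac)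
  qed
  also have "\<dots> = (\<Sum>l<K. \<Sum>i<N. \<Sum>a<N. \<rho> y $$ (a, i) * (\<Sum>z\<in>carrier G. \<rho> z $$ (i, a) * \<tau> (inv z) $$ (l, l)))"
    unfolding sum_distrib_left
    by (subst sum.swap, rule sum.cong[OF refl], subst sum.swap, rule sum.cong[OF refl], rule sum.swap)
  also have "\<dots> = (if \<chi> = \<psi> then of_nat (card (carrier G)) / \<chi> \<one> * \<chi> y else 0)"
  proof (cases "\<chi> = \<psi>")
    case False
    then have "character G \<rho> \<noteq> character G \<tau>" using \<rho>(2) \<tau>(2) by simp
    from coefficient_orthogonality_distinct[OF \<rho>(1) \<tau>(1) this]
    show ?thesis using False by (auto intro!: sum.neutral)
  next
    case True
    then have NK: "N = K" "\<rho> = \<tau>" using same by auto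
    let ?c = "of_nat (card (carrier G)) / of_nat N :: complex"
    have "(\<Sum>l<K. \<Sum>i<N. \<Sum>a<N. \<rho> y $$ (a, i) * (\<Sum>z\<in>carrier G. \<rho> z $$ (i, a) * \<tau> (inv z) $$ (l, l)))
      = (\<Sum>l<N. \<Sum>i<N. \<Sum>a<N. if a = l then (if i = l then \<rho> y $$ (a, i) * ?c else 0) else 0)"
      unfolding NK(1)[symmetric] NK(2)[symmetric]
      by (intro sum.cong refl) (simp add: coefficient_orthogonality[OF \<rho>(1)])
    also have "\<dots> = (\<Sum>l<N. \<rho> y $$ (l, l) * ?c)" by simp
    also have "\<dots> = ?c * \<psi> y"
      using y cr[OF y] by (simp add: \<rho>(2) character_mtrace mtrace_def sum_distrib_left mult.commute)
    finally show ?thesis using True character_one[OF \<rho>(1)] \<rho>(2) by simp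
  qed
  finally show ?thesis .
qed

text \<open>The eigenvalues of \<open>\<rho> x\<close> are roots of unity, and \<open>\<rho> (inv x)\<close> is a power of \<open>\<rho> x\<close>; so it has the
  inverse, that is, the conjugate eigenvalues.\<close>

lemma character_cnj:
  assumes \<rho>: "matrix_rep G N (\<rho> :: 'a \<Rightarrow> complex mat)" and x: "x \<in> carrier G"
  shows "character G \<rho> (inv x) = cnj (character G \<rho> x)"
proof -
  note c = rep_carrier[OF \<rho> x]
  obtain es where es: "char_poly (\<rho> x) = (\<Prod>e\<leftarrow>es. [:- e, 1:])" using char_poly_factorized[OF c] by blast
  define m where "m = ord x"
  have m: "m > 0" using ord_ge_1[OF finG x] by (simp add: m_def)
  have pm: "\<rho> x ^\<^sub>m m = 1\<^sub>m N" using rep_pow[OF \<rho> x, of m] rep_one[OF \<rho>] x by (simp add: m_def)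
  have e1: "e ^ m = 1" if "e \<in> set es" for e
    using eigenvalue_pow_root[OF c, of m 0 e] pm that c unfolding es
    by (auto simp: poly_prod_list prod_list_zero_iff)
  have "x [^] (m - 1) \<otimes> x = \<one>"
    using x m by (metis Suc_diff_1 m_def nat_pow_Suc pow_ord_eq_1)
  then have "inv x = x [^] (m - 1)" using x by (metis inv_equality nat_pow_closed)
  then have "character G \<rho> (inv x) = mtrace (\<rho> x ^\<^sub>m (m - 1))"
    using x rep_pow[OF \<rho> x, of "m - 1"] by (simp add: character_mtrace)
  also have "\<dots> = (\<Sum>e\<leftarrow>es. e ^ (m - 1))" by (rule mtrace_pow_split[OF c es])
  also have "\<dots> = (\<Sum>e\<leftarrow>es. cnj e)"
  proof (intro arg_cong[of _ _ sum_list] map_cong refl)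
    fix e assume "e \<in> set es"
    then have em: "e ^ m = 1" by (rule e1)
    then have "norm e ^ m = 1" by (metis norm_one norm_power)
    then have "norm e = 1" using m by (metis norm_ge_zero power_eq_1_iff less_numeral_extra(3) real_norm_def abs_of_nonneg)
    then have "e * cnj e = 1" by (simp add: complex_norm_square[symmetric])
    moreover have "e * e ^ (m - 1) = 1" using em m by (metis Suc_diff_1 power_Suc)
    ultimately show "e ^ (m - 1) = cnj e" by (metis mult.assoc mult.commute mult.left_neutral)
  qed
  also have "\<dots> = cnj (\<Sum>e\<leftarrow>es. e ^ 1)" by (induction es) auto
  also have "(\<Sum>e\<leftarrow>es. e ^ 1) = mtrace (\<rho> x ^\<^sub>m 1)" by (rule mtrace_pow_split[OF c es, symmetric])
  finally show ?thesis using x c by (simp add: character_mtrace)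
qed

lemma Irr_cnj: "\<chi> \<in> Irr G \<Longrightarrow> x \<in> carrier G \<Longrightarrow> \<chi> (inv x) = cnj (\<chi> x)"
  by (elim IrrE) (simp add: character_cnj[OF irr_rep])

theorem Irr_orthonormal:
  assumes "\<chi> \<in> Irr G" "\<psi> \<in> Irr G"
  shows "cf_inner G \<chi> \<psi> = (if \<chi> = \<psi> then 1 else 0)"
proof -
  have "(\<Sum>x\<in>carrier G. \<chi> x * cnj (\<psi> x)) = (\<Sum>z\<in>carrier G. \<psi> (inv z) * \<chi> (z \<otimes> \<one>))"
    using Irr_cnj[OF assms(2)] by (intro sum.cong) auto
  also have "\<dots> = (if \<psi> = \<chi> then of_nat (card (carrier G)) / \<psi> \<one> * \<psi> \<one> else 0)"
    by (rule Irr_convolution[OF assms(2,1) one_closed])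
  finally show ?thesis using Irr_one[OF assms(2)] finG
    by (auto simp: cf_inner_def card_gt_0_iff)
qed

lemma reg_decomposition:
  shows "\<exists>rs. (\<forall>(m, \<tau>)\<in>set rs. irreducible_rep G m (\<tau> :: 'a \<Rightarrow> complex mat)) \<and>
      (\<forall>g\<in>carrier G. (\<Sum>(m, \<tau>)\<leftarrow>rs. character G \<tau> g) = (if g = \<one> then of_nat (card (carrier G)) else 0))"
proof -
  from composition_factors[OF is_group matrix_rep_reg] obtain rs where
    rs: "\<forall>(m, \<tau>)\<in>set rs. irreducible_rep G m (\<tau> :: 'a \<Rightarrow> complex mat)"
    "\<And>g. g \<in> carrier G \<Longrightarrow> mtrace (reg_rep g :: complex mat) = (\<Sum>(m, \<tau>)\<leftarrow>rs. mtrace (\<tau> g))" by blast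
  have "(\<Sum>(m, \<tau>)\<leftarrow>rs. character G \<tau> g) = (if g = \<one> then of_nat (card (carrier G)) else 0)"
    if "g \<in> carrier G" for g
  proof -
    have "mtrace (reg_rep g :: complex mat) = (if g = \<one> then of_nat (card (carrier G)) else 0)"
      by (rule mtrace_reg[OF that])
    then show ?thesis using rs(2)[OF that] that by (simp add: character_mtrace)
  qed
  then show ?thesis using rs(1) by blast
qed

definition class_function :: "('a \<Rightarrow> complex) \<Rightarrow> bool" where
  "class_function f \<longleftrightarrow> (\<forall>x. x \<notin> carrier G \<longrightarrow> f x = 0) \<and>
     (\<forall>g\<in>carrier G. \<forall>x\<in>carrier G. f (g \<otimes> x \<otimes> inv g) = f x)"

lemma class_functionD:
  assumes "class_function f"
  shows "x \<notin> carrier G \<Longrightarrow> f x = 0" "g \<in> carrier G \<Longrightarrow> x \<in> carrier G \<Longrightarrow> f (g \<otimes> x \<otimes> inv g) = f x"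
    "x \<in> carrier G \<Longrightarrow> y \<in> carrier G \<Longrightarrow> f (x \<otimes> y) = f (y \<otimes> x)"
proof -
  note d = assms[unfolded class_function_def]
  show "x \<notin> carrier G \<Longrightarrow> f x = 0" using d by blast
  show c: "g \<in> carrier G \<Longrightarrow> x \<in> carrier G \<Longrightarrow> f (g \<otimes> x \<otimes> inv g) = f x" for g x using d by blast
  show "f (x \<otimes> y) = f (y \<otimes> x)" if "x \<in> carrier G" "y \<in> carrier G"
    using c[of y "x \<otimes> y"] that by (simp add: m_assoc)
qed

lemma Irr_class_function: "\<chi> \<in> Irr G \<Longrightarrow> class_function \<chi>"
  unfolding class_function_def
proof (intro conjI allI impI ballI)
  assume \<chi>: "\<chi> \<in> Irr G"
  then show "\<chi> x = 0" if "x \<notin> carrier G" for x using Irr_outside that by blast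
  from \<chi> obtain N \<rho> where \<rho>: "irreducible_rep G N \<rho>" "\<chi> = character G \<rho>" by (rule IrrE)
  fix g x assume g: "g \<in> carrier G" and x: "x \<in> carrier G"
  have I: "inverse_mats N (\<rho> (inv g)) (\<rho> g)"
    using rep_inv[OF irr_rep[OF \<rho>(1)], of "inv g"] g by simp
  have "\<rho> (g \<otimes> x \<otimes> inv g) = \<rho> g * \<rho> x * \<rho> (inv g)"
    using g x by (simp add: rep_mult[OF irr_rep[OF \<rho>(1)]])
  then show "\<chi> (g \<otimes> x \<otimes> inv g) = \<chi> x"
    using mtrace_conj[OF I rep_carrier[OF irr_rep[OF \<rho>(1)] x]] g x by (simp add: \<rho>(2) character_mtrace)
qed

text \<open>A class function f orthogonal to all irreducible characters acts as 0 in every irreducible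
  representation, since \<open>\<Sum> f(g) \<tau> (inv g)\<close> is an endomorphism and thus a scalar, of trace 0. The trace of
  the regular representation is a sum of irreducible characters, and it recovers the value \<open>f h\<close>.\<close>

theorem class_function_zero:
  assumes f: "class_function f" and orth: "\<And>\<chi>. \<chi> \<in> Irr G \<Longrightarrow> cf_inner G f \<chi> = 0"
  shows "f = 0"
proof
  fix h
  show "f h = 0 h"
  proof (cases "h \<in> carrier G")
    case h: True
    have irr0: "(\<Sum>g\<in>carrier G. f g * character G \<tau> (inv g \<otimes> h)) = 0" if \<tau>: "irreducible_rep G N \<tau>" for N \<tau>
    proof -
      note c = rep_carrier[OF irr_rep[OF \<tau>]]
      define T where "T = mat N N (\<lambda>(i, j). \<Sum>g\<in>carrier G. f g * \<tau> (inv g) $$ (i, j))"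
      have T: "T \<in> carrier_mat N N" by (simp add: T_def)
      have com: "T * \<tau> k = \<tau> k * T" if k: "k \<in> carrier G" for k
      proof (rule eq_matI)
        fix i j assume "i < dim_row (\<tau> k * T)" "j < dim_col (\<tau> k * T)"
        then have ij: "i < N" "j < N" using c[OF k] T by auto
        have "(T * \<tau> k) $$ (i, j) = (\<Sum>g\<in>carrier G. \<Sum>a<N. f g * \<tau> (inv g) $$ (i, a) * \<tau> k $$ (a, j))"
          unfolding mult_index_sum[OF T c[OF k] ij] using ij
          by (subst sum.swap) (simp add: T_def sum_distrib_right)
        also have "\<dots> = (\<Sum>g\<in>carrier G. f g * \<tau> (inv g \<otimes> k) $$ (i, j))"
          using mult_index_sum[OF c c[OF k] ij] k
          by (intro sum.cong refl) (simp add: rep_mult[OF irr_rep[OF \<tau>]] sum_distrib_left mult.assoc)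
        also have "\<dots> = (\<Sum>g\<in>carrier G. f (k \<otimes> g) * \<tau> (inv (k \<otimes> g) \<otimes> k) $$ (i, j))"
          by (rule sum_shift[OF k, symmetric])
        also have "\<dots> = (\<Sum>g\<in>carrier G. f (g \<otimes> k) * \<tau> (k \<otimes> inv (g \<otimes> k)) $$ (i, j))"
        proof (rule sum.cong[OF refl])
          fix g assume g: "g \<in> carrier G"
          have "inv (k \<otimes> g) \<otimes> k = inv g" "k \<otimes> inv (g \<otimes> k) = inv g"
            using g k by (simp_all add: inv_mult_group m_assoc) (simp add: m_assoc[symmetric])
          then show "f (k \<otimes> g) * \<tau> (inv (k \<otimes> g) \<otimes> k) $$ (i, j) = f (g \<otimes> k) * \<tau> (k \<otimes> inv (g \<otimes> k)) $$ (i, j)"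
            using class_functionD(3)[OF f k g] by simp
        qed
        also have "\<dots> = (\<Sum>g\<in>carrier G. f g * \<tau> (k \<otimes> inv g) $$ (i, j))" by (rule sum_shift_right[OF k])
        also have "\<dots> = (\<Sum>g\<in>carrier G. \<Sum>a<N. \<tau> k $$ (i, a) * (f g * \<tau> (inv g) $$ (a, j)))"
          using mult_index_sum[OF c[OF k] c ij] k
          by (intro sum.cong refl) (simp add: rep_mult[OF irr_rep[OF \<tau>]] sum_distrib_left mult_ac)
        also have "\<dots> = (\<tau> k * T) $$ (i, j)"
          unfolding mult_index_sum[OF c[OF k] T ij] using ij
          by (subst sum.swap) (simp add: T_def sum_distrib_left)
        finally show "(T * \<tau> k) $$ (i, j) = (\<tau> k * T) $$ (i, j)" .
      qed (use c[OF k] T in auto)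
      obtain d where d: "T = d \<cdot>\<^sub>m 1\<^sub>m N"
        using scalar_endos_complex[OF \<tau>] T com unfolding scalar_endos_def by metis
      have "mtrace T = (\<Sum>g\<in>carrier G. f g * character G \<tau> (inv g))"
        unfolding mtrace_def using c by (simp add: T_def, subst sum.swap)
          (auto simp: character_def sum_distrib_left intro!: sum.cong)
      also have "\<dots> = (\<Sum>g\<in>carrier G. f g * cnj (character G \<tau> g))"
        using Irr_cnj[OF IrrI[OF \<tau>]] by simp
      also have "\<dots> = 0"
        using orth[OF IrrI[OF \<tau>]] finG by (auto simp: cf_inner_def card_eq_0_iff)
      finally have "d = 0" using irr_pos[OF \<tau>] by (simp add: d mtrace_def)
      then have T0: "T = 0\<^sub>m N N" unfolding d by (intro eq_matI) auto
      have "(\<Sum>g\<in>carrier G. f g * character G \<tau> (inv g \<otimes> h)) = (\<Sum>g\<in>carrier G. \<Sum>i<N. \<Sum>a<N. f g * \<tau> (inv g) $$ (i, a) * \<tau> h $$ (a, i))"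
      proof (rule sum.cong[OF refl])
        fix g assume g: "g \<in> carrier G"
        have "character G \<tau> (inv g \<otimes> h) = (\<Sum>i<N. \<Sum>a<N. \<tau> (inv g) $$ (i, a) * \<tau> h $$ (a, i))"
          using g h c[of "inv g"] c[OF h] mult_index_sum[OF c[of "inv g"] c[OF h]]
          by (simp add: character_mtrace mtrace_def rep_mult[OF irr_rep[OF \<tau>]] del: index_mult_mat(1))
        then show "f g * character G \<tau> (inv g \<otimes> h) = (\<Sum>i<N. \<Sum>a<N. f g * \<tau> (inv g) $$ (i, a) * \<tau> h $$ (a, i))"
          by (simp add: sum_distrib_left mult.assoc)
      qed
      also have "\<dots> = (\<Sum>i<N. \<Sum>a<N. \<Sum>g\<in>carrier G. f g * \<tau> (inv g) $$ (i, a) * \<tau> h $$ (a, i))"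
        by (subst sum.swap) (intro sum.cong refl sum.swap)
      also have "\<dots> = (\<Sum>i<N. \<Sum>a<N. T $$ (i, a) * \<tau> h $$ (a, i))"
        by (intro sum.cong refl) (simp add: T_def sum_distrib_right)
      finally show ?thesis by (simp add: T0)
    qed
    obtain rs where rs: "\<forall>(m, \<tau>)\<in>set rs. irreducible_rep G m (\<tau> :: 'a \<Rightarrow> complex mat)"
      "\<forall>g\<in>carrier G. (\<Sum>(m, \<tau>)\<leftarrow>rs. character G \<tau> g) = (if g = \<one> then of_nat (card (carrier G)) else 0)"
      using reg_decomposition by blast
    have "(\<Sum>g\<in>carrier G. f g * (\<Sum>(m, \<tau>)\<leftarrow>rs. character G \<tau> (inv g \<otimes> h))) = 0"
      using rs(1)
    proof (induction rs)
      case (Cons r rs)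
      then show ?case using irr0[of "fst r" "snd r"]
        by (auto simp: case_prod_unfold distrib_left sum.distrib)
    qed simp
    also have "(\<Sum>g\<in>carrier G. f g * (\<Sum>(m, \<tau>)\<leftarrow>rs. character G \<tau> (inv g \<otimes> h)))
      = (\<Sum>g\<in>carrier G. if g = h then f g * of_nat (card (carrier G)) else 0)"
    proof (rule sum.cong[OF refl])
      fix g assume g: "g \<in> carrier G"
      have "inv g \<otimes> h = \<one> \<longleftrightarrow> g = h" using g h
        by (metis inv_closed inv_inv inv_equality l_inv)
      then show "f g * (\<Sum>(m, \<tau>)\<leftarrow>rs. character G \<tau> (inv g \<otimes> h)) = (if g = h then f g * of_nat (card (carrier G)) else 0)"
        using rs(2) g h by simp
    qed
    also have "\<dots> = f h * of_nat (card (carrier G))" using finG h by simp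
    finally show ?thesis using finG h by (auto simp: card_eq_0_iff)
  qed (use class_functionD(1)[OF f] in simp)
qed

lemma cf_inner_add_left: "cf_inner G (f + f') k = cf_inner G f k + cf_inner G f' k"
  by (simp add: cf_inner_def distrib_right sum.distrib add_divide_distrib)
lemma cf_inner_diff_left: "cf_inner G (f - f') k = cf_inner G f k - cf_inner G f' k"
  by (simp add: cf_inner_def left_diff_distrib sum_subtractf diff_divide_distrib)
lemma cf_inner_scale_left: "cf_inner G (cscale c f) k = c * cf_inner G f k"
  by (simp add: cf_inner_def cscale_def sum_distrib_left mult.assoc)
lemma cf_inner_sum_left: "cf_inner G (\<Sum>i\<in>S. cscale (c i) (f i)) k = (\<Sum>i\<in>S. c i * cf_inner G (f i) k)"
proof (induction S rule: infinite_finite_induct)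
  case (insert i S)
  have "(\<Sum>i\<in>insert i S. cscale (c i) (f i)) = cscale (c i) (f i) + (\<Sum>i\<in>S. cscale (c i) (f i))"
    using insert.hyps by simp
  then show ?case using insert by (simp add: cf_inner_add_left cf_inner_scale_left del: plus_fun_apply)
qed (simp_all add: cf_inner_def)
lemma cf_inner_cnj: "cf_inner G f k = cnj (cf_inner G k f)"
  by (simp add: cf_inner_def mult.commute)

text \<open>Every irreducible character occurs in the regular character, because its scalar product with it is
  its degree.\<close>

theorem finite_Irr: "finite (Irr G)"
proof -
  obtain rs where rs: "\<forall>(m, \<tau>)\<in>set rs. irreducible_rep G m (\<tau> :: 'a \<Rightarrow> complex mat)"
    "\<forall>g\<in>carrier G. (\<Sum>(m, \<tau>)\<leftarrow>rs. character G \<tau> g) = (if g = \<one> then of_nat (card (carrier G)) else 0)"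
    using reg_decomposition by blast
  have "Irr G \<subseteq> (\<lambda>(m, \<tau>). character G \<tau>) ` set rs"
  proof
    fix \<chi> assume \<chi>: "\<chi> \<in> Irr G"
    show "\<chi> \<in> (\<lambda>(m, \<tau>). character G \<tau>) ` set rs"
    proof (rule ccontr)
      assume no: "\<chi> \<notin> (\<lambda>(m, \<tau>). character G \<tau>) ` set rs"
      have "(\<Sum>g\<in>carrier G. (\<Sum>(m, \<tau>)\<leftarrow>rs. character G \<tau> g) * cnj (\<chi> g)) = 0"
        using rs(1) no
      proof (induction rs)
        case (Cons r rs)
        obtain m \<tau> where r: "r = (m, \<tau>)" by (cases r)
        then have "character G \<tau> \<in> Irr G" "character G \<tau> \<noteq> \<chi>" using Cons.prems IrrI by force+
        then have "cf_inner G (character G \<tau>) \<chi> = 0" using Irr_orthonormal \<chi> by simp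
        then have "(\<Sum>g\<in>carrier G. character G \<tau> g * cnj (\<chi> g)) = 0"
          using finG by (auto simp: cf_inner_def card_eq_0_iff)
        then show ?case using Cons r by (auto simp: distrib_right sum.distrib)
      qed simp
      also have "(\<Sum>g\<in>carrier G. (\<Sum>(m, \<tau>)\<leftarrow>rs. character G \<tau> g) * cnj (\<chi> g))
        = (\<Sum>g\<in>carrier G. if g = \<one> then of_nat (card (carrier G)) * cnj (\<chi> g) else 0)"
        using rs(2) by (intro sum.cong) auto
      also have "\<dots> = of_nat (card (carrier G)) * cnj (\<chi> \<one>)" using finG by simp
      finally show False using finG Irr_one[OF \<chi>] by (auto simp: card_eq_0_iff)
    qed
  qed
  then show ?thesis by (rule finite_subset) auto
qed

theorem class_function_expansion:
  assumes f: "class_function f"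
  shows "f = (\<Sum>\<chi>\<in>Irr G. cscale (cf_inner G f \<chi>) \<chi>)"
proof -
  let ?s = "\<Sum>\<chi>\<in>Irr G. cscale (cf_inner G f \<chi>) \<chi>"
  have "f - ?s = 0"
  proof (rule class_function_zero)
    show "class_function (f - ?s)"
      unfolding class_function_def
    proof (intro conjI allI impI ballI)
      fix x assume "x \<notin> carrier G"
      then show "(f - ?s) x = 0"
        using class_functionD(1)[OF f] Irr_outside
        by (auto simp: sum_fun_apply cscale_def intro!: sum.neutral)
    next
      fix g x assume "g \<in> carrier G" "x \<in> carrier G"
      then show "(f - ?s) (g \<otimes> x \<otimes> inv g) = (f - ?s) x"
        using class_functionD(2)[OF f] class_functionD(2)[OF Irr_class_function]
        by (auto simp: sum_fun_apply cscale_def intro!: sum.cong)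
    qed
    fix \<psi> assume \<psi>: "\<psi> \<in> Irr G"
    have "(\<Sum>\<chi>\<in>Irr G. cf_inner G f \<chi> * cf_inner G \<chi> \<psi>) = (\<Sum>\<chi>\<in>Irr G. if \<chi> = \<psi> then cf_inner G f \<chi> else 0)"
      using Irr_orthonormal \<psi> by (intro sum.cong) auto
    then show "cf_inner G (f - ?s) \<psi> = 0"
      using finite_Irr \<psi> by (simp add: cf_inner_diff_left cf_inner_sum_left)
  qed
  then show ?thesis by simp
qed

end

section \<open>Projective indecomposable characters and unions of blocks\<close>

context fin_group
begin

lemma conj_nat_pow:
  assumes "g \<in> carrier G" "x \<in> carrier G"
  shows "(g \<otimes> x \<otimes> inv g) [^] (k :: nat) = g \<otimes> x [^] k \<otimes> inv g"
proof (induction k)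
  case (Suc k)
  have "inv g \<otimes> (g \<otimes> y) = y" if "y \<in> carrier G" for y
    using assms that by (simp flip: m_assoc)
  then show ?case using Suc assms by (simp add: m_assoc)
qed (use assms in simp)

lemma conj_eq_one:
  assumes "g \<in> carrier G" "x \<in> carrier G"
  shows "g \<otimes> x \<otimes> inv g = \<one> \<longleftrightarrow> x = \<one>"
proof
  assume "g \<otimes> x \<otimes> inv g = \<one>"
  then have "inv g \<otimes> (g \<otimes> x \<otimes> inv g) \<otimes> g = \<one>" using assms by simp
  then show "x = \<one>" using assms by (simp add: m_assoc) (simp add: m_assoc[symmetric])
qed (use assms in simp)

lemma ord_conj:
  assumes "g \<in> carrier G" "x \<in> carrier G"
  shows "ord (g \<otimes> x \<otimes> inv g) = ord x"
  using assms by (subst ord_unique) (auto simp: conj_nat_pow conj_eq_one pow_eq_id)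

lemma p_regular_conj:
  assumes "g \<in> carrier G" "x \<in> carrier G"
  shows "g \<otimes> x \<otimes> inv g \<in> p_regular p G \<longleftrightarrow> x \<in> p_regular p G"
  using assms by (simp add: p_regular_def ord_conj)

lemma p_regular_inv: "x \<in> p_regular p G \<Longrightarrow> inv x \<in> p_regular p G"
  by (auto simp: p_regular_def)

lemma conj_class_self: "x \<in> carrier G \<Longrightarrow> x \<in> conj_class G x"
  unfolding conj_class_def conjugate_def by (rule image_eqI[of _ _ \<one>]) auto

lemma conjugate_conjugate:
  "g \<in> carrier G \<Longrightarrow> h \<in> carrier G \<Longrightarrow> x \<in> carrier G \<Longrightarrow>
     conjugate G g (conjugate G h x) = conjugate G (g \<otimes> h) x"
  by (simp add: conjugate_def inv_mult_group m_assoc)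

lemma conjugate_one: "x \<in> carrier G \<Longrightarrow> conjugate G \<one> x = x" by (simp add: conjugate_def)

lemma conj_class_subset: "x \<in> carrier G \<Longrightarrow> conj_class G x \<subseteq> carrier G"
  by (auto simp: conj_class_def conjugate_def)

lemma conj_class_eq:
  assumes x: "x \<in> carrier G" and y: "y \<in> conj_class G x"
  shows "conj_class G y = conj_class G x"
proof -
  from y obtain g where g: "g \<in> carrier G" "y = conjugate G g x" by (auto simp: conj_class_def)
  have yG: "y \<in> carrier G" using g x by (simp add: conjugate_def)
  have x': "x = conjugate G (inv g) y" using g x by (simp add: conjugate_conjugate conjugate_one)
  have "conj_class G (conjugate G h z) \<subseteq> conj_class G z" if "h \<in> carrier G" "z \<in> carrier G" for h z
    using that by (auto simp: conj_class_def conjugate_conjugate)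
  note sub = this
  have "conj_class G y \<subseteq> conj_class G x" using sub[OF g(1) x] g(2) by simp
  moreover have "conj_class G x \<subseteq> conj_class G y"
    using sub[of "inv g" y] g(1) yG x'[symmetric] by simp
  ultimately show ?thesis by (rule equalityI)
qed

lemma card_conj_class:
  assumes x: "x \<in> carrier G"
  shows "card (conj_class G x) * card (centralizer G x) = card (carrier G)"
proof -
  let ?f = "\<lambda>g. conjugate G g x"
  have fib: "card {g \<in> carrier G. ?f g = y} = card (centralizer G x)" if "y \<in> ?f ` carrier G" for y
  proof -
    from that obtain g0 where g0: "g0 \<in> carrier G" "y = ?f g0" by blast
    have "bij_betw (\<lambda>c. g0 \<otimes> c) (centralizer G x) {g \<in> carrier G. ?f g = y}"
    proof (rule bij_betw_byWitness[where f' = "\<lambda>g. inv g0 \<otimes> g"])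
      show "\<forall>a\<in>centralizer G x. inv g0 \<otimes> (g0 \<otimes> a) = a"
        using g0 by (auto simp: centralizer_def m_assoc[symmetric])
      show "\<forall>a'\<in>{g \<in> carrier G. ?f g = y}. g0 \<otimes> (inv g0 \<otimes> a') = a'"
        using g0 by (auto simp: m_assoc[symmetric])
      show "(\<otimes>) g0 ` centralizer G x \<subseteq> {g \<in> carrier G. ?f g = y}"
      proof safe
        fix c assume c: "c \<in> centralizer G x"
        then have cG: "c \<in> carrier G" "c \<otimes> x = x \<otimes> c" by (auto simp: centralizer_def)
        show "g0 \<otimes> c \<in> carrier G" using g0 cG by simp
        have "conjugate G c x = x \<otimes> c \<otimes> inv c" using cG by (simp add: conjugate_def)
        then have "conjugate G c x = x" using cG x by (simp add: m_assoc)
        then show "?f (g0 \<otimes> c) = y" using conjugate_conjugate[OF g0(1) cG(1) x] g0 by simp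
      qed
      show "(\<lambda>g. inv g0 \<otimes> g) ` {g \<in> carrier G. ?f g = y} \<subseteq> centralizer G x"
      proof safe
        fix g assume g: "g \<in> carrier G" "y = ?f g"
        let ?c = "inv g0 \<otimes> g"
        have c: "?c \<in> carrier G" using g g0 by simp
        have "conjugate G ?c x = conjugate G (inv g0) (conjugate G g0 x)"
          using conjugate_conjugate[of "inv g0" g x] g g0 x by simp
        also have "\<dots> = x" using conjugate_conjugate[of "inv g0" g0 x] g0 x by (simp add: conjugate_one)
        finally have "?c \<otimes> x \<otimes> inv ?c \<otimes> ?c = x \<otimes> ?c" by (simp add: conjugate_def)
        then have "?c \<otimes> x = x \<otimes> ?c" using c x by (simp add: m_assoc[of "?c \<otimes> x" "inv ?c" ?c] del: inv_mult_group)
        then show "?c \<in> centralizer G x" using c by (simp add: centralizer_def)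
      qed
    qed
    then show ?thesis by (simp add: bij_betw_same_card)
  qed
  have "card (carrier G) = (\<Sum>g\<in>carrier G. 1)" by simp
  also have "\<dots> = (\<Sum>y\<in>?f ` carrier G. \<Sum>g\<in>{g \<in> carrier G. ?f g = y}. 1)"
    by (rule sum.image_gen[OF finG])
  also have "\<dots> = (\<Sum>y\<in>?f ` carrier G. card (centralizer G x))"
    by (rule sum.cong[OF refl]) (simp add: fib)
  finally show ?thesis by (simp add: conj_class_def)
qed

lemma centralizer_pos: "x \<in> carrier G \<Longrightarrow> card (centralizer G x) > 0"
  using card_conj_class[of x] finG by (metis card_gt_0_iff empty_iff gr0I mult_0_right)

text \<open>Indicator functions of classes give column orthogonality, and they are where the factor \<open>|C\<^sub>G(x)|\<close>
  in the divisibility statements comes from.\<close>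

lemma class_indicator:
  assumes x: "x \<in> carrier G"
  defines "h \<equiv> \<lambda>z. if z \<in> conj_class G x then 1 else 0 :: complex"
  shows "class_function h" "\<chi> \<in> Irr G \<Longrightarrow> cf_inner G h \<chi> = cnj (\<chi> x) / of_nat (card (centralizer G x))"
proof -
  have CG: "conj_class G x \<subseteq> carrier G" by (rule conj_class_subset[OF x])
  have "g \<otimes> z \<otimes> inv g \<in> conj_class G x \<longleftrightarrow> z \<in> conj_class G x" if g: "g \<in> carrier G" "z \<in> carrier G" for g z
  proof -
    let ?z = "g \<otimes> z \<otimes> inv g"
    have "?z \<in> conj_class G z" using g by (auto simp: conj_class_def conjugate_def)
    then have e: "conj_class G ?z = conj_class G z" by (rule conj_class_eq[OF g(2)])
    show ?thesis
      using conj_class_eq[OF x] e conj_class_self[OF g(2)] conj_class_self[of ?z] g by (metis inv_closed m_closed)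
  qed
  then show "class_function h" unfolding class_function_def h_def using CG by auto
  assume \<chi>: "\<chi> \<in> Irr G"
  have "(\<Sum>z\<in>carrier G. h z * cnj (\<chi> z)) = (\<Sum>z\<in>conj_class G x. cnj (\<chi> z))"
    using CG finG by (intro sum.mono_neutral_cong_right) (auto simp: h_def)
  also have "\<dots> = (\<Sum>z\<in>conj_class G x. cnj (\<chi> x))"
    using class_functionD(2)[OF Irr_class_function[OF \<chi>]] x by (intro sum.cong) (auto simp: conj_class_def conjugate_def)
  finally have "cf_inner G h \<chi> = of_nat (card (conj_class G x)) * cnj (\<chi> x) / of_nat (card (carrier G))"
    by (simp add: cf_inner_def)
  moreover have "of_nat (card (conj_class G x)) * of_nat (card (centralizer G x)) = (of_nat (card (carrier G)) :: complex)"
    using card_conj_class[OF x] by (metis of_nat_mult)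
  moreover have "of_nat (card (conj_class G x)) \<noteq> (0 :: complex)"
    using conj_class_self[OF x] finite_subset[OF CG finG] by (auto simp: card_eq_0_iff)
  ultimately show "cf_inner G h \<chi> = cnj (\<chi> x) / of_nat (card (centralizer G x))"
    by (metis mult_divide_mult_cancel_left)
qed

lemma column_orthogonality_distinct:
  assumes y: "y \<in> carrier G" and nc: "\<And>g. g \<in> carrier G \<Longrightarrow> g \<otimes> y \<otimes> inv g \<noteq> x"
  shows "(\<Sum>\<chi>\<in>Irr G. \<chi> x * cnj (\<chi> y)) = 0"
proof -
  define h where "h = (\<lambda>z. if z \<in> conj_class G y then 1 else 0 :: complex)"
  note h = class_indicator[OF y, folded h_def]
  have "x \<notin> conj_class G y" using nc by (auto simp: conj_class_def conjugate_def)
  then have "0 = h x" by (simp add: h_def)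
  also have "h x = (\<Sum>\<chi>\<in>Irr G. cscale (cf_inner G h \<chi>) \<chi>) x"
    using class_function_expansion[OF h(1)] by simp
  also have "\<dots> = (\<Sum>\<chi>\<in>Irr G. \<chi> x * cnj (\<chi> y)) / of_nat (card (centralizer G y))"
    by (auto simp: sum_fun_apply cscale_def h(2) sum_divide_distrib intro!: sum.cong)
  finally show ?thesis using centralizer_pos[OF y] by simp
qed

text \<open>Fourier expansion with respect to an orthonormal family.\<close>

lemma span_IrrE:
  assumes "u \<in> cfun.span B" "B \<subseteq> Irr G"
  shows "u = (\<Sum>\<chi>\<in>B. cscale (cf_inner G u \<chi>) \<chi>)" "\<And>\<chi>. \<chi> \<in> Irr G \<Longrightarrow> \<chi> \<notin> B \<Longrightarrow> cf_inner G u \<chi> = 0"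
    "class_function u"
proof -
  have fin: "finite B" using finite_subset[OF assms(2) finite_Irr] .
  from assms(1) obtain c where c: "u = (\<Sum>\<chi>\<in>B. cscale (c \<chi>) \<chi>)" using cfun.span_finite[OF fin] by auto
  have in': "cf_inner G u \<psi> = (if \<psi> \<in> B then c \<psi> else 0)" if \<psi>: "\<psi> \<in> Irr G" for \<psi>
  proof -
    have "cf_inner G u \<psi> = (\<Sum>\<chi>\<in>B. if \<chi> = \<psi> then c \<chi> else 0)"
      unfolding c cf_inner_sum_left using Irr_orthonormal \<psi> assms(2) by (intro sum.cong) auto
    then show ?thesis using fin by simp
  qed
  show "u = (\<Sum>\<chi>\<in>B. cscale (cf_inner G u \<chi>) \<chi>)"
  proof -
    have "(\<Sum>\<chi>\<in>B. cscale (cf_inner G u \<chi>) \<chi>) = (\<Sum>\<chi>\<in>B. cscale (c \<chi>) \<chi>)"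
      using in' assms(2) by (intro sum.cong) auto
    then show ?thesis using c by simp
  qed
  show "cf_inner G u \<chi> = 0" if "\<chi> \<in> Irr G" "\<chi> \<notin> B" for \<chi> using in' that by simp
  show "class_function u"
    unfolding class_function_def c
    using class_functionD(1,2)[OF Irr_class_function] assms(2)
    by (auto simp: sum_fun_apply cscale_def subset_iff intro!: sum.neutral sum.cong)
qed

lemma zspan_IrrE:
  assumes "u \<in> zfun.span B" "B \<subseteq> Irr G"
  shows "\<exists>c. \<forall>x. u x = (\<Sum>\<chi>\<in>B. of_int (c \<chi>) * \<chi> x)" "u \<in> cfun.span B"
proof -
  have fin: "finite B" using finite_subset[OF assms(2) finite_Irr] .
  from assms(1) obtain c where c: "u = (\<Sum>\<chi>\<in>B. zscale (c \<chi>) \<chi>)" using zfun.span_finite[OF fin] by auto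
  then show "\<exists>c. \<forall>x. u x = (\<Sum>\<chi>\<in>B. of_int (c \<chi>) * \<chi> x)"
    by (auto simp: sum_fun_apply zscale_def)
  have "u = (\<Sum>\<chi>\<in>B. cscale (of_int (c \<chi>)) \<chi>)"
    unfolding c by (auto simp: zscale_def cscale_def intro!: sum.cong)
  then show "u \<in> cfun.span B"
    by (simp only:) (intro cfun.span_sum cfun.span_scale cfun.span_base)
qed

end

context modular_group
begin

abbreviation "IB \<equiv> IBr p \<theta> G"
abbreviation "dec \<equiv> decomposition_number p \<theta> G"

lemma zfun_IBr_independent: "zfun.independent IB"
proof
  assume "zfun.dependent IB"
  then obtain t u v where t: "finite t" "t \<subseteq> IB" "(\<Sum>v\<in>t. zscale (u v) v) = 0" "v \<in> t" "u v \<noteq> 0"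
    unfolding zfun.dependent_explicit by blast
  have "(\<Sum>\<phi>\<in>t. of_int (u \<phi>) * \<phi> x) = 0" for x
  proof -
    have "(\<Sum>\<phi>\<in>t. of_int (u \<phi>) * \<phi> x) = (\<Sum>v\<in>t. zscale (u v) v) x"
      by (simp add: zscale_def sum_fun_apply)
    then show ?thesis by (simp add: t(3))
  qed
  then have "of_int (u v) = (0 :: complex)" using IBr_linear_independent[OF t(1,2) _ t(4), of "\<lambda>v. of_int (u v)"] by blast
  then show False using t(5) by simp
qed

text \<open>The decomposition numbers are defined as coordinates in the \<open>\<int>\<close>-span of the irreducible Brauer
  characters, so they have their meaning only because restrictions of characters lie in this span.\<close>

lemma Irr_restriction:
  assumes \<chi>: "\<chi> \<in> Irr G" and x: "x \<in> p_regular p G"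
  shows "\<chi> x = (\<Sum>\<phi>\<in>IB. of_int (dec \<chi> \<phi>) * \<phi> x)"
proof -
  from \<chi> obtain N \<rho> where \<rho>: "irreducible_rep G N \<rho>" "\<chi> = character G \<rho>" by (rule IrrE)
  obtain rs :: "(nat \<times> ('a \<Rightarrow> 'k mat)) list" where rs: "\<forall>(m, \<sigma>)\<in>set rs. irreducible_rep G m \<sigma>"
    "\<And>x. x \<in> p_regular p G \<Longrightarrow> mtrace (\<rho> x) = (\<Sum>(m, \<sigma>)\<leftarrow>rs. brauer_character p \<theta> G \<sigma> x)"
    using decomposition_exists[OF irr_rep[OF \<rho>(1)]] by blast
  have "res_regular p G \<chi> = (\<Sum>(m, \<sigma>)\<leftarrow>rs. brauer_character p \<theta> G \<sigma>)"
  proof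
    fix z
    have e: "(\<Sum>(m, \<sigma>)\<leftarrow>rs. brauer_character p \<theta> G \<sigma>) z = (\<Sum>(m, \<sigma>)\<leftarrow>rs. brauer_character p \<theta> G \<sigma> z)"
      by (induction rs) auto
    show "res_regular p G \<chi> z = (\<Sum>(m, \<sigma>)\<leftarrow>rs. brauer_character p \<theta> G \<sigma>) z"
    proof (cases "z \<in> p_regular p G")
      case True
      then show ?thesis using rs(2)[OF True] p_regularD(1)[OF True]
        unfolding e by (simp add: res_regular_def \<rho>(2) character_mtrace)
    next
      case False
      have "(\<Sum>(m, \<sigma>)\<leftarrow>rs. brauer_character p \<theta> G \<sigma> z) = 0"
        using False by (induction rs) (auto simp: brauer_character_def)
      then show ?thesis unfolding e using False by (simp add: res_regular_def)
    qed
  qed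
  also have "\<dots> \<in> zfun.span IB"
    using rs(1)
  proof (induction rs)
    case (Cons r rs)
    obtain m \<sigma> where r: "r = (m, \<sigma>)" by (cases r)
    then have "brauer_character p \<theta> G \<sigma> \<in> IB" using Cons.prems unfolding IBr_def by auto
    then have "brauer_character p \<theta> G \<sigma> + (\<Sum>(m, \<sigma>)\<leftarrow>rs. brauer_character p \<theta> G \<sigma>) \<in> zfun.span IB"
      using Cons by (intro zfun.span_add) (auto intro: zfun.span_base)
    then show ?case by (simp only: r list.map sum_list.Cons prod.case)
  qed (simp add: zfun.span_zero)
  finally have sp: "res_regular p G \<chi> \<in> zfun.span IB" .
  have "(\<Sum>\<phi>\<in>IB. zscale (dec \<chi> \<phi>) \<phi>) = res_regular p G \<chi>"
    unfolding decomposition_number_def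
    by (rule zfun.sum_representation_eq[OF zfun_IBr_independent sp finite_IBr order_refl])
  then have "res_regular p G \<chi> x = (\<Sum>\<phi>\<in>IB. zscale (dec \<chi> \<phi>) \<phi>) x" by simp
  then show ?thesis using x by (simp add: res_regular_def sum_fun_apply zscale_def)
qed

text \<open>The character of the projective indecomposable module with head affording \<open>\<phi>\<close>, defined by
  Brauer reciprocity as a combination of irreducible characters; projective modules themselves do not
  occur.\<close>

definition PIM :: "('a \<Rightarrow> complex) \<Rightarrow> 'a \<Rightarrow> complex" where
  "PIM \<phi> x = (\<Sum>\<chi>\<in>Irr G. of_int (dec \<chi> \<phi>) * \<chi> x)"

lemma PIM_cscale: "PIM \<phi> = (\<Sum>\<chi>\<in>Irr G. cscale (of_int (dec \<chi> \<phi>)) \<chi>)"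
  by (rule ext) (simp add: PIM_def sum_fun_apply cscale_def)

lemma cf_inner_PIM: "cf_inner G u (PIM \<phi>) = (\<Sum>\<chi>\<in>Irr G. of_int (dec \<chi> \<phi>) * cf_inner G u \<chi>)"
  by (subst (1 2) cf_inner_cnj) (simp add: PIM_cscale cf_inner_sum_left)

text \<open>For y not p-regular, \<open>\<Sum> cnj (PIM \<phi> y) \<phi>(x) = \<Sum> \<chi>(x) cnj (\<chi> y)\<close> is 0 for every p-regular x by column
  orthogonality, and the \<open>\<phi>\<close> are linearly independent.\<close>

lemma PIM_vanishes:
  assumes \<phi>: "\<phi> \<in> IB" and y: "y \<notin> p_regular p G"
  shows "PIM \<phi> y = 0"
proof (cases "y \<in> carrier G")
  case False
  then show ?thesis using Irr_outside by (auto simp: PIM_def intro!: sum.neutral)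
next
  case True
  have "(\<Sum>\<phi>\<in>IB. cnj (PIM \<phi> y) * \<phi> x) = 0" if x: "x \<in> p_regular p G" for x
  proof -
    have "(\<Sum>\<phi>\<in>IB. cnj (PIM \<phi> y) * \<phi> x) = (\<Sum>\<phi>\<in>IB. \<Sum>\<chi>\<in>Irr G. cnj (\<chi> y) * (of_int (dec \<chi> \<phi>) * \<phi> x))"
      unfolding PIM_def cnj_sum sum_distrib_right by (auto intro!: sum.cong)
    also have "\<dots> = (\<Sum>\<chi>\<in>Irr G. cnj (\<chi> y) * (\<Sum>\<phi>\<in>IB. of_int (dec \<chi> \<phi>) * \<phi> x))"
      by (subst sum.swap) (simp add: sum_distrib_left)
    also have "\<dots> = (\<Sum>\<chi>\<in>Irr G. \<chi> x * cnj (\<chi> y))"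
      using Irr_restriction[OF _ x] by (intro sum.cong) auto
    also have "\<dots> = 0"
      by (rule column_orthogonality_distinct[OF True])
        (use p_regular_conj[OF _ True] x y in metis)
    finally show ?thesis .
  qed
  then have "cnj (PIM \<phi> y) = 0"
    using IBr_linear_independent[OF finite_IBr order_refl _ \<phi>, of "\<lambda>\<phi>. cnj (PIM \<phi> y)"] by blast
  then show ?thesis by simp
qed

lemma IBr_class_function:
  assumes "\<phi> \<in> IB" shows "class_function \<phi>"
proof -
  from assms obtain N and \<sigma> :: "'a \<Rightarrow> 'k mat" where \<sigma>: "irreducible_rep G N \<sigma>" "\<phi> = brauer_character p \<theta> G \<sigma>" by (rule IBrE)
  show ?thesis
    unfolding class_function_def
  proof (intro conjI allI impI ballI)
    fix x assume "x \<notin> carrier G" then show "\<phi> x = 0" using IBr_zero[OF assms] p_regularD(1) by blast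
  next
    fix g x assume g: "g \<in> carrier G" and x: "x \<in> carrier G"
    have I: "inverse_mats N (\<sigma> (inv g)) (\<sigma> g)"
      using rep_inv[OF irr_rep[OF \<sigma>(1)], of "inv g"] g by simp
    have "\<sigma> (g \<otimes> x \<otimes> inv g) = \<sigma> g * \<sigma> x * \<sigma> (inv g)"
      using g x by (simp add: rep_mult[OF irr_rep[OF \<sigma>(1)]])
    then have "char_poly (\<sigma> (g \<otimes> x \<otimes> inv g)) = char_poly (\<sigma> x)"
      using char_poly_conj[OF I rep_carrier[OF irr_rep[OF \<sigma>(1)] x]] by simp
    then show "\<phi> (g \<otimes> x \<otimes> inv g) = \<phi> x"
      using g x by (simp add: \<sigma>(2) brauer_character_def p_regular_conj ord_conj)
  qed
qed

text \<open>Expanding the class function \<open>\<phi>\<close> in irreducible characters and these again, on p-regular elements,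
  in Brauer characters gives \<open>\<phi> = \<Sum> \<langle>\<phi>, PIM \<psi>\<rangle> \<psi>\<close>; now compare coefficients.\<close>

theorem IBr_PIM_dual:
  assumes \<phi>: "\<phi> \<in> IB" and \<psi>: "\<psi> \<in> IB"
  shows "cf_inner G \<phi> (PIM \<psi>) = (if \<phi> = \<psi> then 1 else 0)"
proof -
  define a where "a \<psi> = cf_inner G \<phi> (PIM \<psi>) - (if \<phi> = \<psi> then 1 else 0)" for \<psi>
  have "(\<Sum>\<psi>\<in>IB. a \<psi> * \<psi> x) = 0" if x: "x \<in> p_regular p G" for x
  proof -
    have "(\<Sum>\<psi>\<in>IB. cf_inner G \<phi> (PIM \<psi>) * \<psi> x) = (\<Sum>\<psi>\<in>IB. \<Sum>\<chi>\<in>Irr G. cf_inner G \<phi> \<chi> * (of_int (dec \<chi> \<psi>) * \<psi> x))"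
      unfolding cf_inner_PIM sum_distrib_right by (auto intro!: sum.cong)
    also have "\<dots> = (\<Sum>\<chi>\<in>Irr G. cf_inner G \<phi> \<chi> * (\<Sum>\<psi>\<in>IB. of_int (dec \<chi> \<psi>) * \<psi> x))"
      by (subst sum.swap) (simp add: sum_distrib_left)
    also have "\<dots> = (\<Sum>\<chi>\<in>Irr G. cscale (cf_inner G \<phi> \<chi>) \<chi>) x"
      using Irr_restriction[OF _ x] by (auto simp: sum_fun_apply cscale_def intro!: sum.cong)
    also have "\<dots> = \<phi> x" using class_function_expansion[OF IBr_class_function[OF \<phi>]] by simp
    finally have "(\<Sum>\<psi>\<in>IB. cf_inner G \<phi> (PIM \<psi>) * \<psi> x) = \<phi> x" .
    moreover have "(\<Sum>\<psi>\<in>IB. (if \<phi> = \<psi> then 1 else 0) * \<psi> x) = (\<Sum>\<psi>\<in>IB. if \<phi> = \<psi> then \<psi> x else 0)"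
      by (intro sum.cong) auto
    ultimately show ?thesis using finite_IBr \<phi> by (simp add: a_def left_diff_distrib sum_subtractf)
  qed
  then have "a \<psi> = 0" by (rule IBr_linear_independent[OF finite_IBr order_refl _ \<psi>])
  then show ?thesis by (simp add: a_def)
qed

end

locale block_union = modular_group p n \<theta> G
  for p n and \<theta> :: "complex \<Rightarrow> 'k::field" and G (structure) +
  fixes B :: "('a \<Rightarrow> complex) set"
  assumes B: "union_of_blocks p \<theta> G B"
begin

abbreviation "bB \<equiv> IBr_of p \<theta> G B"

lemma B_Irr: "B \<subseteq> Irr G"
proof
  fix \<chi> assume "\<chi> \<in> B"
  with B obtain \<psi> where \<psi>: "\<psi> \<in> Irr G" "(\<psi>, \<chi>) \<in> (block_link p \<theta> G)\<^sup>*"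
    unfolding union_of_blocks_def p_blocks_def quotient_def by blast
  from \<psi>(2) \<psi>(1) show "\<chi> \<in> Irr G" by (induction rule: rtrancl_induct) (auto simp: block_link_def)
qed

lemma B_linked:
  assumes "\<chi> \<in> B" "(\<chi>, \<chi>') \<in> block_link p \<theta> G" shows "\<chi>' \<in> B"
proof -
  from B obtain X where X: "X \<subseteq> p_blocks p \<theta> G" "B = \<Union>X" unfolding union_of_blocks_def by blast
  with assms obtain Y where Y: "Y \<in> X" "\<chi> \<in> Y" by blast
  then obtain \<psi> where "Y = (block_link p \<theta> G)\<^sup>* `` {\<psi>}"
    using X unfolding p_blocks_def quotient_def by blast
  then have "\<chi>' \<in> Y" using Y(2) assms(2) by (auto intro: rtrancl_into_rtrancl)
  then show ?thesis using X Y by blast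
qed

lemma IBr_ofD: "\<phi> \<in> bB \<Longrightarrow> \<phi> \<in> IB" by (simp add: IBr_of_def)
lemma finite_bB: "finite bB" using finite_IBr by (simp add: IBr_of_def)

lemma dec_in_B:
  assumes "\<phi> \<in> bB" "\<chi> \<in> Irr G" "dec \<chi> \<phi> \<noteq> 0" shows "\<chi> \<in> B"
  using assms B_linked B_Irr unfolding IBr_of_def block_link_def by blast

lemma dec_in_bB:
  assumes "\<chi> \<in> B" "\<phi> \<in> IB" "dec \<chi> \<phi> \<noteq> 0" shows "\<phi> \<in> bB"
  using assms by (auto simp: IBr_of_def)

lemma PIM_block:
  assumes "\<phi> \<in> bB" shows "PIM \<phi> x = (\<Sum>\<chi>\<in>B. of_int (dec \<chi> \<phi>) * \<chi> x)"
  unfolding PIM_def using dec_in_B[OF assms] B_Irr finite_Irr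
  by (intro sum.mono_neutral_right) auto

lemma B_restriction:
  assumes \<chi>: "\<chi> \<in> B" and x: "x \<in> p_regular p G"
  shows "\<chi> x = (\<Sum>\<phi>\<in>bB. of_int (dec \<chi> \<phi>) * \<phi> x)"
proof -
  have "\<chi> x = (\<Sum>\<phi>\<in>IB. of_int (dec \<chi> \<phi>) * \<phi> x)" using Irr_restriction[OF _ x] \<chi> B_Irr by blast
  also have "\<dots> = (\<Sum>\<phi>\<in>bB. of_int (dec \<chi> \<phi>) * \<phi> x)"
    using dec_in_bB[OF \<chi>] finite_IBr IBr_ofD by (intro sum.mono_neutral_right) auto
  finally show ?thesis .
qed

lemma PIM_zspan:
  assumes "\<phi> \<in> bB" shows "PIM \<phi> \<in> zfun.span B"
proof -
  have "PIM \<phi> = (\<Sum>\<chi>\<in>B. zscale (dec \<chi> \<phi>) \<chi>)"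
    by (rule ext) (simp add: PIM_block[OF assms] sum_fun_apply zscale_def)
  then show ?thesis by (simp only:) (intro zfun.span_sum zfun.span_scale zfun.span_base)
qed

text \<open>The coefficients are the Cartan invariants. Both sides vanish off the p-regular elements.\<close>

lemma PIM_span_IBr:
  assumes "\<phi> \<in> bB" shows "PIM \<phi> \<in> cfun.span bB"
proof -
  have "PIM \<phi> = (\<Sum>\<psi>\<in>bB. cscale (\<Sum>\<chi>\<in>B. of_int (dec \<chi> \<phi>) * of_int (dec \<chi> \<psi>)) \<psi>)"
  proof
    fix x
    show "PIM \<phi> x = (\<Sum>\<psi>\<in>bB. cscale (\<Sum>\<chi>\<in>B. of_int (dec \<chi> \<phi>) * of_int (dec \<chi> \<psi>)) \<psi>) x"
    proof (cases "x \<in> p_regular p G")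
      case True
      have "PIM \<phi> x = (\<Sum>\<chi>\<in>B. \<Sum>\<psi>\<in>bB. of_int (dec \<chi> \<phi>) * of_int (dec \<chi> \<psi>) * \<psi> x)"
        unfolding PIM_block[OF assms]
        by (rule sum.cong[OF refl], subst B_restriction[OF _ True]) (simp_all add: sum_distrib_left mult.assoc)
      also have "\<dots> = (\<Sum>\<psi>\<in>bB. (\<Sum>\<chi>\<in>B. of_int (dec \<chi> \<phi>) * of_int (dec \<chi> \<psi>)) * \<psi> x)"
        by (subst sum.swap) (simp add: sum_distrib_right)
      finally show ?thesis by (simp add: sum_fun_apply cscale_def)
    next
      case False
      then show ?thesis
        using PIM_vanishes[OF IBr_ofD[OF assms] False] IBr_zero[OF IBr_ofD False]
        by (auto simp: sum_fun_apply cscale_def intro!: sum.neutral)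
    qed
  qed
  then show ?thesis by (simp only:) (intro cfun.span_sum cfun.span_scale cfun.span_base)
qed

text \<open>The abstractly defined dual basis consists of the projective indecomposable characters; by
  uniqueness it is enough to know that they lie in the span of the Brauer characters and have the right
  scalar products.\<close>

theorem dual_basis_PIM: "dual_basis G bB = PIM ` bB"
  unfolding dual_basis_def
proof (rule image_cong[OF refl])
  fix \<phi> assume \<phi>: "\<phi> \<in> bB"
  show "(THE \<psi>. \<psi> \<in> cfun.span bB \<and> (\<forall>\<eta>\<in>bB. cf_inner G \<psi> \<eta> = (if \<eta> = \<phi> then 1 else 0))) = PIM \<phi>"
  proof (rule the_equality)
    have d: "cf_inner G (PIM \<phi>) \<eta> = (if \<eta> = \<phi> then 1 else 0)" if "\<eta> \<in> bB" for \<eta>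
      using IBr_PIM_dual[OF IBr_ofD[OF that] IBr_ofD[OF \<phi>]] by (subst cf_inner_cnj) auto
    then show "PIM \<phi> \<in> cfun.span bB \<and> (\<forall>\<eta>\<in>bB. cf_inner G (PIM \<phi>) \<eta> = (if \<eta> = \<phi> then 1 else 0))"
      using PIM_span_IBr[OF \<phi>] by blast
    fix \<psi> assume \<psi>: "\<psi> \<in> cfun.span bB \<and> (\<forall>\<eta>\<in>bB. cf_inner G \<psi> \<eta> = (if \<eta> = \<phi> then 1 else 0))"
    define D where "D = \<psi> - PIM \<phi>"
    have D: "D \<in> cfun.span bB" unfolding D_def using \<psi> PIM_span_IBr[OF \<phi>] by (intro cfun.span_diff) auto
    have orth: "cf_inner G D \<eta> = 0" if "\<eta> \<in> bB" for \<eta>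
      using \<psi> d[OF that] that by (simp add: D_def cf_inner_diff_left)
    from D obtain c where c: "D = (\<Sum>\<eta>\<in>bB. cscale (c \<eta>) \<eta>)" using cfun.span_finite[OF finite_bB] by auto
    have "cf_inner G D D = cnj (cf_inner G (\<Sum>\<eta>\<in>bB. cscale (c \<eta>) \<eta>) D)"
      by (subst cf_inner_cnj) (simp add: c[symmetric])
    also have "cf_inner G (\<Sum>\<eta>\<in>bB. cscale (c \<eta>) \<eta>) D = (\<Sum>\<eta>\<in>bB. c \<eta> * cnj (cf_inner G D \<eta>))"
      unfolding cf_inner_sum_left by (intro sum.cong refl arg_cong2[of _ _ _ _ "(*)"]) (rule cf_inner_cnj)
    also have "\<dots> = 0" using orth by (intro sum.neutral) auto
    finally have "(\<Sum>x\<in>carrier G. D x * cnj (D x)) = 0" using finG by (auto simp: cf_inner_def card_eq_0_iff)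
    then have "complex_of_real (\<Sum>x\<in>carrier G. (norm (D x))\<^sup>2) = 0"
      by (simp only: of_real_sum complex_norm_square)
    then have "(\<Sum>x\<in>carrier G. (norm (D x))\<^sup>2) = 0" by (simp only: of_real_eq_0_iff)
    then have "\<forall>x\<in>carrier G. (norm (D x))\<^sup>2 = 0" using finG by (subst (asm) sum_nonneg_eq_0_iff) auto
    moreover have "D x = 0" if "x \<notin> carrier G" for x
    proof -
      have "\<eta> x = 0" if "\<eta> \<in> bB" for \<eta> using IBr_zero[OF IBr_ofD[OF that]] \<open>x \<notin> carrier G\<close> p_regularD(1) by blast
      then show ?thesis by (auto simp: c sum_fun_apply cscale_def intro!: sum.neutral)
    qed
    ultimately have "D = 0" by (auto simp: fun_eq_iff)
    then show "\<psi> = PIM \<phi>" by (simp add: D_def)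
  qed
qed

theorem dual_span_vanishes:
  assumes "u \<in> cfun.span (dual_basis G bB)" "x \<notin> p_regular p G" shows "u x = 0"
proof -
  from assms(1) obtain c where "u = (\<Sum>v\<in>PIM ` bB. cscale (c v) v)"
    unfolding dual_basis_PIM using cfun.span_finite[of "PIM ` bB"] finite_bB by auto
  then show ?thesis using PIM_vanishes[OF IBr_ofD assms(2)]
    by (auto simp: sum_fun_apply cscale_def intro!: sum.neutral)
qed

lemma dual_span_in_block: "u \<in> cfun.span (dual_basis G bB) \<Longrightarrow> u \<in> cfun.span B"
proof -
  have "PIM ` bB \<subseteq> cfun.span B" using PIM_zspan zspan_IrrE(2)[OF _ B_Irr] by blast
  then have "cfun.span (PIM ` bB) \<subseteq> cfun.span B" by (rule cfun.span_minimal) (rule cfun.subspace_span)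
  then show "u \<in> cfun.span (dual_basis G bB) \<Longrightarrow> u \<in> cfun.span B" unfolding dual_basis_PIM by blast
qed

text \<open>For u in the block, the Brauer characters occurring on p-regular elements are those of the block, with
  the scalar products with the projective indecomposable characters as coefficients.\<close>

theorem block_restriction:
  assumes u: "u \<in> cfun.span B" and x: "x \<in> p_regular p G"
  shows "u x = (\<Sum>\<phi>\<in>bB. cf_inner G u (PIM \<phi>) * \<phi> x)"
proof -
  have "u x = (\<Sum>\<chi>\<in>B. cf_inner G u \<chi> * \<chi> x)"
    using arg_cong[OF span_IrrE(1)[OF u B_Irr], of "\<lambda>f. f x"] by (simp add: sum_fun_apply cscale_def)
  also have "\<dots> = (\<Sum>\<chi>\<in>B. \<Sum>\<phi>\<in>bB. of_int (dec \<chi> \<phi>) * cf_inner G u \<chi> * \<phi> x)"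
    by (rule sum.cong[OF refl], subst B_restriction[OF _ x]) (auto simp: sum_distrib_left intro!: sum.cong)
  also have "\<dots> = (\<Sum>\<phi>\<in>bB. (\<Sum>\<chi>\<in>B. of_int (dec \<chi> \<phi>) * cf_inner G u \<chi>) * \<phi> x)"
    by (subst sum.swap) (simp add: sum_distrib_right)
  also have "\<dots> = (\<Sum>\<phi>\<in>bB. cf_inner G u (PIM \<phi>) * \<phi> x)"
  proof (rule sum.cong[OF refl])
    fix \<phi> assume \<phi>: "\<phi> \<in> bB"
    have "(\<Sum>\<chi>\<in>B. of_int (dec \<chi> \<phi>) * cf_inner G u \<chi>) = (\<Sum>\<chi>\<in>Irr G. of_int (dec \<chi> \<phi>) * cf_inner G u \<chi>)"
      using dec_in_B[OF \<phi>] B_Irr finite_Irr by (intro sum.mono_neutral_left) auto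
    then show "(\<Sum>\<chi>\<in>B. of_int (dec \<chi> \<phi>) * cf_inner G u \<chi>) * \<phi> x = cf_inner G u (PIM \<phi>) * \<phi> x"
      by (simp add: cf_inner_PIM)
  qed
  finally show ?thesis .
qed

end

section \<open>Values divisible by centralizer orders up to a factor prime to p\<close>

context modular_group
begin

text \<open>The eigenvalues are 0 or m-th roots of unity.\<close>

lemma trace_cyc_of_pow:
  fixes A :: "complex mat"
  assumes A: "A \<in> carrier_mat N N" and pw: "A ^\<^sub>m (m + 1) = A ^\<^sub>m 1" and m: "m dvd n"
  shows "mtrace A \<in> cyclotomic_ring n"
proof -
  obtain es where es: "char_poly A = (\<Prod>e\<leftarrow>es. [:- e, 1:])" using char_poly_factorized[OF A] by blast
  have "e \<in> cyclotomic_ring n" if "e \<in> set es" for e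
  proof (cases "e = 0")
    case False
    have "e ^ (m + 1) = e ^ 1"
      using eigenvalue_pow_root[OF A pw] that unfolding es by (auto simp: poly_prod_list prod_list_zero_iff)
    then have "e ^ m = 1" using False by simp
    then show ?thesis by (rule cyc_root_of_unity[OF _ m n])
  qed (simp add: cyc_0)
  then have "(\<Sum>e\<leftarrow>es. e ^ 1) \<in> cyclotomic_ring n" by (intro cyc_sum_list) auto
  then show ?thesis using mtrace_pow_split[OF A es, of 1] A by simp
qed

lemma Irr_cyc:
  assumes "\<chi> \<in> Irr G" shows "\<chi> x \<in> cyclotomic_ring n"
proof (cases "x \<in> carrier G")
  case True
  from assms obtain N \<rho> where \<rho>: "irreducible_rep G N \<rho>" "\<chi> = character G \<rho>" by (rule IrrE)
  have "\<rho> x ^\<^sub>m (ord x + 1) = \<rho> x ^\<^sub>m 1"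
    using rep_ord[OF irr_rep[OF \<rho>(1)] True] rep_carrier[OF irr_rep[OF \<rho>(1)] True] by simp
  from trace_cyc_of_pow[OF rep_carrier[OF irr_rep[OF \<rho>(1)] True] this exp[OF True]]
  show ?thesis using True by (simp add: \<rho>(2) character_mtrace)
qed (use Irr_outside[OF assms] cyc_0 in simp)

text \<open>The average of \<open>\<rho> u\<close> over P is the projection E onto the vectors fixed by P. It commutes with \<open>\<rho> x\<close>,
  so the number in question is the trace of \<open>\<rho> x\<close> on this subspace. The trace is computed from
  \<open>A = \<rho> x * E\<close>, which satisfies \<open>A\<^bsup>ord x + 1\<^esup> = A\<close>.\<close>

lemma subgroup_average_cyc:
  assumes \<rho>: "matrix_rep G N (\<rho> :: 'a \<Rightarrow> complex mat)" and x: "x \<in> carrier G"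
    and P: "subgroup P G" and com: "\<And>u. u \<in> P \<Longrightarrow> u \<otimes> x = x \<otimes> u"
  shows "(\<Sum>u\<in>P. mtrace (\<rho> (x \<otimes> u))) / of_nat (card P) \<in> cyclotomic_ring n"
proof -
  note c = rep_carrier[OF \<rho>]
  have PG: "P \<subseteq> carrier G" using P by (rule subgroup.subset)
  then have PGu: "u \<in> carrier G" if "u \<in> P" for u using that by blast
  have finP: "finite P" using PG finG by (rule finite_subset)
  have cP: "card P > 0" using finP subgroup.one_closed[OF P] by (auto simp: card_gt_0_iff)
  define E where "E = mat N N (\<lambda>(i, j). (\<Sum>u\<in>P. \<rho> u $$ (i, j)) / of_nat (card P))"
  have E: "E \<in> carrier_mat N N" by (simp add: E_def)
  have Er: "(E * \<rho> g) $$ (i, j) = (\<Sum>u\<in>P. \<rho> (u \<otimes> g) $$ (i, j)) / of_nat (card P)"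
    if g: "g \<in> carrier G" and ij: "i < N" "j < N" for g i j
  proof -
    have "(E * \<rho> g) $$ (i, j) = (\<Sum>a<N. (\<Sum>u\<in>P. \<rho> u $$ (i, a) * \<rho> g $$ (a, j)) / of_nat (card P))"
      unfolding mult_index_sum[OF E c[OF g] ij] using ij by (simp add: E_def sum_distrib_right)
    also have "\<dots> = (\<Sum>u\<in>P. \<Sum>a<N. \<rho> u $$ (i, a) * \<rho> g $$ (a, j)) / of_nat (card P)"
      by (subst sum.swap) (simp add: sum_divide_distrib)
    also have "(\<Sum>u\<in>P. \<Sum>a<N. \<rho> u $$ (i, a) * \<rho> g $$ (a, j)) = (\<Sum>u\<in>P. \<rho> (u \<otimes> g) $$ (i, j))"
      using mult_index_sum[OF c c[OF g] ij] PGu g by (intro sum.cong refl) (simp add: rep_mult[OF \<rho>])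
    finally show ?thesis .
  qed
  have rE: "(\<rho> g * E) $$ (i, j) = (\<Sum>u\<in>P. \<rho> (g \<otimes> u) $$ (i, j)) / of_nat (card P)"
    if g: "g \<in> carrier G" and ij: "i < N" "j < N" for g i j
  proof -
    have "(\<rho> g * E) $$ (i, j) = (\<Sum>a<N. (\<Sum>u\<in>P. \<rho> g $$ (i, a) * \<rho> u $$ (a, j)) / of_nat (card P))"
      unfolding mult_index_sum[OF c[OF g] E ij] using ij by (simp add: E_def sum_distrib_left)
    also have "\<dots> = (\<Sum>u\<in>P. \<Sum>a<N. \<rho> g $$ (i, a) * \<rho> u $$ (a, j)) / of_nat (card P)"
      by (subst sum.swap) (simp add: sum_divide_distrib)
    also have "(\<Sum>u\<in>P. \<Sum>a<N. \<rho> g $$ (i, a) * \<rho> u $$ (a, j)) = (\<Sum>u\<in>P. \<rho> (g \<otimes> u) $$ (i, j))"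
      using mult_index_sum[OF c[OF g] c ij] PGu g by (intro sum.cong refl) (simp add: rep_mult[OF \<rho>])
    finally show ?thesis .
  qed
  have Ev: "E * \<rho> v = E" if v: "v \<in> P" for v
  proof (rule eq_matI)
    fix i j assume "i < dim_row E" "j < dim_col E"
    then have ij: "i < N" "j < N" using E by auto
    have "(\<Sum>u\<in>P. \<rho> (u \<otimes> v) $$ (i, j)) = (\<Sum>u\<in>P. \<rho> u $$ (i, j))"
      by (rule sum.reindex_bij_witness[of _ "\<lambda>u. u \<otimes> inv v" "\<lambda>u. u \<otimes> v"])
        (use v PGu subgroup.m_closed[OF P] subgroup.m_inv_closed[OF P] in \<open>auto simp: m_assoc\<close>)
    then show "(E * \<rho> v) $$ (i, j) = E $$ (i, j)" using Er[OF PGu[OF v] ij] ij by (simp add: E_def)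
  qed (use E c[OF PGu[OF v]] in auto)
  have EE: "E * E = E"
  proof (rule eq_matI)
    fix i j assume "i < dim_row E" "j < dim_col E"
    then have ij: "i < N" "j < N" using E by auto
    have "(E * E) $$ (i, j) = (\<Sum>a<N. (\<Sum>v\<in>P. E $$ (i, a) * \<rho> v $$ (a, j)) / of_nat (card P))"
      unfolding mult_index_sum[OF E E ij]
      by (intro sum.cong refl) (use ij in \<open>simp add: E_def sum_distrib_left\<close>)
    also have "\<dots> = (\<Sum>v\<in>P. \<Sum>a<N. E $$ (i, a) * \<rho> v $$ (a, j)) / of_nat (card P)"
      by (subst sum.swap) (simp add: sum_divide_distrib)
    also have "(\<Sum>v\<in>P. \<Sum>a<N. E $$ (i, a) * \<rho> v $$ (a, j)) = (\<Sum>v\<in>P. E $$ (i, j))"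
    proof (rule sum.cong[OF refl])
      fix v assume v: "v \<in> P"
      show "(\<Sum>a<N. E $$ (i, a) * \<rho> v $$ (a, j)) = E $$ (i, j)"
        using mult_index_sum[OF E c[OF PGu[OF v]] ij] Ev[OF v] by simp
    qed
    finally show "(E * E) $$ (i, j) = E $$ (i, j)" using cP by simp
  qed (use E in auto)
  have xE: "\<rho> x * E = E * \<rho> x"
  proof (rule eq_matI)
    fix i j assume "i < dim_row (E * \<rho> x)" "j < dim_col (E * \<rho> x)"
    then have ij: "i < N" "j < N" using E c[OF x] by auto
    show "(\<rho> x * E) $$ (i, j) = (E * \<rho> x) $$ (i, j)"
      unfolding Er[OF x ij] rE[OF x ij] using com by simp
  qed (use E c[OF x] in auto)
  define A where "A = \<rho> x * E"
  have A: "A \<in> carrier_mat N N" using c[OF x] E by (simp add: A_def)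
  have Ak: "A ^\<^sub>m (k + 1) = \<rho> x ^\<^sub>m (k + 1) * E" for k
  proof (induction k)
    case 0
    then show ?case using A c[OF x] by (simp add: A_def)
  next
    case (Suc k)
    define R where "R = \<rho> x ^\<^sub>m (k + 1)"
    have R: "R \<in> carrier_mat N N" unfolding R_def by (rule pow_carrier_mat[OF c[OF x]])
    have "A ^\<^sub>m (Suc k + 1) = (R * E) * (\<rho> x * E)" using Suc by (simp add: A_def R_def)
    also have "\<dots> = (R * E) * (E * \<rho> x)" by (simp add: xE)
    also have "\<dots> = R * ((E * E) * \<rho> x)" using R E c[OF x] by (simp add: assoc_mult_mat[of _ N N _ N _ N])
    also have "\<dots> = R * (\<rho> x * E)" by (simp add: EE xE)
    also have "\<dots> = (R * \<rho> x) * E" using R E c[OF x] by (simp add: assoc_mult_mat[of _ N N _ N _ N])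
    also have "R * \<rho> x = \<rho> x ^\<^sub>m (Suc k + 1)" by (simp add: R_def)
    finally show ?case .
  qed
  have rx: "\<rho> x ^\<^sub>m (ord x + 1) = \<rho> x" using rep_ord[OF \<rho> x] c[OF x] by simp
  have "A ^\<^sub>m (ord x + 1) = A" unfolding Ak rx by (simp add: A_def)
  then have "A ^\<^sub>m (ord x + 1) = A ^\<^sub>m 1" using A by simp
  then have "mtrace A \<in> cyclotomic_ring n" by (rule trace_cyc_of_pow[OF A _ exp[OF x]])
  moreover have "mtrace A = (\<Sum>u\<in>P. mtrace (\<rho> (x \<otimes> u))) / of_nat (card P)"
  proof -
    have "mtrace A = (\<Sum>i<N. (\<Sum>u\<in>P. \<rho> (x \<otimes> u) $$ (i, i)) / of_nat (card P))"
      using A c[OF x] by (auto simp: mtrace_def A_def rE[OF x] simp del: index_mult_mat(1) intro!: sum.cong)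
    also have "\<dots> = (\<Sum>u\<in>P. \<Sum>i<N. \<rho> (x \<otimes> u) $$ (i, i)) / of_nat (card P)"
      by (subst sum.swap) (simp add: sum_divide_distrib)
    also have "(\<Sum>u\<in>P. \<Sum>i<N. \<rho> (x \<otimes> u) $$ (i, i)) = (\<Sum>u\<in>P. mtrace (\<rho> (x \<otimes> u)))"
    proof (rule sum.cong[OF refl])
      fix u assume "u \<in> P"
      then have "\<rho> (x \<otimes> u) \<in> carrier_mat N N" using c x PGu by simp
      then show "(\<Sum>i<N. \<rho> (x \<otimes> u) $$ (i, i)) = mtrace (\<rho> (x \<otimes> u))" by (simp add: mtrace_def)
    qed
    finally show ?thesis .
  qed
  ultimately show ?thesis by simp
qed

lemma centralizer_subgroup: "x \<in> carrier G \<Longrightarrow> subgroup (centralizer G x) G"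
proof (rule subgroupI)
  assume x: "x \<in> carrier G"
  show "centralizer G x \<subseteq> carrier G" by (auto simp: centralizer_def)
  show "centralizer G x \<noteq> {}" using x by (auto simp: centralizer_def intro!: exI[of _ \<one>])
  fix a b assume a: "a \<in> centralizer G x" and b: "b \<in> centralizer G x"
  have aa: "a \<in> carrier G" "a \<otimes> x = x \<otimes> a" and bb: "b \<in> carrier G" "b \<otimes> x = x \<otimes> b"
    using a b by (auto simp: centralizer_def)
  have "a \<otimes> b \<otimes> x = a \<otimes> (x \<otimes> b)" using aa bb x by (simp add: m_assoc)
  also have "\<dots> = (x \<otimes> a) \<otimes> b" using aa bb x by (simp flip: m_assoc)
  finally show "a \<otimes> b \<in> centralizer G x" using aa bb x by (simp add: centralizer_def m_assoc)
next
  fix a assume x: "x \<in> carrier G" and a: "a \<in> centralizer G x"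
  have aa: "a \<in> carrier G" "a \<otimes> x = x \<otimes> a" using a by (auto simp: centralizer_def)
  have "x \<otimes> inv a = inv a \<otimes> (a \<otimes> x) \<otimes> inv a" using aa(1) x by (simp flip: m_assoc)
  also have "\<dots> = inv a \<otimes> (x \<otimes> a) \<otimes> inv a" using aa(2) by simp
  also have "\<dots> = inv a \<otimes> x" using aa(1) x by (simp add: m_assoc)
  finally show "inv a \<in> centralizer G x" using aa by (simp add: centralizer_def)
qed

lemma sylow_centralizer:
  assumes x: "x \<in> carrier G"
  shows "\<exists>P r a. subgroup P G \<and> P \<subseteq> centralizer G x \<and> card (centralizer G x) = card P * r \<and> coprime r p
     \<and> r > 0 \<and> card P = p ^ a"
proof -
  let ?C = "centralizer G x"
  let ?H = "G\<lparr>carrier := ?C\<rparr>"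
  note sC = centralizer_subgroup[OF x]
  have fin: "finite ?C" using finG by (rule finite_subset[rotated]) (auto simp: centralizer_def)
  have c0: "card ?C > 0" using fin subgroup.one_closed[OF sC] by (auto simp: card_gt_0_iff)
  define a where "a = multiplicity p (card ?C)"
  define r where "r = card ?C div p ^ a"
  have cr: "card ?C = p ^ a * r" unfolding r_def a_def by (simp add: multiplicity_dvd)
  have "\<not> p dvd r"
    unfolding r_def a_def using p c0 by (metis multiplicity_decompose not_prime_unit gr_implies_not0)
  then have cop: "coprime r p" using p by (metis coprime_commute prime_imp_coprime)
  have "Coset.order ?H = p ^ a * r" using cr by (simp add: Coset.order_def)
  from sylow_thm[OF p subgroup_imp_group[OF sC] this] fin obtain P where P: "subgroup P ?H" "card P = p ^ a"
    by auto
  have "subgroup P G" by (rule incl_subgroup[OF sC P(1)])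
  moreover have "P \<subseteq> ?C" using subgroup.subset[OF P(1)] by simp
  moreover have "r > 0" using c0 cr by (auto intro: Nat.gr0I)
  ultimately show ?thesis using cr cop P(2) by (intro exI[of _ P] exI[of _ r] exI[of _ a]) simp
qed

text \<open>Let x be p-regular and P a Sylow p-subgroup of its centralizer. For \<open>u \<noteq> 1\<close> in P the element \<open>x u\<close>
  is not p-regular, so f vanishes there and \<open>f x = \<Sum> f (x u)\<close>, the sum over P. By \<open>subgroup_average_cyc\<close> this sum is
  divisible by the order of P; the index of P in the centralizer is prime to p.\<close>

theorem vanishing_character_divisible:
  assumes f: "f \<in> zfun.span (Irr G)" and van: "\<And>y. y \<notin> p_regular p G \<Longrightarrow> f y = 0" and x: "x \<in> carrier G"
  shows "f x / of_nat (card (centralizer G x)) \<in> cyc_local p n"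
proof (cases "x \<in> p_regular p G")
  case False
  then show ?thesis using van loc_cyc[OF cyc_0] by simp
next
  case True
  from f obtain c where c: "\<And>x. f x = (\<Sum>\<chi>\<in>Irr G. of_int (c \<chi>) * \<chi> x)"
    using zspan_IrrE(1)[OF f order_refl] by blast
  from sylow_centralizer[OF x] obtain P r a where P: "subgroup P G" "P \<subseteq> centralizer G x"
    and cr: "card (centralizer G x) = card P * r" "coprime r p" "r > 0" and pa: "card P = p ^ a" by blast
  have Pc: "u \<in> carrier G" "u \<otimes> x = x \<otimes> u" if "u \<in> P" for u using P(2) that by (auto simp: centralizer_def)
  have finP: "finite P" using finite_subset[OF subgroup.subset[OF P(1)] finG] .
  have zero: "f (x \<otimes> u) = 0" if u: "u \<in> P" "u \<noteq> \<one>" for u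
  proof (rule van, rule notI)
    assume reg: "x \<otimes> u \<in> p_regular p G"
    let ?d = "ord (x \<otimes> u)" and ?m = "ord x"
    have uG: "u \<in> carrier G" "x \<otimes> u = u \<otimes> x" using Pc[OF u(1)] by auto
    have "(x \<otimes> u) [^] (?d * ?m) = \<one>"
      using p_regularD(4)[OF reg] uG x by (simp add: nat_pow_pow[symmetric])
    moreover have "(x \<otimes> u) [^] (?d * ?m) = x [^] (?d * ?m) \<otimes> u [^] (?d * ?m)"
      using pow_mult_distrib[OF uG(2) x uG(1)] by simp
    moreover have "x [^] (?d * ?m) = \<one>" using x by (simp add: pow_eq_id)
    ultimately have "u [^] (?d * ?m) = \<one>" using uG(1) by (metis l_one nat_pow_closed)
    then have "ord u dvd ?d * ?m" using pow_eq_id[OF uG(1)] by simp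
    moreover have "coprime (?d * ?m) p" using p_regularD(3)[OF reg] p_regularD(3)[OF True] by simp
    ultimately have "coprime (ord u) p" by (meson coprime_divisors dvd_refl)
    moreover have "u [^] card P = \<one>"
    proof -
      interpret PP: group "G\<lparr>carrier := P\<rparr>" by (rule subgroup_imp_group[OF P(1)])
      have "u [^]\<^bsub>G\<lparr>carrier := P\<rparr>\<^esub> Coset.order (G\<lparr>carrier := P\<rparr>) = \<one>\<^bsub>G\<lparr>carrier := P\<rparr>\<^esub>"
        using PP.pow_order_eq_1[of u] u by simp
      then show ?thesis using nat_pow_consistent[of u "card P" P] by (simp add: Coset.order_def)
    qed
    then have "ord u dvd p ^ a" using pow_eq_id[OF uG(1)] pa by simp
    moreover from \<open>coprime (ord u) p\<close> have "coprime (ord u) (p ^ a)" by simp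
    ultimately have "ord u dvd 1" using coprime_common_divisor[of "ord u" "p ^ a" "ord u"] by simp
    then have "ord u = 1" by simp
    then show False using u ord_eq_1[OF uG(1)] by simp
  qed
  have "(\<Sum>u\<in>P. f (x \<otimes> u)) = (\<Sum>u\<in>P. if u = \<one> then f x else 0)"
    using zero x by (intro sum.cong) auto
  also have "\<dots> = f x" using finP subgroup.one_closed[OF P(1)] by simp
  finally have fx: "f x = (\<Sum>u\<in>P. f (x \<otimes> u))" by simp
  have "f x / of_nat (card P) = (\<Sum>\<chi>\<in>Irr G. of_int (c \<chi>) * ((\<Sum>u\<in>P. \<chi> (x \<otimes> u)) / of_nat (card P)))"
  proof -
    have "(\<Sum>u\<in>P. f (x \<otimes> u)) = (\<Sum>u\<in>P. \<Sum>\<chi>\<in>Irr G. of_int (c \<chi>) * \<chi> (x \<otimes> u))"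
      by (rule sum.cong[OF refl], rule c)
    also have "\<dots> = (\<Sum>\<chi>\<in>Irr G. of_int (c \<chi>) * (\<Sum>u\<in>P. \<chi> (x \<otimes> u)))"
      by (subst sum.swap) (simp add: sum_distrib_left)
    finally have e: "(\<Sum>u\<in>P. f (x \<otimes> u)) = (\<Sum>\<chi>\<in>Irr G. of_int (c \<chi>) * (\<Sum>u\<in>P. \<chi> (x \<otimes> u)))" .
    show ?thesis unfolding fx e by (subst sum_divide_distrib) simp
  qed
  also have "\<dots> \<in> cyclotomic_ring n"
  proof (intro cyc_sum cyc_mult cyc_of_int)
    fix \<chi> assume "\<chi> \<in> Irr G"
    then obtain N \<rho> where \<rho>: "irreducible_rep G N \<rho>" "\<chi> = character G \<rho>" by (rule IrrE)
    have "(\<Sum>u\<in>P. \<chi> (x \<otimes> u)) = (\<Sum>u\<in>P. mtrace (\<rho> (x \<otimes> u)))"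
      using Pc x by (intro sum.cong refl) (simp add: \<rho>(2) character_mtrace)
    then show "(\<Sum>u\<in>P. \<chi> (x \<otimes> u)) / of_nat (card P) \<in> cyclotomic_ring n"
      using subgroup_average_cyc[OF irr_rep[OF \<rho>(1)] x P(1) Pc(2)] by simp
  qed
  finally have "f x / of_nat (card P) / of_nat r \<in> cyc_local p n" by (intro loc_div loc_cyc cr)
  then show ?thesis by (simp add: cr)
qed

end

context block_union
begin

lemma PIM_zspan_Irr: "\<phi> \<in> bB \<Longrightarrow> PIM \<phi> \<in> zfun.span (Irr G)"
  using PIM_zspan zfun.span_mono[OF B_Irr] by blast

text \<open>The coefficient at z of the central idempotent of the group algebra that belongs to B.\<close>

definition block_idem :: "'a \<Rightarrow> complex" where
  "block_idem z = (\<Sum>\<chi>\<in>B. \<chi> \<one> * \<chi> (inv z)) / of_nat (card (carrier G))"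

lemma centralizer_one: "centralizer G \<one> = carrier G" by (auto simp: centralizer_def)

lemma one_regular: "\<one> \<in> p_regular p G" by (simp add: p_regular_def)

text \<open>Osima's theorem. On p-regular elements the coefficient is \<open>\<Sum> PIM \<phi> 1 \<cdot> \<phi> (inv z) / |G|\<close>, and \<open>PIM \<phi> 1\<close>
  is divisible by \<open>|G|\<close>. Exchanging the roles of 1 and \<open>inv z\<close> in this computation shows that it is 0
  on all other elements, because \<open>PIM \<phi>\<close> vanishes there.\<close>

theorem block_idem_local:
  assumes z: "z \<in> carrier G" shows "block_idem z \<in> cyc_local p n"
proof (cases "z \<in> p_regular p G")
  case True
  have "(\<Sum>\<chi>\<in>B. \<chi> \<one> * \<chi> (inv z)) = (\<Sum>\<chi>\<in>B. \<Sum>\<phi>\<in>bB. of_int (dec \<chi> \<phi>) * \<chi> \<one> * \<phi> (inv z))"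
    by (rule sum.cong[OF refl], subst B_restriction[OF _ p_regular_inv[OF True]])
      (auto simp: sum_distrib_left mult_ac)
  also have "\<dots> = (\<Sum>\<phi>\<in>bB. PIM \<phi> \<one> * \<phi> (inv z))"
    by (subst sum.swap) (simp add: PIM_block sum_distrib_right)
  finally have "block_idem z = (\<Sum>\<phi>\<in>bB. PIM \<phi> \<one> / of_nat (card (carrier G)) * \<phi> (inv z))"
    by (simp add: block_idem_def sum_divide_distrib)
  also have "\<dots> \<in> cyc_local p n"
  proof (intro loc_sum loc_mult)
    fix \<phi> assume \<phi>: "\<phi> \<in> bB"
    show "PIM \<phi> \<one> / of_nat (card (carrier G)) \<in> cyc_local p n"
      using vanishing_character_divisible[OF PIM_zspan_Irr[OF \<phi>] PIM_vanishes[OF IBr_ofD[OF \<phi>]] one_closed]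
      by (simp add: centralizer_one)
    show "\<phi> (inv z) \<in> cyc_local p n" by (intro loc_cyc IBr_cyc IBr_ofD \<phi>)
  qed
  finally show ?thesis .
next
  case False
  then have nr: "inv z \<notin> p_regular p G" using p_regular_inv[of "inv z"] z by auto
  have "(\<Sum>\<chi>\<in>B. \<chi> \<one> * \<chi> (inv z)) = (\<Sum>\<chi>\<in>B. \<Sum>\<phi>\<in>bB. of_int (dec \<chi> \<phi>) * \<chi> (inv z) * \<phi> \<one>)"
    by (rule sum.cong[OF refl], subst B_restriction[OF _ one_regular])
      (auto simp: sum_distrib_left sum_distrib_right mult_ac)
  also have "\<dots> = (\<Sum>\<phi>\<in>bB. PIM \<phi> (inv z) * \<phi> \<one>)"
    by (subst sum.swap) (simp add: PIM_block sum_distrib_right)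
  also have "\<dots> = 0" using PIM_vanishes[OF IBr_ofD nr] by (intro sum.neutral) auto
  finally show ?thesis using loc_cyc[OF cyc_0] by (simp add: block_idem_def)
qed

text \<open>The projection is convolution with the block idempotent.\<close>

theorem block_projection_local:
  assumes h: "class_function h" and hl: "\<And>x. x \<in> carrier G \<Longrightarrow> h x \<in> cyc_local p n" and y: "y \<in> carrier G"
  shows "(\<Sum>\<chi>\<in>B. cf_inner G h \<chi> * \<chi> y) \<in> cyc_local p n"
proof -
  have G0: "of_nat (card (carrier G)) \<noteq> (0 :: complex)" using finG by (auto simp: card_eq_0_iff)
  have "(\<Sum>z\<in>carrier G. block_idem z * h (z \<otimes> y))
    = (\<Sum>z\<in>carrier G. \<Sum>\<chi>\<in>B. \<Sum>\<psi>\<in>Irr G. \<chi> \<one> * cf_inner G h \<psi> / of_nat (card (carrier G)) * (\<chi> (inv z) * \<psi> (z \<otimes> y)))"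
  proof (rule sum.cong[OF refl])
    fix z
    have "h (z \<otimes> y) = (\<Sum>\<psi>\<in>Irr G. cf_inner G h \<psi> * \<psi> (z \<otimes> y))"
      using arg_cong[OF class_function_expansion[OF h], of "\<lambda>f. f (z \<otimes> y)"] by (simp add: sum_fun_apply cscale_def)
    then show "block_idem z * h (z \<otimes> y)
        = (\<Sum>\<chi>\<in>B. \<Sum>\<psi>\<in>Irr G. \<chi> \<one> * cf_inner G h \<psi> / of_nat (card (carrier G)) * (\<chi> (inv z) * \<psi> (z \<otimes> y)))"
      unfolding block_idem_def sum_divide_distrib sum_distrib_right
      by (auto simp: sum_distrib_left mult_ac intro!: sum.cong)
  qed
  also have "\<dots> = (\<Sum>\<chi>\<in>B. \<Sum>\<psi>\<in>Irr G. \<Sum>z\<in>carrier G. \<chi> \<one> * cf_inner G h \<psi> / of_nat (card (carrier G)) * (\<chi> (inv z) * \<psi> (z \<otimes> y)))"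
    by (subst sum.swap, rule sum.cong[OF refl], rule sum.swap)
  also have "\<dots> = (\<Sum>\<chi>\<in>B. \<Sum>\<psi>\<in>Irr G. if \<chi> = \<psi> then cf_inner G h \<chi> * \<chi> y else 0)"
  proof (intro sum.cong refl)
    fix \<chi> \<psi> assume \<chi>: "\<chi> \<in> B" and \<psi>: "\<psi> \<in> Irr G"
    have "\<chi> \<in> Irr G" using \<chi> B_Irr by blast
    then show "(\<Sum>z\<in>carrier G. \<chi> \<one> * cf_inner G h \<psi> / of_nat (card (carrier G)) * (\<chi> (inv z) * \<psi> (z \<otimes> y)))
      = (if \<chi> = \<psi> then cf_inner G h \<chi> * \<chi> y else 0)"
      unfolding sum_distrib_left[symmetric] Irr_convolution[OF \<open>\<chi> \<in> Irr G\<close> \<psi> y]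
      using G0 Irr_one by auto
  qed
  also have "\<dots> = (\<Sum>\<chi>\<in>B. cf_inner G h \<chi> * \<chi> y)"
    using finite_Irr B_Irr by (intro sum.cong refl) (auto simp: subset_iff)
  finally have e: "(\<Sum>\<chi>\<in>B. cf_inner G h \<chi> * \<chi> y) = (\<Sum>z\<in>carrier G. block_idem z * h (z \<otimes> y))" by simp
  show ?thesis unfolding e
    by (intro loc_sum loc_mult block_idem_local hl) (use y in auto)
qed

end

section \<open>Expansion of I_hat along an MN-structure\<close>

context fin_group
begin

text \<open>Each class of c contributes \<open>F c / |C\<^sub>G(c)|\<close> to the average of F over G.\<close>

theorem class_sum_local:
  assumes F: "class_function F" and loc: "\<And>c. c \<in> carrier G \<Longrightarrow> F c / of_nat (card (centralizer G c)) \<in> cyc_local p n"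
  shows "(\<Sum>c\<in>carrier G. F c) / of_nat (card (carrier G)) \<in> cyc_local p n"
proof -
  let ?cl = "conj_class G"
  have G0: "of_nat (card (carrier G)) \<noteq> (0 :: complex)" using finG by (auto simp: card_eq_0_iff)
  have "(\<Sum>c\<in>carrier G. F c) = (\<Sum>K\<in>?cl ` carrier G. \<Sum>c\<in>{c \<in> carrier G. ?cl c = K}. F c)"
    by (rule sum.image_gen[OF finG])
  then have "(\<Sum>c\<in>carrier G. F c) / of_nat (card (carrier G))
     = (\<Sum>K\<in>?cl ` carrier G. (\<Sum>c\<in>{c \<in> carrier G. ?cl c = K}. F c) / of_nat (card (carrier G)))"
    by (simp add: sum_divide_distrib)
  also have "\<dots> \<in> cyc_local p n"
  proof (rule loc_sum)
    fix K assume "K \<in> ?cl ` carrier G"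
    then obtain x where x: "x \<in> carrier G" "K = ?cl x" by blast
    have "{c \<in> carrier G. ?cl c = K} = K"
      using conj_class_eq[OF x(1)] conj_class_self conj_class_subset[OF x(1)] x by blast
    moreover have "F c = F x" if "c \<in> K" for c
      using that x class_functionD(2)[OF F] by (auto simp: conj_class_def conjugate_def)
    ultimately have "(\<Sum>c\<in>{c \<in> carrier G. ?cl c = K}. F c) = of_nat (card K) * F x" by simp
    moreover have e: "of_nat (card (carrier G)) = of_nat (card K) * (of_nat (card (centralizer G x)) :: complex)"
      using card_conj_class[OF x(1)] x(2) by (metis of_nat_mult)
    moreover have "of_nat (card K) \<noteq> (0 :: complex)" using G0 e by auto
    ultimately have "(\<Sum>c\<in>{c \<in> carrier G. ?cl c = K}. F c) / of_nat (card (carrier G)) = F x / of_nat (card (centralizer G x))"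
      by (metis mult_divide_mult_cancel_left)
    then show "(\<Sum>c\<in>{c \<in> carrier G. ?cl c = K}. F c) / of_nat (card (carrier G)) \<in> cyc_local p n"
      using loc[OF x(1)] by simp
  qed
  finally show ?thesis .
qed

lemma ord_subgroup:
  assumes H: "subgroup H G" and x: "x \<in> H"
  shows "group.ord (G\<lparr>carrier := H\<rparr>) x = ord x"
proof -
  interpret H: group "G\<lparr>carrier := H\<rparr>" by (rule subgroup_imp_group[OF H])
  have xG: "x \<in> carrier G" using subgroup.subset[OF H] x by blast
  have "H.ord x = ord x \<longleftrightarrow> (\<forall>k. x [^]\<^bsub>G\<lparr>carrier := H\<rparr>\<^esub> (k::nat) = \<one>\<^bsub>G\<lparr>carrier := H\<rparr>\<^esub> \<longleftrightarrow> ord x dvd k)"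
    by (rule H.ord_unique) (use x in simp)
  then show ?thesis using pow_eq_id[OF xG] nat_pow_consistent[of x _ H] by simp
qed

lemma p_regular_subgroup:
  assumes H: "subgroup H G"
  shows "p_regular p (G\<lparr>carrier := H\<rparr>) = H \<inter> p_regular p G"
  using ord_subgroup[OF H] subgroup.subset[OF H] by (auto simp: p_regular_def)

end

text \<open>The preimages \<open>\<Psi> \<phi>\<close> of the projective indecomposable characters of B' under the isometry J. The two
  hypotheses on J each give a preimage, one a generalized character and one in the span of the dual
  basis; they coincide as J is injective. The expansion of \<open>J u\<close> in Brauer characters then has
  the coefficients \<open>\<langle>J u, J (\<Psi> \<phi>)\<rangle> = \<langle>u, \<Psi> \<phi>\<rangle>\<close>.\<close>

lemma dual_transfer:
  fixes H :: "('g, 'm) monoid_scheme" and H' :: "('h, 'n) monoid_scheme" and \<theta> :: "complex \<Rightarrow> 'k::field"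
  assumes "block_union p n \<theta> H B" and "block_union p n \<theta> H' B'"
    and J: "cf_isometry H H' (cfun.span B) (cfun.span B') J"
    and dual: "J ` cfun.span (dual_basis H (IBr_of p \<theta> H B)) = cfun.span (dual_basis H' (IBr_of p \<theta> H' B'))"
    and zsp: "J ` zfun.span B = zfun.span B'"
  shows "\<exists>\<Psi>. (\<forall>\<phi>\<in>IBr_of p \<theta> H' B'. \<Psi> \<phi> \<in> zfun.span B \<and> (\<forall>y. y \<notin> p_regular p H \<longrightarrow> \<Psi> \<phi> y = 0)) \<and>
     (\<forall>u\<in>cfun.span B. \<forall>c\<in>p_regular p H'. J u c = (\<Sum>\<phi>\<in>IBr_of p \<theta> H' B'. cf_inner H u (\<Psi> \<phi>) * \<phi> c))"
proof -
  interpret H: block_union p n \<theta> H B by fact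
  interpret H': block_union p n \<theta> H' B' by fact
  have inj: "inj_on J (cfun.span B)" using J by (auto simp: cf_isometry_def bij_betw_def)
  have inn: "cf_inner H' (J u) (J v) = cf_inner H u v" if "u \<in> cfun.span B" "v \<in> cfun.span B" for u v
    using J that by (auto simp: cf_isometry_def)
  have im: "J u \<in> cfun.span B'" if "u \<in> cfun.span B" for u
    using J that by (auto simp: cf_isometry_def cf_linear_map_def)
  have "\<exists>\<psi>. \<psi> \<in> zfun.span B \<and> \<psi> \<in> cfun.span (dual_basis H H.bB) \<and> J \<psi> = H'.PIM \<phi>" if \<phi>: "\<phi> \<in> H'.bB" for \<phi>
  proof -
    have "H'.PIM \<phi> \<in> J ` zfun.span B" using H'.PIM_zspan[OF \<phi>] zsp by simp
    then obtain \<psi> where \<psi>: "\<psi> \<in> zfun.span B" "J \<psi> = H'.PIM \<phi>" by (metis imageE)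
    have "H'.PIM \<phi> \<in> cfun.span (dual_basis H' H'.bB)"
      unfolding H'.dual_basis_PIM using \<phi> by (intro cfun.span_base) auto
    then obtain \<psi>' where \<psi>': "\<psi>' \<in> cfun.span (dual_basis H H.bB)" "J \<psi>' = H'.PIM \<phi>" using dual by (metis imageE)
    have "\<psi> = \<psi>'"
      using inj_onD[OF inj, of \<psi> \<psi>'] \<psi> \<psi>' H.zspan_IrrE(2)[OF \<psi>(1) H.B_Irr] H.dual_span_in_block[OF \<psi>'(1)] by simp
    then show ?thesis using \<psi> \<psi>' by blast
  qed
  then obtain \<Psi> where \<Psi>: "\<And>\<phi>. \<phi> \<in> H'.bB \<Longrightarrow> \<Psi> \<phi> \<in> zfun.span B"
    "\<And>\<phi>. \<phi> \<in> H'.bB \<Longrightarrow> \<Psi> \<phi> \<in> cfun.span (dual_basis H H.bB)" "\<And>\<phi>. \<phi> \<in> H'.bB \<Longrightarrow> J (\<Psi> \<phi>) = H'.PIM \<phi>"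
    by metis
  have "J u c = (\<Sum>\<phi>\<in>H'.bB. cf_inner H u (\<Psi> \<phi>) * \<phi> c)" if u: "u \<in> cfun.span B" and c: "c \<in> p_regular p H'" for u c
  proof -
    have "cf_inner H' (J u) (H'.PIM \<phi>) = cf_inner H u (\<Psi> \<phi>)" if "\<phi> \<in> H'.bB" for \<phi>
      using inn[OF u H.dual_span_in_block[OF \<Psi>(2)[OF that]]] \<Psi>(3)[OF that] by simp
    then show ?thesis using H'.block_restriction[OF im[OF u] c] by (auto intro!: sum.cong)
  qed
  then show ?thesis using \<Psi>(1) H.dual_span_vanishes[OF \<Psi>(2)] by blast
qed

lemma mn_structureD:
  assumes "mn_structure p \<theta> G B M"
  shows "mn_S M \<subseteq> carrier G" "\<one>\<^bsub>G\<^esub> \<in> mn_S M"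
    "\<And>g s. g \<in> carrier G \<Longrightarrow> s \<in> mn_S M \<Longrightarrow> conjugate G g s \<in> mn_S M"
    "mn_A M \<subseteq> mn_S M \<times> p_regular p G" "bij_betw (\<lambda>(s, c). mn_dot M s c) (mn_A M) (carrier G)"
    "\<And>s c g. (s, c) \<in> mn_A M \<Longrightarrow> g \<in> carrier G \<Longrightarrow> (conjugate G g s, conjugate G g c) \<in> mn_A M"
    "\<And>s c g. (s, c) \<in> mn_A M \<Longrightarrow> g \<in> carrier G \<Longrightarrow>
        conjugate G g (mn_dot M s c) = mn_dot M (conjugate G g s) (conjugate G g c)"
    "\<And>s c. (s, c) \<in> mn_A M \<Longrightarrow> mn_dot M s c = s \<otimes>\<^bsub>G\<^esub> c"
    "\<And>c. c \<in> p_regular p G \<Longrightarrow> (\<one>\<^bsub>G\<^esub>, c) \<in> mn_A M"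
    "\<And>s. s \<in> mn_S M \<Longrightarrow> subgroup (mn_sub M s) G"
    "\<And>s. s \<in> mn_S M \<Longrightarrow> mn_sub M s \<inter> p_regular p G = {c \<in> p_regular p G. (s, c) \<in> mn_A M}"
    "\<And>s. s \<in> mn_S M \<Longrightarrow> union_of_blocks p \<theta> (mn_grp G M s) (mn_blk M s)"
    "\<And>s. s \<in> mn_S M \<Longrightarrow> cf_linear_map (cfun.span B) (cfun.span (mn_blk M s)) (mn_r M s)"
    "\<And>s \<chi> c. s \<in> mn_S M \<Longrightarrow> \<chi> \<in> cfun.span B \<Longrightarrow> (s, c) \<in> mn_A M \<Longrightarrow> mn_r M s \<chi> c = \<chi> (mn_dot M s c)"
    "mn_sub M \<one>\<^bsub>G\<^esub> = carrier G" "mn_blk M \<one>\<^bsub>G\<^esub> = B"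
    "\<And>\<chi>. \<chi> \<in> cfun.span B \<Longrightarrow> mn_r M \<one>\<^bsub>G\<^esub> \<chi> = \<chi>"
proof -
  note d = assms[unfolded mn_structure_def]
  note b = d[THEN conjunct2, THEN conjunct1] and r = d[THEN conjunct2, THEN conjunct2]
  note b' = b[THEN conjunct2, THEN conjunct2] and r' = r[THEN conjunct2, THEN conjunct2]
  have d1: "mn_S M \<subseteq> carrier G \<and> \<one>\<^bsub>G\<^esub> \<in> mn_S M \<and> (\<forall>g\<in>carrier G. \<forall>s\<in>mn_S M. conjugate G g s \<in> mn_S M)"
    by (rule d[THEN conjunct1])
  then show "mn_S M \<subseteq> carrier G" "\<one>\<^bsub>G\<^esub> \<in> mn_S M"
    "\<And>g s. g \<in> carrier G \<Longrightarrow> s \<in> mn_S M \<Longrightarrow> conjugate G g s \<in> mn_S M" by simp_all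
  have d2: "mn_A M \<subseteq> mn_S M \<times> p_regular p G" "bij_betw (\<lambda>(s, c). mn_dot M s c) (mn_A M) (carrier G)"
    "\<forall>c\<in>p_regular p G. (\<one>\<^bsub>G\<^esub>, c) \<in> mn_A M"
    "\<forall>(s, c)\<in>mn_A M.
         (\<forall>g\<in>carrier G.
            (conjugate G g s, conjugate G g c) \<in> mn_A M \<and>
            conjugate G g (mn_dot M s c) = mn_dot M (conjugate G g s) (conjugate G g c)) \<and>
         mn_dot M s c = s \<otimes>\<^bsub>G\<^esub> c \<and> mn_dot M s c = c \<otimes>\<^bsub>G\<^esub> s"
    by (rule b[THEN conjunct1], rule b[THEN conjunct2, THEN conjunct1],
        rule b'[THEN conjunct2, THEN conjunct2], rule b'[THEN conjunct1])
  then show "mn_A M \<subseteq> mn_S M \<times> p_regular p G" "bij_betw (\<lambda>(s, c). mn_dot M s c) (mn_A M) (carrier G)"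
    "\<And>c. c \<in> p_regular p G \<Longrightarrow> (\<one>\<^bsub>G\<^esub>, c) \<in> mn_A M" by simp_all
  show "\<And>s c g. (s, c) \<in> mn_A M \<Longrightarrow> g \<in> carrier G \<Longrightarrow> (conjugate G g s, conjugate G g c) \<in> mn_A M"
    "\<And>s c g. (s, c) \<in> mn_A M \<Longrightarrow> g \<in> carrier G \<Longrightarrow>
        conjugate G g (mn_dot M s c) = mn_dot M (conjugate G g s) (conjugate G g c)"
    "\<And>s c. (s, c) \<in> mn_A M \<Longrightarrow> mn_dot M s c = s \<otimes>\<^bsub>G\<^esub> c"
    using bspec[OF d2(4)] by auto
  have d3: "\<forall>s\<in>mn_S M. subgroup (mn_sub M s) G \<and> mn_sub M s \<subseteq> centralizer G s \<and>
        mn_sub M s \<inter> p_regular p G = {c \<in> p_regular p G. (s, c) \<in> mn_A M}"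
    "\<forall>s\<in>mn_S M. union_of_blocks p \<theta> (mn_grp G M s) (mn_blk M s) \<and>
        cf_linear_map (cfun.span B) (cfun.span (mn_blk M s)) (mn_r M s) \<and>
        (\<forall>\<chi>\<in>cfun.span B. \<forall>c. (s, c) \<in> mn_A M \<longrightarrow> mn_r M s \<chi> c = \<chi> (mn_dot M s c))"
    "mn_sub M \<one>\<^bsub>G\<^esub> = carrier G" "mn_blk M \<one>\<^bsub>G\<^esub> = B" "\<forall>\<chi>\<in>cfun.span B. mn_r M \<one>\<^bsub>G\<^esub> \<chi> = \<chi>"
    by (rule r[THEN conjunct1], rule r[THEN conjunct2, THEN conjunct1], rule r'[THEN conjunct1],
        rule r'[THEN conjunct2, THEN conjunct1], rule r'[THEN conjunct2, THEN conjunct2])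
  then show "mn_sub M \<one>\<^bsub>G\<^esub> = carrier G" "mn_blk M \<one>\<^bsub>G\<^esub> = B"
    "\<And>\<chi>. \<chi> \<in> cfun.span B \<Longrightarrow> mn_r M \<one>\<^bsub>G\<^esub> \<chi> = \<chi>" by simp_all
  show "\<And>s. s \<in> mn_S M \<Longrightarrow> subgroup (mn_sub M s) G"
    "\<And>s. s \<in> mn_S M \<Longrightarrow> mn_sub M s \<inter> p_regular p G = {c \<in> p_regular p G. (s, c) \<in> mn_A M}"
    using bspec[OF d3(1)] by simp_all
  show "\<And>s. s \<in> mn_S M \<Longrightarrow> union_of_blocks p \<theta> (mn_grp G M s) (mn_blk M s)"
    "\<And>s. s \<in> mn_S M \<Longrightarrow> cf_linear_map (cfun.span B) (cfun.span (mn_blk M s)) (mn_r M s)"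
    "\<And>s \<chi> c. s \<in> mn_S M \<Longrightarrow> \<chi> \<in> cfun.span B \<Longrightarrow> (s, c) \<in> mn_A M \<Longrightarrow> mn_r M s \<chi> c = \<chi> (mn_dot M s c)"
    using bspec[OF d3(2)] by simp_all
qed

text \<open>The hypotheses in the form in which they are used for one direction, from G to G'. The vanishing of r outside \<open>\<Lambda>0\<close> belongs to the other direction, in which the two groups are
  exchanged.\<close>

locale mn_transfer =
  fixes p n :: nat and \<theta> :: "complex \<Rightarrow> 'k::field"
    and G :: "('g, 'm) monoid_scheme" and G' :: "('h, 'n) monoid_scheme"
    and B :: "('g \<Rightarrow> complex) set" and B' :: "('h \<Rightarrow> complex) set"
    and M :: "'g mn_data" and M' :: "'h mn_data" and rep :: "'g set \<Rightarrow> 'g" and rep' :: "'h set \<Rightarrow> 'h"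
    and \<Lambda>0 :: "'g set set" and \<Lambda>0' :: "'h set set" and \<sigma> :: "'g set \<Rightarrow> 'h set"
    and I :: "'g set \<Rightarrow> ('g \<Rightarrow> complex) \<Rightarrow> 'h \<Rightarrow> complex"
  assumes mod: "modular p n \<theta>"
    and G: "group G" "finite (carrier G)" and G': "group G'" "finite (carrier G')"
    and exps: "\<And>x. x \<in> carrier G \<Longrightarrow> group.ord G x dvd n" "\<And>x. x \<in> carrier G' \<Longrightarrow> group.ord G' x dvd n"
    and spl: "\<And>H. subgroup H G \<Longrightarrow> splitting_field TYPE('k) (G\<lparr>carrier := H\<rparr>)"
      "\<And>H. subgroup H G' \<Longrightarrow> splitting_field TYPE('k) (G'\<lparr>carrier := H\<rparr>)"
    and mn: "mn_structure p \<theta> G B M" and mn': "mn_structure p \<theta> G' B' M'"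
    and rep: "\<And>l. l \<in> mn_Lambda G M \<Longrightarrow> rep l \<in> l" and rep': "\<And>l. l \<in> mn_Lambda G' M' \<Longrightarrow> rep' l \<in> l"
    and \<Lambda>0: "\<Lambda>0 \<subseteq> mn_Lambda G M"
    and zero': "\<And>l \<chi>. l \<in> mn_Lambda G' M' \<Longrightarrow> l \<notin> \<Lambda>0' \<Longrightarrow> \<chi> \<in> cfun.span B' \<Longrightarrow> mn_r M' (rep' l) \<chi> = 0"
    and \<sigma>: "\<sigma> ` \<Lambda>0 = \<Lambda>0'" and \<Lambda>0': "\<Lambda>0' \<subseteq> mn_Lambda G' M'"
    and one0: "{\<one>\<^bsub>G\<^esub>} \<in> \<Lambda>0" and \<sigma>1: "\<sigma> {\<one>\<^bsub>G\<^esub>} = {\<one>\<^bsub>G'\<^esub>}"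
    and iso: "\<And>l. l \<in> \<Lambda>0 \<Longrightarrow> cf_isometry (mn_grp G M (rep l)) (mn_grp G' M' (rep' (\<sigma> l)))
           (cfun.span (mn_blk M (rep l))) (cfun.span (mn_blk M' (rep' (\<sigma> l)))) (I l)"
    and comm: "\<And>l \<chi>. l \<in> \<Lambda>0 \<Longrightarrow> \<chi> \<in> cfun.span B \<Longrightarrow>
           I l (mn_r M (rep l) \<chi>) = mn_r M' (rep' (\<sigma> l)) (I {\<one>\<^bsub>G\<^esub>} \<chi>)"
    and dual: "\<And>l. l \<in> \<Lambda>0 \<Longrightarrow>
           I l ` cfun.span (dual_basis (mn_grp G M (rep l)) (IBr_of p \<theta> (mn_grp G M (rep l)) (mn_blk M (rep l)))) =
           cfun.span (dual_basis (mn_grp G' M' (rep' (\<sigma> l)))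
                       (IBr_of p \<theta> (mn_grp G' M' (rep' (\<sigma> l))) (mn_blk M' (rep' (\<sigma> l)))))"
    and zsp: "\<And>l. l \<in> \<Lambda>0 \<Longrightarrow> I l ` zfun.span (mn_blk M (rep l)) = zfun.span (mn_blk M' (rep' (\<sigma> l)))"
begin

lemma fin_group_G: "fin_group G" using G by (simp add: fin_group_def fin_group_axioms_def)
lemma fin_group_G': "fin_group G'" using G' by (simp add: fin_group_def fin_group_axioms_def)

lemma rep_in_S: "l \<in> mn_Lambda G M \<Longrightarrow> rep l \<in> mn_S M" using rep by (auto simp: mn_Lambda_def)
lemma rep_in_S': "l \<in> mn_Lambda G' M' \<Longrightarrow> rep' l \<in> mn_S M'" using rep' by (auto simp: mn_Lambda_def)

lemma block_union_sub:
  assumes fg: "fin_group X" and ex: "\<And>x. x \<in> carrier X \<Longrightarrow> group.ord X x dvd n"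
    and sp: "\<And>H. subgroup H X \<Longrightarrow> splitting_field TYPE('k) (X\<lparr>carrier := H\<rparr>)"
    and H: "subgroup H X" and b: "union_of_blocks p \<theta> (X\<lparr>carrier := H\<rparr>) C"
  shows "block_union p n \<theta> (X\<lparr>carrier := H\<rparr>) C"
proof -
  interpret X: fin_group X by fact
  interpret H: group "X\<lparr>carrier := H\<rparr>" by (rule X.subgroup_imp_group[OF H])
  have "fin_group (X\<lparr>carrier := H\<rparr>)"
    by unfold_locales (use finite_subset[OF subgroup.subset[OF H] X.finG] in simp)
  then show ?thesis
    unfolding block_union_def modular_group_def modular_group_axioms_def block_union_axioms_def
    using mod b sp[OF H] X.ord_subgroup[OF H] ex subgroup.subset[OF H] by auto
qed

lemma block_union_rep: "s \<in> mn_S M \<Longrightarrow> block_union p n \<theta> (mn_grp G M s) (mn_blk M s)"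
  by (rule block_union_sub[OF fin_group_G exps(1) spl(1) mn_structureD(10)[OF mn] mn_structureD(12)[OF mn]])

lemma block_union_rep': "s \<in> mn_S M' \<Longrightarrow> block_union p n \<theta> (mn_grp G' M' s) (mn_blk M' s)"
  by (rule block_union_sub[OF fin_group_G' exps(2) spl(2) mn_structureD(10)[OF mn'] mn_structureD(12)[OF mn']])

lemma block_union_G: "block_union p n \<theta> G B"
  using block_union_rep[OF mn_structureD(2)[OF mn]] by (simp add: mn_structureD(15,16)[OF mn])

lemma block_union_G': "block_union p n \<theta> G' B'"
  using block_union_rep'[OF mn_structureD(2)[OF mn']] by (simp add: mn_structureD(15,16)[OF mn'])

lemma rep_one: "rep {\<one>\<^bsub>G\<^esub>} = \<one>\<^bsub>G\<^esub>" using rep[of "{\<one>\<^bsub>G\<^esub>}"] one0 \<Lambda>0 by auto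
lemma rep_one': "rep' {\<one>\<^bsub>G'\<^esub>} = \<one>\<^bsub>G'\<^esub>" using rep'[of "{\<one>\<^bsub>G'\<^esub>}"] one0 \<sigma> \<sigma>1 \<Lambda>0' by (metis imageI singletonD subsetD)

lemma iso_one: "cf_isometry G G' (cfun.span B) (cfun.span B') (I {\<one>\<^bsub>G\<^esub>})"
  using iso[OF one0] by (simp add: \<sigma>1 rep_one rep_one' mn_structureD(15,16)[OF mn] mn_structureD(15,16)[OF mn'])

lemma I_one_span: "\<chi> \<in> cfun.span B \<Longrightarrow> I {\<one>\<^bsub>G\<^esub>} \<chi> \<in> cfun.span B'"
  using iso_one by (auto simp: cf_isometry_def cf_linear_map_def)

text \<open>By compatibility with r, the value of \<open>I {1} \<chi>\<close> at the product is that of \<open>I l (r \<chi>)\<close> at c, which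
  \<open>dual_transfer\<close> expands in Brauer characters; summing over \<open>\<chi>\<close> gives the formula. The set \<open>\<Phi>\<close> consists of the Brauer characters of the
  block of \<open>G'\<^sub>\<lambda>\<close>; only the integrality of their values matters below.\<close>

lemma hat_formula:
  assumes l: "l \<in> \<Lambda>0" and c: "(rep' (\<sigma> l), c) \<in> mn_A M'"
  shows "\<exists>\<Phi> \<Psi>. (\<forall>\<phi>\<in>\<Phi>. (\<forall>z. \<phi> z \<in> cyclotomic_ring n) \<and> \<Psi> \<phi> \<in> zfun.span (mn_blk M (rep l)) \<and>
        (\<forall>y. y \<notin> p_regular p (mn_grp G M (rep l)) \<longrightarrow> \<Psi> \<phi> y = 0)) \<and>
     (\<forall>x. I_hat B (I {\<one>\<^bsub>G\<^esub>}) x (mn_dot M' (rep' (\<sigma> l)) c) =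
        (\<Sum>\<phi>\<in>\<Phi>. cf_inner (mn_grp G M (rep l)) (\<Sum>\<chi>\<in>B. cscale (cnj (\<chi> x)) (mn_r M (rep l) \<chi>)) (\<Psi> \<phi>) * \<phi> c))"
proof -
  let ?s = "rep l" and ?s' = "rep' (\<sigma> l)"
  let ?H = "mn_grp G M ?s" and ?H' = "mn_grp G' M' ?s'"
  have s: "?s \<in> mn_S M" using l \<Lambda>0 rep_in_S by blast
  have s': "?s' \<in> mn_S M'" using l \<Lambda>0' \<sigma> rep_in_S' by blast
  interpret G: block_union p n \<theta> G B by (rule block_union_G)
  interpret G': fin_group G' by (rule fin_group_G')
  interpret H: block_union p n \<theta> ?H "mn_blk M ?s" by (rule block_union_rep[OF s])
  interpret H': block_union p n \<theta> ?H' "mn_blk M' ?s'" by (rule block_union_rep'[OF s'])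
  obtain \<Psi> where \<Psi>: "\<And>\<phi>. \<phi> \<in> H'.bB \<Longrightarrow> \<Psi> \<phi> \<in> zfun.span (mn_blk M ?s)"
      "\<And>\<phi> y. \<phi> \<in> H'.bB \<Longrightarrow> y \<notin> p_regular p ?H \<Longrightarrow> \<Psi> \<phi> y = 0"
    and J: "\<And>u c. u \<in> cfun.span (mn_blk M ?s) \<Longrightarrow> c \<in> p_regular p ?H' \<Longrightarrow>
       I l u c = (\<Sum>\<phi>\<in>H'.bB. cf_inner ?H u (\<Psi> \<phi>) * \<phi> c)"
    using dual_transfer[OF block_union_rep[OF s] block_union_rep'[OF s'] iso[OF l] dual[OF l] zsp[OF l]] by blast
  have cr: "c \<in> p_regular p ?H'"
    using c mn_structureD(4)[OF mn'] mn_structureD(11)[OF mn' s'] G'.p_regular_subgroup[OF mn_structureD(10)[OF mn' s']] by blast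
  have Bs: "\<chi> \<in> cfun.span B" if "\<chi> \<in> B" for \<chi> using that by (rule cfun.span_base)
  have rs: "mn_r M ?s \<chi> \<in> cfun.span (mn_blk M ?s)" if "\<chi> \<in> B" for \<chi>
    using mn_structureD(13)[OF mn s] Bs[OF that] by (auto simp: cf_linear_map_def)
  have val: "I {\<one>\<^bsub>G\<^esub>} \<chi> (mn_dot M' ?s' c) = (\<Sum>\<phi>\<in>H'.bB. cf_inner ?H (mn_r M ?s \<chi>) (\<Psi> \<phi>) * \<phi> c)" if \<chi>: "\<chi> \<in> B" for \<chi>
  proof -
    have "I {\<one>\<^bsub>G\<^esub>} \<chi> (mn_dot M' ?s' c) = mn_r M' ?s' (I {\<one>\<^bsub>G\<^esub>} \<chi>) c"
      using mn_structureD(14)[OF mn' s' I_one_span[OF Bs[OF \<chi>]] c] by simp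
    also have "\<dots> = I l (mn_r M ?s \<chi>) c" using comm[OF l Bs[OF \<chi>]] by simp
    also have "\<dots> = (\<Sum>\<phi>\<in>H'.bB. cf_inner ?H (mn_r M ?s \<chi>) (\<Psi> \<phi>) * \<phi> c)" by (rule J[OF rs[OF \<chi>] cr])
    finally show ?thesis .
  qed
  have "I_hat B (I {\<one>\<^bsub>G\<^esub>}) x (mn_dot M' ?s' c) =
        (\<Sum>\<phi>\<in>H'.bB. cf_inner ?H (\<Sum>\<chi>\<in>B. cscale (cnj (\<chi> x)) (mn_r M ?s \<chi>)) (\<Psi> \<phi>) * \<phi> c)" for x
  proof -
    have "I_hat B (I {\<one>\<^bsub>G\<^esub>}) x (mn_dot M' ?s' c)
      = (\<Sum>\<chi>\<in>B. \<Sum>\<phi>\<in>H'.bB. cnj (\<chi> x) * cf_inner ?H (mn_r M ?s \<chi>) (\<Psi> \<phi>) * \<phi> c)"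
      unfolding I_hat_def by (rule sum.cong[OF refl]) (simp add: val sum_distrib_left mult.assoc)
    also have "\<dots> = (\<Sum>\<phi>\<in>H'.bB. (\<Sum>\<chi>\<in>B. cnj (\<chi> x) * cf_inner ?H (mn_r M ?s \<chi>) (\<Psi> \<phi>)) * \<phi> c)"
      by (subst sum.swap) (simp add: sum_distrib_right)
    finally show ?thesis by (simp add: H.cf_inner_sum_left)
  qed
  moreover have "\<phi> z \<in> cyclotomic_ring n" if "\<phi> \<in> H'.bB" for \<phi> z by (rule H'.IBr_cyc[OF H'.IBr_ofD[OF that]])
  ultimately show ?thesis using \<Psi> by (intro exI[of _ H'.bB] exI[of _ \<Psi>]) blast
qed

text \<open>For \<open>\<lambda> = {1}\<close> the coefficient \<open>\<langle>w, \<Psi> \<phi>\<rangle>\<close> is the conjugate of \<open>\<Psi> \<phi> x\<close>, which is 0.\<close>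

theorem hat_vanishes:
  assumes x: "x \<in> carrier G" "x \<notin> p_regular p G" and x': "x' \<in> p_regular p G'"
  shows "I_hat B (I {\<one>\<^bsub>G\<^esub>}) x x' = 0"
proof -
  interpret G: block_union p n \<theta> G B by (rule block_union_G)
  interpret G': fin_group G' by (rule fin_group_G')
  have c: "(rep' (\<sigma> {\<one>\<^bsub>G\<^esub>}), x') \<in> mn_A M'"
    using mn_structureD(9)[OF mn' x'] by (simp add: \<sigma>1 rep_one')
  have x'G: "x' \<in> carrier G'" using x' by (simp add: p_regular_def)
  have d: "mn_dot M' (rep' (\<sigma> {\<one>\<^bsub>G\<^esub>})) x' = x'"
    using mn_structureD(8)[OF mn' c] x'G by (simp add: \<sigma>1 rep_one')
  obtain \<Phi> \<Psi> where A: "\<forall>\<phi>\<in>\<Phi>. (\<forall>z. \<phi> z \<in> cyclotomic_ring n) \<and> \<Psi> \<phi> \<in> zfun.span (mn_blk M (rep {\<one>\<^bsub>G\<^esub>})) \<and>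
        (\<forall>y. y \<notin> p_regular p (mn_grp G M (rep {\<one>\<^bsub>G\<^esub>})) \<longrightarrow> \<Psi> \<phi> y = 0)"
     and hat: "\<forall>x. I_hat B (I {\<one>\<^bsub>G\<^esub>}) x (mn_dot M' (rep' (\<sigma> {\<one>\<^bsub>G\<^esub>})) x') =
        (\<Sum>\<phi>\<in>\<Phi>. cf_inner (mn_grp G M (rep {\<one>\<^bsub>G\<^esub>})) (\<Sum>\<chi>\<in>B. cscale (cnj (\<chi> x)) (mn_r M (rep {\<one>\<^bsub>G\<^esub>}) \<chi>)) (\<Psi> \<phi>) * \<phi> x')"
    using hat_formula[OF one0 c] by blast
  have \<Psi>: "\<And>\<phi>. \<phi> \<in> \<Phi> \<Longrightarrow> \<Psi> \<phi> \<in> zfun.span B" "\<And>\<phi> y. \<phi> \<in> \<Phi> \<Longrightarrow> y \<notin> p_regular p G \<Longrightarrow> \<Psi> \<phi> y = 0"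
    using A by (auto simp: rep_one mn_structureD(15,16)[OF mn])
  have e: "I_hat B (I {\<one>\<^bsub>G\<^esub>}) x x' = (\<Sum>\<phi>\<in>\<Phi>. cf_inner G (\<Sum>\<chi>\<in>B. cscale (cnj (\<chi> x)) (mn_r M \<one>\<^bsub>G\<^esub> \<chi>)) (\<Psi> \<phi>) * \<phi> x')"
    using hat by (simp add: d rep_one mn_structureD(15,16)[OF mn])
  have "cf_inner G (\<Sum>\<chi>\<in>B. cscale (cnj (\<chi> x)) (mn_r M \<one>\<^bsub>G\<^esub> \<chi>)) (\<Psi> \<phi>) = 0" if \<phi>: "\<phi> \<in> \<Phi>" for \<phi>
  proof -
    have sp: "\<Psi> \<phi> \<in> cfun.span B" by (rule G.zspan_IrrE(2)[OF \<Psi>(1)[OF \<phi>] G.B_Irr])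
    have "cf_inner G (\<Sum>\<chi>\<in>B. cscale (cnj (\<chi> x)) (mn_r M \<one>\<^bsub>G\<^esub> \<chi>)) (\<Psi> \<phi>)
      = (\<Sum>\<chi>\<in>B. cnj (\<chi> x) * cf_inner G (mn_r M \<one>\<^bsub>G\<^esub> \<chi>) (\<Psi> \<phi>))" by (rule G.cf_inner_sum_left)
    also have "\<dots> = (\<Sum>\<chi>\<in>B. cnj (cf_inner G (\<Psi> \<phi>) \<chi> * \<chi> x))"
    proof (rule sum.cong[OF refl])
      fix \<chi> assume "\<chi> \<in> B"
      then have "mn_r M \<one>\<^bsub>G\<^esub> \<chi> = \<chi>" using mn_structureD(17)[OF mn] cfun.span_base by blast
      then show "cnj (\<chi> x) * cf_inner G (mn_r M \<one>\<^bsub>G\<^esub> \<chi>) (\<Psi> \<phi>) = cnj (cf_inner G (\<Psi> \<phi>) \<chi> * \<chi> x)"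
        using G.cf_inner_cnj[of \<chi> "\<Psi> \<phi>"] by simp
    qed
    also have "\<dots> = cnj ((\<Sum>\<chi>\<in>B. cscale (cf_inner G (\<Psi> \<phi>) \<chi>) \<chi>) x)"
      by (simp add: sum_fun_apply cscale_def)
    also have "\<dots> = cnj (\<Psi> \<phi> x)" using G.span_IrrE(1)[OF sp G.B_Irr] by simp
    finally show ?thesis using \<Psi>(2)[OF \<phi> x(2)] by simp
  qed
  then show ?thesis unfolding e by (intro sum.neutral) auto
qed

text \<open>The coefficients \<open>\<langle>w, \<Psi> \<phi>\<rangle>\<close> divided by \<open>|C\<^sub>G(x)|\<close> are p-local. The quotient \<open>w d / |C\<^sub>G(x)|\<close> is a value of
  the projection onto B of the indicator function of the class of x, and each class of \<open>G\<^sub>\<lambda>\<close>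
  contributes this quotient times the conjugate of \<open>\<Psi> \<phi> d / |C(d)|\<close>, the centralizer being that in
  \<open>G\<^sub>\<lambda>\<close>.\<close>

theorem hat_divisible:
  assumes x: "x \<in> carrier G" and x': "x' \<in> carrier G'"
  shows "I_hat B (I {\<one>\<^bsub>G\<^esub>}) x x' / of_nat (card (centralizer G x)) \<in> cyc_local p n"
proof -
  interpret G: block_union p n \<theta> G B by (rule block_union_G)
  interpret G': block_union p n \<theta> G' B' by (rule block_union_G')
  let ?C = "of_nat (card (centralizer G x)) :: complex"
  have C0: "?C \<noteq> 0" using G.centralizer_pos[OF x] by simp
  from mn_structureD(5)[OF mn'] x' obtain s' c' where sc: "(s', c') \<in> mn_A M'" "x' = mn_dot M' s' c'"
    unfolding bij_betw_def by force
  have s'S: "s' \<in> mn_S M'" and c'G: "c' \<in> carrier G'" using sc(1) mn_structureD(4)[OF mn'] by (auto simp: p_regular_def)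
  have s'G: "s' \<in> carrier G'" using s'S mn_structureD(1)[OF mn'] by blast
  \<comment> \<open>\<open>I_hat x\<close> is a class function on G', so x' can be conjugated until its S-part is the chosen
    representative\<close>
  define l' where "l' = conj_class G' s'"
  have l': "l' \<in> mn_Lambda G' M'"
    using s'G mn_structureD(3)[OF mn' _ s'S] by (auto simp: mn_Lambda_def l'_def conj_classes_def conj_class_def)
  from rep'[OF l'] obtain t where t: "t \<in> carrier G'" "rep' l' = conjugate G' t s'" by (auto simp: l'_def conj_class_def)
  define c where "c = conjugate G' t c'"
  have cA: "(rep' l', c) \<in> mn_A M'" using mn_structureD(6)[OF mn' sc(1) t(1)] by (simp add: t(2) c_def)
  have x't: "conjugate G' t x' = mn_dot M' (rep' l') c"
    using mn_structureD(7)[OF mn' sc(1) t(1)] by (simp add: t(2) c_def sc(2))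
  have Ix': "I {\<one>\<^bsub>G\<^esub>} \<chi> x' = I {\<one>\<^bsub>G\<^esub>} \<chi> (mn_dot M' (rep' l') c)" if "\<chi> \<in> B" for \<chi>
  proof -
    have "G'.class_function (I {\<one>\<^bsub>G\<^esub>} \<chi>)"
      by (rule G'.span_IrrE(3)[OF I_one_span[OF cfun.span_base[OF that]] G'.B_Irr])
    from G'.class_functionD(2)[OF this t(1) x'] show ?thesis by (simp add: x't[symmetric] conjugate_def)
  qed
  then have hat: "I_hat B (I {\<one>\<^bsub>G\<^esub>}) x x' = I_hat B (I {\<one>\<^bsub>G\<^esub>}) x (mn_dot M' (rep' l') c)"
    by (simp add: I_hat_def)
  show ?thesis
  proof (cases "l' \<in> \<Lambda>0'")
    case False
    have "I {\<one>\<^bsub>G\<^esub>} \<chi> (mn_dot M' (rep' l') c) = 0" if "\<chi> \<in> B" for \<chi>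
      using mn_structureD(14)[OF mn' rep_in_S'[OF l'] I_one_span[OF cfun.span_base[OF that]] cA]
        zero'[OF l' False I_one_span[OF cfun.span_base[OF that]]] by simp
    then have "I_hat B (I {\<one>\<^bsub>G\<^esub>}) x x' = 0" unfolding hat unfolding I_hat_def by (intro sum.neutral) auto
    then show ?thesis using loc_cyc[OF cyc_0] by simp
  next
    case True
    then obtain l where l: "l \<in> \<Lambda>0" "l' = \<sigma> l" using \<sigma> by blast
    let ?s = "rep l" let ?H = "mn_grp G M ?s"
    have s: "?s \<in> mn_S M" using l \<Lambda>0 rep_in_S by blast
    interpret H: block_union p n \<theta> ?H "mn_blk M ?s" by (rule block_union_rep[OF s])
    define w where "w = (\<Sum>\<chi>\<in>B. cscale (cnj (\<chi> x)) (mn_r M ?s \<chi>))"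
    have wsp: "w \<in> cfun.span (mn_blk M ?s)"
      unfolding w_def using mn_structureD(13)[OF mn s] cfun.span_base
      by (intro cfun.span_sum cfun.span_scale) (auto simp: cf_linear_map_def)
    have wcl: "H.class_function w" by (rule H.span_IrrE(3)[OF wsp H.B_Irr])
    define h where "h = (\<lambda>z. if z \<in> conj_class G x then 1 else 0 :: complex)"
    note hcl = G.class_indicator[OF x, folded h_def]
    have wloc: "w d / ?C \<in> cyc_local p n" if d: "d \<in> p_regular p ?H" for d
    proof -
      have dA: "(?s, d) \<in> mn_A M"
        using d mn_structureD(11)[OF mn s] G.p_regular_subgroup[OF mn_structureD(10)[OF mn s]] by blast
      let ?y = "mn_dot M ?s d"
      have y: "?y \<in> carrier G" using mn_structureD(5)[OF mn] dA unfolding bij_betw_def by force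
      have "w d = (\<Sum>\<chi>\<in>B. cnj (\<chi> x) * \<chi> ?y)"
        using mn_structureD(14)[OF mn s cfun.span_base dA] by (auto simp: w_def sum_fun_apply cscale_def intro!: sum.cong)
      then have "w d / ?C = (\<Sum>\<chi>\<in>B. cf_inner G h \<chi> * \<chi> ?y)"
        using hcl(2) G.B_Irr by (auto simp: sum_divide_distrib intro!: sum.cong)
      also have "\<dots> \<in> cyc_local p n"
        by (rule G.block_projection_local[OF hcl(1) _ y]) (auto simp: h_def intro: loc_cyc cyc_0 cyc_1)
      finally show ?thesis .
    qed
    obtain \<Phi> \<Psi> where A: "\<forall>\<phi>\<in>\<Phi>. (\<forall>z. \<phi> z \<in> cyclotomic_ring n) \<and> \<Psi> \<phi> \<in> zfun.span (mn_blk M ?s) \<and>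
          (\<forall>y. y \<notin> p_regular p ?H \<longrightarrow> \<Psi> \<phi> y = 0)"
       and hat': "\<forall>x. I_hat B (I {\<one>\<^bsub>G\<^esub>}) x (mn_dot M' (rep' (\<sigma> l)) c) =
          (\<Sum>\<phi>\<in>\<Phi>. cf_inner ?H (\<Sum>\<chi>\<in>B. cscale (cnj (\<chi> x)) (mn_r M ?s \<chi>)) (\<Psi> \<phi>) * \<phi> c)"
      using hat_formula[OF l(1) cA[unfolded l(2)]] by blast
    have \<Psi>: "\<And>\<phi>. \<phi> \<in> \<Phi> \<Longrightarrow> \<Psi> \<phi> \<in> zfun.span (mn_blk M ?s)"
        "\<And>\<phi> y. \<phi> \<in> \<Phi> \<Longrightarrow> y \<notin> p_regular p ?H \<Longrightarrow> \<Psi> \<phi> y = 0"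
      and cyc: "\<And>\<phi> z. \<phi> \<in> \<Phi> \<Longrightarrow> \<phi> z \<in> cyclotomic_ring n"
      using A by blast+
    have e: "I_hat B (I {\<one>\<^bsub>G\<^esub>}) x (mn_dot M' (rep' l') c) = (\<Sum>\<phi>\<in>\<Phi>. cf_inner ?H w (\<Psi> \<phi>) * \<phi> c)"
      using hat' by (simp add: w_def l(2))
    have part: "cf_inner ?H w (\<Psi> \<phi>) / ?C \<in> cyc_local p n" if \<phi>: "\<phi> \<in> \<Phi>" for \<phi>
    proof -
      have \<Psi>Irr: "\<Psi> \<phi> \<in> zfun.span (Irr ?H)" using \<Psi>(1)[OF \<phi>] zfun.span_mono[OF H.B_Irr] by blast
      have \<Psi>cl: "H.class_function (\<Psi> \<phi>)"
        by (rule H.span_IrrE(3)[OF H.zspan_IrrE(2)[OF \<Psi>(1)[OF \<phi>] H.B_Irr] H.B_Irr])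
      define F where "F d = w d / ?C * cnj (\<Psi> \<phi> d)" for d
      have "(\<Sum>d\<in>carrier ?H. F d) / of_nat (card (carrier ?H)) \<in> cyc_local p n"
      proof (rule H.class_sum_local)
        show "H.class_function F"
          unfolding H.class_function_def F_def using H.class_functionD(1,2)[OF wcl] H.class_functionD(1,2)[OF \<Psi>cl] by auto
        fix d assume d: "d \<in> carrier ?H"
        show "F d / of_nat (card (centralizer ?H d)) \<in> cyc_local p n"
        proof (cases "d \<in> p_regular p ?H")
          case True
          have "F d / of_nat (card (centralizer ?H d)) = w d / ?C * cnj (\<Psi> \<phi> d / of_nat (card (centralizer ?H d)))"
            by (simp add: F_def)
          also have "\<dots> \<in> cyc_local p n"
            using loc_mult[OF wloc[OF True] loc_cnj[OF H.vanishing_character_divisible[OF \<Psi>Irr \<Psi>(2)[OF \<phi>] d] modular.n[OF mod]]] by simp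
          finally show ?thesis .
        next
          case False
          then show ?thesis using \<Psi>(2)[OF \<phi> False] loc_cyc[OF cyc_0] by (simp add: F_def)
        qed
      qed
      also have "(\<Sum>d\<in>carrier ?H. F d) / of_nat (card (carrier ?H)) = cf_inner ?H w (\<Psi> \<phi>) / ?C"
        unfolding cf_inner_def F_def by (simp add: sum_divide_distrib mult.commute)
      finally show ?thesis .
    qed
    have "I_hat B (I {\<one>\<^bsub>G\<^esub>}) x x' / ?C = (\<Sum>\<phi>\<in>\<Phi>. cf_inner ?H w (\<Psi> \<phi>) / ?C * \<phi> c)"
      unfolding hat e by (simp add: sum_divide_distrib)
    also have "\<dots> \<in> cyc_local p n"
    proof (rule loc_sum)
      fix \<phi> assume \<phi>: "\<phi> \<in> \<Phi>"
      show "cf_inner ?H w (\<Psi> \<phi>) / ?C * \<phi> c \<in> cyc_local p n"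
        by (rule loc_mult[OF part[OF \<phi>] loc_cyc[OF cyc[OF \<phi>]]])
    qed
    finally show ?thesis .
  qed
qed

end

section \<open>Inverting the isometries\<close>

lemma cf_isometry_inverse:
  assumes f: "cf_isometry H H' V W f" and V: "cfun.subspace V"
  shows "cf_isometry H' H W V (inv_into V f)"
proof -
  let ?g = "inv_into V f"
  have bij: "bij_betw f V W" and lin: "cf_linear_map V W f"
    and inn: "\<And>\<phi> \<psi>. \<phi> \<in> V \<Longrightarrow> \<psi> \<in> V \<Longrightarrow> cf_inner H' (f \<phi>) (f \<psi>) = cf_inner H \<phi> \<psi>"
    using f by (auto simp: cf_isometry_def)
  have gV: "?g w \<in> V" and fg: "f (?g w) = w" if "w \<in> W" for w
    using that bij by (auto simp: bij_betw_def inv_into_into f_inv_into_f)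
  have gf: "?g (f v) = v" if "v \<in> V" for v using that bij by (simp add: bij_betw_def)
  have "?g (a + b) = ?g a + ?g b" if "a \<in> W" "b \<in> W" for a b
  proof -
    have "f (?g a + ?g b) = a + b" using lin gV fg that by (simp add: cf_linear_map_def)
    then show ?thesis using gf[of "?g a + ?g b"] cfun.subspace_add[OF V] gV that by simp
  qed
  moreover have "?g (cscale c a) = cscale c (?g a)" if "a \<in> W" for a c
  proof -
    have "f (cscale c (?g a)) = cscale c a" using lin gV fg that by (simp add: cf_linear_map_def)
    then show ?thesis using gf[of "cscale c (?g a)"] cfun.subspace_scale[OF V] gV that by simp
  qed
  ultimately have "cf_linear_map W V ?g" using gV by (auto simp: cf_linear_map_def)
  moreover have "cf_inner H (?g a) (?g b) = cf_inner H' a b" if "a \<in> W" "b \<in> W" for a b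
    using inn[OF gV[OF that(1)] gV[OF that(2)]] fg that by simp
  ultimately show ?thesis using bij_betw_inv_into[OF bij] by (simp add: cf_isometry_def)
qed

lemma inv_into_image_image:
  assumes "inj_on f V" "A \<subseteq> V" "f ` A = C" shows "inv_into V f ` C = A"
  using assms by (force simp: inv_into_f_f subset_iff)

context mn_transfer
begin

text \<open>All hypotheses pass to the inverse maps. For the compatibility with r, write a function in the
  span of B' as the image of some \<open>\<chi>\<close>.\<close>

lemma inverse_transfer:
  assumes zero: "\<And>l \<chi>. l \<in> mn_Lambda G M \<Longrightarrow> l \<notin> \<Lambda>0 \<Longrightarrow> \<chi> \<in> cfun.span B \<Longrightarrow> mn_r M (rep l) \<chi> = 0"
    and inj: "inj_on \<sigma> \<Lambda>0"
  shows "mn_transfer p n \<theta> G' G B' B M' M rep' rep \<Lambda>0' \<Lambda>0 (inv_into \<Lambda>0 \<sigma>)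
     (\<lambda>l'. inv_into (cfun.span (mn_blk M (rep (inv_into \<Lambda>0 \<sigma> l')))) (I (inv_into \<Lambda>0 \<sigma> l')))"
proof -
  let ?\<tau> = "inv_into \<Lambda>0 \<sigma>"
  have \<tau>: "?\<tau> l' \<in> \<Lambda>0" "\<sigma> (?\<tau> l') = l'" if "l' \<in> \<Lambda>0'" for l'
    using that \<sigma> by (auto simp: inv_into_into f_inv_into_f)
  have \<tau>1: "?\<tau> {\<one>\<^bsub>G'\<^esub>} = {\<one>\<^bsub>G\<^esub>}" using inv_into_f_f[OF inj one0] by (simp add: \<sigma>1)
  have injI: "inj_on (I l) (cfun.span (mn_blk M (rep l)))" if "l \<in> \<Lambda>0" for l
    using iso[OF that] by (simp add: cf_isometry_def bij_betw_def)
  have s: "rep l \<in> mn_S M" if "l \<in> \<Lambda>0" for l using that \<Lambda>0 rep_in_S by blast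
  show ?thesis
  proof (rule mn_transfer.intro)
    show "modular p n \<theta>" by (rule mod)
    show "group G'" "finite (carrier G')" "group G" "finite (carrier G)" by (fact G' G)+
    show "mn_structure p \<theta> G' B' M'" "mn_structure p \<theta> G B M" by (fact mn' mn)+
    show "\<Lambda>0' \<subseteq> mn_Lambda G' M'" "\<Lambda>0 \<subseteq> mn_Lambda G M" by (fact \<Lambda>0' \<Lambda>0)+
    show "?\<tau> ` \<Lambda>0' = \<Lambda>0" using inj \<sigma> by (metis inv_into_image_cancel order_refl)
    show "{\<one>\<^bsub>G'\<^esub>} \<in> \<Lambda>0'" using one0 \<sigma> \<sigma>1 by (metis imageI)
    show "?\<tau> {\<one>\<^bsub>G'\<^esub>} = {\<one>\<^bsub>G\<^esub>}" by (rule \<tau>1)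
    fix l' assume l': "l' \<in> \<Lambda>0'"
    note l = \<tau>(1)[OF l'] and sl = \<tau>(2)[OF l']
    interpret H: block_union p n \<theta> "mn_grp G M (rep (?\<tau> l'))" "mn_blk M (rep (?\<tau> l'))"
      by (rule block_union_rep[OF s[OF l]])
    show "cf_isometry (mn_grp G' M' (rep' l')) (mn_grp G M (rep (?\<tau> l')))
        (cfun.span (mn_blk M' (rep' l'))) (cfun.span (mn_blk M (rep (?\<tau> l'))))
        (inv_into (cfun.span (mn_blk M (rep (?\<tau> l')))) (I (?\<tau> l')))"
      using cf_isometry_inverse[OF iso[OF l] cfun.subspace_span] by (simp add: sl)
    show "inv_into (cfun.span (mn_blk M (rep (?\<tau> l')))) (I (?\<tau> l')) `
          cfun.span (dual_basis (mn_grp G' M' (rep' l')) (IBr_of p \<theta> (mn_grp G' M' (rep' l')) (mn_blk M' (rep' l')))) =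
        cfun.span (dual_basis (mn_grp G M (rep (?\<tau> l'))) (IBr_of p \<theta> (mn_grp G M (rep (?\<tau> l'))) (mn_blk M (rep (?\<tau> l')))))"
      by (rule inv_into_image_image[OF injI[OF l] _ dual[OF l, unfolded sl]]) (use H.dual_span_in_block in blast)
    show "inv_into (cfun.span (mn_blk M (rep (?\<tau> l')))) (I (?\<tau> l')) ` zfun.span (mn_blk M' (rep' l')) =
        zfun.span (mn_blk M (rep (?\<tau> l')))"
      by (rule inv_into_image_image[OF injI[OF l] _ zsp[OF l, unfolded sl]]) (use H.zspan_IrrE(2)[OF _ H.B_Irr] in blast)
    fix \<psi> assume \<psi>: "\<psi> \<in> cfun.span B'"
    have "bij_betw (I {\<one>\<^bsub>G\<^esub>}) (cfun.span B) (cfun.span B')" using iso_one by (simp add: cf_isometry_def)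
    then obtain \<chi> where \<chi>: "\<chi> \<in> cfun.span B" "\<psi> = I {\<one>\<^bsub>G\<^esub>} \<chi>" "inv_into (cfun.span B) (I {\<one>\<^bsub>G\<^esub>}) \<psi> = \<chi>"
      using \<psi> by (metis bij_betw_def f_inv_into_f inv_into_into)
    have mr: "mn_r M (rep (?\<tau> l')) \<chi> \<in> cfun.span (mn_blk M (rep (?\<tau> l')))"
      using mn_structureD(13)[OF mn s[OF l]] \<chi>(1) by (auto simp: cf_linear_map_def)
    have e: "mn_r M' (rep' l') \<psi> = I (?\<tau> l') (mn_r M (rep (?\<tau> l')) \<chi>)"
      using comm[OF l \<chi>(1)] by (simp add: sl \<chi>(2))
    have "inv_into (cfun.span (mn_blk M (rep (?\<tau> l')))) (I (?\<tau> l')) (mn_r M' (rep' l') \<psi>) = mn_r M (rep (?\<tau> l')) \<chi>"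
      unfolding e by (rule inv_into_f_f[OF injI[OF l] mr])
    also have "\<chi> = inv_into (cfun.span (mn_blk M (rep (?\<tau> {\<one>\<^bsub>G'\<^esub>})))) (I (?\<tau> {\<one>\<^bsub>G'\<^esub>})) \<psi>"
      using \<chi>(3) by (simp add: \<tau>1 rep_one mn_structureD(16)[OF mn])
    finally show "inv_into (cfun.span (mn_blk M (rep (?\<tau> l')))) (I (?\<tau> l')) (mn_r M' (rep' l') \<psi>) =
        mn_r M (rep (?\<tau> l')) (inv_into (cfun.span (mn_blk M (rep (?\<tau> {\<one>\<^bsub>G'\<^esub>})))) (I (?\<tau> {\<one>\<^bsub>G'\<^esub>})) \<psi>)" .
  qed (use exps spl rep rep' zero in auto)
qed

text \<open>In the orthonormal bases B and B' the matrix of the inverse isometry is the conjugate transpose.\<close>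

lemma hat_inverse:
  "I_hat B (I {\<one>\<^bsub>G\<^esub>}) x x' = cnj (I_hat B' (inv_into (cfun.span B) (I {\<one>\<^bsub>G\<^esub>})) x' x)"
proof -
  interpret G: block_union p n \<theta> G B by (rule block_union_G)
  interpret G': block_union p n \<theta> G' B' by (rule block_union_G')
  let ?I = "I {\<one>\<^bsub>G\<^esub>}" let ?J = "inv_into (cfun.span B) ?I"
  have J: "cf_isometry G' G (cfun.span B') (cfun.span B) ?J"
    by (rule cf_isometry_inverse[OF iso_one cfun.subspace_span])
  have bij: "bij_betw ?I (cfun.span B) (cfun.span B')" using iso_one by (simp add: cf_isometry_def)
  have swap: "cf_inner G' (?I \<chi>) \<psi> = cnj (cf_inner G (?J \<psi>) \<chi>)" if "\<chi> \<in> B" "\<psi> \<in> B'" for \<chi> \<psi>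
  proof -
    have \<psi>: "\<psi> \<in> cfun.span B'" and \<chi>: "\<chi> \<in> cfun.span B" using that by (auto intro: cfun.span_base)
    have "cf_inner G' (?I \<chi>) \<psi> = cf_inner G' (?I \<chi>) (?I (?J \<psi>))"
      using bij \<psi> by (simp add: bij_betw_def f_inv_into_f)
    also have "\<dots> = cf_inner G \<chi> (?J \<psi>)"
      using iso_one \<chi> \<psi> bij by (auto simp: cf_isometry_def bij_betw_def inv_into_into)
    also have "\<dots> = cnj (cf_inner G (?J \<psi>) \<chi>)" by (rule G.cf_inner_cnj)
    finally show ?thesis .
  qed
  have e1: "?I \<chi> x' = (\<Sum>\<psi>\<in>B'. cf_inner G' (?I \<chi>) \<psi> * \<psi> x')" if "\<chi> \<in> B" for \<chi>
    using arg_cong[OF G'.span_IrrE(1)[OF I_one_span[OF cfun.span_base[OF that]] G'.B_Irr], of "\<lambda>f. f x'"]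
    by (simp add: sum_fun_apply cscale_def)
  have e2: "?J \<psi> x = (\<Sum>\<chi>\<in>B. cf_inner G (?J \<psi>) \<chi> * \<chi> x)" if "\<psi> \<in> B'" for \<psi>
  proof -
    have "?J \<psi> \<in> cfun.span B" using J cfun.span_base[OF that] by (auto simp: cf_isometry_def cf_linear_map_def)
    from arg_cong[OF G.span_IrrE(1)[OF this G.B_Irr], of "\<lambda>f. f x"] show ?thesis
      by (simp add: sum_fun_apply cscale_def)
  qed
  have "I_hat B ?I x x' = (\<Sum>\<chi>\<in>B. \<Sum>\<psi>\<in>B'. cnj (\<chi> x) * (cnj (cf_inner G (?J \<psi>) \<chi>) * \<psi> x'))"
    unfolding I_hat_def by (rule sum.cong[OF refl]) (simp add: e1 sum_distrib_left swap)
  also have "\<dots> = (\<Sum>\<psi>\<in>B'. \<Sum>\<chi>\<in>B. cnj (cnj (\<psi> x') * (cf_inner G (?J \<psi>) \<chi> * \<chi> x)))"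
    by (subst sum.swap) (simp add: mult_ac)
  also have "\<dots> = cnj (I_hat B' ?J x' x)"
    unfolding I_hat_def cnj_sum by (rule sum.cong[OF refl]) (simp add: e2 sum_distrib_left)
  finally show ?thesis .
qed

end

lemma cyclotomic_embeddingD:
  assumes e: "cyclotomic_embedding n R \<iota>"
  shows "\<iota> 0 = 0" "\<iota> (of_nat k) = of_nat k"
proof -
  have add: "\<iota> (x + y) = \<iota> x + \<iota> y" if "x \<in> cyclotomic_ring n" "y \<in> cyclotomic_ring n" for x y
    using e that by (auto simp: cyclotomic_embedding_def)
  show z: "\<iota> 0 = 0" using add[OF cyc_0 cyc_0] by (metis add_0 add_right_cancel)
  show "\<iota> (of_nat k) = of_nat k"
    using e by (induction k) (auto simp: z add cyc_1 cyc_of_nat cyclotomic_embedding_def)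
qed

text \<open>An integer prime to p is not 0 in the residue field, hence has valuation 0.\<close>

lemma p_modular_unit:
  fixes red :: "'K::field_char_0 \<Rightarrow> 'k::field"
  assumes pm: "p_modular_system p R red" and p: "prime p" and m: "coprime m p"
  shows "inverse (of_nat m) \<in> R" "\<And>x y. x \<in> R \<Longrightarrow> y \<in> R \<Longrightarrow> x * y \<in> R"
proof -
  from pm obtain v where v: "discrete_valuation v" and R: "R = {x. x = 0 \<or> 0 \<le> v x}"
    and rv: "\<And>x. x \<in> R \<Longrightarrow> red x = 0 \<longleftrightarrow> x = 0 \<or> 0 < v x" and r1: "red 1 = 1"
    and rh: "\<And>x y. x \<in> R \<Longrightarrow> y \<in> R \<Longrightarrow> red (x + y) = red x + red y" and ch: "CHAR('k) = p"
    unfolding p_modular_system_def by blast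
  have vm: "v (x * y) = v x + v y" if "x \<noteq> 0" "y \<noteq> 0" for x y using v that by (simp add: discrete_valuation_def)
  have va: "min (v x) (v y) \<le> v (x + y)" if "x \<noteq> 0" "y \<noteq> 0" "x + y \<noteq> 0" for x y
    using v that by (simp add: discrete_valuation_def)
  have v1: "v 1 = 0" using vm[of 1 1] by simp
  have nat: "of_nat k \<in> R \<and> red (of_nat k) = of_nat k" for k
  proof (induction k)
    case 0
    have "0 \<in> R" by (simp add: R)
    moreover have "red 0 = 0" using rv[OF \<open>0 \<in> R\<close>] by simp
    ultimately show ?case by simp
  next
    case (Suc k)
    have 1: "1 \<in> R" by (simp add: R v1)
    have "(1 + of_nat k :: 'K) \<in> R"
      using Suc va[of 1 "of_nat k"] v1 by (cases "k = 0") (auto simp: R simp flip: of_nat_Suc)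
    then show ?case using Suc rh[OF 1, of "of_nat k"] r1 by simp
  qed
  have m0: "m \<noteq> 0" using m p by (auto intro: ccontr)
  have "\<not> p dvd m" using m p by (meson coprime_common_divisor dvd_refl not_prime_unit)
  then have "red (of_nat m) \<noteq> 0" using nat[of m] ch of_nat_eq_0_iff_char_dvd[of m, where 'a = 'k] by simp
  then have "\<not> 0 < v (of_nat m)" using rv nat[of m] by blast
  moreover have "v (of_nat m) + v (inverse (of_nat m)) = 0"
    using vm[of "of_nat m" "inverse (of_nat m)"] m0 v1 by simp
  ultimately show "inverse (of_nat m) \<in> R" by (simp add: R)
  show "x * y \<in> R" if "x \<in> R" "y \<in> R" for x y using that vm[of x y] by (cases "x = 0"; cases "y = 0") (auto simp: R)
qed

text \<open>Clearing a denominator prime to p gives an equation in \<open>\<int>[\<zeta>\<^sub>n]\<close>, to which \<open>\<iota>\<close> applies; the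
  denominator is invertible in R.\<close>

lemma local_divisible_embed:
  fixes red :: "'K::field_char_0 \<Rightarrow> 'k::field"
  assumes pm: "p_modular_system p R red" and p: "prime p" and e: "cyclotomic_embedding n R \<iota>"
    and z: "z \<in> cyclotomic_ring n" and d: "z / of_nat c \<in> cyc_local p n" and c: "c > 0"
  shows "\<iota> z \<in> (\<lambda>r. of_nat c * r) ` R"
proof -
  from d obtain m where m: "coprime m p" "of_nat m * (z / of_nat c) \<in> cyclotomic_ring n"
    unfolding cyc_local_def by blast
  let ?o = "of_nat m * (z / of_nat c)"
  have mult: "\<iota> (x * y) = \<iota> x * \<iota> y" if "x \<in> cyclotomic_ring n" "y \<in> cyclotomic_ring n" for x y
    using e that by (auto simp: cyclotomic_embedding_def)
  have "of_nat m * z = of_nat c * ?o" using c by simp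
  then have "of_nat m * \<iota> z = of_nat c * \<iota> ?o"
    using mult[OF cyc_of_nat[of m] z] mult[OF cyc_of_nat[of c] m(2)] cyclotomic_embeddingD(2)[OF e] by metis
  moreover have "m \<noteq> 0" using m(1) p by (auto intro: ccontr)
  ultimately have "\<iota> z = of_nat c * (\<iota> ?o * inverse (of_nat m))" by (simp add: field_simps)
  moreover have "\<iota> ?o * inverse (of_nat m) \<in> R"
    by (rule p_modular_unit(2)[OF pm p m(1) _ p_modular_unit(1)[OF pm p m(1)]])
      (use e m(2) in \<open>auto simp: cyclotomic_embedding_def\<close>)
  ultimately show ?thesis by (rule image_eqI)
qed

theorem theorem2p20:
  fixes p :: nat
    and G :: "('g, 'm) monoid_scheme" and G' :: "('h, 'n) monoid_scheme"
    and R :: "'K::field_char_0 set" and red :: "'K \<Rightarrow> 'k::field" and \<iota> :: "complex \<Rightarrow> 'K"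
    and B :: "('g \<Rightarrow> complex) set" and B' :: "('h \<Rightarrow> complex) set"
    and M :: "'g mn_data" and M' :: "'h mn_data"
    and rep :: "'g set \<Rightarrow> 'g" and rep' :: "'h set \<Rightarrow> 'h"
    and E :: "'g \<Rightarrow> 'g \<Rightarrow> 'g set" and E' :: "'h \<Rightarrow> 'h \<Rightarrow> 'h set"
    and \<Lambda>0 :: "'g set set" and \<Lambda>0' :: "'h set set"
    and \<sigma> :: "'g set \<Rightarrow> 'h set"
    and I :: "'g set \<Rightarrow> ('g \<Rightarrow> complex) \<Rightarrow> 'h \<Rightarrow> complex"
  defines "\<theta> \<equiv> red \<circ> \<iota>"
  assumes "prime p"
    and "group G" and "finite (carrier G)" and "group G'" and "finite (carrier G')"
    and "splitting_p_modular_system p R red G" and "splitting_p_modular_system p R red G'"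
    and "cyclotomic_embedding (lcm (group_exponent G) (group_exponent G')) R \<iota>"
    and "union_of_blocks p \<theta> G B" and "union_of_blocks p \<theta> G' B'"
    and "mn_structure p \<theta> G B M" and "mn_structure p \<theta> G' B' M'"
    and "\<forall>l\<in>mn_Lambda G M. rep l \<in> l" and "\<forall>l\<in>mn_Lambda G' M'. rep' l \<in> l"
    and "\<Lambda>0 \<subseteq> mn_Lambda G M" and "\<Lambda>0' \<subseteq> mn_Lambda G' M'"
    and "\<forall>l\<in>mn_Lambda G M - \<Lambda>0. \<forall>\<chi>\<in>cfun.span B. mn_r M (rep l) \<chi> = 0"
    and "\<forall>l\<in>mn_Lambda G' M' - \<Lambda>0'. \<forall>\<chi>\<in>cfun.span B'. mn_r M' (rep' l) \<chi> = 0"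
    and "bij_betw \<sigma> \<Lambda>0 \<Lambda>0'" and "{\<one>\<^bsub>G\<^esub>} \<in> \<Lambda>0" and "\<sigma> {\<one>\<^bsub>G\<^esub>} = {\<one>\<^bsub>G'\<^esub>}"
    and "\<forall>l\<in>\<Lambda>0. cf_isometry (mn_grp G M (rep l)) (mn_grp G' M' (rep' (\<sigma> l)))
           (cfun.span (mn_blk M (rep l))) (cfun.span (mn_blk M' (rep' (\<sigma> l)))) (I l)"
    and "\<forall>l\<in>\<Lambda>0. \<forall>\<chi>\<in>cfun.span B.
           I l (mn_r M (rep l) \<chi>) = mn_r M' (rep' (\<sigma> l)) (I {\<one>\<^bsub>G\<^esub>} \<chi>)"
    and "\<forall>l\<in>\<Lambda>0.
           I l ` cfun.span (dual_basis (mn_grp G M (rep l))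
                             (IBr_of p \<theta> (mn_grp G M (rep l)) (mn_blk M (rep l)))) =
           cfun.span (dual_basis (mn_grp G' M' (rep' (\<sigma> l)))
                       (IBr_of p \<theta> (mn_grp G' M' (rep' (\<sigma> l))) (mn_blk M' (rep' (\<sigma> l)))))"
    and "\<forall>l\<in>\<Lambda>0. I l ` zfun.span (mn_blk M (rep l)) = zfun.span (mn_blk M' (rep' (\<sigma> l)))"
    and "\<forall>(s, c)\<in>mn_A M.
           class_representatives (mn_grp G M (rep (conj_class G s)))
             (transported G (rep (conj_class G s)) s c) (E s c)"
    and "\<forall>(s, c)\<in>mn_A M'.
           class_representatives (mn_grp G' M' (rep' (conj_class G' s)))
             (transported G' (rep' (conj_class G' s)) s c) (E' s c)"
    and "\<forall>(s, c)\<in>mn_A M. \<not> p dvd card (E s c)"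
    and "\<forall>(s, c)\<in>mn_A M'. \<not> p dvd card (E' s c)"
  shows "broue_isometry p R \<iota> G G' B B' (I {\<one>\<^bsub>G\<^esub>})"
proof -
  define n where "n = lcm (group_exponent G) (group_exponent G')"
  have emb: "cyclotomic_embedding n R \<iota>" using assms(9) by (simp add: n_def)
  have pm: "p_modular_system p R red" using assms(7) by (simp add: splitting_p_modular_system_def)
  have fG: "fin_group G" and fG': "fin_group G'" using assms(3-6) by (simp_all add: fin_group_def fin_group_axioms_def)
  have exps: "group.ord G x dvd n" if "x \<in> carrier G" for x
    unfolding n_def group_exponent_def using that by (intro dvd_lcmI1 dvd_Lcm) auto
  have exps': "group.ord G' x dvd n" if "x \<in> carrier G'" for x
    unfolding n_def group_exponent_def using that by (intro dvd_lcmI2 dvd_Lcm) auto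
  \<comment> \<open>\<open>\<int>[\<zeta>\<^sub>n]\<close> has the expected roots of unity only for \<open>n > 0\<close>\<close>
  have pos: "Lcm (group.ord X ` carrier X) > 0" if "fin_group X" for X :: "('x, 'y) monoid_scheme"
  proof -
    interpret X: fin_group X by fact
    have "0 \<notin> X.ord ` carrier X" using X.ord_ge_1[OF X.finG] by fastforce
    then show ?thesis using X.finG by (intro gr0I) (simp add: Lcm_0_iff)
  qed
  have n0: "n > 0" unfolding n_def group_exponent_def using pos[OF fG] pos[OF fG'] by (simp add: lcm_pos_nat)
  have \<iota>R: "\<iota> x \<in> R" if "x \<in> cyclotomic_ring n" for x using emb that by (auto simp: cyclotomic_embedding_def)
  have red: "red 1 = 1" "\<And>x y. x \<in> R \<Longrightarrow> y \<in> R \<Longrightarrow> red (x + y) = red x + red y \<and> red (x * y) = red x * red y"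
    "CHAR('k) = p" using pm by (auto simp: p_modular_system_def)
  have mod: "modular p n \<theta>"
    by unfold_locales (use assms(2) n0 red \<iota>R emb in \<open>auto simp: \<theta>_def cyclotomic_embedding_def\<close>)
  have fwd: "mn_transfer p n \<theta> G G' B B' M M' rep rep' \<Lambda>0 \<Lambda>0' \<sigma> I"
  proof (rule mn_transfer.intro)
    show "\<sigma> ` \<Lambda>0 = \<Lambda>0'" using assms(20) by (simp add: bij_betw_def)
    show "splitting_field TYPE('k) (G\<lparr>carrier := H\<rparr>)" if "subgroup H G" for H
      using assms(7) that by (simp add: splitting_p_modular_system_def)
    show "splitting_field TYPE('k) (G'\<lparr>carrier := H\<rparr>)" if "subgroup H G'" for H
      using assms(8) that by (simp add: splitting_p_modular_system_def)
  qed (use mod assms exps exps' in auto)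
  interpret T: mn_transfer p n \<theta> G G' B B' M M' rep rep' \<Lambda>0 \<Lambda>0' \<sigma> I by (rule fwd)
  interpret G: block_union p n \<theta> G B by (rule T.block_union_G)
  interpret G': block_union p n \<theta> G' B' by (rule T.block_union_G')
  let ?I = "I {\<one>\<^bsub>G\<^esub>}" let ?J = "inv_into (cfun.span B) ?I"
  let ?\<tau> = "inv_into \<Lambda>0 \<sigma>"
  have inj: "inj_on \<sigma> \<Lambda>0" using assms(20) by (simp add: bij_betw_def)
  interpret S: mn_transfer p n \<theta> G' G B' B M' M rep' rep \<Lambda>0' \<Lambda>0 ?\<tau>
     "\<lambda>l'. inv_into (cfun.span (mn_blk M (rep (?\<tau> l')))) (I (?\<tau> l'))"
    by (rule T.inverse_transfer[OF _ inj]) (use assms(18) in auto)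
  have \<tau>1: "?\<tau> {\<one>\<^bsub>G'\<^esub>} = {\<one>\<^bsub>G\<^esub>}" by (rule S.\<sigma>1)
  \<comment> \<open>at the trivial class the inverse data consist of the inverse of \<open>I {1}\<close>\<close>
  have J: "inv_into (cfun.span (mn_blk M (rep (?\<tau> {\<one>\<^bsub>G'\<^esub>})))) (I (?\<tau> {\<one>\<^bsub>G'\<^esub>})) = ?J"
    by (simp add: \<tau>1 T.rep_one mn_structureD(16)[OF T.mn])
  have hat: "I_hat B ?I x x' = cnj (I_hat B' ?J x' x)" for x x' by (rule T.hat_inverse)
  have zsp: "?I ` zfun.span B = zfun.span B'"
    using T.zsp[OF T.one0] by (simp add: T.\<sigma>1 T.rep_one T.rep_one' mn_structureD(16)[OF T.mn] mn_structureD(16)[OF T.mn'])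
  have cyc: "I_hat B ?I x x' \<in> cyclotomic_ring n" for x x'
    unfolding I_hat_def
  proof (rule cyc_sum, rule cyc_mult)
    fix \<chi> assume \<chi>: "\<chi> \<in> B"
    show "cnj (\<chi> x) \<in> cyclotomic_ring n" using G.Irr_cyc G.B_Irr \<chi> by (intro cyc_cnj n0) blast
    have "?I \<chi> \<in> zfun.span B'" using zsp zfun.span_base[OF \<chi>] by blast
    then obtain c where "\<And>x. ?I \<chi> x = (\<Sum>\<psi>\<in>B'. of_int (c \<psi>) * \<psi> x)" using G'.zspan_IrrE(1)[OF _ G'.B_Irr] by blast
    then show "?I \<chi> x' \<in> cyclotomic_ring n" using G'.Irr_cyc G'.B_Irr by (auto intro!: cyc_sum cyc_mult cyc_of_int)
  qed
  show ?thesis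
    unfolding broue_isometry_def
  proof (intro conjI ballI)
    show "cf_isometry G G' (cfun.span B) (cfun.span B') ?I" by (rule T.iso_one)
    show "?I ` zfun.span B = zfun.span B'" by (rule zsp)
    fix x x' assume x: "x \<in> carrier G" and x': "x' \<in> carrier G'"
    have d: "I_hat B ?I x x' / of_nat (card (centralizer G x)) \<in> cyc_local p n" by (rule T.hat_divisible[OF x x'])
    have "I_hat B' ?J x' x / of_nat (card (centralizer G' x')) \<in> cyc_local p n"
      using S.hat_divisible[OF x' x] unfolding J .
    from loc_cnj[OF this n0] have d': "I_hat B ?I x x' / of_nat (card (centralizer G' x')) \<in> cyc_local p n"
      by (simp add: hat)
    show "\<iota> (I_hat B ?I x x') \<in> (\<lambda>r. of_nat (card (centralizer G x)) * r) ` R \<inter>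
        (\<lambda>r. of_nat (card (centralizer G' x')) * r) ` R"
      using local_divisible_embed[OF pm assms(2) emb cyc d G.centralizer_pos[OF x]]
        local_divisible_embed[OF pm assms(2) emb cyc d' G'.centralizer_pos[OF x']] by blast
    show "I_hat B ?I x x' \<noteq> 0 \<longrightarrow> (x \<in> p_regular p G \<longleftrightarrow> x' \<in> p_regular p G')"
    proof (intro impI iffI; rule ccontr)
      assume nz: "I_hat B ?I x x' \<noteq> 0" and "x \<in> p_regular p G" "x' \<notin> p_regular p G'"
      then have "I_hat B' ?J x' x = 0" using S.hat_vanishes[OF x'] unfolding J by blast
      then show False using nz by (simp add: hat)
    next
      assume "I_hat B ?I x x' \<noteq> 0" "x' \<in> p_regular p G'" "x \<notin> p_regular p G"
      then show False using T.hat_vanishes[OF x] by blast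
    qed
  qed
qed

end
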